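(* Let $\lambda>3$ and let $\varkappa\in\mathbb{Z}_2$ be a dyadic integer. Then the Jacobi operator $J_\varkappa$ on $\ell^2(\mathbb{Z})$ (defined in the context from the polynomial $T(z)=z^2-\lambda$) has no eigenvalues. It has purely singular continuous spectrum.
   Context: Fix a real number $\lambda>3$ and let $T(z)=z^2-\lambda$; $T^{\circ n}$ denotes the $n$-fold composition of $T$ with itself. Let $\mathsf{E}=\mathbb{C}\setminus\{z\in\mathbb{C}: T^{\circ n}(z)\to\infty,\ n\to\infty\}$ be the Julia set of $T$; it is a compact subset of $\mathbb{R}$ of zero Lebesgue measure. Let $\mu_{\mathsf{E}}$ be the equilibrium (probability) measure of $\mathsf{E}$, and let $(p_n)_{n\ge 0}$ be the orthonormal polynomials of $\mu_{\mathsf{E}}$ with positive leading coefficients. They satisfy $x p_n(x)=a_n p_{n-1}(x)+a_{n+1}p_{n+1}(x)$ for $n\ge 0$, with $a_0=0$ and $a_n>0$ for $n\ge1$ (the diagonal coefficients vanish by symmetry). The dyadic integers $\mathbb{Z}_2$ are the completion of $\mathbb{Z}$ with respect to the metric $d(m,n)=2^{-j}$ if $m-n\in 2^j\mathbb{Z}\setminus 2^{j+1}\mathbb{Z}$ (and $d(m,m)=0$). It is known that for $\lambda>3$ the sequence $(a_n)_{n\ge 0}$ is limit periodic: for every $\epsilon>0$ there is $n_0$ such that $|a_{k+s2^n}-a_k|\le\epsilon$ for all $n\ge n_0$, uniformly in $k,s$. Hence $n\mapsto a_n$ extends to a continuous function $\varkappa\mapsto a_\varkappa$ on $\mathbb{Z}_2$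 by $a_\varkappa=\lim_{j} a_{k_j}$ for nonnegative integers $k_j\to\varkappa$ in $\mathbb{Z}_2$. For $\varkappa\in\mathbb{Z}_2$, $J_\varkappa$ is the bounded self-adjoint operator on $\ell^2(\mathbb{Z})$ given on the standard basis $\{e_n\}_{n\in\mathbb{Z}}$ by $J_\varkappa e_n=a_{\varkappa+n}e_{n-1}+a_{\varkappa+n+1}e_{n+1}$. *)

theory Defs
  imports "HOL-Probability.Probability" "HOL-Computational_Algebra.Polynomial"
begin

section \<open>The dyadic integers\<close>

definition dyadic_dist :: "int \<Rightarrow> int \<Rightarrow> real" where
  "dyadic_dist m n = (if m = n then 0 else (1/2) ^ multiplicity 2 (m - n))"

lemma dyadic_dist_eq_iff:
  "m \<noteq> n \<Longrightarrow> dyadic_dist m n = (1/2) ^ j \<longleftrightarrow> 2 ^ j dvd m - n \<and> \<not> 2 ^ Suc j dvd m - n"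
proof -
  assume mn: "m \<noteq> n"
  have "dyadic_dist m n = (1/2) ^ j \<longleftrightarrow> multiplicity 2 (m - n) = j"
    using mn power_inject_exp'[of "1/2::real" "multiplicity 2 (m - n)" j]
    by (auto simp: dyadic_dist_def)
  also have "\<dots> \<longleftrightarrow> 2 ^ j dvd m - n \<and> \<not> 2 ^ Suc j dvd m - n"
    using mn by (subst (1 2) power_dvd_iff_le_multiplicity) auto
  finally show ?thesis .
qed

lemma dyadic_dist_le_iff: "dyadic_dist m n \<le> (1/2) ^ j \<longleftrightarrow> 2 ^ j dvd m - n"
proof (cases "m = n")
  case False
  then have "2 ^ j dvd m - n \<longleftrightarrow> j \<le> multiplicity 2 (m - n)"
    by (intro power_dvd_iff_le_multiplicity) auto
  then show ?thesis using False by (simp add: dyadic_dist_def power_decreasing_iff)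
qed (simp add: dyadic_dist_def)

lemma dyadic_dist_commute: "dyadic_dist m n = dyadic_dist n m"
proof -
  have "dyadic_dist a b \<le> dyadic_dist b a" for a b
  proof (cases "a = b")
    case False
    then obtain j where "dyadic_dist b a = (1/2) ^ j" by (auto simp: dyadic_dist_def)
    then show ?thesis using dyadic_dist_le_iff[of b a j] dyadic_dist_le_iff[of a b j]
      by (simp add: dvd_diff_commute)
  qed simp
  then show ?thesis by (meson antisym)
qed

lemma dyadic_dist_ultrametric: "dyadic_dist x z \<le> max (dyadic_dist x y) (dyadic_dist y z)"
proof -
  have *: "dyadic_dist a c \<le> dyadic_dist b c" if "dyadic_dist a b \<le> dyadic_dist b c" for a b c
  proof (cases "b = c")
    case True
    with that show ?thesis by (cases "a = b") (auto simp: dyadic_dist_def split: if_splits)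
  next
    case False
    then obtain j where j: "dyadic_dist b c = (1/2) ^ j" by (auto simp: dyadic_dist_def)
    with that have "2 ^ j dvd a - b" "2 ^ j dvd b - c"
      by (simp_all flip: dyadic_dist_le_iff)
    then have "2 ^ j dvd (a - b) + (b - c)" by (rule dvd_add)
    then show ?thesis using j dyadic_dist_le_iff by simp
  qed
  show ?thesis
    using *[of x y z] *[of z y x] dyadic_dist_commute[of x z] dyadic_dist_commute[of x y]
      dyadic_dist_commute[of y z] by linarith
qed

interpretation dyadic_dist: Metric_space UNIV dyadic_dist
proof
  show nn: "0 \<le> dyadic_dist x y" for x y by (simp add: dyadic_dist_def)
  show "dyadic_dist x y = dyadic_dist y x" for x y
    by (rule dyadic_dist_commute)
  show "dyadic_dist x y = 0 \<longleftrightarrow> x = y" for x y by (simp add: dyadic_dist_def)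
  show "dyadic_dist x z \<le> dyadic_dist x y + dyadic_dist y z" for x y z
    using dyadic_dist_ultrametric[of x z y] nn[of x y] nn[of y z] by linarith
qed

lemma ex_half_power_less: "e > 0 \<Longrightarrow> \<exists>j. (1/2::real) ^ j < e"
  by (rule real_arch_pow_inv) auto

lemma dyadic_MCauchy_iff:
  "dyadic_dist.MCauchy X \<longleftrightarrow> (\<forall>j. \<exists>N. \<forall>m\<ge>N. \<forall>n\<ge>N. 2 ^ j dvd X m - X n)"
proof
  assume X: "dyadic_dist.MCauchy X"
  show "\<forall>j. \<exists>N. \<forall>m\<ge>N. \<forall>n\<ge>N. 2 ^ j dvd X m - X n"
  proof
    fix j
    have "(1/2::real) ^ j > 0" by simp
    with X obtain N where "\<forall>m n. N \<le> m \<longrightarrow> N \<le> n \<longrightarrow> dyadic_dist (X m) (X n) < (1/2) ^ j"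
      unfolding dyadic_dist.MCauchy_def by blast
    then show "\<exists>N. \<forall>m\<ge>N. \<forall>n\<ge>N. 2 ^ j dvd X m - X n"
      using dyadic_dist_le_iff by (metis less_imp_le)
  qed
next
  assume X: "\<forall>j. \<exists>N. \<forall>m\<ge>N. \<forall>n\<ge>N. 2 ^ j dvd X m - X n"
  show "dyadic_dist.MCauchy X"
    unfolding dyadic_dist.MCauchy_def
  proof (intro conjI allI impI)
    fix e :: real assume "e > 0"
    then obtain j where "(1/2) ^ j < e" using ex_half_power_less by blast
    moreover obtain N where "\<forall>m\<ge>N. \<forall>n\<ge>N. 2 ^ j dvd X m - X n" using X by blast
    ultimately show "\<exists>N. \<forall>m n. N \<le> m \<longrightarrow> N \<le> n \<longrightarrow> dyadic_dist (X m) (X n) < e"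
      using dyadic_dist_le_iff by (meson le_less_trans)
  qed simp
qed

lemma dyadic_dist_tendsto_0_iff:
  "(\<lambda>n. dyadic_dist (X n) (Y n)) \<longlonglongrightarrow> 0 \<longleftrightarrow> (\<forall>j. \<exists>N. \<forall>n\<ge>N. 2 ^ j dvd X n - Y n)"
proof
  assume L: "(\<lambda>n. dyadic_dist (X n) (Y n)) \<longlonglongrightarrow> 0"
  show "\<forall>j. \<exists>N. \<forall>n\<ge>N. 2 ^ j dvd X n - Y n"
  proof
    fix j
    have "(1/2::real) ^ j > 0" by simp
    then have "\<forall>\<^sub>F n in sequentially. dyadic_dist (X n) (Y n) < (1/2) ^ j"
      using L by (rule order_tendstoD(2)[rotated])
    then show "\<exists>N. \<forall>n\<ge>N. 2 ^ j dvd X n - Y n"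
      unfolding eventually_sequentially using dyadic_dist_le_iff by (metis less_imp_le)
  qed
next
  assume X: "\<forall>j. \<exists>N. \<forall>n\<ge>N. 2 ^ j dvd X n - Y n"
  show "(\<lambda>n. dyadic_dist (X n) (Y n)) \<longlonglongrightarrow> 0"
  proof (rule LIMSEQ_I)
    fix e :: real assume "e > 0"
    then obtain j where "(1/2) ^ j < e" using ex_half_power_less by blast
    moreover obtain N where "\<forall>n\<ge>N. 2 ^ j dvd X n - Y n" using X by blast
    ultimately show "\<exists>N. \<forall>n\<ge>N. norm (dyadic_dist (X n) (Y n) - 0) < e"
      using dyadic_dist_le_iff by (metis abs_of_nonneg diff_zero dyadic_dist.nonneg le_less_trans real_norm_def)
  qed
qed

definition dyadic_rel :: "(nat \<Rightarrow> int) \<Rightarrow> (nat \<Rightarrow> int) \<Rightarrow> bool" where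
  "dyadic_rel X Y \<longleftrightarrow> dyadic_dist.MCauchy X \<and> dyadic_dist.MCauchy Y \<and>
     (\<lambda>n. dyadic_dist (X n) (Y n)) \<longlonglongrightarrow> 0"

lemma dyadic_rel_refl: "dyadic_rel X X \<longleftrightarrow> dyadic_dist.MCauchy X"
  by (simp add: dyadic_rel_def dyadic_dist_def)

lemma dyadic_MCauchy_const [simp]: "dyadic_dist.MCauchy (\<lambda>_. m)"
  by (simp add: dyadic_MCauchy_iff)

lemma dyadic_rel_sym: "dyadic_rel X Y \<Longrightarrow> dyadic_rel Y X"
  by (simp add: dyadic_rel_def dyadic_dist.commute)

lemma dyadic_rel_trans:
  assumes "dyadic_rel X Y" "dyadic_rel Y Z"
  shows "dyadic_rel X Z"
proof -
  have "\<exists>N. \<forall>n\<ge>N. 2 ^ j dvd X n - Z n" for j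
  proof -
    obtain N1 N2 where N: "\<forall>n\<ge>N1. 2 ^ j dvd X n - Y n" "\<forall>n\<ge>N2. 2 ^ j dvd Y n - Z n"
      using assms unfolding dyadic_rel_def dyadic_dist_tendsto_0_iff by blast
    have "2 ^ j dvd X n - Z n" if "n \<ge> max N1 N2" for n
      using dvd_add[of "2 ^ j" "X n - Y n" "Y n - Z n"] N that by simp
    then show ?thesis by blast
  qed
  then show ?thesis
    using assms unfolding dyadic_rel_def dyadic_dist_tendsto_0_iff by blast
qed

text \<open>The completion of the integers: Cauchy sequences modulo null sequences.\<close>

quotient_type dyadic = "nat \<Rightarrow> int" / partial: dyadic_rel
  morphisms rep_dyadic Dyadic
proof (rule part_equivpI)
  show "\<exists>X. dyadic_rel X X" using dyadic_rel_refl dyadic_MCauchy_const by blast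
  show "symp dyadic_rel" by (rule sympI) (rule dyadic_rel_sym)
  show "transp dyadic_rel" by (rule transpI) (rule dyadic_rel_trans)
qed

lemma dyadic_rel_iff:
  "dyadic_rel X Y \<longleftrightarrow> (\<forall>j. \<exists>N. \<forall>m\<ge>N. \<forall>n\<ge>N. 2 ^ j dvd X m - X n \<and> 2 ^ j dvd Y m - Y n \<and> 2 ^ j dvd X n - Y n)"
  (is "_ \<longleftrightarrow> (\<forall>j. ?P j)")
proof
  assume r: "dyadic_rel X Y"
  show "\<forall>j. ?P j"
  proof
    fix j
    obtain N1 N2 N3 where "\<forall>m\<ge>N1. \<forall>n\<ge>N1. 2 ^ j dvd X m - X n"
      "\<forall>m\<ge>N2. \<forall>n\<ge>N2. 2 ^ j dvd Y m - Y n" "\<forall>n\<ge>N3. 2 ^ j dvd X n - Y n"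
      using r unfolding dyadic_rel_def dyadic_MCauchy_iff dyadic_dist_tendsto_0_iff by metis
    then show "?P j" by (intro exI[of _ "max N1 (max N2 N3)"]) auto
  qed
next
  assume "\<forall>j. ?P j"
  then show "dyadic_rel X Y"
    unfolding dyadic_rel_def dyadic_MCauchy_iff dyadic_dist_tendsto_0_iff by (meson order_refl)
qed

lemma dyadic_rel_binary:
  fixes f :: "int \<Rightarrow> int \<Rightarrow> int"
  assumes f: "\<And>j a b c d. 2 ^ j dvd a - b \<Longrightarrow> 2 ^ j dvd c - d \<Longrightarrow> 2 ^ j dvd f a c - f b d"
    and "dyadic_rel X X'" "dyadic_rel Y Y'"
  shows "dyadic_rel (\<lambda>n. f (X n) (Y n)) (\<lambda>n. f (X' n) (Y' n))"
  unfolding dyadic_rel_iff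
proof
  fix j
  obtain N1 where N1: "\<forall>m\<ge>N1. \<forall>n\<ge>N1. 2 ^ j dvd X m - X n \<and> 2 ^ j dvd X' m - X' n \<and> 2 ^ j dvd X n - X' n"
    using assms(2) unfolding dyadic_rel_iff by metis
  obtain N2 where N2: "\<forall>m\<ge>N2. \<forall>n\<ge>N2. 2 ^ j dvd Y m - Y n \<and> 2 ^ j dvd Y' m - Y' n \<and> 2 ^ j dvd Y n - Y' n"
    using assms(3) unfolding dyadic_rel_iff by metis
  show "\<exists>N. \<forall>m\<ge>N. \<forall>n\<ge>N. 2 ^ j dvd f (X m) (Y m) - f (X n) (Y n) \<and>
      2 ^ j dvd f (X' m) (Y' m) - f (X' n) (Y' n) \<and> 2 ^ j dvd f (X n) (Y n) - f (X' n) (Y' n)"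
    by (rule exI[of _ "max N1 N2"]) (use N1 N2 in \<open>auto intro!: f\<close>)
qed

lemma dyadic_MCauchy_binary:
  assumes "\<And>j a b c d. 2 ^ j dvd a - b \<Longrightarrow> 2 ^ j dvd c - d \<Longrightarrow> 2 ^ j dvd f a c - f b d"
    and "dyadic_dist.MCauchy X" "dyadic_dist.MCauchy Y"
  shows "dyadic_dist.MCauchy (\<lambda>n. f (X n) (Y n))"
  using dyadic_rel_binary[of f X X Y Y] assms unfolding dyadic_rel_refl by blast

lemma dvd_diff_diff: "(k::int) dvd a - b \<Longrightarrow> k dvd c - d \<Longrightarrow> k dvd a - c - (b - d)"
  using dvd_diff[of k "a - b" "c - d"] by (simp add: algebra_simps)

lemma dvd_mult_diff: "(k::int) dvd a - b \<Longrightarrow> k dvd c - d \<Longrightarrow> k dvd a * c - b * d"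
  unfolding mult_diff_mult by (intro dvd_add) auto

lemma dvd_minus_diff: "(k::int) dvd a - b \<Longrightarrow> k dvd - a - - b"
  by (metis dvd_minus_iff minus_diff_minus)

lemma dyadic_MCauchy_add: "dyadic_dist.MCauchy X \<Longrightarrow> dyadic_dist.MCauchy Y \<Longrightarrow> dyadic_dist.MCauchy (\<lambda>n. X n + Y n)"
  by (rule dyadic_MCauchy_binary) (auto simp: add_diff_add)

lemma dyadic_MCauchy_diff: "dyadic_dist.MCauchy X \<Longrightarrow> dyadic_dist.MCauchy Y \<Longrightarrow> dyadic_dist.MCauchy (\<lambda>n. X n - Y n)"
  by (rule dyadic_MCauchy_binary[where f = "(-)"]) (rule dvd_diff_diff)

lemma dyadic_MCauchy_mult: "dyadic_dist.MCauchy X \<Longrightarrow> dyadic_dist.MCauchy Y \<Longrightarrow> dyadic_dist.MCauchy (\<lambda>n. X n * Y n)"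
  by (rule dyadic_MCauchy_binary[where f = "(*)"]) (rule dvd_mult_diff)

lemmas dyadic_MCauchy_intros = dyadic_MCauchy_add dyadic_MCauchy_diff dyadic_MCauchy_mult

instantiation dyadic :: comm_ring_1
begin

lift_definition zero_dyadic :: dyadic is "\<lambda>_. 0"
  by (simp add: dyadic_rel_refl)

lift_definition one_dyadic :: dyadic is "\<lambda>_. 1"
  by (simp add: dyadic_rel_refl)

lift_definition plus_dyadic :: "dyadic \<Rightarrow> dyadic \<Rightarrow> dyadic" is "\<lambda>X Y n. X n + Y n"
  by (rule dyadic_rel_binary) (auto simp: add_diff_add)

lift_definition minus_dyadic :: "dyadic \<Rightarrow> dyadic \<Rightarrow> dyadic" is "\<lambda>X Y n. X n - Y n"
  by (rule dyadic_rel_binary[where f = "(-)"]) (rule dvd_diff_diff)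

lift_definition uminus_dyadic :: "dyadic \<Rightarrow> dyadic" is "\<lambda>X n. - X n"
  by (rule dyadic_rel_binary[where f = "\<lambda>x y. - x"]) (rule dvd_minus_diff)

lift_definition times_dyadic :: "dyadic \<Rightarrow> dyadic \<Rightarrow> dyadic" is "\<lambda>X Y n. X n * Y n"
  by (rule dyadic_rel_binary[where f = "(*)"]) (rule dvd_mult_diff)

instance
proof
  fix a b c :: dyadic
  show "a + b + c = a + (b + c)"
    by transfer (simp add: dyadic_rel_refl add.assoc dyadic_MCauchy_intros)
  show "a + b = b + a"
    by transfer (simp add: dyadic_rel_refl add.commute dyadic_MCauchy_intros)
  show "0 + a = a" by transfer simp
  show "- a + a = 0" by transfer (simp add: dyadic_rel_refl)
  show "a - b = a + - b"
    by transfer (simp add: dyadic_rel_refl dyadic_MCauchy_intros)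
  show "a * b * c = a * (b * c)"
    by transfer (simp add: dyadic_rel_refl mult.assoc dyadic_MCauchy_intros)
  show "a * b = b * a"
    by transfer (simp add: dyadic_rel_refl mult.commute dyadic_MCauchy_intros)
  show "1 * a = a" by transfer simp
  show "(a + b) * c = a * c + b * c"
    by transfer (simp add: dyadic_rel_refl distrib_right dyadic_MCauchy_intros)
  show "(0::dyadic) \<noteq> 1"
    by transfer (simp add: dyadic_rel_def dyadic_dist_def LIMSEQ_const_iff)
qed

end

lemma dyadic_of_int: "of_int m = Dyadic (\<lambda>_. m)"
proof -
  have *: "of_nat k = Dyadic (\<lambda>_. int k)" for k
  proof (induction k)
    case 0
    show ?case by (simp add: zero_dyadic_def)
  next
    case (Suc k)
    have "of_nat (Suc k) = Dyadic (\<lambda>_. 1) + Dyadic (\<lambda>_. int k)"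
      using Suc by (simp add: one_dyadic_def)
    also have "\<dots> = Dyadic (\<lambda>_. 1 + int k)"
      by (rule plus_dyadic.abs_eq) (simp_all add: dyadic_rel_refl)
    finally show ?case by simp
  qed
  show ?thesis
  proof (cases m rule: int_cases2)
    case (nonneg n)
    then show ?thesis by (simp add: *)
  next
    case (nonpos n)
    have "- Dyadic (\<lambda>_. int n) = Dyadic (\<lambda>_. - int n)"
      by (rule uminus_dyadic.abs_eq) (simp add: dyadic_rel_refl)
    then show ?thesis using nonpos by (simp add: *)
  qed
qed

lemma dyadic_dist_diff_le:
  "\<bar>dyadic_dist a b - dyadic_dist c d\<bar> \<le> dyadic_dist a c + dyadic_dist b d"
proof -
  have "dyadic_dist a b \<le> dyadic_dist a c + (dyadic_dist c d + dyadic_dist d b)"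
       "dyadic_dist c d \<le> dyadic_dist c a + (dyadic_dist a b + dyadic_dist b d)"
    using dyadic_dist.triangle[of a c b] dyadic_dist.triangle[of c d b]
          dyadic_dist.triangle[of c a d] dyadic_dist.triangle[of a b d] by auto
  then show ?thesis
    using dyadic_dist_commute[of a c] dyadic_dist_commute[of b d] by linarith
qed

lemma dyadic_dist_convergent:
  assumes "dyadic_dist.MCauchy X" "dyadic_dist.MCauchy Y"
  shows "convergent (\<lambda>n. dyadic_dist (X n) (Y n))"
proof (rule Cauchy_convergent, rule metric_CauchyI)
  fix e :: real assume "e > 0"
  then have "e / 2 > 0" by simp
  then obtain N1 N2 where
    N: "\<forall>m n. N1 \<le> m \<longrightarrow> N1 \<le> n \<longrightarrow> dyadic_dist (X m) (X n) < e / 2"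
       "\<forall>m n. N2 \<le> m \<longrightarrow> N2 \<le> n \<longrightarrow> dyadic_dist (Y m) (Y n) < e / 2"
    using assms unfolding dyadic_dist.MCauchy_def by meson
  have "dist (dyadic_dist (X m) (Y m)) (dyadic_dist (X n) (Y n)) < e"
    if "m \<ge> max N1 N2" "n \<ge> max N1 N2" for m n
  proof -
    have "dyadic_dist (X m) (X n) < e / 2" "dyadic_dist (Y m) (Y n) < e / 2"
      using N that by auto
    then show ?thesis
      using dyadic_dist_diff_le[of "X m" "Y m" "X n" "Y n"] by (simp add: dist_real_def)
  qed
  then show "\<exists>M. \<forall>m\<ge>M. \<forall>n\<ge>M. dist (dyadic_dist (X m) (Y m)) (dyadic_dist (X n) (Y n)) < e"
    by blast
qed

instantiation dyadic :: metric_space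
begin

lift_definition dist_dyadic :: "dyadic \<Rightarrow> dyadic \<Rightarrow> real"
  is "\<lambda>X Y. lim (\<lambda>n. dyadic_dist (X n) (Y n))"
proof -
  fix X X' Y Y' assume r: "dyadic_rel X X'" "dyadic_rel Y Y'"
  have "convergent (\<lambda>n. dyadic_dist (X n) (Y n))"
    using r dyadic_dist_convergent by (simp add: dyadic_rel_def)
  then have L: "(\<lambda>n. dyadic_dist (X n) (Y n)) \<longlonglongrightarrow> lim (\<lambda>n. dyadic_dist (X n) (Y n))"
    by (simp add: convergent_LIMSEQ_iff)
  have S: "(\<lambda>n. dyadic_dist (X n) (X' n) + dyadic_dist (Y n) (Y' n)) \<longlonglongrightarrow> 0"
    using r unfolding dyadic_rel_def by (auto intro: tendsto_eq_intros)
  have "(\<lambda>n. dyadic_dist (X' n) (Y' n) - dyadic_dist (X n) (Y n)) \<longlonglongrightarrow> 0"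
  proof (rule Lim_null_comparison[OF _ S], intro always_eventually allI)
    show "norm (dyadic_dist (X' n) (Y' n) - dyadic_dist (X n) (Y n)) \<le>
        dyadic_dist (X n) (X' n) + dyadic_dist (Y n) (Y' n)" for n
      using dyadic_dist_diff_le[of "X n" "Y n" "X' n" "Y' n"] by (simp add: abs_minus_commute)
  qed
  from tendsto_add[OF this L] have "(\<lambda>n. dyadic_dist (X' n) (Y' n)) \<longlonglongrightarrow> lim (\<lambda>n. dyadic_dist (X n) (Y n))"
    by simp
  then show "lim (\<lambda>n. dyadic_dist (X n) (Y n)) = lim (\<lambda>n. dyadic_dist (X' n) (Y' n))"
    by (simp add: limI)
qed

definition uniformity_dyadic :: "(dyadic \<times> dyadic) filter" where
  "uniformity_dyadic = (INF e\<in>{0<..}. principal {(x, y). dist x y < e})"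

definition open_dyadic :: "dyadic set \<Rightarrow> bool" where
  "open_dyadic U \<longleftrightarrow> (\<forall>x\<in>U. \<forall>\<^sub>F (x', y) in uniformity. x' = x \<longrightarrow> y \<in> U)"

instance
proof
  show "(uniformity :: (dyadic \<times> dyadic) filter) = (INF e\<in>{0<..}. principal {(x, y). dist x y < e})"
    by (rule uniformity_dyadic_def)
  show "open U \<longleftrightarrow> (\<forall>x\<in>U. \<forall>\<^sub>F (x', y) in uniformity. x' = x \<longrightarrow> y \<in> U)" for U :: "dyadic set"
    by (rule open_dyadic_def)
  show "dist x y = 0 \<longleftrightarrow> x = y" for x y :: dyadic
  proof transfer
    fix X Y assume r: "dyadic_rel X X" "dyadic_rel Y Y"
    then have "convergent (\<lambda>n. dyadic_dist (X n) (Y n))"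
      using dyadic_dist_convergent by (simp add: dyadic_rel_def)
    then show "lim (\<lambda>n. dyadic_dist (X n) (Y n)) = 0 \<longleftrightarrow> dyadic_rel X Y"
      using r unfolding convergent_LIMSEQ_iff dyadic_rel_def by (metis limI)
  qed
  show "dist x y \<le> dist x z + dist y z" for x y z :: dyadic
  proof transfer
    fix X Y Z assume "dyadic_rel X X" "dyadic_rel Y Y" "dyadic_rel Z Z"
    then have "(\<lambda>n. dyadic_dist (X n) (Y n)) \<longlonglongrightarrow> lim (\<lambda>n. dyadic_dist (X n) (Y n))"
      "(\<lambda>n. dyadic_dist (X n) (Z n)) \<longlonglongrightarrow> lim (\<lambda>n. dyadic_dist (X n) (Z n))"
      "(\<lambda>n. dyadic_dist (Y n) (Z n)) \<longlonglongrightarrow> lim (\<lambda>n. dyadic_dist (Y n) (Z n))"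
      using dyadic_dist_convergent by (simp_all add: dyadic_rel_refl flip: convergent_LIMSEQ_iff)
    from this(1) tendsto_add[OF this(2,3)]
    show "lim (\<lambda>n. dyadic_dist (X n) (Y n)) \<le>
        lim (\<lambda>n. dyadic_dist (X n) (Z n)) + lim (\<lambda>n. dyadic_dist (Y n) (Z n))"
      by (rule LIMSEQ_le)
         (use dyadic_dist.triangle dyadic_dist_commute in \<open>metis UNIV_I\<close>)
  qed
qed

end

lemma dist_dyadic_of_int: "dist (of_int m :: dyadic) (of_int n) = dyadic_dist m n"
  by (simp add: dyadic_of_int dist_dyadic.abs_eq dyadic_rel_refl)

lemma of_int_tendsto_Dyadic:
  assumes "dyadic_dist.MCauchy X"
  shows "(\<lambda>n. of_int (X n)) \<longlonglongrightarrow> Dyadic X"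
proof (rule metric_LIMSEQ_I)
  fix e :: real assume "e > 0"
  then have "e / 2 > 0" by simp
  then obtain N where N: "\<forall>m n. N \<le> m \<longrightarrow> N \<le> n \<longrightarrow> dyadic_dist (X m) (X n) < e / 2"
    using assms unfolding dyadic_dist.MCauchy_def by meson
  have "dist (of_int (X n)) (Dyadic X) < e" if n: "n \<ge> N" for n
  proof -
    have "convergent (\<lambda>k. dyadic_dist (X n) (X k))"
      by (rule dyadic_dist_convergent) (use assms in auto)
    then have "(\<lambda>k. dyadic_dist (X n) (X k)) \<longlonglongrightarrow> lim (\<lambda>k. dyadic_dist (X n) (X k))"
      by (simp add: convergent_LIMSEQ_iff)
    then have "lim (\<lambda>k. dyadic_dist (X n) (X k)) \<le> e / 2"
      by (rule LIMSEQ_le_const2) (use N n in \<open>auto intro!: exI[of _ N] less_imp_le\<close>)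
    then show ?thesis
      using \<open>e > 0\<close> assms by (simp add: dyadic_of_int dist_dyadic.abs_eq dyadic_rel_refl)
  qed
  then show "\<exists>N. \<forall>n\<ge>N. dist (of_int (X n)) (Dyadic X) < e" by blast
qed

lemma dyadic_of_int_dense: "closure (range (of_int :: int \<Rightarrow> dyadic)) = UNIV"
proof -
  have "x \<in> closure (range of_int)" for x :: dyadic
  proof (induction x)
    case (1 X)
    then have "(\<lambda>n. of_int (X n)) \<longlonglongrightarrow> Dyadic X"
      by (intro of_int_tendsto_Dyadic) (simp add: dyadic_rel_refl)
    then show ?case
      unfolding closure_sequential by (intro exI[of _ "\<lambda>n. of_int (X n)"]) auto
  qed
  then show ?thesis by auto
qed

instance dyadic :: complete_space
proof
  fix x :: "nat \<Rightarrow> dyadic"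
  assume x: "Cauchy x"
  have "\<exists>m. dist (of_int m) (x k) < inverse (real (Suc k))" for k
    using dyadic_of_int_dense closure_approachable[of "x k" "range of_int"] by auto
  then obtain m where m: "\<And>k. dist (of_int (m k)) (x k) < inverse (real (Suc k))"
    by metis
  have m0: "(\<lambda>k. dist (of_int (m k)) (x k)) \<longlonglongrightarrow> 0"
  proof (rule tendsto_sandwich[OF _ _ tendsto_const LIMSEQ_inverse_real_of_nat])
    show "\<forall>\<^sub>F k in sequentially. dist (of_int (m k)) (x k) \<le> inverse (real (Suc k))"
      using less_imp_le[OF m] by (intro always_eventually allI)
  qed simp
  have "dyadic_dist.MCauchy m"
    unfolding dyadic_dist.MCauchy_def
  proof (intro conjI allI impI)
    fix e :: real assume "e > 0"
    then have e3: "e / 3 > 0" by simp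
    obtain N1 where N1: "\<forall>i\<ge>N1. \<forall>j\<ge>N1. dist (x i) (x j) < e / 3"
      using metric_CauchyD[OF x e3] by blast
    obtain N2 where N2: "\<forall>i\<ge>N2. dist (of_int (m i)) (x i) < e / 3"
      using order_tendstoD(2)[OF m0 e3] unfolding eventually_sequentially by blast
    have "dyadic_dist (m i) (m j) < e" if "i \<ge> max N1 N2" "j \<ge> max N1 N2" for i j
    proof -
      have "dist (x i) (x j) < e / 3" "dist (of_int (m i)) (x i) < e / 3"
        "dist (of_int (m j)) (x j) < e / 3"
        using N1 N2 that by auto
      moreover have "dist (of_int (m i)) (of_int (m j) :: dyadic) \<le>
          dist (of_int (m i)) (x i) + (dist (x i) (x j) + dist (of_int (m j)) (x j))"
        by (metis add_left_mono dist_commute dist_triangle order_trans)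
      ultimately show ?thesis by (simp add: dist_dyadic_of_int)
    qed
    then show "\<exists>N. \<forall>n n'. N \<le> n \<longrightarrow> N \<le> n' \<longrightarrow> dyadic_dist (m n) (m n') < e" by blast
  qed simp
  then have "(\<lambda>k. of_int (m k)) \<longlonglongrightarrow> Dyadic m" by (rule of_int_tendsto_Dyadic)
  then have "(\<lambda>k. dist (of_int (m k)) (Dyadic m)) \<longlonglongrightarrow> 0" by (rule tendsto_dist_iff[THEN iffD1])
  with m0 have S: "(\<lambda>k. dist (of_int (m k)) (x k) + dist (of_int (m k)) (Dyadic m)) \<longlonglongrightarrow> 0 + 0"
    by (rule tendsto_add)
  have "(\<lambda>k. dist (x k) (Dyadic m)) \<longlonglongrightarrow> 0"
  proof (rule Lim_null_comparison[OF _ S[simplified]], intro always_eventually allI)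
    show "norm (dist (x k) (Dyadic m)) \<le> dist (of_int (m k)) (x k) + dist (of_int (m k)) (Dyadic m)" for k
      using dist_triangle3[of "x k" "Dyadic m" "of_int (m k)"] by simp
  qed
  then have "x \<longlonglongrightarrow> Dyadic m" by (rule tendsto_dist_iff[THEN iffD2])
  then show "convergent x" by (rule convergentI)
qed


section \<open>The Julia set and its equilibrium measure\<close>

definition quad_map :: "real \<Rightarrow> complex \<Rightarrow> complex" where
  "quad_map lam z = z\<^sup>2 - of_real lam"

definition julia_set :: "real \<Rightarrow> complex set" where
  "julia_set lam = UNIV - {z. filterlim (\<lambda>n. (quad_map lam ^^ n) z) at_infinity sequentially}"

text \<open>
  The value at coinciding points has to be set by hand because \<open>ln 0 = 0\<close>.  The integral of
  the kernel is split into its positive and negative parts; for measures on a compact set the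
  subtracted term is finite.
\<close>

definition log_kernel :: "complex \<Rightarrow> complex \<Rightarrow> ereal" where
  "log_kernel z w = (if z = w then \<infinity> else ereal (ln (1 / dist z w)))"

definition log_energy :: "complex measure \<Rightarrow> ereal" where
  "log_energy \<mu> =
     enn2ereal (\<integral>\<^sup>+z. (\<integral>\<^sup>+w. e2ennreal (log_kernel z w) \<partial>\<mu>) \<partial>\<mu>) -
     enn2ereal (\<integral>\<^sup>+z. (\<integral>\<^sup>+w. e2ennreal (- log_kernel z w) \<partial>\<mu>) \<partial>\<mu>)"

definition prob_measures_on :: "complex set \<Rightarrow> complex measure set" where
  "prob_measures_on K = {\<mu>. prob_space \<mu> \<and> sets \<mu> = sets borel \<and> (AE z in \<mu>. z \<in> K)}"

text \<open>
  As usual, only compact sets of positive capacity have an equilibrium measure; hence the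
  requirement of finite energy.
\<close>

definition equilibrium_measure :: "complex set \<Rightarrow> complex measure \<Rightarrow> bool" where
  "equilibrium_measure K \<mu> \<longleftrightarrow>
     \<mu> \<in> prob_measures_on K \<and> log_energy \<mu> < \<infinity> \<and>
     (\<forall>\<nu>\<in>prob_measures_on K. log_energy \<mu> \<le> log_energy \<nu>)"

section \<open>Orthonormal polynomials and recurrence coefficients\<close>

definition orthonormal_polys :: "complex measure \<Rightarrow> (nat \<Rightarrow> complex poly) \<Rightarrow> bool" where
  "orthonormal_polys \<mu> p \<longleftrightarrow>
     (\<forall>n. degree (p n) = n \<and> (\<exists>c>0. lead_coeff (p n) = of_real c)) \<and>
     (\<forall>m n. (LINT z|\<mu>. poly (p m) z * cnj (poly (p n) z)) = (if m = n then 1 else 0))"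

definition recurrence_coeffs :: "(nat \<Rightarrow> complex poly) \<Rightarrow> (nat \<Rightarrow> real) \<Rightarrow> bool" where
  "recurrence_coeffs p a \<longleftrightarrow>
     a 0 = 0 \<and> (\<forall>n\<ge>1. a n > 0) \<and>
     [:0, 1:] * p 0 = smult (of_real (a 1)) (p 1) \<and>
     (\<forall>n\<ge>1. [:0, 1:] * p n =
        smult (of_real (a n)) (p (n - 1)) + smult (of_real (a (n + 1))) (p (n + 1)))"

definition dyadic_extension :: "(nat \<Rightarrow> real) \<Rightarrow> dyadic \<Rightarrow> real" where
  "dyadic_extension a \<kappa> =
     (THE L. \<forall>k :: nat \<Rightarrow> nat. (\<lambda>j. of_nat (k j)) \<longlonglongrightarrow> \<kappa> \<longrightarrow> (\<lambda>j. a (k j)) \<longlonglongrightarrow> L)"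

section \<open>Operators on square-summable bilateral sequences\<close>

definition ell2 :: "(int \<Rightarrow> complex) set" where
  "ell2 = {f. (\<lambda>n. (cmod (f n))\<^sup>2) summable_on UNIV}"

definition ell2_inner :: "(int \<Rightarrow> complex) \<Rightarrow> (int \<Rightarrow> complex) \<Rightarrow> complex" where
  "ell2_inner f g = (\<Sum>\<^sub>\<infinity>n. f n * cnj (g n))"

definition ell2_norm :: "(int \<Rightarrow> complex) \<Rightarrow> real" where
  "ell2_norm f = sqrt (\<Sum>\<^sub>\<infinity>n. (cmod (f n))\<^sup>2)"

type_synonym ell2_operator = "(int \<Rightarrow> complex) \<Rightarrow> (int \<Rightarrow> complex)"

definition ell2_eigenvalue :: "ell2_operator \<Rightarrow> complex \<Rightarrow> bool" where
  "ell2_eigenvalue A z \<longleftrightarrow> (\<exists>f\<in>ell2. f \<noteq> (\<lambda>_. 0) \<and> A f = (\<lambda>n. z * f n))"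

definition ell2_resolvent_set :: "ell2_operator \<Rightarrow> complex set" where
  "ell2_resolvent_set A = {z. bij_betw (\<lambda>f n. A f n - z * f n) ell2 ell2 \<and>
     (\<exists>C. \<forall>f\<in>ell2. ell2_norm f \<le> C * ell2_norm (\<lambda>n. A f n - z * f n))}"

definition ell2_spectrum :: "ell2_operator \<Rightarrow> complex set" where
  "ell2_spectrum A = UNIV - ell2_resolvent_set A"

text \<open>
  The spectral measure of a bounded self-adjoint \<open>A\<close> at \<open>f\<close> is the finite Borel measure
  \<open>M\<close> on the spectrum with \<open>\<langle>q(A) f, f\<rangle> = \<integral> q \<partial>M\<close> for continuous \<open>q\<close>.  The continuous functional
  calculus is by definition the uniform limit of the polynomial one, so by linearity the
  identity is required for monomials \<open>q\<close> only.
\<close>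

definition spectral_measure :: "ell2_operator \<Rightarrow> (int \<Rightarrow> complex) \<Rightarrow> real measure \<Rightarrow> bool" where
  "spectral_measure A f M \<longleftrightarrow>
     finite_measure M \<and> sets M = sets borel \<and> (AE x in M. complex_of_real x \<in> ell2_spectrum A) \<and>
     (\<forall>k. ell2_inner ((A ^^ k) f) f = of_real (LINT x|M. x ^ k))"

definition singular_continuous :: "real measure \<Rightarrow> bool" where
  "singular_continuous M \<longleftrightarrow>
     (\<forall>x. emeasure M {x} = 0) \<and>
     (\<exists>S\<in>sets borel. emeasure lborel S = 0 \<and> emeasure M (UNIV - S) = 0)"

definition purely_singular_continuous_spectrum :: "ell2_operator \<Rightarrow> bool" where
  "purely_singular_continuous_spectrum A \<longleftrightarrow>
     (\<forall>f\<in>ell2. \<exists>M. spectral_measure A f M \<and> singular_continuous M)"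

text \<open>The bounded operator determined by its action on the standard basis (lemma below).\<close>

definition jacobi_operator :: "(dyadic \<Rightarrow> real) \<Rightarrow> dyadic \<Rightarrow> ell2_operator" where
  "jacobi_operator \<alpha> \<kappa> f = (\<lambda>n.
     of_real (\<alpha> (\<kappa> + of_int (n + 1))) * f (n + 1) + of_real (\<alpha> (\<kappa> + of_int n)) * f (n - 1))"

definition std_basis :: "int \<Rightarrow> int \<Rightarrow> complex" where
  "std_basis n = (\<lambda>m. if m = n then 1 else 0)"

lemma jacobi_operator_std_basis:
  "jacobi_operator \<alpha> \<kappa> (std_basis n) =
     (\<lambda>m. of_real (\<alpha> (\<kappa> + of_int n)) * std_basis (n - 1) m +
          of_real (\<alpha> (\<kappa> + of_int n + 1)) * std_basis (n + 1) m)"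
  by (auto simp: jacobi_operator_def std_basis_def fun_eq_iff add.assoc)

end

theory Submission
  imports Defs
begin

text \<open>
  Write \<open>T x = x\<^sup>2 - \<lambda>\<close>.  The proof needs four facts about \<open>T\<close>, its Julia set \<open>E\<close> and the coefficients.

  \<^bold>\<open>The equilibrium measure is balanced.\<close>  Distances on \<open>E\<close> obey \<open>T x - T y = (x - y) (x + y)\<close>.
  Read forwards, and with positive definiteness of the logarithmic kernel, this says that pushing a
  measure on \<open>E\<close> forward under \<open>T\<close> at most doubles its energy; read backwards, that its pullback
  under the two branches of the inverse of \<open>T\<close> has half the energy.  Hence a minimizer has energy
  \<open>0\<close>, and so has its pullback.  As their midpoint cannot have less energy, positive definiteness
  forces both to have the same moments (\<open>equilibrium_balanced\<close>).

  \<^bold>\<open>The coefficients obey a renormalization.\<close>  For a balanced measure \<open>P\<^bsub>2n\<^esub> = P\<^sub>n \<circ> T\<close>,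
  and the recurrence gives \<open>a\<^bsub>2n\<^esub>\<^sup>2 + a\<^bsub>2n+1\<^esub>\<^sup>2 = \<lambda>\<close> and \<open>a\<^bsub>2n\<^esub> a\<^bsub>2n-1\<^esub> = a\<^sub>n\<close>
  (\<open>coeff_sum\<close>, \<open>coeff_product\<close>).  For \<open>\<lambda> > 3\<close> these relations contract differences of squared
  coefficients (\<open>b_diff_bound\<close>), so that \<open>a\<close> is limit periodic and they pass to all dyadic indices.
  In consequence, if \<open>f\<close> is an eigenvector of \<open>J\<^bsub>2\<kappa>+r\<^esub>\<close> for \<open>z\<close>, then \<open>n \<mapsto> f (2n - r)\<close> is
  one of \<open>J\<^sub>\<kappa>\<close> for \<open>T z\<close> (\<open>eigenvector_halve\<close>).

  \<^bold>\<open>There are no eigenvalues.\<close>  Iterating, the orbit of an eigenvalue \<open>z\<close> consists of eigenvalues of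
  uniformly bounded operators; so \<open>z \<in> E\<close>, and the orbit is real and stays away from \<open>0\<close>.  Let \<open>h\<^sub>k\<close> be
  the \<open>k\<close>-th restriction of a real eigenvector \<open>f\<close>.  The mass of \<open>f\<close> on a block of length \<open>2\<^sup>k\<close>
  is \<open>2\<^sup>k\<close> times a value of \<open>h\<^sub>k\<^sup>2\<close> up to boundary terms (\<open>block_mass\<close>), which are controlled by the
  values of \<open>2\<^sup>k h\<^sub>k\<^sup>2\<close> next to the two ends (\<open>boundary_bound_u\<close>).  This makes \<open>2\<^sup>k h\<^sub>k\<^sup>2\<close> summable with
  sum at most \<open>\<parallel>f\<parallel>\<^sup>2\<close>, geometrically decaying outside the bulk of \<open>f\<close>, and bounds \<open>(f x)\<^sup>2\<close> in terms
  of the values of \<open>2\<^sup>k f\<^sup>2\<close> at the two ends of the block around \<open>x\<close> (\<open>block_estimate\<close>).  From one level to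
  the next exactly one end moves, by the length of the block, into the region of decay; if an end
  is eventually constant, \<open>f\<close> vanishes there.  Along suitable levels both end values
  therefore tend to \<open>0\<close>, and \<open>f x = 0\<close> (\<open>solution_zero\<close>).

  \<^bold>\<open>The spectral measures are singular continuous.\<close>  The moments of \<open>J\<^sub>\<kappa>\<close> at a finitely supported
  vector \<open>f\<close> are limits, as \<open>k \<rightarrow> \<kappa>\<close>, of those of the measures with density \<open>\<bar>\<Sum>\<^sub>n f\<^sub>n P\<^bsub>n+k\<^esub>\<bar>\<^sup>2\<close>
  with respect to the equilibrium measure.  By Helly's theorem some limit measure on \<open>E\<close> has these moments, and
  truncation extends this to every square-summable \<open>f\<close> (\<open>moment_measure_exists\<close>).  The set \<open>E\<close> is
  a null set (\<open>real_julia_null\<close>), and an atom would produce an eigenvector (\<open>atom_eigenvalue\<close>).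
\<close>

section \<open>Orthogonal polynomials of an invariant functional\<close>

text \<open>
  Repeated division by \<open>x\<^sup>2 + c\<close> splits a polynomial into a part in \<open>x\<^sup>2 + c\<close> and \<open>x\<close> times such a
  part, as for even and odd polynomials.  The degree bound is what lets orthogonality of \<open>P\<^sub>n\<close> pass
  to \<open>P\<^sub>n \<circ> T\<close>.
\<close>

lemma quadratic_decomposition:
  fixes r :: "'a::field poly"
  shows "\<exists>e od. r = e \<circ>\<^sub>p [:c, 0, 1:] + [:0, 1:] * (od \<circ>\<^sub>p [:c, 0, 1:]) \<and> 2 * degree e \<le> degree r"
proof (induction "degree r" arbitrary: r rule: less_induct)
  case less
  define T where "T = [:c, 0, 1:]"
  have T: "degree T = 2" by (simp add: T_def)
  have lin: "\<exists>a b. p = [:a, b:]" if "degree p < 2" for p :: "'a poly"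
  proof -
    have "coeff p n = coeff [:coeff p 0, coeff p 1:] n" for n
      using that coeff_eq_0[of p n] by (cases n; cases "n - 1") (auto simp: numeral_2_eq_2)
    then show ?thesis by (metis poly_eqI)
  qed
  show ?case
  proof (cases "degree r < 2")
    case True
    then obtain a b where "r = [:a, b:]" using lin by blast
    then have "r = [:a:] \<circ>\<^sub>p T + [:0, 1:] * ([:b:] \<circ>\<^sub>p T) \<and> 2 * degree [:a:] \<le> degree r"
      by simp
    then show ?thesis unfolding T_def by blast
  next
    case False
    have T0: "T \<noteq> 0" by (simp add: T_def)
    define q where "q = r div T"
    have "r mod T = 0 \<or> degree (r mod T) < 2" using degree_mod_less[of T r] T T0 by auto
    then have "degree (r mod T) < 2" by auto
    then obtain a b where ab: "r mod T = [:a, b:]" using lin by blast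
    have r: "r = T * q + [:a, b:]" unfolding q_def ab[symmetric] by simp
    have q0: "q \<noteq> 0"
    proof
      assume "q = 0"
      then have "r = [:a, b:]" using r by simp
      then show False using False by (simp split: if_splits)
    qed
    have dT: "degree (T * q) = 2 + degree q" using q0 T T0 by (simp add: degree_mult_eq)
    have "degree [:a, b:] < degree (T * q)" unfolding dT by simp
    then have dr: "degree r = 2 + degree q" unfolding r dT[symmetric] by (rule degree_add_eq_left)
    then obtain e od where eo: "q = e \<circ>\<^sub>p T + [:0, 1:] * (od \<circ>\<^sub>p T)" "2 * degree e \<le> degree q"
      using less[of q] unfolding T_def by auto
    have "r = (pCons a e) \<circ>\<^sub>p T + [:0, 1:] * ((pCons b od) \<circ>\<^sub>p T)"
      unfolding r pcompose_pCons by (subst eo(1)) (simp add: algebra_simps)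
    moreover have "degree (pCons a e) \<le> Suc (degree e)" by (rule degree_pCons_le)
    ultimately show ?thesis using eo(2) dr unfolding T_def by (intro exI[of _ "pCons a e"] exI[of _ "pCons b od"]) auto
  qed
qed

text \<open>
  The functional \<open>L\<close> stands for integration against a measure that is even and invariant under
  \<open>T\<close>, as far as polynomials can tell.
\<close>

locale invariant_orthonormal_polys =
  fixes L :: "real poly \<Rightarrow> real" and P :: "nat \<Rightarrow> real poly" and a :: "nat \<Rightarrow> real" and lam :: real
  assumes L_add: "\<And>p q. L (p + q) = L p + L q"
    and L_smult: "\<And>c p. L (smult c p) = c * L p"
    and L_inv: "\<And>q. L (q \<circ>\<^sub>p [:-lam, 0, 1:]) = L q"
    and L_odd: "\<And>q. L ([:0, 1:] * (q \<circ>\<^sub>p [:-lam, 0, 1:])) = 0"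
    and orth: "\<And>m n. L (P m * P n) = (if m = n then 1 else 0)"
    and degP: "\<And>n. degree (P n) = n"
    and lcP: "\<And>n. lead_coeff (P n) > 0"
    and a0: "a 0 = 0"
    and rec: "\<And>n. [:0, 1:] * P n = smult (a n) (P (n - 1)) + smult (a (n + 1)) (P (n + 1))"
begin

abbreviation "T \<equiv> [:-lam, 0, 1:]"

lemma L_expand: "L ((smult c p + smult d q) * r) = c * L (p * r) + d * L (q * r)"
  by (simp only: distrib_right mult_smult_left L_add L_smult)

lemma L_expand': "L (r * (smult c p + smult d q)) = c * L (r * p) + d * L (r * q)"
  by (simp only: distrib_left mult_smult_right L_add L_smult)

lemma L_diff: "L (p - q) = L p - L q"
  using L_add[of p "smult (-1) q"] L_smult[of "-1" q] by simp

lemma L_0: "L 0 = 0" using L_smult[of 0 0] by simp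

lemma lower_remainder:
  assumes "degree e \<le> n"
  shows "e - smult (coeff e n / lead_coeff (P n)) (P n) = 0 \<or>
    degree (e - smult (coeff e n / lead_coeff (P n)) (P n)) < n"
proof -
  define d where "d = e - smult (coeff e n / lead_coeff (P n)) (P n)"
  have "coeff d n = 0" using lcP[of n] degP[of n] by (simp add: d_def)
  moreover have "degree d \<le> n" unfolding d_def using assms degP[of n]
    by (intro degree_diff_le) (auto intro: order_trans[OF degree_smult_le])
  ultimately have "d = 0 \<or> degree d < n"
    by (metis leading_coeff_0_iff order_le_less)
  then show ?thesis by (simp add: d_def)
qed

lemma L_lower: "degree e < n \<Longrightarrow> L (P n * e) = 0"
proof (induction "degree e" arbitrary: e rule: less_induct)
  case less
  define t where "t = coeff e (degree e) / lead_coeff (P (degree e))"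
  define d where "d = e - smult t (P (degree e))"
  have "d = 0 \<or> degree d < degree e" using lower_remainder[of e "degree e"] by (simp add: d_def t_def)
  then have "L (P n * d) = 0" using less L_0 by auto
  moreover have "e = d + smult t (P (degree e))" by (simp add: d_def)
  then have "L (P n * e) = L (P n * d) + t * L (P n * P (degree e))"
    using L_expand'[of "P n" 1 d t "P (degree e)"] by simp
  ultimately show ?case using orth less.prems by simp
qed

text \<open>
  By the decomposition, pairing \<open>P\<^sub>n \<circ> T\<close> with a polynomial of degree below \<open>2n\<close> amounts to pairing
  \<open>P\<^sub>n\<close> with one of degree below \<open>n\<close>, because \<open>L\<close> is even and invariant.  So \<open>P\<^sub>n \<circ> T\<close> is a
  multiple of \<open>P\<^bsub>2n\<^esub>\<close>; invariance fixes its norm and positivity of the leading coefficients its sign.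
\<close>

lemma P_double: "P (2 * n) = P n \<circ>\<^sub>p T"
proof -
  define Q where "Q = P n \<circ>\<^sub>p T"
  have dQ: "degree Q = 2 * n" by (simp add: Q_def degree_pcompose degP)
  have lQ: "lead_coeff Q > 0" using lcP[of n] by (simp add: Q_def lead_coeff_comp)
  have Qorth: "L (Q * r) = 0" if "degree r < 2 * n" for r
  proof -
    obtain e od where eo: "r = e \<circ>\<^sub>p T + [:0, 1:] * (od \<circ>\<^sub>p T)" "2 * degree e \<le> degree r"
      using quadratic_decomposition by blast
    have "Q * r = (P n * e) \<circ>\<^sub>p T + [:0, 1:] * ((P n * od) \<circ>\<^sub>p T)"
      unfolding Q_def pcompose_mult by (subst eo(1)) (simp add: algebra_simps)
    then have "L (Q * r) = L (P n * e)" using L_add L_inv L_odd by simp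
    then show ?thesis using L_lower[of e n] eo(2) that by simp
  qed
  define t where "t = lead_coeff Q / lead_coeff (P (2 * n))"
  have t: "t > 0" using lQ lcP by (simp add: t_def)
  define d where "d = Q - smult t (P (2 * n))"
  have d: "d = 0 \<or> degree d < 2 * n"
    using lower_remainder[of Q "2 * n"] dQ by (simp add: d_def t_def)
  have "d = 0"
  proof (rule ccontr)
    assume d0: "d \<noteq> 0"
    define k where "k = degree d"
    have k: "k < 2 * n" using d d0 by (simp add: k_def)
    have "L (P k * d) = L (Q * P k) - t * L (P (2 * n) * P k)"
      unfolding d_def right_diff_distrib L_diff mult_smult_right L_smult by (simp only: mult.commute)
    then have z: "L (P k * d) = 0" using Qorth[of "P k"] L_lower[of "P k" "2 * n"] degP k by simp
    define tt where "tt = coeff d k / lead_coeff (P k)"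
    define d' where "d' = d - smult tt (P k)"
    have "d' = 0 \<or> degree d' < k" using lower_remainder[of d k] by (simp add: d'_def tt_def k_def)
    then have "L (P k * d') = 0" using L_lower L_0 by auto
    moreover have "d = d' + smult tt (P k)" by (simp add: d'_def)
    ultimately have "L (P k * d) = tt"
      using orth[of k k] L_expand'[of "P k" 1 d' tt "P k"] by simp
    moreover have "tt \<noteq> 0" using d0 lcP[of k] by (auto simp: tt_def k_def)
    ultimately show False using z by simp
  qed
  then have Qt: "Q = smult t (P (2 * n))" by (simp add: d_def)
  have "L (Q * Q) = L (P n * P n)" unfolding Q_def pcompose_mult[symmetric] by (rule L_inv)
  moreover have "L (Q * Q) = t * t * L (P (2 * n) * P (2 * n))" unfolding Qt
    by (simp add: L_smult)
  ultimately have "t * t = 1" using orth[of n n] orth[of "2*n" "2*n"] by simp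
  then have "t\<^sup>2 = 1" by (simp add: power2_eq_square)
  then have "t = 1" using t by (simp add: power2_eq_1_iff)
  then show ?thesis using Qt by (simp add: Q_def)
qed

lemma shift_product: "L (([:0, 1:] * P m) * ([:0, 1:] * P n)) =
   a m * a n * (if m - 1 = n - 1 then 1 else 0) + a m * a (n + 1) * (if m - 1 = n + 1 then 1 else 0)
   + a (m + 1) * a n * (if m + 1 = n - 1 then 1 else 0) + a (m + 1) * a (n + 1) * (if m = n then 1 else 0)"
  unfolding rec L_expand L_expand' orth by (simp add: algebra_simps)

lemma jacobi_entry: "L (([:0, 1:] * P m) * P n) =
   a m * (if m - 1 = n then 1 else 0) + a (m + 1) * (if m + 1 = n then 1 else 0)"
  unfolding rec L_expand orth by simp

text \<open>
  Since \<open>x\<^sup>2 = T x + \<lambda>\<close>, the square of the Jacobi matrix restricted to even indices is the Jacobi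
  matrix itself plus \<open>\<lambda>\<close>.  The two relations for the coefficients below are the diagonal and the
  off-diagonal entries of this identity.
\<close>

lemma double_entry: "L (([:0, 1:] * P (2 * m)) * ([:0, 1:] * P (2 * n))) =
  L (([:0, 1:] * P m) * P n) + lam * (if m = n then 1 else 0)"
proof -
  have "([:0, 1:] * P (2 * m)) * ([:0, 1:] * P (2 * n)) = (([:0, 1:] * P m) * P n) \<circ>\<^sub>p T + smult lam (P (2 * m) * P (2 * n))"
  proof -
    have X: "[:0, 1:] * [:0, 1:] = T + [:lam:]" by simp
    have "([:0, 1:] * P (2 * m)) * ([:0, 1:] * P (2 * n)) = ([:0, 1:] * [:0, 1:]) * (P (2 * m) * P (2 * n))"
      by (simp only: mult_ac)
    also have "\<dots> = T * (P (2 * m) * P (2 * n)) + smult lam (P (2 * m) * P (2 * n))"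
      unfolding X distrib_right by simp
    also have "T * (P (2 * m) * P (2 * n)) = (([:0, 1:] * P m) * P n) \<circ>\<^sub>p T"
    proof -
      have XT: "[:0, 1:] \<circ>\<^sub>p T = T" by (simp add: pcompose_pCons)
      show ?thesis unfolding P_double pcompose_mult XT by (simp only: mult_ac)
    qed
    finally show ?thesis .
  qed
  then show ?thesis using orth[of "2*m" "2*n"] by (simp only: L_add L_smult L_inv) (cases "m = n", simp_all)
qed

lemma coeff_sum: "(a (2 * n))\<^sup>2 + (a (2 * n + 1))\<^sup>2 = lam"
proof -
  have "L (([:0, 1:] * P n) * P n) = 0" unfolding jacobi_entry using a0 by (cases n) auto
  then have "L (([:0, 1:] * P (2 * n)) * ([:0, 1:] * P (2 * n))) = lam" using double_entry[of n n] by simp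
  then show ?thesis unfolding shift_product by (auto simp: power2_eq_square a0)
qed

lemma coeff_product: "n \<ge> 1 \<Longrightarrow> a (2 * n) * a (2 * n - 1) = a n"
proof -
  assume n: "n \<ge> 1"
  have "L (([:0, 1:] * P n) * P (n - 1)) = a n" unfolding jacobi_entry using n by auto
  then have "L (([:0, 1:] * P (2 * n)) * ([:0, 1:] * P (2 * (n - 1)))) = a n" using double_entry[of n "n - 1"] n by simp
  moreover obtain m where m: "n = Suc m" using n by (cases n) auto
  moreover have "(2 * Suc m - 1 = 2 * (Suc m - 1) - 1) = False" "(2 * Suc m - 1 = 2 * (Suc m - 1) + 1) = True"
    "(2 * Suc m + 1 = 2 * (Suc m - 1) - 1) = False" "(2 * Suc m = 2 * (Suc m - 1)) = False"
    "2 * (Suc m - 1) + 1 = 2 * Suc m - 1"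
    by auto
  ultimately show ?thesis unfolding shift_product m by (simp only: if_True if_False mult_1_right mult_zero_right add_0_left add_0_right)
qed

end

section \<open>Limit periodicity\<close>

locale doubling_sequence =
  fixes a :: "nat \<Rightarrow> real" and lam :: real
  assumes lam: "lam > 3" and a0: "a 0 = 0" and nn: "\<And>n. 0 \<le> a n"
    and sum_sq: "\<And>n. (a (2 * n))\<^sup>2 + (a (2 * n + 1))\<^sup>2 = lam"
    and prod: "\<And>n. n \<ge> 1 \<Longrightarrow> a (2 * n) * a (2 * n - 1) = a n"
begin

abbreviation "b n \<equiv> (a n)\<^sup>2"

lemma b_le: "b n \<le> lam"
proof (cases "even n")
  case True
  then obtain i where "n = 2 * i" by blast
  then show ?thesis using sum_sq[of i] by simp (smt (verit) zero_le_power2)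
next
  case False
  then obtain i where "n = 2 * i + 1" by (metis oddE)
  then show ?thesis using sum_sq[of i] by simp (smt (verit) zero_le_power2)
qed

lemma b_double: "n \<ge> 1 \<Longrightarrow> b (2 * n) * (lam - b (2 * (n - 1))) = b n"
proof -
  assume n: "n \<ge> 1"
  have "2 * n - 1 = 2 * (n - 1) + 1" using n by simp
  then have "lam - b (2 * (n - 1)) = b (2 * n - 1)" using sum_sq[of "n - 1"] by simp
  then show ?thesis using prod[OF n] by (simp flip: power_mult_distrib)
qed

text \<open>
  Strong induction on \<open>b (2n) (\<lambda> - b (2n - 2)) = b n\<close>: it remains to bound \<open>b n\<close> by
  \<open>\<lambda> - b (2n - 2)\<close>.  For even \<open>n\<close> the left side is at most \<open>1\<close> and the right side at least \<open>\<lambda> - 1\<close>.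
  For \<open>n = 2i + 1\<close> the claim is \<open>b (4i) \<le> b (2i)\<close>, and dividing by a number of size at least \<open>\<lambda> - 1\<close>
  only decreases.
\<close>

lemma b_even_le: "b (2 * n) \<le> 1"
proof (induction n rule: less_induct)
  case (less n)
  show ?case
  proof (cases "n = 0")
    case True
    then show ?thesis by (simp add: a0)
  next
    case False
    then have n: "n \<ge> 1" by simp
    have A: "lam - b (2 * (n - 1)) \<ge> lam - 1" using less[of "n - 1"] n by simp
    have "b n \<le> lam - b (2 * (n - 1))"
    proof (cases "even n")
      case True
      then obtain i where i: "n = 2 * i" by blast
      then have "b n \<le> 1" using less[of i] n by simp
      then show ?thesis using A lam by simp
    next
      case False
      then obtain i where i: "n = 2 * i + 1" by (metis oddE)
      have "b (2 * (2 * i)) \<le> b (2 * i)"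
      proof (cases "i = 0")
        case True
        then show ?thesis by (simp add: a0)
      next
        case False
        have "b (2 * (2 * i - 1)) \<le> 1" using less[of "2 * i - 1"] i by simp
        then have "b (2 * (2 * i)) * 1 \<le> b (2 * (2 * i)) * (lam - b (2 * (2 * i - 1)))"
          using lam by (intro mult_left_mono) auto
        then show ?thesis using b_double[of "2 * i"] False by simp
      qed
      then show ?thesis using sum_sq[of i] i by simp
    qed
    then have "b (2 * n) * (lam - b (2 * (n - 1))) \<le> 1 * (lam - b (2 * (n - 1)))" using b_double[OF n] by simp
    then show ?thesis using A lam by (simp only: mult_le_cancel_right_pos)
  qed
qed

text \<open>
  The map \<open>n \<mapsto> 2n\<close> gains a factor \<open>2\<close> in the congruence, and \<open>b (2n) = b n / (\<lambda> - b (2n - 2))\<close> gains a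
  factor \<open>\<lambda> - 2 > 1\<close> in the difference: the numerators contribute \<open>1 / (\<lambda> - 1)\<close> of the old difference
  and the denominators \<open>1 / (\<lambda> - 1)\<close> of the new one.  Odd indices follow from the sum rule.
\<close>

lemma b_diff_bound: "2 ^ n dvd int k - int l \<Longrightarrow> \<bar>b k - b l\<bar> \<le> lam * (1 / (lam - 2)) ^ n"
proof (induction n arbitrary: k l)
  case 0
  show ?case using b_le[of k] b_le[of l] by simp (smt (verit) zero_le_power2)
next
  case (Suc n)
  define D where "D = lam * (1 / (lam - 2)) ^ n"
  have D: "D \<ge> 0" using lam by (simp add: D_def)
  \<comment> \<open>The denominators contain the preceding even entry, hence an inner induction.\<close>
  have even_case: "2 ^ n dvd int i - int j \<Longrightarrow> \<bar>b (2 * i) - b (2 * j)\<bar> \<le> D / (lam - 2)" for i j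
  proof (induction i arbitrary: j)
    case 0
    show ?case
    proof (cases "j = 0")
      case True
      then show ?thesis using D lam by simp
    next
      case False
      then have "b (2 * j) * (lam - 2) \<le> b (2 * j) * (lam - b (2 * (j - 1)))"
        using b_even_le[of "j - 1"] by (intro mult_left_mono) auto
      also have "\<dots> = b j" using b_double[of j] False by simp
      also have "\<dots> \<le> D" using Suc.IH[OF 0] by (simp add: a0 D_def)
      finally show ?thesis using lam by (simp add: a0 pos_le_divide_eq)
    qed
  next
    case (Suc i)
    show ?case
    proof (cases "j = 0")
      case True
      have "b (2 * Suc i) * (lam - 2) \<le> b (2 * Suc i) * (lam - b (2 * i))"
        using b_even_le[of "i"] by (intro mult_left_mono) auto
      also have "\<dots> = b (Suc i)" using b_double[of "Suc i"] by simp
      also have "\<dots> \<le> D" using \<open>\<And>l k. 2 ^ n dvd int k - int l \<Longrightarrow> \<bar>b k - b l\<bar> \<le> lam * (1 / (lam - 2)) ^ n\<close>[OF Suc.prems] True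
        by (simp add: a0 D_def)
      finally show ?thesis using lam True by (simp add: a0 pos_le_divide_eq)
    next
      case False
      then obtain j' where j: "j = Suc j'" by (cases j) auto
      define A where "A = lam - b (2 * i)"
      define B where "B = lam - b (2 * j')"
      have A: "A \<ge> lam - 1" using b_even_le[of i] by (simp add: A_def)
      have e1: "b (2 * Suc i) * A = b (Suc i)" using b_double[of "Suc i"] by (simp add: A_def)
      have e2: "b (2 * j) * B = b j" using b_double[of "j"] j by (simp add: B_def)
      have "A * (b (2 * Suc i) - b (2 * j)) = (b (Suc i) - b j) + b (2 * j) * (B - A)"
        using e1 e2 by (simp add: algebra_simps)
      moreover have "\<bar>b (Suc i) - b j\<bar> \<le> D"
        using \<open>\<And>l k. 2 ^ n dvd int k - int l \<Longrightarrow> \<bar>b k - b l\<bar> \<le> lam * (1 / (lam - 2)) ^ n\<close>[OF Suc.prems]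
        by (simp add: D_def)
      moreover have "\<bar>b (2 * j) * (B - A)\<bar> \<le> 1 * (D / (lam - 2))"
        unfolding abs_mult
      proof (rule mult_mono)
        show "\<bar>b (2 * j)\<bar> \<le> 1" using b_even_le[of j] by simp
        show "\<bar>B - A\<bar> \<le> D / (lam - 2)" using Suc.IH[of j'] Suc.prems j by (simp add: A_def B_def)
      qed auto
      ultimately have "\<bar>A * (b (2 * Suc i) - b (2 * j))\<bar> \<le> D + D / (lam - 2)" by linarith
      also have "\<dots> = (lam - 1) * (D / (lam - 2))" using lam by (simp add: field_simps)
      finally have "A * \<bar>b (2 * Suc i) - b (2 * j)\<bar> \<le> (lam - 1) * (D / (lam - 2))"
        using A lam by (simp add: abs_mult)
      moreover have "(lam - 1) * \<bar>b (2 * Suc i) - b (2 * j)\<bar> \<le> A * \<bar>b (2 * Suc i) - b (2 * j)\<bar>"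
        using A by (intro mult_right_mono) auto
      ultimately have "(lam - 1) * \<bar>b (2 * Suc i) - b (2 * j)\<bar> \<le> (lam - 1) * (D / (lam - 2))" by linarith
      then show ?thesis using lam by (simp only: mult_le_cancel_left_pos)
    qed
  qed
  have eq: "lam * (1 / (lam - 2)) ^ Suc n = D / (lam - 2)" by (simp add: D_def)
  have par: "even (int k - int l)" using Suc.prems by (metis dvd_mult_left power_Suc)
  show ?case
  proof (cases "even k")
    case True
    then obtain i j where ij: "k = 2 * i" "l = 2 * j" using par by (auto elim!: evenE simp: even_diff_iff)
    have "(2::int) * 2 ^ n dvd 2 * (int i - int j)" using Suc.prems ij by (simp add: algebra_simps)
    then have "2 ^ n dvd int i - int j" by (simp only: dvd_mult_cancel_left) simp
    then show ?thesis unfolding eq unfolding ij by (rule even_case)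
  next
    case False
    then have "odd l" using par by simp
    then obtain i j where ij: "k = 2 * i + 1" "l = 2 * j + 1" using False by (metis oddE)
    have "(2::int) * 2 ^ n dvd 2 * (int i - int j)" using Suc.prems ij by (simp add: algebra_simps)
    then have "2 ^ n dvd int i - int j" by (simp only: dvd_mult_cancel_left) simp
    then have "\<bar>b (2 * i) - b (2 * j)\<bar> \<le> D / (lam - 2)" by (rule even_case)
    moreover have "b k - b l = - (b (2 * i) - b (2 * j))" using sum_sq[of i] sum_sq[of j] ij by simp
    ultimately show ?thesis unfolding eq by simp
  qed
qed

lemma limit_periodic:
  assumes "e > 0"
  shows "\<exists>n. \<forall>k l. 2 ^ n dvd int k - int l \<longrightarrow> \<bar>a k - a l\<bar> \<le> e"
proof -
  have "0 < 1 / (lam - 2)" "1 / (lam - 2) < 1" using lam by auto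
  then obtain n where n: "(1 / (lam - 2)) ^ n < e\<^sup>2 / lam"
    using real_arch_pow_inv[of "e\<^sup>2 / lam" "1 / (lam - 2)"] assms lam by auto
  have "\<bar>a k - a l\<bar> \<le> e" if "2 ^ n dvd int k - int l" for k l
  proof -
    have "\<bar>a k - a l\<bar>\<^sup>2 \<le> \<bar>a k - a l\<bar> * (a k + a l)"
      unfolding power2_eq_square using nn[of k] nn[of l] by (intro mult_left_mono) auto
    also have "\<dots> = \<bar>b k - b l\<bar>"
      using nn[of k] nn[of l] by (simp add: square_diff_square_factored power2_eq_square abs_mult)
    also have "\<dots> \<le> e\<^sup>2" proof -
      have "lam * (1 / (lam - 2)) ^ n \<le> lam * (e\<^sup>2 / lam)" using n lam by (intro mult_left_mono) auto
      then show ?thesis using b_diff_bound[OF that] lam by simp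
    qed
    finally show ?thesis using assms by (simp add: abs_le_square_iff[symmetric] power2_le_iff_abs_le)
  qed
  then show ?thesis by blast
qed

definition \<alpha> :: "dyadic \<Rightarrow> real" where "\<alpha> = dyadic_extension a"

lemma Cauchy_along:
  assumes "(\<lambda>j. of_nat (k j)) \<longlonglongrightarrow> (\<kappa>::dyadic)" "(\<lambda>j. of_nat (l j)) \<longlonglongrightarrow> \<kappa>" and e: "e > 0"
  shows "\<exists>N. \<forall>i\<ge>N. \<forall>j\<ge>N. \<bar>a (k i) - a (l j)\<bar> \<le> e"
proof -
  obtain n where n: "\<And>k l. 2 ^ n dvd int k - int l \<Longrightarrow> \<bar>a k - a l\<bar> \<le> e"
    using limit_periodic[OF e] by blast
  have p: "(1/2::real) ^ Suc n > 0" by simp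
  obtain N1 where N1: "\<And>i. i \<ge> N1 \<Longrightarrow> dist (of_nat (k i)) \<kappa> < (1/2) ^ Suc n"
    using metric_LIMSEQ_D[OF assms(1) p] by blast
  obtain N2 where N2: "\<And>i. i \<ge> N2 \<Longrightarrow> dist (of_nat (l i)) \<kappa> < (1/2) ^ Suc n"
    using metric_LIMSEQ_D[OF assms(2) p] by blast
  have "\<bar>a (k i) - a (l j)\<bar> \<le> e" if "i \<ge> max N1 N2" "j \<ge> max N1 N2" for i j
  proof -
    have "dist (of_int (int (k i)) :: dyadic) (of_int (int (l j))) \<le> (1/2) ^ n"
      using N1[of i] N2[of j] that dist_triangle2[of "of_nat (k i) :: dyadic" "of_nat (l j)" \<kappa>] by simp
    then show ?thesis using n unfolding dist_dyadic_of_int dyadic_dist_le_iff by blast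
  qed
  then show ?thesis by blast
qed

text \<open>
  Adding suitable multiples of \<open>2\<^sup>i\<close> to the \<open>i\<close>-th term does not change the class but makes the terms
  nonnegative and unbounded.  Any fixed integer shift then eventually lands where \<open>a\<close> is defined.
\<close>

lemma nonneg_representative:
  obtains k :: "nat \<Rightarrow> nat" where "dyadic_dist.MCauchy (\<lambda>i. int (k i))" "\<kappa> = Dyadic (\<lambda>i. int (k i))" "\<And>i. i \<le> k i"
proof (induction \<kappa>)
  case (1 X)
  then have X: "dyadic_dist.MCauchy X" by (simp add: dyadic_rel_refl)
  define Z where "Z i = (\<bar>X i\<bar> + int i) * 2 ^ i" for i
  define k where "k i = nat (X i + Z i)" for i
  have ge: "int i \<le> X i + Z i" for i
  proof -
    have "(\<bar>X i\<bar> + int i) * 1 \<le> Z i" unfolding Z_def by (intro mult_left_mono) auto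
    then have "\<bar>X i\<bar> + int i \<le> Z i" by simp
    then show ?thesis using abs_ge_minus_self[of "X i"] by linarith
  qed
  have ik: "int (k i) = X i + Z i" for i using ge[of i] by (simp add: k_def)
  have rel: "dyadic_rel X (\<lambda>i. int (k i))"
  proof -
    have d: "2 ^ j dvd X i - int (k i)" if "j \<le> i" for i j
      unfolding ik Z_def using that by (simp add: le_imp_power_dvd)
    have "\<exists>N. \<forall>m\<ge>N. \<forall>n\<ge>N. 2 ^ j dvd X m - X n \<and> 2 ^ j dvd int (k m) - int (k n) \<and> 2 ^ j dvd X n - int (k n)" for j
    proof -
      obtain N where N: "\<forall>m\<ge>N. \<forall>n\<ge>N. 2 ^ j dvd X m - X n" using X unfolding dyadic_MCauchy_iff by blast
      have "2 ^ j dvd int (k m) - int (k n)" if "m \<ge> max N j" "n \<ge> max N j" for m n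
      proof -
        have "2 ^ j dvd (X m - X n) - (X m - int (k m)) + (X n - int (k n))"
          using N d[of j m] d[of j n] that by (intro dvd_add[OF dvd_diff]) auto
        then show ?thesis by simp
      qed
      then show ?thesis using N d by (intro exI[of _ "max N j"]) auto
    qed
    then show ?thesis unfolding dyadic_rel_iff by blast
  qed
  have "dyadic_dist.MCauchy (\<lambda>i. int (k i))" using rel by (simp add: dyadic_rel_def)
  moreover have "Dyadic X = Dyadic (\<lambda>i. int (k i))" using rel
    by (metis Quotient3_rel_abs Quotient3_dyadic)
  moreover have "i \<le> k i" for i using ge[of i] ik[of i] by linarith
  ultimately show ?case using 1 by blast
qed

lemma alpha_tendsto:
  assumes k: "(\<lambda>j. of_nat (k j)) \<longlonglongrightarrow> (\<kappa>::dyadic)"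
  shows "(\<lambda>j. a (k j)) \<longlonglongrightarrow> \<alpha> \<kappa>"
proof -
  have "Cauchy (\<lambda>j. a (k j))"
  proof (rule metric_CauchyI)
    fix e :: real assume "e > 0"
    then obtain N where "\<forall>i\<ge>N. \<forall>j\<ge>N. \<bar>a (k i) - a (k j)\<bar> \<le> e / 2" using Cauchy_along[OF k k, of "e/2"] by auto
    then show "\<exists>M. \<forall>m\<ge>M. \<forall>n\<ge>M. dist (a (k m)) (a (k n)) < e"
      using \<open>e > 0\<close> by (intro exI[of _ N]) (fastforce simp: dist_real_def)
  qed
  then obtain L where L: "(\<lambda>j. a (k j)) \<longlonglongrightarrow> L" using Cauchy_convergent convergentD by blast
  have all: "(\<lambda>j. a (l j)) \<longlonglongrightarrow> L" if l: "(\<lambda>j. of_nat (l j)) \<longlonglongrightarrow> \<kappa>" for l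
  proof -
    have "(\<lambda>j. a (l j) - a (k j)) \<longlonglongrightarrow> 0"
    proof (rule LIMSEQ_I)
      fix e :: real assume "e > 0"
      then obtain N where "\<forall>i\<ge>N. \<forall>j\<ge>N. \<bar>a (l i) - a (k j)\<bar> \<le> e / 2" using Cauchy_along[OF l k, of "e/2"] by auto
      then show "\<exists>M. \<forall>n\<ge>M. norm (a (l n) - a (k n) - 0) < e"
        using \<open>e > 0\<close> by (intro exI[of _ N]) fastforce
    qed
    from tendsto_add[OF this L] show ?thesis by simp
  qed
  have "\<alpha> \<kappa> = L" unfolding \<alpha>_def dyadic_extension_def
    using all k LIMSEQ_unique by (intro the_equality) blast+
  then show ?thesis using L by simp
qed

lemma alpha_tendsto_Dyadic:
  assumes X: "dyadic_dist.MCauchy X" and nnX: "\<forall>\<^sub>F i in sequentially. 0 \<le> X i"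
  shows "(\<lambda>i. a (nat (X i))) \<longlonglongrightarrow> \<alpha> (Dyadic X)"
proof (rule alpha_tendsto)
  have "(\<lambda>n. of_int (X n)) \<longlonglongrightarrow> Dyadic X" using X by (rule of_int_tendsto_Dyadic)
  then show "(\<lambda>j. of_nat (nat (X j))) \<longlonglongrightarrow> Dyadic X"
    by (rule Lim_transform_eventually) (use nnX in eventually_elim, simp add: of_nat_nat)
qed

lemma Dyadic_add: "dyadic_dist.MCauchy X \<Longrightarrow> dyadic_dist.MCauchy Y \<Longrightarrow> Dyadic X + Dyadic Y = Dyadic (\<lambda>i. X i + Y i)"
  by (rule plus_dyadic.abs_eq) (simp_all add: dyadic_rel_refl)

lemma Dyadic_add_int: "dyadic_dist.MCauchy X \<Longrightarrow> Dyadic X + of_int n = Dyadic (\<lambda>i. X i + n)"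
  unfolding dyadic_of_int by (subst Dyadic_add) auto

lemma MCauchy_add_const: "dyadic_dist.MCauchy X \<Longrightarrow> dyadic_dist.MCauchy (\<lambda>i. X i + n)"
  by (intro dyadic_MCauchy_add) auto

lemma alpha_shift_tendsto:
  assumes k: "dyadic_dist.MCauchy (\<lambda>i. int (k i))" "\<And>i. i \<le> k i"
  shows "(\<lambda>i. a (nat (int (k i) + n))) \<longlonglongrightarrow> \<alpha> (Dyadic (\<lambda>i. int (k i)) + of_int n)"
  unfolding Dyadic_add_int[OF k(1)]
proof (rule alpha_tendsto_Dyadic)
  show "dyadic_dist.MCauchy (\<lambda>i. int (k i) + n)" using k(1) by (rule MCauchy_add_const)
  show "\<forall>\<^sub>F i in sequentially. 0 \<le> int (k i) + n"
    unfolding eventually_sequentially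
  proof (intro exI[of _ "nat \<bar>n\<bar>"] allI impI)
    fix i assume "nat \<bar>n\<bar> \<le> i"
    then show "0 \<le> int (k i) + n" using k(2)[of i] by linarith
  qed
qed

lemma alpha_double_tendsto:
  assumes k: "dyadic_dist.MCauchy (\<lambda>i. int (k i))" "\<And>i. i \<le> k i"
  shows "(\<lambda>i. a (nat (2 * int (k i) + n))) \<longlonglongrightarrow> \<alpha> (2 * Dyadic (\<lambda>i. int (k i)) + of_int n)"
proof -
  have D: "2 * Dyadic (\<lambda>i. int (k i)) = Dyadic (\<lambda>i. int (2 * k i))"
    using Dyadic_add[OF k(1) k(1)] by simp
  have "dyadic_dist.MCauchy (\<lambda>i. int (2 * k i))" using dyadic_MCauchy_add[OF k(1) k(1)] by simp
  moreover have "i \<le> 2 * k i" for i using k(2)[of i] by simp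
  ultimately have "(\<lambda>i. a (nat (int (2 * k i) + n))) \<longlonglongrightarrow> \<alpha> (Dyadic (\<lambda>i. int (2 * k i)) + of_int n)"
    by (rule alpha_shift_tendsto)
  then show ?thesis unfolding D by simp
qed

text \<open>
  All of these are relations for \<open>a\<close> passed to the limit along a nonnegative representative.
\<close>

lemma alpha_bounds: "0 \<le> \<alpha> \<kappa>" "(\<alpha> \<kappa>)\<^sup>2 \<le> lam"
  and alpha_sum: "(\<alpha> (2 * \<kappa>))\<^sup>2 + (\<alpha> (2 * \<kappa> + 1))\<^sup>2 = lam"
  and alpha_prod: "\<alpha> (2 * \<kappa>) * \<alpha> (2 * \<kappa> - 1) = \<alpha> \<kappa>"
  and alpha_even: "(\<alpha> (2 * \<kappa>))\<^sup>2 \<le> 1"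
proof -
  obtain k :: "nat \<Rightarrow> nat" where k: "dyadic_dist.MCauchy (\<lambda>i. int (k i))" "\<And>i. i \<le> k i" and \<kappa>: "\<kappa> = Dyadic (\<lambda>i. int (k i))"
    using nonneg_representative[of \<kappa>] by metis
  have l0: "(\<lambda>i. a (k i)) \<longlonglongrightarrow> \<alpha> \<kappa>" using alpha_shift_tendsto[OF k, of 0] by (simp add: \<kappa>)
  show "0 \<le> \<alpha> \<kappa>" by (rule LIMSEQ_le_const[OF l0]) (use nn in auto)
  show "(\<alpha> \<kappa>)\<^sup>2 \<le> lam" by (rule LIMSEQ_le_const2[OF tendsto_power[OF l0]]) (use b_le in auto)
  have d0: "(\<lambda>i. a (2 * k i)) \<longlonglongrightarrow> \<alpha> (2 * \<kappa>)" using alpha_double_tendsto[OF k, of 0] by (simp add: \<kappa> nat_mult_distrib)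
  have "nat (2 * int (k i) + 1) = 2 * k i + 1" for i by simp
  then have d1: "(\<lambda>i. a (2 * k i + 1)) \<longlonglongrightarrow> \<alpha> (2 * \<kappa> + 1)" using alpha_double_tendsto[OF k, of 1] by (simp add: \<kappa>)
  have "nat (2 * int (k i) + -1) = 2 * k i - 1" for i by simp
  then have d2: "(\<lambda>i. a (2 * k i - 1)) \<longlonglongrightarrow> \<alpha> (2 * \<kappa> - 1)" using alpha_double_tendsto[OF k, of "-1"] by (simp add: \<kappa>)
  have "(\<lambda>i. (a (2 * k i))\<^sup>2 + (a (2 * k i + 1))\<^sup>2) \<longlonglongrightarrow> (\<alpha> (2 * \<kappa>))\<^sup>2 + (\<alpha> (2 * \<kappa> + 1))\<^sup>2"
    by (intro tendsto_intros d0 d1)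
  then have "(\<lambda>i::nat. lam) \<longlonglongrightarrow> (\<alpha> (2 * \<kappa>))\<^sup>2 + (\<alpha> (2 * \<kappa> + 1))\<^sup>2" by (simp only: sum_sq)
  then show "(\<alpha> (2 * \<kappa>))\<^sup>2 + (\<alpha> (2 * \<kappa> + 1))\<^sup>2 = lam" by (rule LIMSEQ_unique[OF _ tendsto_const])
  have "(\<lambda>i. a (2 * k i) * a (2 * k i - 1)) \<longlonglongrightarrow> \<alpha> (2 * \<kappa>) * \<alpha> (2 * \<kappa> - 1)" by (intro tendsto_intros d0 d2)
  moreover have "\<forall>\<^sub>F i in sequentially. a (2 * k i) * a (2 * k i - 1) = a (k i)"
    unfolding eventually_sequentially using prod k(2) by (intro exI[of _ 1]) (metis order_trans)
  ultimately have "(\<lambda>i. a (k i)) \<longlonglongrightarrow> \<alpha> (2 * \<kappa>) * \<alpha> (2 * \<kappa> - 1)" by (rule Lim_transform_eventually)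
  then show "\<alpha> (2 * \<kappa>) * \<alpha> (2 * \<kappa> - 1) = \<alpha> \<kappa>" using l0 LIMSEQ_unique by blast
  show "(\<alpha> (2 * \<kappa>))\<^sup>2 \<le> 1" by (rule LIMSEQ_le_const2[OF tendsto_power[OF d0]]) (use b_even_le in auto)
qed

lemma dyadic_halve: fixes \<kappa> :: dyadic shows "\<exists>\<kappa>' r. r \<in> {0, 1::int} \<and> \<kappa> = 2 * \<kappa>' + of_int r"
proof (induction \<kappa>)
  case (1 X)
  then have X: "dyadic_dist.MCauchy X" by (simp add: dyadic_rel_refl)
  have "\<exists>N. \<forall>m\<ge>N. \<forall>n\<ge>N. 2 ^ 1 dvd X m - X n" using X unfolding dyadic_MCauchy_iff by (rule spec)
  then obtain N where N: "\<forall>m\<ge>N. \<forall>n\<ge>N. 2 ^ 1 dvd X m - X n" ..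
  define r where "r = X N mod 2"
  define Y where "Y i = X i div 2" for i
  have XY: "X i = 2 * Y i + r" if "i \<ge> N" for i
  proof -
    have "2 ^ 1 dvd X i - X N" using N that by blast
    then have "X i mod 2 = X N mod 2" unfolding power_one_right by (simp only: mod_eq_dvd_iff)
    then show ?thesis unfolding Y_def r_def by (metis mult_div_mod_eq)
  qed
  have Y: "dyadic_dist.MCauchy Y"
    unfolding dyadic_MCauchy_iff
  proof
    fix j
    have "\<exists>N'. \<forall>m\<ge>N'. \<forall>n\<ge>N'. 2 ^ Suc j dvd X m - X n" using X unfolding dyadic_MCauchy_iff by (rule spec)
    then obtain N' where N': "\<forall>m\<ge>N'. \<forall>n\<ge>N'. 2 ^ Suc j dvd X m - X n" ..
    have "2 ^ j dvd Y m - Y n" if "m \<ge> max N N'" "n \<ge> max N N'" for m n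
    proof -
      have "X m - X n = 2 * (Y m - Y n)" using that XY[of m] XY[of n] by simp
      moreover have "2 ^ Suc j dvd X m - X n" using N' that by simp
      ultimately have "2 * 2 ^ j dvd 2 * (Y m - Y n)" by (simp only: power_Suc)
      then show ?thesis by (simp only: dvd_mult_cancel_left) simp
    qed
    then show "\<exists>N. \<forall>m\<ge>N. \<forall>n\<ge>N. 2 ^ j dvd Y m - Y n" by blast
  qed
  have C: "dyadic_dist.MCauchy (\<lambda>i. (Y i + Y i) + r)" using dyadic_MCauchy_add[OF Y Y] by (rule MCauchy_add_const)
  have "2 * Dyadic Y + of_int r = Dyadic (\<lambda>i. (Y i + Y i) + r)"
    using Dyadic_add[OF Y Y] Dyadic_add_int[OF dyadic_MCauchy_add[OF Y Y], of r] by simp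
  moreover have "dyadic_rel X (\<lambda>i. (Y i + Y i) + r)"
    unfolding dyadic_rel_def dyadic_dist_tendsto_0_iff using X C XY by (intro conjI allI exI[of _ N]) auto
  then have "Dyadic X = Dyadic (\<lambda>i. (Y i + Y i) + r)" by (metis Quotient3_rel_abs Quotient3_dyadic)
  moreover have "r \<in> {0, 1}" by (auto simp: r_def)
  ultimately show ?case by metis
qed

end

section \<open>The Julia set\<close>

locale quadratic_julia =
  fixes lam :: real
  assumes lam: "lam > 3"
begin

text \<open>The positive fixed point of \<open>T\<close>, which bounds the Julia set.\<close>

definition beta :: real where "beta = (1 + sqrt (1 + 4 * lam)) / 2"

lemma beta_sq: "beta\<^sup>2 = beta + lam"
proof -
  have "(sqrt (1 + 4 * lam))\<^sup>2 = 1 + 4 * lam" using lam by simp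
  then show ?thesis unfolding beta_def by (simp add: power2_eq_square field_simps)
qed

lemma beta_gt: "beta > 23/10"
proof -
  have "sqrt ((18/5)\<^sup>2) < sqrt (1 + 4 * lam)" using lam by (intro real_sqrt_less_mono) (simp add: power2_eq_square)
  then have "18/5 < sqrt (1 + 4 * lam)" by simp
  then show ?thesis by (simp add: beta_def)
qed

text \<open>
  This gap separates the Julia set from the critical point \<open>0\<close>, see \<open>julia_Re\<close>.
\<close>

lemma gap: "lam - beta > 69/100"
proof -
  have "lam - beta = beta * (beta - 2)" using beta_sq by (simp add: power2_eq_square algebra_simps)
  moreover have "(23/10) * (3/10) < beta * (beta - 2)" using beta_gt by (intro mult_strict_mono) auto
  ultimately show ?thesis by simp
qed

abbreviation "orb n z \<equiv> (quad_map lam ^^ n) z"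

text \<open>
  Outside the disc of radius \<open>\<beta>\<close> the distance to the disc at least doubles with each application of \<open>T\<close>.
\<close>

lemma escape:
  assumes "cmod z > beta"
  shows "filterlim (\<lambda>n. orb n z) at_infinity sequentially"
proof -
  have grow: "cmod (orb n z) - beta \<ge> 2 ^ n * (cmod z - beta)" for n
  proof (induction n)
    case 0
    show ?case by simp
  next
    case (Suc n)
    define y where "y = orb n z"
    have "0 \<le> 2 ^ n * (cmod z - beta)" using assms by simp
    then have y: "cmod y \<ge> beta" using Suc by (simp add: y_def)
    have "cmod (y\<^sup>2) - cmod (of_real lam) \<le> cmod (y\<^sup>2 - of_real lam)" by (rule norm_triangle_ineq2)
    then have "cmod (orb (Suc n) z) - beta \<ge> (cmod y)\<^sup>2 - lam - beta"
      using lam by (simp add: y_def quad_map_def norm_power)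
    also have "(cmod y)\<^sup>2 - lam - beta = (cmod y - beta) * (cmod y + beta)"
      using beta_sq by (simp add: power2_eq_square algebra_simps)
    also have "\<dots> \<ge> (cmod y - beta) * 2" using y beta_gt by (intro mult_left_mono) auto
    finally show ?case using Suc by (simp add: y_def)
  qed
  have "filterlim (\<lambda>n. (cmod z - beta) * 2 ^ n :: real) at_top sequentially"
    using assms filterlim_realpow_sequentially_gt1[of "2::real"]
    by (intro filterlim_tendsto_pos_mult_at_top[OF tendsto_const])
      (auto simp: filterlim_at_infinity_conv_norm_at_top norm_power)
  then have "filterlim (\<lambda>n. cmod (orb n z)) at_top sequentially"
  proof (rule filterlim_at_top_mono)
    show "\<forall>\<^sub>F n in sequentially. (cmod z - beta) * 2 ^ n \<le> cmod (orb n z)"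
    proof (intro always_eventually allI)
      fix n
      have "(cmod z - beta) * 2 ^ n = 2 ^ n * (cmod z - beta)" by (rule mult.commute)
      then show "(cmod z - beta) * 2 ^ n \<le> cmod (orb n z)" using grow[of n] beta_gt by linarith
    qed
  qed
  then show ?thesis by (simp add: filterlim_at_infinity_conv_norm_at_top)
qed

lemma julia_invariant: "quad_map lam z \<in> julia_set lam \<longleftrightarrow> z \<in> julia_set lam"
proof -
  have "filterlim (\<lambda>n. orb n (quad_map lam z)) at_infinity sequentially \<longleftrightarrow>
    filterlim (\<lambda>n. orb (Suc n) z) at_infinity sequentially"
    by (simp add: funpow_swap1)
  also have "\<dots> \<longleftrightarrow> filterlim (\<lambda>n. orb n z) at_infinity sequentially"
    by (rule filterlim_sequentially_Suc)
  finally show ?thesis by (simp add: julia_set_def)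
qed

lemma julia_orbit: "z \<in> julia_set lam \<Longrightarrow> orb n z \<in> julia_set lam"
  by (induction n) (auto simp: julia_invariant)

lemma bounded_orbit_julia:
  assumes "\<And>n. cmod (orb n z) \<le> B"
  shows "z \<in> julia_set lam"
proof -
  have "\<not> filterlim (\<lambda>n. orb n z) at_infinity sequentially"
  proof
    assume "filterlim (\<lambda>n. orb n z) at_infinity sequentially"
    then have "filterlim (\<lambda>n. cmod (orb n z)) at_top sequentially" by (simp add: filterlim_at_infinity_conv_norm_at_top)
    then have "\<forall>\<^sub>F n in sequentially. B + 1 \<le> cmod (orb n z)" by (simp add: filterlim_at_top)
    then obtain n where "B + 1 \<le> cmod (orb n z)" unfolding eventually_sequentially by blast
    then show False using assms by (meson less_add_one not_le order_trans)
  qed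
  then show ?thesis by (simp add: julia_set_def)
qed

lemma julia_iff: "z \<in> julia_set lam \<longleftrightarrow> (\<forall>n. cmod (orb n z) \<le> beta)"
proof
  assume "z \<in> julia_set lam"
  then have "orb n z \<in> julia_set lam" for n by (rule julia_orbit)
  then show "\<forall>n. cmod (orb n z) \<le> beta" using escape unfolding julia_set_def by (metis DiffD2 mem_Collect_eq not_le)
qed (blast intro: bounded_orbit_julia)

lemma julia_Re: 
  assumes "z \<in> julia_set lam"
  shows "(Re z)\<^sup>2 \<ge> lam - beta"
proof -
  have "cmod (quad_map lam z) \<le> beta" using assms julia_iff[of z] by (auto dest: spec[of _ "Suc 0"])
  then have "- beta \<le> Re (quad_map lam z)" using abs_Re_le_cmod[of "quad_map lam z"] by linarith
  then show ?thesis by (simp add: quad_map_def power2_eq_square) (smt (verit) zero_le_square)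
qed

text \<open>
  One step multiplies the imaginary part by \<open>2 Re z\<close>, which exceeds \<open>8/5\<close> in absolute value along
  the orbit; but the orbit is bounded.
\<close>

lemma julia_real:
  assumes "z \<in> julia_set lam"
  shows "Im z = 0"
proof (rule ccontr)
  assume nz: "Im z \<noteq> 0"
  have grow: "(8/5) ^ n * \<bar>Im z\<bar> \<le> \<bar>Im (orb n z)\<bar>" for n
  proof (induction n)
    case 0
    show ?case by simp
  next
    case (Suc n)
    define y where "y = orb n z"
    have "(4/5)\<^sup>2 \<le> (Re y)\<^sup>2" using julia_Re[of y] julia_orbit[OF assms, of n] gap by (simp add: y_def power2_eq_square)
    then have "4/5 \<le> \<bar>Re y\<bar>" by (simp flip: abs_le_square_iff)
    then have "8/5 * \<bar>Im y\<bar> \<le> 2 * \<bar>Re y\<bar> * \<bar>Im y\<bar>" by (intro mult_right_mono) auto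
    also have "\<dots> = \<bar>Im (orb (Suc n) z)\<bar>"
      by (simp add: y_def quad_map_def power2_eq_square abs_mult)
    finally show ?case using Suc by (simp add: y_def)
  qed
  obtain n where "beta / \<bar>Im z\<bar> < (8/5) ^ n" using real_arch_pow[of "8/5" "beta / \<bar>Im z\<bar>"] by auto
  then have "beta < (8/5) ^ n * \<bar>Im z\<bar>" using nz by (simp add: pos_divide_less_eq)
  also have "\<dots> \<le> cmod (orb n z)" using grow[of n] abs_Im_le_cmod order_trans by blast
  finally show False using assms julia_iff by (meson not_le)
qed

definition real_quad :: "real \<Rightarrow> real" where "real_quad x = x\<^sup>2 - lam"

definition real_julia :: "real set" where "real_julia = {x. complex_of_real x \<in> julia_set lam}"

lemma quad_map_of_real: "quad_map lam (of_real x) = of_real (real_quad x)"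
  by (simp add: quad_map_def real_quad_def)

lemma orb_of_real: "orb n (of_real x) = of_real ((real_quad ^^ n) x)"
  by (induction n) (simp_all add: quad_map_of_real)

lemma real_julia_iff: "x \<in> real_julia \<longleftrightarrow> (\<forall>n. \<bar>(real_quad ^^ n) x\<bar> \<le> beta)"
  by (simp add: real_julia_def julia_iff orb_of_real)

lemma real_julia_quad: "real_quad x \<in> real_julia \<longleftrightarrow> x \<in> real_julia"
  unfolding real_julia_def by (metis julia_invariant mem_Collect_eq quad_map_of_real)

lemma real_julia_abs: "x \<in> real_julia \<Longrightarrow> \<bar>x\<bar> \<le> beta"
  using real_julia_iff[of x] by (metis funpow_0)

lemma julia_eq_real_julia: "z \<in> julia_set lam \<longleftrightarrow> Im z = 0 \<and> Re z \<in> real_julia"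
  unfolding real_julia_def by (metis complex_is_Real_iff julia_real mem_Collect_eq of_real_Re Im_complex_of_real)

lemma real_julia_low: "x \<in> real_julia \<Longrightarrow> 2/3 \<le> \<bar>x\<bar>"
proof -
  assume "x \<in> real_julia"
  then have "(2/3)\<^sup>2 \<le> x\<^sup>2" using julia_Re[of "of_real x"] gap by (simp add: real_julia_def power2_eq_square)
  then show ?thesis by (simp flip: abs_le_square_iff)
qed

lemma closed_real_julia: "closed real_julia"
proof -
  have c: "continuous_on UNIV (real_quad ^^ n)" for n
  proof (induction n)
    case (Suc n)
    show ?case unfolding funpow.simps comp_def unfolding real_quad_def
      using Suc by (intro continuous_intros) (simp add: real_quad_def[abs_def])
  qed (simp add: id_def)
  have "real_julia = (\<Inter>n. {x. \<bar>(real_quad ^^ n) x\<bar> \<le> beta})" using real_julia_iff by auto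
  moreover have "closed {x. \<bar>(real_quad ^^ n) x\<bar> \<le> beta}" for n
    using c by (intro closed_Collect_le continuous_intros) auto
  ultimately show ?thesis by auto
qed

lemma real_julia_borel [measurable]: "real_julia \<in> sets borel" using closed_real_julia by simp

definition branch :: "real \<Rightarrow> real" where "branch y = sqrt (lam + y)"

lemma branch_mono: "x \<le> y \<Longrightarrow> branch x \<le> branch y" by (simp add: branch_def)

lemma branch_ge: "- beta \<le> y \<Longrightarrow> 4/5 \<le> branch y"
  unfolding branch_def using gap by (intro real_le_rsqrt) (simp add: power2_eq_square)

lemma branch_le: "y \<le> beta \<Longrightarrow> branch y \<le> beta"
  unfolding branch_def using beta_sq beta_gt by (intro real_le_lsqrt) auto

lemma real_quad_branch: "- beta \<le> y \<Longrightarrow> real_quad (branch y) = y" "- beta \<le> y \<Longrightarrow> real_quad (- branch y) = y"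
  unfolding branch_def real_quad_def using gap by auto

lemma branch_quad: "branch (real_quad x) = \<bar>x\<bar>" by (simp add: branch_def real_quad_def)

text \<open>
  The length of \<open>[u, v]\<close> in the coordinate \<open>\<theta>\<close> with \<open>x = \<beta> sin \<theta>\<close>.  Both inverse branches of \<open>T\<close>
  contract this length by a factor below \<open>1/2\<close>, which need not hold for the Euclidean length
  near \<open>-\<beta>\<close>, where the branches are steepest.
\<close>

definition arc_length :: "real \<Rightarrow> real \<Rightarrow> real" where "arc_length u v = arcsin (v / beta) - arcsin (u / beta)"

lemma length_le_arc_length:
  assumes "- beta \<le> u" "u \<le> v" "v \<le> beta"
  shows "v - u \<le> beta * arc_length u v"
proof -
  have b: "beta > 0" using beta_gt by simp
  have "(\<lambda>y. beta * arcsin (y / beta) - y) u \<le> (\<lambda>y. beta * arcsin (y / beta) - y) v"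
  proof (rule DERIV_nonneg_imp_increasing_open[OF assms(2)])
    show "continuous_on {u..v} (\<lambda>y. beta * arcsin (y / beta) - y)"
      using assms b by (intro continuous_intros) (auto simp: divide_simps)
  next
    fix y assume "u < y" "y < v"
    then have y: "- beta < y" "y < beta" using assms by auto
    then have yb: "- 1 < y / beta" "y / beta < 1" using b by (auto simp: divide_simps)
    have D: "((\<lambda>y. beta * arcsin (y / beta) - y) has_real_derivative (beta * (inverse (sqrt (1 - (y / beta)\<^sup>2)) * (1 / beta)) - 1)) (at y)"
      using b yb by (auto intro!: derivative_eq_intros)
    have "(y / beta)\<^sup>2 < 1" using yb by (simp add: abs_square_less_1)
    then have "0 < sqrt (1 - (y / beta)\<^sup>2)" "sqrt (1 - (y / beta)\<^sup>2) \<le> 1" by auto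
    then have "1 \<le> inverse (sqrt (1 - (y / beta)\<^sup>2))" by (simp add: one_le_inverse)
    then show "\<exists>l. ((\<lambda>y. beta * arcsin (y / beta) - y) has_real_derivative l) (at y) \<and> 0 \<le> l" using D b by auto
  qed
  then show ?thesis by (simp add: arc_length_def algebra_simps)
qed

definition contraction :: real where "contraction = sqrt (2 / beta) / 2"

text \<open>
  The derivative of the left side is dominated by that of the right side.  After inserting
  \<open>\<beta>\<^sup>2 = \<beta> + \<lambda>\<close> this is \<open>\<beta> (\<beta> + y) \<le> 2 (\<lambda> + y)\<close>, that is, \<open>(\<beta> - 2) (\<beta> - y) \<ge> 0\<close>.
\<close>

lemma arc_length_branch:
  assumes "- beta \<le> u" "u \<le> v" "v \<le> beta"
  shows "arc_length (branch u) (branch v) \<le> contraction * arc_length u v"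
proof -
  have b: "beta > 0" using beta_gt by simp
  define G where "G y = contraction * arcsin (y / beta) - arcsin (branch y / beta)" for y
  have "G u \<le> G v"
  proof (rule DERIV_nonneg_imp_increasing_open[OF assms(2)])
    have "- 1 \<le> branch y / beta \<and> branch y / beta \<le> 1" if "y \<in> {u..v}" for y
      using branch_ge[of y] branch_le[of y] that assms b by (auto simp: divide_simps)
    then show "continuous_on {u..v} G"
      unfolding G_def unfolding branch_def using assms b gap
      by (intro continuous_intros) (auto simp: divide_simps branch_def)
  next
    fix y assume "u < y" "y < v"
    then have y: "- beta < y" "y < beta" using assms by auto
    then have yb: "- 1 < y / beta" "y / beta < 1" using b by (auto simp: divide_simps)
    have ly: "lam + y > 0" using y gap by simp
    have "branch y < branch beta" using y unfolding branch_def by simp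
    also have "branch beta = beta" unfolding branch_def using beta_sq b
      by (metis add.commute less_eq_real_def real_sqrt_unique)
    finally have bb: "- 1 < branch y / beta" "branch y / beta < 1" using b branch_ge[of y] y by (auto simp: divide_simps)
    define l where "l = contraction * (inverse (sqrt (1 - (y / beta)\<^sup>2)) * (1 / beta))
        - inverse (sqrt (1 - (branch y / beta)\<^sup>2)) * (inverse (branch y) / 2 / beta)"
    have D: "(G has_real_derivative l) (at y)"
      unfolding G_def l_def unfolding branch_def
      using b yb bb ly by (auto intro!: derivative_eq_intros simp: branch_def)
    have s1: "sqrt (1 - (y / beta)\<^sup>2) = sqrt (beta - y) * sqrt (beta + y) / beta"
    proof -
      have "1 - (y / beta)\<^sup>2 = (beta - y) * (beta + y) / beta\<^sup>2" using b by (simp add: power2_eq_square field_simps)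
      then show ?thesis using b by (simp add: real_sqrt_mult real_sqrt_divide)
    qed
    have s2: "sqrt (1 - (branch y / beta)\<^sup>2) = sqrt (beta - y) / beta"
    proof -
      have "(branch y)\<^sup>2 = lam + y" using ly by (simp add: branch_def)
      then have "1 - (branch y / beta)\<^sup>2 = (beta\<^sup>2 - (lam + y)) / beta\<^sup>2"
        using b by (simp add: power_divide diff_divide_distrib)
      also have "beta\<^sup>2 - (lam + y) = beta - y" using beta_sq by simp
      finally have "1 - (branch y / beta)\<^sup>2 = (beta - y) / beta\<^sup>2" .
      then show ?thesis using b by (simp add: real_sqrt_divide)
    qed
    have pos: "sqrt (beta - y) > 0" "sqrt (beta + y) > 0" "branch y > 0" using y branch_ge[of y] by auto
    have key: "sqrt (beta + y) \<le> 2 * contraction * branch y"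
    proof -
      have "beta * (beta + y) \<le> 2 * (lam + y)"
      proof -
        have "2 * (lam + y) - beta * (beta + y) = (beta - 2) * (beta - y)"
          using beta_sq by (simp add: power2_eq_square algebra_simps)
        moreover have "0 \<le> (beta - 2) * (beta - y)" using beta_gt y by auto
        ultimately show ?thesis by linarith
      qed
      then have "beta + y \<le> (2 / beta) * (lam + y)" using b by (simp add: field_simps)
      then have "sqrt (beta + y) \<le> sqrt ((2 / beta) * (lam + y))" by (rule real_sqrt_le_mono)
      also have "\<dots> = 2 * contraction * branch y" by (simp add: contraction_def branch_def del: real_sqrt_divide flip: real_sqrt_mult)
      finally show ?thesis .
    qed
    have "l = (2 * contraction * branch y - sqrt (beta + y)) / (2 * branch y * sqrt (beta - y) * sqrt (beta + y))"
      unfolding l_def s1 s2 using pos b by (simp add: field_simps)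
    then have "0 \<le> l" using key pos by simp
    then show "\<exists>l. (G has_real_derivative l) (at y) \<and> 0 \<le> l" using D by blast
  qed
  then show ?thesis by (simp add: G_def arc_length_def algebra_simps)
qed

text \<open>
  The intervals are the images of \<open>[-\<beta>, \<beta>]\<close> under the \<open>2\<^sup>n\<close> branches of the inverse of \<open>T\<^sup>n\<close>.
\<close>

lemma cover:
  "\<exists>S. finite S \<and> card S \<le> 2 ^ n \<and> real_julia \<subseteq> (\<Union>(u,v)\<in>S. {u..v}) \<and>
     (\<forall>(u,v)\<in>S. - beta \<le> u \<and> u \<le> v \<and> v \<le> beta \<and> arc_length u v \<le> pi * contraction ^ n)"
proof (induction n)
  case 0
  have "arc_length (-beta) beta \<le> pi" using beta_gt by (simp add: arc_length_def)
  then show ?case using real_julia_abs beta_gt by (intro exI[of _ "{(-beta, beta)}"]) fastforce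
next
  case (Suc n)
  then obtain S where S: "finite S" "card S \<le> 2 ^ n" "real_julia \<subseteq> (\<Union>(u,v)\<in>S. {u..v})"
    "\<And>u v. (u,v) \<in> S \<Longrightarrow> - beta \<le> u \<and> u \<le> v \<and> v \<le> beta \<and> arc_length u v \<le> pi * contraction ^ n" by fast
  define S1 where "S1 = (\<lambda>(u,v). (branch u, branch v)) ` S"
  define S2 where "S2 = (\<lambda>(u,v). (- branch v, - branch u)) ` S"
  have "card S1 \<le> 2 ^ n" "card S2 \<le> 2 ^ n" unfolding S1_def S2_def
    using card_image_le[OF S(1)] S(2) order_trans by blast+
  then have "card (S1 \<union> S2) \<le> 2 ^ Suc n" using card_Un_le[of S1 S2] by simp
  moreover have "finite (S1 \<union> S2)" using S(1) by (simp add: S1_def S2_def)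
  moreover have "x \<in> (\<Union>(u,v)\<in>S1 \<union> S2. {u..v})" if "x \<in> real_julia" for x
  proof -
    have "real_quad x \<in> real_julia" using that by (simp add: real_julia_quad)
    then obtain u v where uv: "(u,v) \<in> S" "u \<le> real_quad x" "real_quad x \<le> v" using S(3) by fastforce
    then have ab: "branch u \<le> \<bar>x\<bar>" "\<bar>x\<bar> \<le> branch v" unfolding branch_quad[symmetric] by (auto intro: branch_mono)
    show ?thesis
    proof (cases "x \<ge> 0")
      case True
      have "(branch u, branch v) \<in> S1 \<union> S2" using uv(1) unfolding S1_def by force
      moreover have "x \<in> {branch u..branch v}" using ab True by auto
      ultimately show ?thesis by blast
    next
      case False
      have "(- branch v, - branch u) \<in> S1 \<union> S2" using uv(1) unfolding S2_def by force
      moreover have "x \<in> {- branch v..- branch u}" using ab False by auto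
      ultimately show ?thesis by blast
    qed
  qed
  moreover have "- beta \<le> u' \<and> u' \<le> v' \<and> v' \<le> beta \<and> arc_length u' v' \<le> pi * contraction ^ Suc n" if uv': "(u',v') \<in> S1 \<union> S2" for u' v'
  proof -
    obtain u v where uv: "(u,v) \<in> S" and c: "(u' = branch u \<and> v' = branch v) \<or> (u' = - branch v \<and> v' = - branch u)"
      using uv' unfolding S1_def S2_def by auto
    have b: "- beta \<le> u" "u \<le> v" "v \<le> beta" "arc_length u v \<le> pi * contraction ^ n" using S(4)[OF uv] by auto
    have "contraction \<ge> 0" using beta_gt by (simp add: contraction_def)
    then have "arc_length (branch u) (branch v) \<le> contraction * (pi * contraction ^ n)"
      using arc_length_branch[OF b(1-3)] mult_left_mono[OF b(4)] by (meson order_trans)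
    moreover have "arc_length (- branch v) (- branch u) = arc_length (branch u) (branch v)"
    proof -
      have "arcsin (- branch w / beta) = - arcsin (branch w / beta)" if "- beta \<le> w" "w \<le> beta" for w
        using arcsin_minus[of "branch w / beta"] branch_ge[of w] branch_le[of w] that beta_gt
        by (simp add: divide_simps)
      then show ?thesis using b by (simp add: arc_length_def)
    qed
    moreover have "4/5 \<le> branch u" "branch u \<le> branch v" "branch v \<le> beta"
      using b branch_ge[of u] branch_mono[of u v] branch_le[of v] by auto
    ultimately show ?thesis using c by (auto simp: mult.left_commute)
  qed
  ultimately show ?case by (intro exI[of _ "S1 \<union> S2"]) blast
qed

lemma real_julia_null: "emeasure lborel real_julia = 0"
proof -
  have b: "beta > 0" using beta_gt by simp
  have bound: "emeasure lborel real_julia \<le> ennreal (beta * pi * (2 * contraction) ^ n)" for n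
  proof -
    obtain S where S: "finite S" "card S \<le> 2 ^ n" "real_julia \<subseteq> (\<Union>(u,v)\<in>S. {u..v})"
      "\<And>u v. (u,v) \<in> S \<Longrightarrow> - beta \<le> u \<and> u \<le> v \<and> v \<le> beta \<and> arc_length u v \<le> pi * contraction ^ n" using cover[of n] by fast
    have "emeasure lborel real_julia \<le> emeasure lborel (\<Union>p\<in>S. {fst p..snd p})"
      using S(3) S(1) by (intro emeasure_mono) (auto simp: case_prod_beta)
    also have "\<dots> \<le> (\<Sum>p\<in>S. emeasure lborel {fst p..snd p})"
      using S(1) by (intro emeasure_subadditive_finite) auto
    also have "\<dots> \<le> (\<Sum>p\<in>S. ennreal (beta * (pi * contraction ^ n)))"
    proof (rule sum_mono)
      fix p assume p: "p \<in> S"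
      then have uv: "- beta \<le> fst p" "fst p \<le> snd p" "snd p \<le> beta" "arc_length (fst p) (snd p) \<le> pi * contraction ^ n"
        using S(4)[of "fst p" "snd p"] by auto
      have "snd p - fst p \<le> beta * arc_length (fst p) (snd p)" using uv by (intro length_le_arc_length)
      also have "\<dots> \<le> beta * (pi * contraction ^ n)" using uv b by (intro mult_left_mono) auto
      finally show "emeasure lborel {fst p..snd p} \<le> ennreal (beta * (pi * contraction ^ n))"
        using uv by (simp add: ennreal_leI)
    qed
    also have "\<dots> = of_nat (card S) * ennreal (beta * (pi * contraction ^ n))" by simp
    also have "\<dots> \<le> of_nat (2 ^ n) * ennreal (beta * (pi * contraction ^ n))"
      using S(2) by (intro mult_right_mono) (auto simp del: of_nat_power)
    also have "\<dots> = ennreal (real (2 ^ n) * (beta * (pi * contraction ^ n)))"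
      by (simp add: ennreal_mult' ennreal_of_nat_eq_real_of_nat del: of_nat_power)
    also have "real (2 ^ n) * (beta * (pi * contraction ^ n)) = beta * pi * (2 * contraction) ^ n"
      by (simp add: power_mult_distrib)
    finally show ?thesis .
  qed
  have "2 * contraction < 1" "0 \<le> 2 * contraction" using beta_gt by (auto simp: contraction_def)
  then have "(\<lambda>n. beta * pi * (2 * contraction) ^ n) \<longlonglongrightarrow> beta * pi * 0"
    by (intro tendsto_intros LIMSEQ_power_zero) auto
  then have "(\<lambda>n. ennreal (beta * pi * (2 * contraction) ^ n)) \<longlonglongrightarrow> ennreal 0" by (intro tendsto_ennrealI) simp
  then have "emeasure lborel real_julia \<le> ennreal 0" by (rule LIMSEQ_le_const) (use bound in blast)
  then show ?thesis by simp
qed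

end

section \<open>Positive definiteness of the logarithmic kernel\<close>

text \<open>
  The real part of the power series of \<open>-ln (1 - w)\<close> at \<open>w = r e\<^bsup>i\<alpha>\<^esup>\<close>.
\<close>

lemma cos_series:
  assumes "0 \<le> r" "r < 1"
  shows "(\<lambda>n. r ^ n / real n * cos (real n * \<alpha>)) sums (- ln (1 - 2 * r * cos \<alpha> + r\<^sup>2) / 2)"
proof -
  define w where "w = of_real r * cis \<alpha>"
  have nw: "norm w = r" using assms by (simp add: w_def norm_mult)
  then have "norm (- w) < 1" using assms by simp
  then have "(\<lambda>n. (- 1) ^ Suc n / of_nat n * (- w) ^ n) sums ln (1 + (- w))" by (rule Ln_series)
  then have A: "(\<lambda>n. Re ((- 1) ^ Suc n / of_nat n * (- w) ^ n)) sums Re (ln (1 + (- w)))" by (rule sums_Re)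
  have B: "Re ((- 1) ^ Suc n / of_nat n * (- w) ^ n) = - (r ^ n / real n * cos (real n * \<alpha>))" for n
  proof -
    have "(- 1) ^ Suc n / of_nat n * (- w) ^ n = ((- 1) ^ n * (- 1) ^ n) * (- (w ^ n / of_nat n))"
      by (simp add: power_minus[of w])
    also have "(- 1 :: complex) ^ n * (- 1) ^ n = 1" by (simp flip: power_mult_distrib)
    also have "w ^ n = of_real (r ^ n) * cis (real n * \<alpha>)"
      by (simp add: w_def power_mult_distrib Complex.DeMoivre)
    finally have "(- 1) ^ Suc n / of_nat n * (- w) ^ n
       = - (of_real (r ^ n) * cis (real n * \<alpha>) / of_nat n)" by (simp only: mult_1_left)
    then show ?thesis by (simp only: Re_divide_of_nat uminus_complex.sel Re_complex_of_real times_complex.sel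
        Im_complex_of_real cis.sel) simp
  qed
  have C: "Re (ln (1 + (- w))) = ln (1 - 2 * r * cos \<alpha> + r\<^sup>2) / 2"
  proof -
    have "1 + (- w) \<noteq> 0" using nw assms by auto
    then have "Re (ln (1 + (- w))) = ln (cmod (1 + (- w)))" by (rule Re_Ln)
    also have "cmod (1 + (- w)) = sqrt (1 - 2 * r * cos \<alpha> + r\<^sup>2)"
    proof -
      have "(1 - r * cos \<alpha>)\<^sup>2 + (r * sin \<alpha>)\<^sup>2 = 1 - 2 * r * cos \<alpha> + r\<^sup>2"
        by (simp add: power_mult_distrib sin_squared_eq power2_diff algebra_simps)
      then show ?thesis by (simp add: cmod_def w_def)
    qed
    also have "1 - 2 * r * cos \<alpha> + r\<^sup>2 \<ge> 0" 
    proof -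
      have "r * cos \<alpha> \<le> r * 1" using assms by (intro mult_left_mono) auto
      then have "(1 - r)\<^sup>2 \<le> 1 - 2 * r * cos \<alpha> + r\<^sup>2" by (simp add: power2_eq_square algebra_simps)
      then show ?thesis using zero_le_power2 order_trans by blast
    qed
    then have "ln (sqrt (1 - 2 * r * cos \<alpha> + r\<^sup>2)) = ln (1 - 2 * r * cos \<alpha> + r\<^sup>2) / 2"
      by (cases "1 - 2 * r * cos \<alpha> + r\<^sup>2 = 0") (simp_all add: ln_sqrt)
    finally show ?thesis .
  qed
  from A have "(\<lambda>n. - (r ^ n / real n * cos (real n * \<alpha>))) sums (ln (1 - 2 * r * cos \<alpha> + r\<^sup>2) / 2)"
    unfolding B C .
  from sums_minus[OF this] show ?thesis by simp
qed

text \<open>This is \<open>\<bar>1 - r e\<^bsup>i\<alpha>\<^esup>\<bar>\<^sup>2\<close>.\<close>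

definition abel_factor :: "real \<Rightarrow> real \<Rightarrow> real" where "abel_factor r \<alpha> = 1 - 2 * r * cos \<alpha> + r\<^sup>2"

lemma abel_factor_pos: "0 \<le> r \<Longrightarrow> r < 1 \<Longrightarrow> 0 < abel_factor r \<alpha>"
proof -
  assume r: "0 \<le> r" "r < 1"
  have "r * cos \<alpha> \<le> r * 1" using r by (intro mult_left_mono) auto
  then have "(1 - r)\<^sup>2 \<le> abel_factor r \<alpha>" by (simp add: abel_factor_def power2_eq_square algebra_simps)
  moreover have "0 < (1 - r)\<^sup>2" using r by simp
  ultimately show ?thesis by linarith
qed

lemma abel_factor_le: "0 \<le> r \<Longrightarrow> r < 1 \<Longrightarrow> abel_factor r \<alpha> \<le> 4"
proof -
  assume r: "0 \<le> r" "r < 1"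
  have "r * (-1) \<le> r * cos \<alpha>" using r by (intro mult_left_mono) auto
  moreover have "r\<^sup>2 \<le> 1" using r by (simp add: power_le_one)
  ultimately show ?thesis using r by (simp add: abel_factor_def)
qed

lemma abel_factor_ge: "0 \<le> r \<Longrightarrow> 2 * r * (1 - cos \<alpha>) \<le> abel_factor r \<alpha>"
proof -
  have "0 \<le> (1 - r)\<^sup>2" by simp
  then show ?thesis by (simp add: abel_factor_def power2_eq_square algebra_simps)
qed

lemma cos_pair: fixes s t :: real shows "(1 - cos (s + t)) * (1 - cos (s - t)) = (cos s - cos t)\<^sup>2"
proof -
  have a: "cos (s + t) + cos (s - t) = 2 * cos s * cos t" unfolding cos_add cos_diff by linarith
  have "cos (s + t) * cos (s - t) = (cos s)\<^sup>2 * (cos t)\<^sup>2 - (sin s)\<^sup>2 * (sin t)\<^sup>2"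
    unfolding cos_add cos_diff power2_eq_square by (simp only: algebra_simps)
  also have "\<dots> = (cos s)\<^sup>2 + (cos t)\<^sup>2 - 1" by (simp add: sin_squared_eq algebra_simps)
  finally have b: "cos (s + t) * cos (s - t) = (cos s)\<^sup>2 + (cos t)\<^sup>2 - 1" .
  have "(1 - cos (s + t)) * (1 - cos (s - t)) = 1 - (cos (s + t) + cos (s - t)) + cos (s + t) * cos (s - t)"
    by (simp add: algebra_simps)
  then show ?thesis unfolding a b by (simp add: power2_eq_square algebra_simps)
qed

text \<open>
  On \<open>[-R, R]\<close> the kernel \<open>-ln \<bar>x - y\<bar>\<close> has, up to a constant, an expansion in the products
  \<open>cos (n s) cos (n t)\<close> with \<open>x = R cos s\<close>, \<open>y = R cos t\<close> and positive coefficients \<open>2 / n\<close>.  This is the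
  source of positive definiteness.  As the expansion converges badly near the diagonal, its
  Abel means are used, with the factor \<open>r\<^sup>n\<close> inserted, and \<open>r\<close> tends to \<open>1\<close> at the end.
\<close>

locale log_energy_on_interval =
  fixes R :: real
  assumes R: "R > 0"
begin

text \<open>The clamping only makes the function continuous on the whole line.\<close>

definition angle :: "real \<Rightarrow> real" where "angle x = arccos (max (-1) (min 1 (x / R)))"

lemma cos_angle: "\<bar>x\<bar> \<le> R \<Longrightarrow> cos (angle x) = x / R"
proof -
  assume "\<bar>x\<bar> \<le> R"
  then have "- 1 \<le> x / R" "x / R \<le> 1" by (simp_all add: pos_le_divide_eq pos_divide_le_eq R abs_le_iff)
  then show ?thesis by (simp add: angle_def)
qed

lemma angle_measurable [measurable]: "angle \<in> borel_measurable borel"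
  unfolding angle_def using R by (intro borel_measurable_continuous_onI continuous_intros) auto

text \<open>
  The closed form of the \<open>r\<close>-th Abel mean, see \<open>abel_kernel_sums\<close>.
\<close>

definition abel_kernel :: "real \<Rightarrow> real \<Rightarrow> real \<Rightarrow> real" where
  "abel_kernel r x y = - ln (abel_factor r (angle x + angle y)) / 2 - ln (abel_factor r (angle x - angle y)) / 2"

lemma abel_kernel_measurable [measurable]: "(\<lambda>p. abel_kernel r (fst p) (snd p)) \<in> borel_measurable (borel \<Otimes>\<^sub>M borel)"
  unfolding abel_kernel_def abel_factor_def by measurable

definition abel_product :: "real \<Rightarrow> real \<Rightarrow> real \<Rightarrow> real" where
  "abel_product r x y = abel_factor r (angle x + angle y) * abel_factor r (angle x - angle y)"

lemma abel_kernel_product: "0 \<le> r \<Longrightarrow> r < 1 \<Longrightarrow> abel_kernel r x y = - ln (abel_product r x y) / 2"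
  using abel_factor_pos by (simp add: abel_kernel_def abel_product_def ln_mult_pos add_divide_distrib)

lemma abel_product_pos: "0 \<le> r \<Longrightarrow> r < 1 \<Longrightarrow> 0 < abel_product r x y"
  by (simp add: abel_product_def abel_factor_pos)

lemma abel_product_le: "0 \<le> r \<Longrightarrow> r < 1 \<Longrightarrow> abel_product r x y \<le> 4 * 4"
  unfolding abel_product_def by (intro mult_mono abel_factor_le) (auto intro: less_imp_le abel_factor_pos)

text \<open>
  By \<open>cos_pair\<close> the two factors together degenerate near the diagonal no faster than \<open>(x - y)\<^sup>2\<close>.
  This dominates the Abel means uniformly in \<open>r\<close>.
\<close>

lemma abel_product_ge:
  assumes "1/2 \<le> r" "r < 1" "\<bar>x\<bar> \<le> R" "\<bar>y\<bar> \<le> R"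
  shows "(\<bar>x - y\<bar> / R)\<^sup>2 \<le> abel_product r x y"
proof -
  have "(2 * r * (1 - cos (angle x + angle y))) * (2 * r * (1 - cos (angle x - angle y))) \<le> abel_product r x y"
    unfolding abel_product_def using assms
    by (intro mult_mono abel_factor_ge) (auto intro!: less_imp_le[OF abel_factor_pos])
  also have "(2 * r * (1 - cos (angle x + angle y))) * (2 * r * (1 - cos (angle x - angle y)))
     = (2 * r)\<^sup>2 * ((1 - cos (angle x + angle y)) * (1 - cos (angle x - angle y)))"
    by (simp add: power2_eq_square)
  also have "\<dots> = (2 * r)\<^sup>2 * (\<bar>x - y\<bar> / R)\<^sup>2"
    unfolding cos_pair using cos_angle assms by (simp add: power_divide flip: diff_divide_distrib)
  finally have "(2 * r)\<^sup>2 * (\<bar>x - y\<bar> / R)\<^sup>2 \<le> abel_product r x y" .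
  moreover have "1 * (\<bar>x - y\<bar> / R)\<^sup>2 \<le> (2 * r)\<^sup>2 * (\<bar>x - y\<bar> / R)\<^sup>2"
    using assms one_le_power[of "2 * r" 2] by (intro mult_right_mono) auto
  ultimately show ?thesis by linarith
qed

lemma abel_kernel_ge: "0 \<le> r \<Longrightarrow> r < 1 \<Longrightarrow> - ln 4 \<le> abel_kernel r x y"
proof -
  assume r: "0 \<le> r" "r < 1"
  have "ln (abel_product r x y) \<le> ln (4 * 4)" using abel_product_le[OF r] abel_product_pos[OF r] by (intro ln_mono) auto
  also have "\<dots> = 2 * ln 4" by (simp only: ln_mult) simp
  finally show ?thesis by (simp add: abel_kernel_product[OF r])
qed

lemma abel_kernel_le:
  assumes "1/2 \<le> r" "r < 1" "\<bar>x\<bar> \<le> R" "\<bar>y\<bar> \<le> R" "x \<noteq> y"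
  shows "abel_kernel r x y \<le> ln R - ln \<bar>x - y\<bar>"
proof -
  have d: "0 < \<bar>x - y\<bar> / R" using assms R by simp
  have "ln ((\<bar>x - y\<bar> / R)\<^sup>2) \<le> ln (abel_product r x y)"
    using abel_product_ge[OF assms(1-4)] d by (intro ln_mono) (auto intro: zero_less_power)
  then have "2 * ln (\<bar>x - y\<bar> / R) \<le> ln (abel_product r x y)" using d by (simp add: ln_realpow)
  then show ?thesis using assms R by (simp add: abel_kernel_product ln_div)
qed

lemma abel_kernel_tendsto:
  assumes "\<bar>x\<bar> \<le> R" "\<bar>y\<bar> \<le> R" "x \<noteq> y" "\<rho> \<longlonglongrightarrow> 1" "\<And>i. 0 \<le> \<rho> i" "\<And>i. \<rho> i < 1"
  shows "(\<lambda>i. abel_kernel (\<rho> i) x y) \<longlonglongrightarrow> ln (R/2) - ln \<bar>x - y\<bar>"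
proof -
  have d: "0 < \<bar>x - y\<bar> / R" using assms R by simp
  have "(\<lambda>i. abel_product (\<rho> i) x y) \<longlonglongrightarrow> (1 - 2 * 1 * cos (angle x + angle y) + 1\<^sup>2) * (1 - 2 * 1 * cos (angle x - angle y) + 1\<^sup>2)"
    unfolding abel_product_def abel_factor_def by (intro tendsto_intros assms)
  also have "(1 - 2 * 1 * cos (angle x + angle y) + 1\<^sup>2) * (1 - 2 * 1 * cos (angle x - angle y) + 1\<^sup>2)
     = 4 * ((1 - cos (angle x + angle y)) * (1 - cos (angle x - angle y)))" by (simp add: algebra_simps)
  also have "\<dots> = (2 * (\<bar>x - y\<bar> / R))\<^sup>2"
    unfolding cos_pair using cos_angle assms by (simp add: power_divide power_mult_distrib flip: diff_divide_distrib)
  finally have "(\<lambda>i. - ln (abel_product (\<rho> i) x y) / 2) \<longlonglongrightarrow> - ln ((2 * (\<bar>x - y\<bar> / R))\<^sup>2) / 2"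
    using d by (intro tendsto_intros) auto
  moreover have "- ln ((2 * (\<bar>x - y\<bar> / R))\<^sup>2) / 2 = ln (R/2) - ln \<bar>x - y\<bar>"
  proof -
    have "ln ((2 * (\<bar>x - y\<bar> / R))\<^sup>2) = 2 * ln (2 * (\<bar>x - y\<bar> / R))" using d by (simp add: ln_realpow)
    also have "ln (2 * (\<bar>x - y\<bar> / R)) = ln 2 + (ln \<bar>x - y\<bar> - ln R)" using d assms R by (subst ln_mult_pos) (auto simp: ln_div)
    finally show ?thesis using R by (simp add: ln_div)
  qed
  ultimately show ?thesis using assms by (simp add: abel_kernel_product)
qed

lemma abel_kernel_sums:
  assumes "0 \<le> r" "r < 1"
  shows "(\<lambda>n. 2 * r ^ n / real n * (cos (real n * angle x) * cos (real n * angle y))) sums abel_kernel r x y"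
proof -
  have "(\<lambda>n. r ^ n / real n * cos (real n * (angle x + angle y)) + r ^ n / real n * cos (real n * (angle x - angle y)))
    sums (- ln (1 - 2 * r * cos (angle x + angle y) + r\<^sup>2) / 2 + - ln (1 - 2 * r * cos (angle x - angle y) + r\<^sup>2) / 2)"
    by (intro sums_add cos_series assms)
  moreover have "r ^ n / real n * cos (real n * (angle x + angle y)) + r ^ n / real n * cos (real n * (angle x - angle y))
     = 2 * r ^ n / real n * (cos (real n * angle x) * cos (real n * angle y))" for n
  proof -
    have "cos (real n * (angle x + angle y)) + cos (real n * (angle x - angle y)) = 2 * (cos (real n * angle x) * cos (real n * angle y))"
      by (simp add: distrib_left right_diff_distrib cos_add cos_diff)
    then show ?thesis unfolding distrib_left[symmetric] by simp
  qed
  ultimately show ?thesis by (simp add: abel_kernel_def abel_factor_def)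
qed

definition bdd_prob :: "real measure \<Rightarrow> bool" where
  "bdd_prob M \<longleftrightarrow> prob_space M \<and> sets M = sets borel \<and> (AE x in M. \<bar>x\<bar> \<le> R)"

text \<open>
  As \<open>ln 0 = 0\<close>, integrability alone would not detect mass on the diagonal.
\<close>

definition finite_energy :: "real measure \<Rightarrow> real measure \<Rightarrow> bool" where
  "finite_energy M N \<longleftrightarrow> (AE p in M \<Otimes>\<^sub>M N. fst p \<noteq> snd p) \<and> integrable (M \<Otimes>\<^sub>M N) (\<lambda>p. ln \<bar>fst p - snd p\<bar>)"

definition energy :: "real measure \<Rightarrow> real measure \<Rightarrow> real" where
  "energy M N = (LINT p|(M \<Otimes>\<^sub>M N). - ln \<bar>fst p - snd p\<bar>)"

definition cos_moment :: "nat \<Rightarrow> real measure \<Rightarrow> real" where "cos_moment n M = (LINT x|M. cos (real n * angle x))"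

definition abel_energy :: "real \<Rightarrow> real measure \<Rightarrow> real measure \<Rightarrow> real" where
  "abel_energy r M N = (LINT p|(M \<Otimes>\<^sub>M N). abel_kernel r (fst p) (snd p))"

lemma bdd_probD:
  assumes "bdd_prob M"
  shows "prob_space M" "sets M = sets borel" "space M = UNIV" "AE x in M. \<bar>x\<bar> \<le> R"
  using assms sets_eq_imp_space_eq[of M borel] unfolding bdd_prob_def by auto

lemma pair_facts:
  assumes "bdd_prob M" "bdd_prob N"
  shows "prob_space (M \<Otimes>\<^sub>M N)" "sets (M \<Otimes>\<^sub>M N) = sets (borel \<Otimes>\<^sub>M borel)" "space (M \<Otimes>\<^sub>M N) = UNIV"
    "AE p in M \<Otimes>\<^sub>M N. \<bar>fst p\<bar> \<le> R \<and> \<bar>snd p\<bar> \<le> R" "pair_sigma_finite M N"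
    "borel_measurable (M \<Otimes>\<^sub>M N) = borel_measurable (borel \<Otimes>\<^sub>M (borel::real measure))"
proof -
  interpret M: prob_space M using bdd_probD[OF assms(1)] by simp
  interpret N: prob_space N using bdd_probD[OF assms(2)] by simp
  interpret P: pair_prob_space M N ..
  note [measurable_cong] = bdd_probD(2)[OF assms(1)] bdd_probD(2)[OF assms(2)]
  show "prob_space (M \<Otimes>\<^sub>M N)" by (rule P.prob_space_axioms)
  show s: "sets (M \<Otimes>\<^sub>M N) = sets (borel \<Otimes>\<^sub>M borel)"
    by (intro sets_pair_measure_cong bdd_probD assms)
  show sp: "space (M \<Otimes>\<^sub>M N) = UNIV" by (simp add: space_pair_measure bdd_probD[OF assms(1)] bdd_probD[OF assms(2)])
  show "pair_sigma_finite M N" ..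
  show "borel_measurable (M \<Otimes>\<^sub>M N) = borel_measurable (borel \<Otimes>\<^sub>M (borel::real measure))"
    by (rule measurable_cong_sets[OF s refl])
  show "AE p in M \<Otimes>\<^sub>M N. \<bar>fst p\<bar> \<le> R \<and> \<bar>snd p\<bar> \<le> R"
  proof (rule P.AE_pair_measure)
    show "{x \<in> space (M \<Otimes>\<^sub>M N). \<bar>fst x\<bar> \<le> R \<and> \<bar>snd x\<bar> \<le> R} \<in> sets (M \<Otimes>\<^sub>M N)" by measurable
    show "AE x in M. AE y in N. \<bar>fst (x, y)\<bar> \<le> R \<and> \<bar>snd (x, y)\<bar> \<le> R"
      using bdd_probD(4)[OF assms(1)]
    proof eventually_elim
      case (elim x)
      show ?case using bdd_probD(4)[OF assms(2)] by eventually_elim (use elim in auto)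
    qed
  qed
qed

lemma abel_energy_sums:
  assumes r: "0 \<le> r" "r < 1" and MN: "bdd_prob M" "bdd_prob N"
  shows "(\<lambda>n. 2 * r ^ n / real n * (cos_moment n M * cos_moment n N)) sums abel_energy r M N"
proof -
  interpret M: prob_space M using bdd_probD[OF MN(1)] by simp
  interpret N: prob_space N using bdd_probD[OF MN(2)] by simp
  interpret P: pair_prob_space M N ..
  note [measurable_cong] = bdd_probD(2)[OF MN(1)] bdd_probD(2)[OF MN(2)]
  define f where "f n p = 2 * r ^ n / real n * (cos (real n * angle (fst p)) * cos (real n * angle (snd p)))" for n and p :: "real \<times> real"
  have bnd: "\<bar>cos a * cos b\<bar> \<le> 1" for a b :: real
    unfolding abs_mult by (intro mult_le_one) auto
  have fb: "norm (f n p) \<le> 2 * r ^ n" for n p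
  proof (cases "n = 0")
    case False
    have "norm (f n p) = 2 * r ^ n / real n * \<bar>cos (real n * angle (fst p)) * cos (real n * angle (snd p))\<bar>"
      using r by (simp add: f_def abs_mult)
    also have "\<dots> \<le> 2 * r ^ n / real n * 1" using r bnd by (intro mult_left_mono) auto
    also have "\<dots> \<le> 2 * r ^ n" using r False by (simp add: divide_le_eq) (simp add: mult_le_cancel_left1)
    finally show ?thesis .
  qed (use r in \<open>simp add: f_def\<close>)
  have fm [measurable]: "f n \<in> borel_measurable (M \<Otimes>\<^sub>M N)" for n unfolding f_def by measurable
  have fi: "integrable (M \<Otimes>\<^sub>M N) (f n)" for n
    by (rule P.integrable_const_bound[where B = "2 * r ^ n"]) (use fb in auto)
  have geo: "summable (\<lambda>n. 2 * r ^ n)" using r by (intro summable_mult summable_geometric) auto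
  have sn: "summable (\<lambda>n. norm (f n p))" for p
    by (rule summable_comparison_test'[OF geo]) (use fb in auto)
  have "(\<lambda>n. LINT p|(M \<Otimes>\<^sub>M N). f n p) sums (LINT p|(M \<Otimes>\<^sub>M N). (\<Sum>n. f n p))"
  proof (rule sums_integral[OF fi])
    show "AE p in M \<Otimes>\<^sub>M N. summable (\<lambda>n. norm (f n p))" using sn by simp
    show "summable (\<lambda>n. LINT p|(M \<Otimes>\<^sub>M N). norm (f n p))"
    proof (rule summable_comparison_test'[OF geo])
      fix n
      have "(LINT p|(M \<Otimes>\<^sub>M N). norm (f n p)) \<le> (LINT p|(M \<Otimes>\<^sub>M N). 2 * r ^ n)"
        using fi fb by (intro integral_mono) auto
      then show "norm (LINT p|(M \<Otimes>\<^sub>M N). norm (f n p)) \<le> 2 * r ^ n" by (simp add: P.prob_space)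
    qed
  qed
  moreover have "(\<Sum>n. f n p) = abel_kernel r (fst p) (snd p)" for p
    using abel_kernel_sums[OF r] unfolding f_def by (rule sums_unique[symmetric])
  moreover have "(LINT p|(M \<Otimes>\<^sub>M N). f n p) = 2 * r ^ n / real n * (cos_moment n M * cos_moment n N)" for n
  proof -
    have gi: "integrable (M \<Otimes>\<^sub>M N) (\<lambda>p. cos (real n * angle (fst p)) * cos (real n * angle (snd p)))"
      by (rule P.integrable_const_bound[where B = 1]) (use bnd in auto)
    have "(LINT p|(M \<Otimes>\<^sub>M N). cos (real n * angle (fst p)) * cos (real n * angle (snd p)))
      = (LINT x|M. LINT y|N. cos (real n * angle x) * cos (real n * angle y))"
      using P.integral_fst'[OF gi] by simp
    also have "\<dots> = cos_moment n M * cos_moment n N" by (simp add: cos_moment_def)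
    finally show ?thesis unfolding f_def by simp
  qed
  ultimately show ?thesis by (simp add: abel_energy_def)
qed

text \<open>
  All terms of the series for the difference are nonnegative squares, so that each single one of
  them is a lower bound.
\<close>

lemma abel_energy_pd:
  assumes r: "0 \<le> r" "r < 1" and MN: "bdd_prob M" "bdd_prob N"
  shows "2 * r ^ n / real n * (cos_moment n M - cos_moment n N)\<^sup>2 \<le> abel_energy r M M + abel_energy r N N - 2 * abel_energy r M N"
proof -
  define t where "t n = 2 * r ^ n / real n * (cos_moment n M - cos_moment n N)\<^sup>2" for n
  have "(\<lambda>n. 2 * r ^ n / real n * (cos_moment n M * cos_moment n M) + 2 * r ^ n / real n * (cos_moment n N * cos_moment n N)
     - 2 * (2 * r ^ n / real n * (cos_moment n M * cos_moment n N))) sums (abel_energy r M M + abel_energy r N N - 2 * abel_energy r M N)"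
    by (intro sums_add sums_diff sums_mult abel_energy_sums assms)
  moreover have "2 * r ^ n / real n * (cos_moment n M * cos_moment n M) + 2 * r ^ n / real n * (cos_moment n N * cos_moment n N)
     - 2 * (2 * r ^ n / real n * (cos_moment n M * cos_moment n N)) = t n" for n
    by (simp add: t_def power2_eq_square algebra_simps)
  ultimately have t: "t sums (abel_energy r M M + abel_energy r N N - 2 * abel_energy r M N)" by simp
  have "sum t {n} \<le> suminf t" using sums_summable[OF t] r by (intro sum_le_suminf) (auto simp: t_def)
  then show ?thesis using sums_unique[OF t] by (simp add: t_def)
qed

text \<open>
  Any sequence that increases to \<open>1\<close> would do; \<open>abel_product_ge\<close> needs it to start at \<open>1/2\<close>.
\<close>

definition rho :: "nat \<Rightarrow> real" where "rho i = 1 - 1 / real (i + 2)"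

lemma radii: "1/2 \<le> rho i" "0 \<le> rho i" "rho i < 1" "rho \<longlonglongrightarrow> 1"
proof -
  show "1/2 \<le> rho i" "0 \<le> rho i" "rho i < 1" by (auto simp: rho_def divide_simps)
  have "(\<lambda>i. 1 - 1 / real (i + 2)) \<longlonglongrightarrow> 1 - 0"
    by (intro tendsto_intros LIMSEQ_ignore_initial_segment[OF lim_1_over_n])
  then show "rho \<longlonglongrightarrow> 1" by (simp add: rho_def[abs_def])
qed

lemma abel_energy_lim:
  assumes M: "bdd_prob M" "finite_energy M M"
  shows "(\<lambda>i. abel_energy (rho i) M M) \<longlonglongrightarrow> energy M M + ln (R / 2)"
proof -
  note pf = pair_facts[OF M(1) M(1)]
  interpret P: prob_space "M \<Otimes>\<^sub>M M" by (rule pf(1))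
  note [measurable_cong] = bdd_probD(2)[OF M(1)]
  have int: "integrable (M \<Otimes>\<^sub>M M) (\<lambda>p. ln \<bar>fst p - snd p\<bar>)" using M(2) by (simp add: finite_energy_def)
  have "(\<lambda>i. LINT p|(M \<Otimes>\<^sub>M M). abel_kernel (rho i) (fst p) (snd p)) \<longlonglongrightarrow> (LINT p|(M \<Otimes>\<^sub>M M). ln (R/2) - ln \<bar>fst p - snd p\<bar>)"
  proof (rule integral_dominated_convergence)
    show "integrable (M \<Otimes>\<^sub>M M) (\<lambda>p. ln 4 + \<bar>ln R\<bar> + \<bar>ln \<bar>fst p - snd p\<bar>\<bar>)"
      using int by (intro Bochner_Integration.integrable_add integrable_abs) auto
    show "AE p in M \<Otimes>\<^sub>M M. (\<lambda>i. abel_kernel (rho i) (fst p) (snd p)) \<longlonglongrightarrow> ln (R/2) - ln \<bar>fst p - snd p\<bar>"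
      using pf(4) M(2)[unfolded finite_energy_def, THEN conjunct1]
      by eventually_elim (use radii in \<open>auto intro!: abel_kernel_tendsto\<close>)
    show "AE p in M \<Otimes>\<^sub>M M. norm (abel_kernel (rho i) (fst p) (snd p)) \<le> ln 4 + \<bar>ln R\<bar> + \<bar>ln \<bar>fst p - snd p\<bar>\<bar>" for i
      using pf(4) M(2)[unfolded finite_energy_def, THEN conjunct1]
    proof eventually_elim
      case (elim p)
      have "- ln 4 \<le> abel_kernel (rho i) (fst p) (snd p)" by (rule abel_kernel_ge[OF radii(2,3)])
      moreover have "abel_kernel (rho i) (fst p) (snd p) \<le> ln R - ln \<bar>fst p - snd p\<bar>"
        using elim by (intro abel_kernel_le radii) auto
      moreover have "(0::real) \<le> ln 4" by simp
      ultimately show ?case unfolding real_norm_def by linarith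
    qed
  qed measurable
  moreover have "(LINT p|(M \<Otimes>\<^sub>M M). ln (R/2) - ln \<bar>fst p - snd p\<bar>) = energy M M + ln (R/2)"
    using int by (simp add: energy_def P.prob_space)
  ultimately show ?thesis by (simp add: abel_energy_def)
qed

lemma no_atoms:
  assumes "bdd_prob M" "finite_energy M M"
  shows "emeasure M {x} = 0"
proof -
  interpret M: prob_space M using bdd_probD[OF assms(1)] by simp
  note sM = bdd_probD[OF assms(1)]
  have m: "{x} \<in> sets M" using sM by simp
  have E: "AE p in M \<Otimes>\<^sub>M M. p \<notin> {x} \<times> {x}"
    using assms(2)[unfolded finite_energy_def, THEN conjunct1] by eventually_elim auto
  have s: "{x} \<times> {x} \<in> sets (M \<Otimes>\<^sub>M M)" using m by (intro pair_measureI)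
  have q: "{p \<in> space (M \<Otimes>\<^sub>M M). \<not> p \<notin> {x} \<times> {x}} = {x} \<times> {x}" by (auto simp: space_pair_measure sM)
  have "emeasure (M \<Otimes>\<^sub>M M) ({x} \<times> {x}) = 0" using AE_iff_measurable[OF s q] E by (rule iffD1)
  then show ?thesis using M.emeasure_pair_measure_Times[OF m m] by simp
qed

text \<open>
  Finiteness of the mutual energy is part of the conclusion.  Positive definiteness of the Abel means
  bounds the mutual Abel energies by those of \<open>M\<close> and \<open>N\<close>, which converge, and Fatou's lemma turns this into a bound for
  the mutual energy of \<open>M\<close> and \<open>N\<close>.
\<close>

lemma energy_pd:
  assumes M: "bdd_prob M" "finite_energy M M" and N: "bdd_prob N" "finite_energy N N"
  shows "finite_energy M N" "2 / real n * (cos_moment n M - cos_moment n N)\<^sup>2 \<le> energy M M + energy N N - 2 * energy M N"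
proof -
  note pf = pair_facts[OF M(1) N(1)]
  interpret P: prob_space "M \<Otimes>\<^sub>M N" by (rule pf(1))
  interpret PP: pair_sigma_finite M N by (rule pf(5))
  note [measurable_cong] = bdd_probD(2)[OF M(1)] bdd_probD(2)[OF N(1)]
  have ne: "AE p in M \<Otimes>\<^sub>M N. fst p \<noteq> snd p"
  proof (rule PP.AE_pair_measure)
    show "{x \<in> space (M \<Otimes>\<^sub>M N). fst x \<noteq> snd x} \<in> sets (M \<Otimes>\<^sub>M N)" by measurable
    have "AE y in N. x \<noteq> y" for x
    proof -
      have "{x} \<in> null_sets N" using no_atoms[OF N, of x] bdd_probD(2)[OF N(1)] by (simp add: null_sets_def)
      then have "AE y in N. y \<notin> {x}" by (rule AE_not_in)
      then show ?thesis by eventually_elim auto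
    qed
    then show "AE x in M. AE y in N. fst (x, y) \<noteq> snd (x, y)" by simp
  qed
  \<comment> \<open>The shift by \<open>ln 4\<close> makes the Abel kernels nonnegative, as needed for Fatou's lemma.\<close>
  define g where "g p = ln (R/2) - ln \<bar>fst p - snd p\<bar> + ln 4" for p :: "real \<times> real"
  have gm [measurable]: "g \<in> borel_measurable (M \<Otimes>\<^sub>M N)" unfolding g_def by measurable
  define f where "f i p = abel_kernel (rho i) (fst p) (snd p) + ln 4" for i and p :: "real \<times> real"
  have fm [measurable]: "f i \<in> borel_measurable (M \<Otimes>\<^sub>M N)" for i unfolding f_def by measurable
  have fnn: "0 \<le> f i p" for i p using abel_kernel_ge[OF radii(2,3)] by (simp add: f_def add.commute) (smt (verit))
  have lim: "AE p in M \<Otimes>\<^sub>M N. (\<lambda>i. f i p) \<longlonglongrightarrow> g p"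
    using pf(4) ne unfolding f_def g_def
    by eventually_elim (use radii in \<open>auto intro!: abel_kernel_tendsto tendsto_add\<close>)
  then have gnn: "AE p in M \<Otimes>\<^sub>M N. 0 \<le> g p"
    by eventually_elim (use fnn in \<open>auto intro!: LIMSEQ_le_const\<close>)
  define \<delta> where "\<delta> = (cos_moment n M - cos_moment n N)\<^sup>2"
  define B where "B = (energy M M + energy N N - 2 / real n * \<delta>) / 2 + ln (R/2) + ln 4"
  have fint: "integrable (M \<Otimes>\<^sub>M N) (f i)" for i
  proof -
    have pos: "0 < abel_factor (rho i) \<alpha>" "(1 - rho i)\<^sup>2 \<le> abel_factor (rho i) \<alpha>" "abel_factor (rho i) \<alpha> \<le> 4" for \<alpha>
    proof -
      show "0 < abel_factor (rho i) \<alpha>" "abel_factor (rho i) \<alpha> \<le> 4" using radii abel_factor_pos abel_factor_le by auto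
      have "rho i * cos \<alpha> \<le> rho i * 1" using radii by (intro mult_left_mono) auto
      then show "(1 - rho i)\<^sup>2 \<le> abel_factor (rho i) \<alpha>" by (simp add: abel_factor_def power2_eq_square algebra_simps)
    qed
    have lb: "ln ((1 - rho i)\<^sup>2) \<le> ln (abel_factor (rho i) \<alpha>)" for \<alpha>
      using pos[of \<alpha>] radii(3)[of i] by (intro ln_mono) auto
    have "AE p in M \<Otimes>\<^sub>M N. norm (f i p) \<le> - ln ((1 - rho i)\<^sup>2) + ln 4"
    proof (rule AE_I2)
      fix p
      have "f i p \<le> - ln ((1 - rho i)\<^sup>2) + ln 4"
        using lb[of "angle (fst p) + angle (snd p)"] lb[of "angle (fst p) - angle (snd p)"] unfolding f_def abel_kernel_def by linarith
      then show "norm (f i p) \<le> - ln ((1 - rho i)\<^sup>2) + ln 4" using fnn[of i p] by simp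
    qed
    then show ?thesis by (rule P.integrable_const_bound) measurable
  qed
  have f_le: "(LINT p|(M \<Otimes>\<^sub>M N). f i p) \<le> (abel_energy (rho i) M M + abel_energy (rho i) N N - 2 * rho i ^ n / real n * \<delta>) / 2 + ln 4" for i
  proof -
    have "integrable (M \<Otimes>\<^sub>M N) (\<lambda>p. f i p - ln 4)" using fint by (intro Bochner_Integration.integrable_diff) auto
    then have "(LINT p|(M \<Otimes>\<^sub>M N). f i p) = abel_energy (rho i) M N + ln 4"
      unfolding abel_energy_def f_def by (simp add: P.prob_space)
    then show ?thesis using abel_energy_pd[OF radii(2,3) M(1) N(1), of i n] by (simp add: \<delta>_def)
  qed
  have Blim: "(\<lambda>i. (abel_energy (rho i) M M + abel_energy (rho i) N N - 2 * rho i ^ n / real n * \<delta>) / 2 + ln 4) \<longlonglongrightarrow> B"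
  proof -
    have "(\<lambda>i. (abel_energy (rho i) M M + abel_energy (rho i) N N - rho i ^ n * (2 / real n * \<delta>)) / 2 + ln 4) \<longlonglongrightarrow>
      ((energy M M + ln (R/2)) + (energy N N + ln (R/2)) - 1 ^ n * (2 / real n * \<delta>)) / 2 + ln 4"
      by (intro tendsto_intros abel_energy_lim M N radii(4)) simp
    moreover have "rho i ^ n * (2 / real n * \<delta>) = 2 * rho i ^ n / real n * \<delta>" for i by simp
    ultimately show ?thesis by (simp add: B_def add_divide_distrib diff_divide_distrib algebra_simps)
  qed
  have "(\<integral>\<^sup>+p. ennreal (g p) \<partial>(M \<Otimes>\<^sub>M N)) = (\<integral>\<^sup>+p. liminf (\<lambda>i. ennreal (f i p)) \<partial>(M \<Otimes>\<^sub>M N))"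
  proof (rule nn_integral_cong_AE)
    show "AE p in M \<Otimes>\<^sub>M N. ennreal (g p) = liminf (\<lambda>i. ennreal (f i p))"
      using lim by eventually_elim (auto intro!: lim_imp_Liminf[symmetric] tendsto_ennrealI)
  qed
  also have "\<dots> \<le> liminf (\<lambda>i. \<integral>\<^sup>+p. ennreal (f i p) \<partial>(M \<Otimes>\<^sub>M N))"
    by (rule nn_integral_liminf) measurable
  also have "\<dots> \<le> liminf (\<lambda>i. ennreal ((abel_energy (rho i) M M + abel_energy (rho i) N N - 2 * rho i ^ n / real n * \<delta>) / 2 + ln 4))"
  proof (rule Liminf_mono, intro always_eventually allI)
    fix i
    have "(\<integral>\<^sup>+p. ennreal (f i p) \<partial>(M \<Otimes>\<^sub>M N)) = ennreal (LINT p|(M \<Otimes>\<^sub>M N). f i p)"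
      using fint fnn by (intro nn_integral_eq_integral) auto
    then show "(\<integral>\<^sup>+p. ennreal (f i p) \<partial>(M \<Otimes>\<^sub>M N)) \<le> ennreal ((abel_energy (rho i) M M + abel_energy (rho i) N N - 2 * rho i ^ n / real n * \<delta>) / 2 + ln 4)"
      using f_le[of i] by (simp add: ennreal_leI)
  qed
  also have "\<dots> = ennreal B" by (intro lim_imp_Liminf tendsto_ennrealI Blim) simp
  finally have nn: "(\<integral>\<^sup>+p. ennreal (g p) \<partial>(M \<Otimes>\<^sub>M N)) \<le> ennreal B" .
  have gi: "integrable (M \<Otimes>\<^sub>M N) g"
    using nn gnn by (intro integrableI_nonneg) (auto simp: less_top[symmetric] top_unique)
  have "integrable (M \<Otimes>\<^sub>M N) (\<lambda>p. ln (R/2) + ln 4 - g p)" using gi by (intro Bochner_Integration.integrable_diff) auto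
  then have li: "integrable (M \<Otimes>\<^sub>M N) (\<lambda>p. ln \<bar>fst p - snd p\<bar>)" by (simp add: g_def)
  then show "finite_energy M N" using ne by (simp add: finite_energy_def)
  have "ennreal (LINT p|(M \<Otimes>\<^sub>M N). g p) \<le> ennreal B"
    using nn gi gnn by (subst nn_integral_eq_integral[symmetric]) auto
  moreover have Bnn: "0 \<le> B"
  proof (rule LIMSEQ_le_const[OF Blim], intro exI allI impI)
    fix i
    have "0 \<le> (LINT p|(M \<Otimes>\<^sub>M N). f i p)" using fnn by (intro integral_nonneg_AE) auto
    then show "0 \<le> (abel_energy (rho i) M M + abel_energy (rho i) N N - 2 * rho i ^ n / real n * \<delta>) / 2 + ln 4" using f_le[of i] by linarith
  qed
  ultimately have "(LINT p|(M \<Otimes>\<^sub>M N). g p) \<le> B" by simp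
  moreover have "(LINT p|(M \<Otimes>\<^sub>M N). g p) = ln (R/2) + energy M N + ln 4"
    using li by (simp add: g_def energy_def P.prob_space)
  ultimately show "2 / real n * (cos_moment n M - cos_moment n N)\<^sup>2 \<le> energy M M + energy N N - 2 * energy M N"
    by (simp add: B_def \<delta>_def)
qed

text \<open>
  Products \<open>cos (n \<theta>) (cos \<theta>)\<^sup>j\<close> are combinations of the functions \<open>cos (k \<theta>)\<close>.
\<close>

lemma moments_eq:
  assumes MN: "bdd_prob M" "bdd_prob N" and c: "\<And>n. n \<ge> 1 \<Longrightarrow> cos_moment n M = cos_moment n N"
  shows "(LINT x|M. x ^ k) = (LINT x|N. x ^ k)"
proof -
  interpret M: prob_space M using bdd_probD[OF MN(1)] by simp
  interpret N: prob_space N using bdd_probD[OF MN(2)] by simp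
  note [measurable_cong] = bdd_probD(2)[OF MN(1)] bdd_probD(2)[OF MN(2)]
  have bnd: "\<bar>cos a * cos b ^ j\<bar> \<le> 1" for a b :: real and j
    unfolding abs_mult power_abs by (intro mult_le_one power_le_one) auto
  have iM: "integrable M (\<lambda>x. cos (a * angle x) * cos (angle x) ^ j)" for a j
    by (rule M.integrable_const_bound[where B = 1]) (use bnd in auto)
  have iN: "integrable N (\<lambda>x. cos (a * angle x) * cos (angle x) ^ j)" for a j
    by (rule N.integrable_const_bound[where B = 1]) (use bnd in auto)
  have step: "cos (real n * t) * cos t ^ Suc j = (cos (real (n + 1) * t) * cos t ^ j + cos (\<bar>real n - 1\<bar> * t) * cos t ^ j) / 2" for n j t
  proof -
    have "cos (\<bar>real n - 1\<bar> * t) = cos ((real n - 1) * t)"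
      by (metis abs_if cos_minus minus_mult_left)
    then have "cos (real (n + 1) * t) + cos (\<bar>real n - 1\<bar> * t) = 2 * cos (real n * t) * cos t"
      by (simp add: distrib_right left_diff_distrib cos_add cos_diff)
    then have "(cos (real (n + 1) * t) + cos (\<bar>real n - 1\<bar> * t)) * cos t ^ j / 2 = cos (real n * t) * cos t ^ Suc j"
      by simp
    then show ?thesis by (simp add: distrib_right)
  qed
  have absn: "\<exists>m. \<bar>real n - 1\<bar> = real m" for n
    by (cases n) (auto intro: exI[of _ 1] simp: abs_if)
  have all: "(LINT x|M. cos (real n * angle x) * cos (angle x) ^ j) = (LINT x|N. cos (real n * angle x) * cos (angle x) ^ j)" for n j
  proof (induction j arbitrary: n)
    case 0
    show ?case
    proof (cases "n = 0")
      case True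
      then show ?thesis by (simp add: M.prob_space N.prob_space)
    next
      case False
      then show ?thesis using c[of n] by (simp add: cos_moment_def)
    qed
  next
    case (Suc j)
    obtain m where m: "\<bar>real n - 1\<bar> = real m" using absn by blast
    show ?case unfolding step m using Suc[of "n + 1"] Suc[of m] iM iN
      by (simp del: of_nat_add of_nat_Suc)
  qed
  have e: "(LINT x|L. x ^ k) = R ^ k * (LINT x|L. cos (angle x) ^ k)" if L: "bdd_prob L" for L
  proof -
    note [measurable_cong] = bdd_probD(2)[OF L]
    have "(LINT x|L. x ^ k) = (LINT x|L. R ^ k * cos (angle x) ^ k)"
    proof (rule integral_cong_AE)
      show "AE x in L. x ^ k = R ^ k * cos (angle x) ^ k"
        using bdd_probD(4)[OF L] by eventually_elim (use R in \<open>simp add: cos_angle power_divide\<close>)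
    qed measurable
    then show ?thesis by simp
  qed
  show ?thesis using all[of 0 k] by (simp add: e MN)
qed

end

section \<open>Averages of measures and their energy\<close>

text \<open>
  The average of two probability measures, as the law of a fair coin toss that chooses between two
  independent samples.
\<close>

definition mix :: "real measure \<Rightarrow> real measure \<Rightarrow> real measure" where
  "mix M N = distr (measure_pmf (bernoulli_pmf (1/2)) \<Otimes>\<^sub>M (M \<Otimes>\<^sub>M N)) borel (\<lambda>q. if fst q then fst (snd q) else snd (snd q))"

lemma sets_mix [simp]: "sets (mix M N) = sets borel"
  by (simp add: mix_def)

lemma nn_integral_mix:
  assumes M: "prob_space M" "sets M = sets borel" and N: "prob_space N" "sets N = sets borel"
    and g: "g \<in> borel_measurable borel"
  shows "(\<integral>\<^sup>+x. g x \<partial>mix M N) = ennreal (1/2) * (\<integral>\<^sup>+x. g x \<partial>M) + ennreal (1/2) * (\<integral>\<^sup>+x. g x \<partial>N)"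
proof -
  interpret M: prob_space M by fact
  interpret N: prob_space N by fact
  interpret P: pair_prob_space M N ..
  interpret C: prob_space "measure_pmf (bernoulli_pmf (1/2))" by (rule prob_space_measure_pmf)
  interpret Q: pair_prob_space "measure_pmf (bernoulli_pmf (1/2))" "M \<Otimes>\<^sub>M N" ..
  note [measurable_cong] = M(2) N(2)
  note [measurable] = g
  have "(\<integral>\<^sup>+x. g x \<partial>mix M N) = (\<integral>\<^sup>+q. g (if fst q then fst (snd q) else snd (snd q)) \<partial>(measure_pmf (bernoulli_pmf (1/2)) \<Otimes>\<^sub>M (M \<Otimes>\<^sub>M N)))"
    unfolding mix_def by (subst nn_integral_distr) measurable
  also have "\<dots> = (\<integral>\<^sup>+b. \<integral>\<^sup>+p. g (if b then fst p else snd p) \<partial>(M \<Otimes>\<^sub>M N) \<partial>measure_pmf (bernoulli_pmf (1/2)))"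
    by (subst P.nn_integral_fst[symmetric]) (auto)
  also have "\<dots> = (\<integral>\<^sup>+p. g (fst p) \<partial>(M \<Otimes>\<^sub>M N)) * ennreal (1/2) + (\<integral>\<^sup>+p. g (snd p) \<partial>(M \<Otimes>\<^sub>M N)) * ennreal (1/2)"
    by (subst nn_integral_bernoulli_pmf) auto
  also have "(\<integral>\<^sup>+p. g (fst p) \<partial>(M \<Otimes>\<^sub>M N)) = (\<integral>\<^sup>+x. g x \<partial>M)"
    by (subst N.nn_integral_fst[symmetric]) (auto simp: N.emeasure_space_1)
  also have "(\<integral>\<^sup>+p. g (snd p) \<partial>(M \<Otimes>\<^sub>M N)) = (\<integral>\<^sup>+x. g x \<partial>N)"
    by (subst N.nn_integral_fst[symmetric]) (auto simp: M.emeasure_space_1)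
  finally show ?thesis by (simp add: mult.commute)
qed

text \<open>
  The statement that \<open>Q\<close> is the average of \<open>A\<close> and \<open>B\<close>, in a form that also covers the product measures
  on which energies are defined.
\<close>

definition avg :: "'a measure \<Rightarrow> 'a measure \<Rightarrow> 'a measure \<Rightarrow> bool" where
  "avg Q A B \<longleftrightarrow> sets A = sets Q \<and> sets B = sets Q \<and> (\<forall>g\<in>borel_measurable Q.
     (\<integral>\<^sup>+x. g x \<partial>Q) = ennreal (1/2) * (\<integral>\<^sup>+x. g x \<partial>A) + ennreal (1/2) * (\<integral>\<^sup>+x. g x \<partial>B))"

lemma avg_emeasure:
  assumes "avg Q A B" "S \<in> sets Q"
  shows "emeasure Q S = ennreal (1/2) * emeasure A S + ennreal (1/2) * emeasure B S"
proof -
  have "(\<integral>\<^sup>+x. indicator S x \<partial>Q) = ennreal (1/2) * (\<integral>\<^sup>+x. indicator S x \<partial>A) + ennreal (1/2) * (\<integral>\<^sup>+x. indicator S x \<partial>B)"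
    using assms unfolding avg_def by (elim conjE bspec) auto
  then show ?thesis using assms by (simp add: avg_def nn_integral_indicator)
qed

lemma avg_AE:
  assumes Q: "avg Q A B" and "{x \<in> space Q. \<not> P x} \<in> sets Q" and "AE x in A. P x" "AE x in B. P x"
  shows "AE x in Q. P x"
proof -
  have sp: "space A = space Q" "space B = space Q" using Q sets_eq_imp_space_eq unfolding avg_def by blast+
  have s: "{x \<in> space Q. \<not> P x} \<in> sets A" "{x \<in> space Q. \<not> P x} \<in> sets B" using Q assms(2) unfolding avg_def by auto
  have "emeasure A {x \<in> space Q. \<not> P x} = 0" using assms(3) s sp AE_iff_measurable[OF s(1)] by auto
  moreover have "emeasure B {x \<in> space Q. \<not> P x} = 0" using assms(4) s sp AE_iff_measurable[OF s(2)] by auto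
  ultimately have "emeasure Q {x \<in> space Q. \<not> P x} = 0" using avg_emeasure[OF Q assms(2)] by simp
  then show ?thesis using AE_iff_measurable[OF assms(2)] by auto
qed

lemma half_sum_real:
  assumes "p \<noteq> top" "q \<noteq> top"
  shows "enn2real (ennreal (1/2) * p + ennreal (1/2) * q) = (enn2real p + enn2real q) / 2"
proof -
  obtain x y where xy: "p = ennreal x" "0 \<le> x" "q = ennreal y" "0 \<le> y" using assms by (cases p; cases q) auto
  have "ennreal (1/2) * p + ennreal (1/2) * q = ennreal (1/2 * x + 1/2 * y)"
    unfolding xy(1,3) using xy(2,4) by (simp only: ennreal_mult[symmetric] ennreal_plus[symmetric] zero_le_divide_1_iff zero_le_numeral mult_nonneg_nonneg)
  moreover have "enn2real (ennreal (1/2 * x + 1/2 * y)) = 1/2 * x + 1/2 * y" using xy by (intro enn2real_ennreal) simp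
  ultimately have "enn2real (ennreal (1/2) * p + ennreal (1/2) * q) = 1/2 * x + 1/2 * y" by (simp only:)
  also have "\<dots> = (enn2real p + enn2real q) / 2" using xy by (simp add: add_divide_distrib)
  finally show ?thesis .
qed

lemma avg_integral:
  fixes f :: "'a \<Rightarrow> real"
  assumes Q: "avg Q A B" and i: "integrable A f" "integrable B f"
  shows "integrable Q f" "(LINT x|Q. f x) = ((LINT x|A. f x) + (LINT x|B. f x)) / 2"
proof -
  have fm: "f \<in> borel_measurable Q" using Q i(1) unfolding avg_def
    by (metis borel_measurable_integrable measurable_cong_sets)
  have e1: "(\<integral>\<^sup>+x. ennreal (f x) \<partial>Q) = ennreal (1/2) * (\<integral>\<^sup>+x. ennreal (f x) \<partial>A) + ennreal (1/2) * (\<integral>\<^sup>+x. ennreal (f x) \<partial>B)"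
    using Q fm unfolding avg_def by (elim conjE bspec) auto
  have e2: "(\<integral>\<^sup>+x. ennreal (- f x) \<partial>Q) = ennreal (1/2) * (\<integral>\<^sup>+x. ennreal (- f x) \<partial>A) + ennreal (1/2) * (\<integral>\<^sup>+x. ennreal (- f x) \<partial>B)"
    using Q fm unfolding avg_def by (elim conjE bspec) auto
  have fin: "(\<integral>\<^sup>+x. ennreal (f x) \<partial>A) \<noteq> top" "(\<integral>\<^sup>+x. ennreal (f x) \<partial>B) \<noteq> top"
    "(\<integral>\<^sup>+x. ennreal (- f x) \<partial>A) \<noteq> top" "(\<integral>\<^sup>+x. ennreal (- f x) \<partial>B) \<noteq> top"
    using i by (auto simp: real_integrable_def)
  show iQ: "integrable Q f" unfolding real_integrable_def e1 e2 using fin fm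
    by (auto simp: ennreal_mult_eq_top_iff)
  show "(LINT x|Q. f x) = ((LINT x|A. f x) + (LINT x|B. f x)) / 2"
    unfolding real_lebesgue_integral_def[OF iQ] real_lebesgue_integral_def[OF i(1)] real_lebesgue_integral_def[OF i(2)] e1 e2
    half_sum_real[OF fin(1,2)] half_sum_real[OF fin(3,4)]
    by (simp add: diff_divide_distrib add_divide_distrib)
qed

lemma avg_mix:
  assumes "prob_space M" "sets M = sets borel" "prob_space N" "sets N = sets borel"
  shows "avg (mix M N) M N"
  unfolding avg_def using assms nn_integral_mix[OF assms] by (simp add: measurable_cong_sets[OF sets_mix refl])

lemma prob_space_mix:
  assumes "prob_space M" "sets M = sets borel" "prob_space N" "sets N = sets borel"
  shows "prob_space (mix M N)"
proof
  have [simp]: "space M = UNIV" "space N = UNIV" "space (mix M N) = UNIV"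
    using assms sets_eq_imp_space_eq[of _ "borel::real measure"] by (auto simp: mix_def)
  have "emeasure M UNIV = 1" "emeasure N UNIV = 1"
    using prob_space.emeasure_space_1[OF assms(1)] prob_space.emeasure_space_1[OF assms(3)] by auto
  then have "emeasure (mix M N) UNIV = ennreal (1/2) * 1 + ennreal (1/2) * 1"
    using avg_emeasure[OF avg_mix[OF assms], of UNIV] by simp
  also have "\<dots> = ennreal (1/2 + 1/2)" by (subst ennreal_plus) (auto simp only: mult_1_right zero_le_divide_1_iff zero_le_numeral)
  also have "\<dots> = 1" by simp
  finally show "emeasure (mix M N) (space (mix M N)) = 1" by simp
qed

lemma avg_pair_left:
  assumes Q: "avg Q A B" and s: "sigma_finite_measure N" 
  shows "avg (Q \<Otimes>\<^sub>M N) (A \<Otimes>\<^sub>M N) (B \<Otimes>\<^sub>M N)"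
  unfolding avg_def
proof (intro conjI ballI)
  interpret N: sigma_finite_measure N by fact
  have sA: "sets A = sets Q" and sB: "sets B = sets Q" using Q by (auto simp: avg_def)
  show "sets (A \<Otimes>\<^sub>M N) = sets (Q \<Otimes>\<^sub>M N)" "sets (B \<Otimes>\<^sub>M N) = sets (Q \<Otimes>\<^sub>M N)"
    using sA sB by (auto intro: sets_pair_measure_cong)
  fix g :: "'a \<times> 'b \<Rightarrow> ennreal" assume g: "g \<in> borel_measurable (Q \<Otimes>\<^sub>M N)"
  have gA: "g \<in> borel_measurable (A \<Otimes>\<^sub>M N)" "g \<in> borel_measurable (B \<Otimes>\<^sub>M N)"
    using g measurable_cong_sets[OF sets_pair_measure_cong[OF sA refl, of N] refl] measurable_cong_sets[OF sets_pair_measure_cong[OF sB refl, of N] refl] by auto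
  have "(\<lambda>x. \<integral>\<^sup>+y. g (x, y) \<partial>N) \<in> borel_measurable Q" using g by measurable
  then have "(\<integral>\<^sup>+x. \<integral>\<^sup>+y. g (x, y) \<partial>N \<partial>Q) = ennreal (1/2) * (\<integral>\<^sup>+x. \<integral>\<^sup>+y. g (x, y) \<partial>N \<partial>A) + ennreal (1/2) * (\<integral>\<^sup>+x. \<integral>\<^sup>+y. g (x, y) \<partial>N \<partial>B)"
    using Q unfolding avg_def by blast
  then show "(\<integral>\<^sup>+x. g x \<partial>(Q \<Otimes>\<^sub>M N)) = ennreal (1/2) * (\<integral>\<^sup>+x. g x \<partial>(A \<Otimes>\<^sub>M N)) + ennreal (1/2) * (\<integral>\<^sup>+x. g x \<partial>(B \<Otimes>\<^sub>M N))"
    using N.nn_integral_fst[OF g] N.nn_integral_fst[OF gA(1)] N.nn_integral_fst[OF gA(2)] by simp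
qed

lemma avg_pair_right:
  assumes Q: "avg Q A B" and s: "sigma_finite_measure Q" "sigma_finite_measure A" "sigma_finite_measure B"
  shows "avg (N \<Otimes>\<^sub>M Q) (N \<Otimes>\<^sub>M A) (N \<Otimes>\<^sub>M B)"
  unfolding avg_def
proof (intro conjI ballI)
  interpret Q: sigma_finite_measure Q by fact
  interpret A: sigma_finite_measure A by fact
  interpret B: sigma_finite_measure B by fact
  have sA: "sets A = sets Q" and sB: "sets B = sets Q" using Q by (auto simp: avg_def)
  show "sets (N \<Otimes>\<^sub>M A) = sets (N \<Otimes>\<^sub>M Q)" "sets (N \<Otimes>\<^sub>M B) = sets (N \<Otimes>\<^sub>M Q)"
    using sA sB by (auto intro: sets_pair_measure_cong)
  fix g :: "'b \<times> 'a \<Rightarrow> ennreal" assume g: "g \<in> borel_measurable (N \<Otimes>\<^sub>M Q)"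
  have gA: "g \<in> borel_measurable (N \<Otimes>\<^sub>M A)" "g \<in> borel_measurable (N \<Otimes>\<^sub>M B)"
    using g measurable_cong_sets[OF sets_pair_measure_cong[OF refl sA, of N] refl] measurable_cong_sets[OF sets_pair_measure_cong[OF refl sB, of N] refl] by auto
  have "(\<integral>\<^sup>+x. \<integral>\<^sup>+y. g (x, y) \<partial>Q \<partial>N) = (\<integral>\<^sup>+x. ennreal (1/2) * (\<integral>\<^sup>+y. g (x, y) \<partial>A) + ennreal (1/2) * (\<integral>\<^sup>+y. g (x, y) \<partial>B) \<partial>N)"
  proof (rule nn_integral_cong)
    fix x assume "x \<in> space N"
    then have "(\<lambda>y. g (x, y)) \<in> borel_measurable Q" using g by measurable
    then show "(\<integral>\<^sup>+y. g (x, y) \<partial>Q) = ennreal (1/2) * (\<integral>\<^sup>+y. g (x, y) \<partial>A) + ennreal (1/2) * (\<integral>\<^sup>+y. g (x, y) \<partial>B)"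
      using Q unfolding avg_def by blast
  qed
  also have "\<dots> = ennreal (1/2) * (\<integral>\<^sup>+x. \<integral>\<^sup>+y. g (x, y) \<partial>A \<partial>N) + ennreal (1/2) * (\<integral>\<^sup>+x. \<integral>\<^sup>+y. g (x, y) \<partial>B \<partial>N)"
    using A.borel_measurable_nn_integral_fst[OF gA(1)] B.borel_measurable_nn_integral_fst[OF gA(2)]
    by (simp add: nn_integral_add nn_integral_cmult)
  finally show "(\<integral>\<^sup>+x. g x \<partial>(N \<Otimes>\<^sub>M Q)) = ennreal (1/2) * (\<integral>\<^sup>+x. g x \<partial>(N \<Otimes>\<^sub>M A)) + ennreal (1/2) * (\<integral>\<^sup>+x. g x \<partial>(N \<Otimes>\<^sub>M B))"
    using Q.nn_integral_fst[OF g] A.nn_integral_fst[OF gA(1)] B.nn_integral_fst[OF gA(2)] by simp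
qed

context log_energy_on_interval
begin

lemma bdd_prob_mix: "bdd_prob M \<Longrightarrow> bdd_prob N \<Longrightarrow> bdd_prob (mix M N)"
proof -
  assume MN: "bdd_prob M" "bdd_prob N"
  have a: "avg (mix M N) M N" using MN by (intro avg_mix) (auto simp: bdd_prob_def)
  have "AE x in mix M N. \<bar>x\<bar> \<le> R"
  proof (rule avg_AE[OF a])
    have [simp]: "space (mix M N) = UNIV" by (simp add: mix_def)
    show "{x \<in> space (mix M N). \<not> \<bar>x\<bar> \<le> R} \<in> sets (mix M N)" by simp
  qed (use MN in \<open>auto simp: bdd_prob_def\<close>)
  then show ?thesis using MN by (auto simp: bdd_prob_def prob_space_mix)
qed

lemma finite_energy_avg:
  assumes a: "avg (M \<Otimes>\<^sub>M N) (A \<Otimes>\<^sub>M C) (B \<Otimes>\<^sub>M D)" and s: "sets (M \<Otimes>\<^sub>M N) = sets (borel \<Otimes>\<^sub>M borel)"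
    and g: "finite_energy A C" "finite_energy B D"
  shows "finite_energy M N" "energy M N = (energy A C + energy B D) / 2"
proof -
  have m: "{x \<in> space (M \<Otimes>\<^sub>M N). \<not> fst x \<noteq> snd x} \<in> sets (M \<Otimes>\<^sub>M N)"
  proof -
    have "{x \<in> space (borel \<Otimes>\<^sub>M borel :: (real \<times> real) measure). \<not> fst x \<noteq> snd x} \<in> sets (borel \<Otimes>\<^sub>M borel)" by measurable
    then show ?thesis unfolding s sets_eq_imp_space_eq[OF s] .
  qed
  have "AE p in M \<Otimes>\<^sub>M N. fst p \<noteq> snd p" by (rule avg_AE[OF a m]) (use g in \<open>auto simp: finite_energy_def\<close>)
  moreover have "integrable (M \<Otimes>\<^sub>M N) (\<lambda>p. ln \<bar>fst p - snd p\<bar>)" by (rule avg_integral[OF a]) (use g in \<open>auto simp: finite_energy_def\<close>)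
  ultimately show "finite_energy M N" by (simp add: finite_energy_def)
  show "energy M N = (energy A C + energy B D) / 2" unfolding energy_def
    by (rule avg_integral(2)[OF a]) (use g in \<open>auto simp: finite_energy_def\<close>)
qed

lemma finite_energy_mix_left:
  assumes "bdd_prob A" "bdd_prob B" "bdd_prob N" "finite_energy A N" "finite_energy B N"
  shows "finite_energy (mix A B) N" "energy (mix A B) N = (energy A N + energy B N) / 2"
proof -
  have a: "avg (mix A B) A B" using assms by (intro avg_mix) (auto simp: bdd_prob_def)
  have "sigma_finite_measure N" using assms(3) by (simp add: bdd_prob_def prob_space_imp_sigma_finite)
  from avg_pair_left[OF a this] 
  show "finite_energy (mix A B) N" "energy (mix A B) N = (energy A N + energy B N) / 2"
    using finite_energy_avg pair_facts(2)[OF bdd_prob_mix[OF assms(1,2)] assms(3)] assms(4,5) by blast+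
qed

lemma finite_energy_mix_right:
  assumes "bdd_prob A" "bdd_prob B" "bdd_prob N" "finite_energy N A" "finite_energy N B"
  shows "finite_energy N (mix A B)" "energy N (mix A B) = (energy N A + energy N B) / 2"
proof -
  have a: "avg (mix A B) A B" using assms by (intro avg_mix) (auto simp: bdd_prob_def)
  have "sigma_finite_measure (mix A B)" "sigma_finite_measure A" "sigma_finite_measure B"
    using assms bdd_prob_mix[OF assms(1,2)] by (auto simp: bdd_prob_def prob_space_imp_sigma_finite)
  from avg_pair_right[OF a this] 
  show "finite_energy N (mix A B)" "energy N (mix A B) = (energy N A + energy N B) / 2"
    using finite_energy_avg pair_facts(2)[OF assms(3) bdd_prob_mix[OF assms(1,2)]] assms(4,5) by blast+
qed

lemma finite_energy_mix:
  assumes "bdd_prob A" "bdd_prob B" "finite_energy A A" "finite_energy A B" "finite_energy B A" "finite_energy B B"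
  shows "finite_energy (mix A B) (mix A B)" "energy (mix A B) (mix A B) = (energy A A + energy A B + energy B A + energy B B) / 4"
proof -
  have 1: "finite_energy A (mix A B)" "energy A (mix A B) = (energy A A + energy A B) / 2"
    using finite_energy_mix_right[of A B A] assms by auto
  have 2: "finite_energy B (mix A B)" "energy B (mix A B) = (energy B A + energy B B) / 2"
    using finite_energy_mix_right[of A B B] assms by auto
  show "finite_energy (mix A B) (mix A B)" "energy (mix A B) (mix A B) = (energy A A + energy A B + energy B A + energy B B) / 4"
    using finite_energy_mix_left[of A B "mix A B"] assms 1 2 bdd_prob_mix by (auto simp: field_simps)
qed

lemma finite_energy_distr:
  assumes M: "bdd_prob M" and N: "bdd_prob N"
    and h [measurable]: "h \<in> borel_measurable borel" and k [measurable]: "k \<in> borel_measurable borel"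
  shows "finite_energy (distr M borel h) (distr N borel k) \<longleftrightarrow>
     (AE p in M \<Otimes>\<^sub>M N. h (fst p) \<noteq> k (snd p)) \<and> integrable (M \<Otimes>\<^sub>M N) (\<lambda>p. ln \<bar>h (fst p) - k (snd p)\<bar>)"
   "energy (distr M borel h) (distr N borel k) = (LINT p|(M \<Otimes>\<^sub>M N). - ln \<bar>h (fst p) - k (snd p)\<bar>)"
proof -
  note [measurable_cong] = bdd_probD(2)[OF M] bdd_probD(2)[OF N]
  interpret N: prob_space N using bdd_probD(1)[OF N] .
  have sf: "sigma_finite_measure (distr N borel k)"
    by (intro prob_space_imp_sigma_finite N.prob_space_distr) measurable
  have eq: "distr M borel h \<Otimes>\<^sub>M distr N borel k = distr (M \<Otimes>\<^sub>M N) (borel \<Otimes>\<^sub>M borel) (\<lambda>(x, y). (h x, k y))"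
    by (rule pair_measure_distr[OF _ _ sf]) measurable
  have T: "(\<lambda>(x, y). (h x, k y)) \<in> measurable (M \<Otimes>\<^sub>M N) (borel \<Otimes>\<^sub>M borel)" by measurable
  have "(AE p in distr M borel h \<Otimes>\<^sub>M distr N borel k. fst p \<noteq> snd p) \<longleftrightarrow> (AE p in M \<Otimes>\<^sub>M N. h (fst p) \<noteq> k (snd p))"
    unfolding eq by (subst AE_distr_iff[OF T]) (measurable, simp add: case_prod_beta)
  moreover have "integrable (distr M borel h \<Otimes>\<^sub>M distr N borel k) (\<lambda>p. ln \<bar>fst p - snd p\<bar>) \<longleftrightarrow>
     integrable (M \<Otimes>\<^sub>M N) (\<lambda>p. ln \<bar>h (fst p) - k (snd p)\<bar>)"
    unfolding eq by (subst integrable_distr_eq[OF T]) (measurable, simp add: case_prod_beta)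
  ultimately show "finite_energy (distr M borel h) (distr N borel k) \<longleftrightarrow>
     (AE p in M \<Otimes>\<^sub>M N. h (fst p) \<noteq> k (snd p)) \<and> integrable (M \<Otimes>\<^sub>M N) (\<lambda>p. ln \<bar>h (fst p) - k (snd p)\<bar>)"
    by (simp add: finite_energy_def)
  show "energy (distr M borel h) (distr N borel k) = (LINT p|(M \<Otimes>\<^sub>M N). - ln \<bar>h (fst p) - k (snd p)\<bar>)"
    unfolding energy_def eq by (subst integral_distr[OF T]) (measurable, simp add: case_prod_beta)
qed

lemma bdd_prob_distr:
  assumes M: "bdd_prob M" and h [measurable]: "h \<in> borel_measurable borel" and "AE x in M. \<bar>h x\<bar> \<le> R"
  shows "bdd_prob (distr M borel h)"
proof -
  note [measurable_cong] = bdd_probD(2)[OF M]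
  interpret M: prob_space M using bdd_probD(1)[OF M] .
  have "AE x in distr M borel h. \<bar>x\<bar> \<le> R" using assms(3) by (subst AE_distr_iff) auto
  then show ?thesis unfolding bdd_prob_def by (auto intro!: M.prob_space_distr)
qed

text \<open>The real counterpart of the positive part of \<open>log_kernel\<close>.\<close>

definition energy_kernel :: "real \<times> real \<Rightarrow> ennreal" where
  "energy_kernel p = (if fst p = snd p then \<infinity> else ennreal (- ln \<bar>fst p - snd p\<bar>))"

lemma log_energy_real:
  assumes M: "bdd_prob M"
  shows "log_energy (distr M borel complex_of_real) =
    enn2ereal (\<integral>\<^sup>+p. energy_kernel p \<partial>(M \<Otimes>\<^sub>M M)) - enn2ereal (\<integral>\<^sup>+p. ennreal (ln \<bar>fst p - snd p\<bar>) \<partial>(M \<Otimes>\<^sub>M M))"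
proof -
  note [measurable_cong] = bdd_probD(2)[OF M]
  interpret M: prob_space M using bdd_probD(1)[OF M] .
  define D where "D = distr M borel complex_of_real"
  interpret D: prob_space D unfolding D_def by (intro M.prob_space_distr) measurable
  have sD [measurable_cong]: "sets D = sets borel" by (simp add: D_def)
  have lkm: "(\<lambda>p. log_kernel (fst p) (snd p)) \<in> borel_measurable (borel \<Otimes>\<^sub>M borel)"
    unfolding log_kernel_def by measurable
  have key: "(\<integral>\<^sup>+z. \<integral>\<^sup>+w. G (z, w) \<partial>D \<partial>D) = (\<integral>\<^sup>+p. G (of_real (fst p), of_real (snd p)) \<partial>(M \<Otimes>\<^sub>M M))"
    if G [measurable]: "G \<in> borel_measurable (borel \<Otimes>\<^sub>M borel)" for G :: "complex \<times> complex \<Rightarrow> ennreal"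
  proof -
    have DI: "(\<integral>\<^sup>+z. H z \<partial>D) = (\<integral>\<^sup>+x. H (of_real x) \<partial>M)" if "H \<in> borel_measurable borel" for H :: "complex \<Rightarrow> ennreal"
      unfolding D_def by (rule nn_integral_distr) (use that in measurable)
    have "(\<lambda>z. \<integral>\<^sup>+w. G (z, w) \<partial>D) \<in> borel_measurable borel" by measurable
    then have "(\<integral>\<^sup>+z. \<integral>\<^sup>+w. G (z, w) \<partial>D \<partial>D) = (\<integral>\<^sup>+x. \<integral>\<^sup>+w. G (of_real x, w) \<partial>D \<partial>M)"
      by (rule DI)
    also have "\<dots> = (\<integral>\<^sup>+x. \<integral>\<^sup>+y. G (of_real x, of_real y) \<partial>M \<partial>M)"
      by (intro nn_integral_cong DI) measurable
    also have "\<dots> = (\<integral>\<^sup>+p. G (of_real (fst p), of_real (snd p)) \<partial>(M \<Otimes>\<^sub>M M))"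
      by (subst M.nn_integral_fst[symmetric]) auto
    finally show ?thesis .
  qed
  have k1: "e2ennreal (log_kernel (of_real x) (of_real y)) = energy_kernel (x, y)" for x y
    by (simp add: log_kernel_def energy_kernel_def dist_real_def ln_div ln_inverse dist_of_real)
  have k2: "e2ennreal (- log_kernel (of_real x) (of_real y)) = ennreal (ln \<bar>x - y\<bar>)" for x y
    by (simp add: log_kernel_def dist_real_def ln_div ln_inverse dist_of_real e2ennreal_neg)
  have m1: "(\<lambda>p. e2ennreal (log_kernel (fst p) (snd p))) \<in> borel_measurable (borel \<Otimes>\<^sub>M borel)"
    "(\<lambda>p. e2ennreal (- log_kernel (fst p) (snd p))) \<in> borel_measurable (borel \<Otimes>\<^sub>M borel)"
    using lkm by measurable
  show ?thesis
    unfolding log_energy_def D_def[symmetric] using key[OF m1(1)] key[OF m1(2)] by (simp add: k1 k2)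
qed

lemma pos_part_finite:
  assumes M: "bdd_prob M"
  shows "(\<integral>\<^sup>+p. ennreal (ln \<bar>fst p - snd p\<bar>) \<partial>(M \<Otimes>\<^sub>M M)) < \<infinity>"
proof -
  note pf = pair_facts[OF M M]
  interpret P: prob_space "M \<Otimes>\<^sub>M M" by (rule pf(1))
  have "(\<integral>\<^sup>+p. ennreal (ln \<bar>fst p - snd p\<bar>) \<partial>(M \<Otimes>\<^sub>M M)) \<le> (\<integral>\<^sup>+p. ennreal (2 * R) \<partial>(M \<Otimes>\<^sub>M M))"
  proof (rule nn_integral_mono_AE)
    show "AE p in M \<Otimes>\<^sub>M M. ennreal (ln \<bar>fst p - snd p\<bar>) \<le> ennreal (2 * R)"
      using pf(4)
    proof eventually_elim
      case (elim p)
      have "ln \<bar>fst p - snd p\<bar> \<le> 2 * R"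
      proof (cases "fst p = snd p")
        case False
        then have "ln \<bar>fst p - snd p\<bar> \<le> \<bar>fst p - snd p\<bar>" by (simp add: ln_bound)
        then show ?thesis using elim by linarith
      qed (use R in simp)
      then show ?case by (rule ennreal_leI)
    qed
  qed
  also have "\<dots> = ennreal (2 * R)" by (simp add: P.emeasure_space_1)
  finally show ?thesis using le_less_trans by fastforce
qed

text \<open>
  On a bounded set \<open>ln \<bar>x - y\<bar>\<close> is bounded above, so that a finite energy bounds the negative part of the
  logarithm as well.
\<close>

lemma log_energy_finite_imp:
  assumes M: "bdd_prob M" and fin: "log_energy (distr M borel complex_of_real) < \<infinity>"
  shows "finite_energy M M"
proof -
  note [measurable_cong] = bdd_probD(2)[OF M]
  define p where "p = (\<integral>\<^sup>+p. energy_kernel p \<partial>(M \<Otimes>\<^sub>M M))"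
  define q where "q = (\<integral>\<^sup>+p. ennreal (ln \<bar>fst p - snd p\<bar>) \<partial>(M \<Otimes>\<^sub>M M))"
  have km [measurable]: "energy_kernel \<in> borel_measurable (M \<Otimes>\<^sub>M M)" unfolding energy_kernel_def[abs_def] by measurable
  have q: "q < top" using pos_part_finite[OF M] by (simp add: q_def)
  have "p \<noteq> top"
  proof
    assume "p = top"
    then have "log_energy (distr M borel complex_of_real) = \<infinity>"
      using log_energy_real[OF M] q unfolding p_def[symmetric] q_def[symmetric]
      by (cases q) (auto simp: top_ennreal.rep_eq enn2ereal_ennreal top_ereal_def)
    then show False using fin by simp
  qed
  then have pfin: "(\<integral>\<^sup>+p. energy_kernel p \<partial>(M \<Otimes>\<^sub>M M)) \<noteq> \<infinity>" by (simp add: p_def)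
  have "AE p in M \<Otimes>\<^sub>M M. energy_kernel p \<noteq> \<infinity>" by (rule nn_integral_PInf_AE[OF km pfin])
  then have ne: "AE p in M \<Otimes>\<^sub>M M. fst p \<noteq> snd p" by eventually_elim (auto simp: energy_kernel_def)
  have "(\<integral>\<^sup>+p. ennreal (- ln \<bar>fst p - snd p\<bar>) \<partial>(M \<Otimes>\<^sub>M M)) = (\<integral>\<^sup>+p. energy_kernel p \<partial>(M \<Otimes>\<^sub>M M))"
    by (rule nn_integral_cong_AE) (use ne in \<open>eventually_elim, simp add: energy_kernel_def\<close>)
  then have "integrable (M \<Otimes>\<^sub>M M) (\<lambda>p. ln \<bar>fst p - snd p\<bar>)"
    unfolding real_integrable_def using pfin q by (auto simp: q_def)
  then show ?thesis using ne by (simp add: finite_energy_def)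
qed

lemma log_energy_eq_energy:
  assumes M: "bdd_prob M" and g: "finite_energy M M"
  shows "log_energy (distr M borel complex_of_real) = ereal (energy M M)"
proof -
  note [measurable_cong] = bdd_probD(2)[OF M]
  have ne: "AE p in M \<Otimes>\<^sub>M M. fst p \<noteq> snd p" and i: "integrable (M \<Otimes>\<^sub>M M) (\<lambda>p. ln \<bar>fst p - snd p\<bar>)"
    using g by (auto simp: finite_energy_def)
  have i': "integrable (M \<Otimes>\<^sub>M M) (\<lambda>p. - ln \<bar>fst p - snd p\<bar>)" using i by simp
  have kpe: "(\<integral>\<^sup>+p. energy_kernel p \<partial>(M \<Otimes>\<^sub>M M)) = (\<integral>\<^sup>+p. ennreal (- ln \<bar>fst p - snd p\<bar>) \<partial>(M \<Otimes>\<^sub>M M))"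
    by (rule nn_integral_cong_AE) (use ne in \<open>eventually_elim, simp add: energy_kernel_def\<close>)
  have fin: "(\<integral>\<^sup>+p. ennreal (- ln \<bar>fst p - snd p\<bar>) \<partial>(M \<Otimes>\<^sub>M M)) \<noteq> top" "(\<integral>\<^sup>+p. ennreal (ln \<bar>fst p - snd p\<bar>) \<partial>(M \<Otimes>\<^sub>M M)) \<noteq> top"
    using i by (auto simp: real_integrable_def)
  have conv: "enn2ereal a - enn2ereal b = ereal (enn2real a - enn2real b)" if "a \<noteq> top" "b \<noteq> top" for a b
    using that by (cases a; cases b) (auto simp: enn2ereal_ennreal)
  show ?thesis unfolding log_energy_real[OF M] kpe conv[OF fin] energy_def
    using real_lebesgue_integral_def[OF i'] by simp
qed

end

section \<open>The equilibrium measure is balanced\<close>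

context quadratic_julia
begin

lemma beta_pos: "beta > 0" using beta_gt by simp

sublocale LE: log_energy_on_interval beta
  by standard (rule beta_pos)

text \<open>The measures on the Julia set, transferred to the real line.\<close>

definition admissible :: "real measure \<Rightarrow> bool" where
  "admissible N \<longleftrightarrow> prob_space N \<and> sets N = sets borel \<and> (AE x in N. x \<in> real_julia)"

lemma admissible_bdd: "admissible N \<Longrightarrow> LE.bdd_prob N"
  unfolding admissible_def LE.bdd_prob_def using real_julia_abs by (auto elim!: eventually_mono)

lemma admissible_distr:
  assumes N: "admissible N" and h [measurable]: "h \<in> borel_measurable borel" and hE: "\<And>x. x \<in> real_julia \<Longrightarrow> h x \<in> real_julia"
  shows "admissible (distr N borel h)"
proof -
  interpret N: prob_space N using N by (simp add: admissible_def)
  have [measurable_cong]: "sets N = sets borel" using N by (simp add: admissible_def)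
  have "AE x in N. h x \<in> real_julia" using N hE unfolding admissible_def by (auto elim!: eventually_mono)
  then have "AE x in distr N borel h. x \<in> real_julia" by (subst AE_distr_iff) auto
  then show ?thesis unfolding admissible_def by (auto intro!: N.prob_space_distr)
qed

lemma admissible_mix:
  assumes "admissible M" "admissible N"
  shows "admissible (mix M N)"
proof -
  have a: "avg (mix M N) M N" using assms by (intro avg_mix) (auto simp: admissible_def)
  have [simp]: "space (mix M N) = UNIV" by (simp add: mix_def)
  have "AE x in mix M N. x \<in> real_julia"
    by (rule avg_AE[OF a]) (use assms real_julia_borel in \<open>auto simp: admissible_def Compl_eq[symmetric]\<close>)
  then show ?thesis using assms by (auto simp: admissible_def prob_space_mix)
qed

lemma branch_measurable [measurable]: "branch \<in> borel_measurable borel"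
  unfolding branch_def[abs_def] by measurable

lemma real_quad_measurable [measurable]: "real_quad \<in> borel_measurable borel"
  unfolding real_quad_def[abs_def] by measurable

lemma branch_real_julia: "x \<in> real_julia \<Longrightarrow> branch x \<in> real_julia" "x \<in> real_julia \<Longrightarrow> - branch x \<in> real_julia"
  using real_julia_abs[of x] real_quad_branch[of x] real_julia_quad[of "branch x"] real_julia_quad[of "- branch x"] by (auto simp: abs_le_iff)

text \<open>
  The reflection of \<open>m\<close> at \<open>0\<close> has the same energy as \<open>m\<close>, so positive definiteness bounds the
  mutual energy of the two by it.
\<close>

lemma energy_reflected:
  assumes m: "admissible m" "LE.finite_energy m m"
  shows "AE p in m \<Otimes>\<^sub>M m. fst p + snd p \<noteq> 0" "integrable (m \<Otimes>\<^sub>M m) (\<lambda>p. ln \<bar>fst p + snd p\<bar>)"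
    "- (LINT p|(m \<Otimes>\<^sub>M m). ln \<bar>fst p + snd p\<bar>) \<le> LE.energy m m"
proof -
  note mb = admissible_bdd[OF m(1)]
  have sm: "sets m = sets borel" using m by (simp add: admissible_def)
  have um: "uminus \<in> borel_measurable (borel :: real measure)" by measurable
  define n where "n = distr m borel (uminus :: real \<Rightarrow> real)"
  have nb: "LE.bdd_prob n" unfolding n_def
    by (rule LE.bdd_prob_distr[OF mb um]) (use LE.bdd_probD(4)[OF mb] in simp)
  have flip: "\<bar>- x - - y\<bar> = \<bar>x - y\<bar>" for x y :: real by simp
  have gn: "LE.finite_energy n n" unfolding n_def LE.finite_energy_distr(1)[OF mb mb um um] flip
    using m(2) unfolding LE.finite_energy_def by auto
  have en: "LE.energy n n = LE.energy m m" unfolding n_def LE.finite_energy_distr(2)[OF mb mb um um] flip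
    by (simp add: LE.energy_def)
  have idm: "distr m borel (\<lambda>x. x) = m" using sm by (simp add: distr_id2)
  have idb: "(\<lambda>x::real. x) \<in> borel_measurable borel" by measurable
  have g: "LE.finite_energy m n" "2 / real 0 * (LE.cos_moment 0 m - LE.cos_moment 0 n)\<^sup>2 \<le> LE.energy m m + LE.energy n n - 2 * LE.energy m n"
    using LE.energy_pd[OF mb m(2) nb gn] by blast+
  have "LE.finite_energy (distr m borel (\<lambda>x. x)) n" using g(1) unfolding idm .
  then have g1: "(AE p in m \<Otimes>\<^sub>M m. fst p \<noteq> - snd p) \<and> integrable (m \<Otimes>\<^sub>M m) (\<lambda>p. ln \<bar>fst p - - snd p\<bar>)"
    unfolding n_def LE.finite_energy_distr(1)[OF mb mb idb um] .
  then show i: "integrable (m \<Otimes>\<^sub>M m) (\<lambda>p. ln \<bar>fst p + snd p\<bar>)" by simp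
  show "AE p in m \<Otimes>\<^sub>M m. fst p + snd p \<noteq> 0" using g1[THEN conjunct1] by eventually_elim auto
  have "LE.energy (distr m borel (\<lambda>x. x)) n = (LINT p|(m \<Otimes>\<^sub>M m). - ln \<bar>fst p - - snd p\<bar>)"
    unfolding n_def by (rule LE.finite_energy_distr(2)[OF mb mb idb um])
  then have "LE.energy m n = - (LINT p|(m \<Otimes>\<^sub>M m). ln \<bar>fst p + snd p\<bar>)" unfolding idm by simp
  then show "- (LINT p|(m \<Otimes>\<^sub>M m). ln \<bar>fst p + snd p\<bar>) \<le> LE.energy m m" using g(2) en by simp
qed

text \<open>
  By \<open>T x - T y = (x - y) (x + y)\<close> the energy of the image is the energy of \<open>m\<close> plus the mutual energy of
  \<open>m\<close> and its reflection.
\<close>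

lemma energy_pushforward:
  assumes m: "admissible m" "LE.finite_energy m m"
  shows "LE.finite_energy (distr m borel real_quad) (distr m borel real_quad)" "LE.energy (distr m borel real_quad) (distr m borel real_quad) \<le> 2 * LE.energy m m"
proof -
  note mb = admissible_bdd[OF m(1)] and r = energy_reflected[OF m]
  note [measurable_cong] = LE.bdd_probD(2)[OF mb]
  have ne: "AE p in m \<Otimes>\<^sub>M m. fst p \<noteq> snd p" and i: "integrable (m \<Otimes>\<^sub>M m) (\<lambda>p. ln \<bar>fst p - snd p\<bar>)"
    using m(2) by (auto simp: LE.finite_energy_def)
  have diff: "real_quad x - real_quad y = (x - y) * (x + y)" for x y by (simp add: real_quad_def power2_eq_square algebra_simps)
  have eq: "AE p in m \<Otimes>\<^sub>M m. ln \<bar>real_quad (fst p) - real_quad (snd p)\<bar> = ln \<bar>fst p - snd p\<bar> + ln \<bar>fst p + snd p\<bar>"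
    using ne r(1) by eventually_elim (auto simp: diff abs_mult ln_mult_pos)
  have s: "integrable (m \<Otimes>\<^sub>M m) (\<lambda>p. ln \<bar>fst p - snd p\<bar> + ln \<bar>fst p + snd p\<bar>)" using i r(2) by simp
  have "integrable (m \<Otimes>\<^sub>M m) (\<lambda>p. ln \<bar>real_quad (fst p) - real_quad (snd p)\<bar>)"
    by (subst integrable_cong_AE[OF _ _ eq]) (use s in measurable)
  moreover have "AE p in m \<Otimes>\<^sub>M m. real_quad (fst p) \<noteq> real_quad (snd p)"
    using ne r(1)
  proof eventually_elim
    case (elim p)
    then have "real_quad (fst p) - real_quad (snd p) \<noteq> 0" unfolding diff by simp
    then show ?case by simp
  qed
  ultimately show "LE.finite_energy (distr m borel real_quad) (distr m borel real_quad)"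
    unfolding LE.finite_energy_distr(1)[OF mb mb real_quad_measurable real_quad_measurable] by simp
  have "LE.energy (distr m borel real_quad) (distr m borel real_quad) = - (LINT p|(m \<Otimes>\<^sub>M m). ln \<bar>real_quad (fst p) - real_quad (snd p)\<bar>)"
    unfolding LE.finite_energy_distr(2)[OF mb mb real_quad_measurable real_quad_measurable] by simp
  also have "(LINT p|(m \<Otimes>\<^sub>M m). ln \<bar>real_quad (fst p) - real_quad (snd p)\<bar>) = (LINT p|(m \<Otimes>\<^sub>M m). ln \<bar>fst p - snd p\<bar> + ln \<bar>fst p + snd p\<bar>)"
    by (rule integral_cong_AE[OF _ _ eq]) measurable
  also have "\<dots> = - LE.energy m m + (LINT p|(m \<Otimes>\<^sub>M m). ln \<bar>fst p + snd p\<bar>)" using i r(2) by (simp add: LE.energy_def)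
  finally show "LE.energy (distr m borel real_quad) (distr m borel real_quad) \<le> 2 * LE.energy m m" using r(3) by simp
qed

text \<open>
  The law of \<open>\<epsilon> sqrt (\<lambda> + X)\<close>, where \<open>X\<close> has law \<open>m\<close> and \<open>\<epsilon>\<close> is an independent fair sign.
\<close>

definition pullback :: "real measure \<Rightarrow> real measure" where
  "pullback m = mix (distr m borel branch) (distr m borel (\<lambda>x. - branch x))"

lemma admissible_pullback: "admissible m \<Longrightarrow> admissible (pullback m)"
  unfolding pullback_def by (intro admissible_mix admissible_distr) (auto intro: branch_real_julia)

text \<open>
  With \<open>K = \<integral> ln (branch x + branch y)\<close>, each branch has self-energy \<open>I + K\<close>, where \<open>I\<close> is the energy of
  \<open>m\<close>, because of \<open>x - y = (branch x - branch y) (branch x + branch y)\<close>; the mutual energy of opposite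
  branches is \<open>- K\<close>.  In the average over the four pairs \<open>K\<close> cancels.
\<close>

lemma energy_pullback:
  assumes m: "admissible m" "LE.finite_energy m m"
  shows "LE.finite_energy (pullback m) (pullback m)" "LE.energy (pullback m) (pullback m) = LE.energy m m / 2"
proof -
  note mb = admissible_bdd[OF m(1)]
  note [measurable_cong] = LE.bdd_probD(2)[OF mb]
  interpret P: prob_space "m \<Otimes>\<^sub>M m" by (rule LE.pair_facts(1)[OF mb mb])
  have ne: "AE p in m \<Otimes>\<^sub>M m. fst p \<noteq> snd p" and i: "integrable (m \<Otimes>\<^sub>M m) (\<lambda>p. ln \<bar>fst p - snd p\<bar>)"
    using m(2) by (auto simp: LE.finite_energy_def)
  note rng = LE.pair_facts(4)[OF mb mb]
  have b: "4/5 \<le> branch x" "branch x \<le> beta" if "\<bar>x\<bar> \<le> beta" for x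
    using that branch_ge[of x] branch_le[of x] by (auto simp: abs_le_iff)
  define l where "l p = ln (branch (fst p) + branch (snd p))" for p :: "real \<times> real"
  have lm [measurable]: "l \<in> borel_measurable (m \<Otimes>\<^sub>M m)" unfolding l_def by measurable
  have li: "integrable (m \<Otimes>\<^sub>M m) l"
  proof (rule P.integrable_const_bound[where B = "2 * beta"])
    show "AE p in m \<Otimes>\<^sub>M m. norm (l p) \<le> 2 * beta" using rng
    proof eventually_elim
      case (elim p)
      have "1 \<le> branch (fst p) + branch (snd p)" "branch (fst p) + branch (snd p) \<le> 2 * beta"
        using b[of "fst p"] b[of "snd p"] elim by auto
      then have "0 \<le> l p" "l p \<le> 2 * beta" unfolding l_def
        using ln_bound[of "branch (fst p) + branch (snd p)"] by auto
      then show ?case by simp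
    qed
  qed measurable
  define K where "K = (LINT p|(m \<Otimes>\<^sub>M m). l p)"
  have diff: "x - y = (branch x - branch y) * (branch x + branch y)" if "\<bar>x\<bar> \<le> beta" "\<bar>y\<bar> \<le> beta" for x y
  proof -
    have "(branch x)\<^sup>2 = lam + x" "(branch y)\<^sup>2 = lam + y" using that gap unfolding branch_def by (auto simp: abs_le_iff)
    then show ?thesis by (simp add: power2_eq_square algebra_simps)
  qed
  have nb: "AE p in m \<Otimes>\<^sub>M m. branch (fst p) \<noteq> branch (snd p)"
    using ne rng by eventually_elim (use diff in fastforce)
  have eq: "AE p in m \<Otimes>\<^sub>M m. ln \<bar>branch (fst p) - branch (snd p)\<bar> = ln \<bar>fst p - snd p\<bar> - l p"
    using nb rng
  proof eventually_elim
    case (elim p)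
    have "1 \<le> branch (fst p) + branch (snd p)" using b[of "fst p"] b[of "snd p"] elim by auto
    then have "ln \<bar>fst p - snd p\<bar> = ln \<bar>branch (fst p) - branch (snd p)\<bar> + l p"
      unfolding l_def using diff[of "fst p" "snd p"] elim by (simp add: abs_mult ln_mult_pos)
    then show ?case by simp
  qed
  have s: "integrable (m \<Otimes>\<^sub>M m) (\<lambda>p. ln \<bar>fst p - snd p\<bar> - l p)" using i li by simp
  have bi: "integrable (m \<Otimes>\<^sub>M m) (\<lambda>p. ln \<bar>branch (fst p) - branch (snd p)\<bar>)"
    by (subst integrable_cong_AE[OF _ _ eq]) (use s in measurable)
  have bI: "(LINT p|(m \<Otimes>\<^sub>M m). ln \<bar>branch (fst p) - branch (snd p)\<bar>) = - LE.energy m m - K"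
  proof -
    have "(LINT p|(m \<Otimes>\<^sub>M m). ln \<bar>branch (fst p) - branch (snd p)\<bar>) = (LINT p|(m \<Otimes>\<^sub>M m). ln \<bar>fst p - snd p\<bar> - l p)"
      by (rule integral_cong_AE[OF _ _ eq]) measurable
    then show ?thesis using i li by (simp add: LE.energy_def K_def)
  qed
  define A where "A = distr m borel branch"
  define B where "B = distr m borel (\<lambda>x. - branch x)"
  have mA: "branch \<in> borel_measurable borel" and mB: "(\<lambda>x. - branch x) \<in> borel_measurable borel" by measurable
  have AB: "LE.bdd_prob A" "LE.bdd_prob B" unfolding A_def B_def
    by (intro admissible_bdd admissible_distr m; auto intro: branch_real_julia)+
  have neg: "\<bar>- x - - y\<bar> = \<bar>x - y\<bar>" "\<bar>x - - y\<bar> = \<bar>x + y\<bar>" "\<bar>- x - y\<bar> = \<bar>x + y\<bar>" for x y :: real by auto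
  have pe: "AE p in m \<Otimes>\<^sub>M m. ln \<bar>branch (fst p) + branch (snd p)\<bar> = l p"
    using rng
  proof eventually_elim
    case (elim p)
    have "1 \<le> branch (fst p) + branch (snd p)" using b[of "fst p"] b[of "snd p"] elim by auto
    then show ?case by (simp add: l_def)
  qed
  have pi': "integrable (m \<Otimes>\<^sub>M m) (\<lambda>p. ln \<bar>branch (fst p) + branch (snd p)\<bar>)"
    by (subst integrable_cong_AE[OF _ _ pe]) (use li in measurable)
  have pI: "(LINT p|(m \<Otimes>\<^sub>M m). ln \<bar>branch (fst p) + branch (snd p)\<bar>) = K"
    unfolding K_def by (rule integral_cong_AE[OF _ _ pe]) measurable
  have pne: "AE p in m \<Otimes>\<^sub>M m. branch (fst p) \<noteq> - branch (snd p)" "AE p in m \<Otimes>\<^sub>M m. - branch (fst p) \<noteq> branch (snd p)"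
  proof -
    have "AE p in m \<Otimes>\<^sub>M m. 0 < branch (fst p) + branch (snd p)" using rng
    proof eventually_elim
      case (elim p)
      then show ?case using b[of "fst p"] b[of "snd p"] by auto
    qed
    then show "AE p in m \<Otimes>\<^sub>M m. branch (fst p) \<noteq> - branch (snd p)" "AE p in m \<Otimes>\<^sub>M m. - branch (fst p) \<noteq> branch (snd p)"
      by (eventually_elim, simp)+
  qed
  have gAA: "LE.finite_energy A A" "LE.energy A A = LE.energy m m + K"
    unfolding A_def LE.finite_energy_distr[OF mb mb mA mA] using nb bi bI by auto
  have gBB: "LE.finite_energy B B" "LE.energy B B = LE.energy m m + K"
    unfolding B_def LE.finite_energy_distr[OF mb mb mB mB] neg(1) using nb bi bI by auto
  have gAB: "LE.finite_energy A B" "LE.energy A B = - K"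
    unfolding A_def B_def LE.finite_energy_distr[OF mb mb mA mB] neg using pne pi' pI by auto
  have gBA: "LE.finite_energy B A" "LE.energy B A = - K"
    unfolding A_def B_def LE.finite_energy_distr[OF mb mb mB mA] neg using pne pi' pI by auto
  show "LE.finite_energy (pullback m) (pullback m)" "LE.energy (pullback m) (pullback m) = LE.energy m m / 2"
    unfolding pullback_def A_def[symmetric] B_def[symmetric]
    using LE.finite_energy_mix[OF AB gAA(1) gAB(1) gBA(1) gBB(1)] gAA(2) gAB(2) gBA(2) gBB(2) by auto
qed

text \<open>
  Comparing \<open>m\<close> with its pullback and its image gives \<open>I \<le> I / 2\<close> and \<open>I \<le> 2 I\<close>, so that
  \<open>m\<close> and its pullback both have energy \<open>0\<close>.  Comparing \<open>m\<close> with the average of the two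
  shows that their mutual energy is not negative, and positive definiteness then leaves no room for different cosine
  moments.
\<close>

lemma equilibrium_balanced:
  assumes m: "admissible m" "LE.finite_energy m m"
    and min: "\<And>N. admissible N \<Longrightarrow> LE.finite_energy N N \<Longrightarrow> LE.energy m m \<le> LE.energy N N"
  shows "(LINT x|m. x ^ k) = (LINT x|pullback m. x ^ k)"
proof -
  note mb = admissible_bdd[OF m(1)]
  define \<nu> where "\<nu> = pullback m"
  have an: "admissible \<nu>" using admissible_pullback[OF m(1)] by (simp add: \<nu>_def)
  note nb = admissible_bdd[OF an]
  have gn: "LE.finite_energy \<nu> \<nu>" "LE.energy \<nu> \<nu> = LE.energy m m / 2" using energy_pullback[OF m] by (auto simp: \<nu>_def)
  have "LE.energy m m \<le> LE.energy m m / 2" using min[OF an gn(1)] gn(2) by simp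
  moreover have "LE.energy m m \<le> 2 * LE.energy m m"
    using min[OF admissible_distr[OF m(1) real_quad_measurable] energy_pushforward(1)[OF m]] energy_pushforward(2)[OF m]
    by (simp add: real_julia_quad)
  ultimately have e0: "LE.energy m m = 0" "LE.energy \<nu> \<nu> = 0" using gn(2) by auto
  have g1: "LE.finite_energy m \<nu>" and p1: "\<And>n. 2 / real n * (LE.cos_moment n m - LE.cos_moment n \<nu>)\<^sup>2 \<le> - 2 * LE.energy m \<nu>"
    using LE.energy_pd[OF mb m(2) nb gn(1)] e0 by auto
  have g2: "LE.finite_energy \<nu> m" and p2: "\<And>n. 2 / real n * (LE.cos_moment n \<nu> - LE.cos_moment n m)\<^sup>2 \<le> - 2 * LE.energy \<nu> m"
    using LE.energy_pd[OF nb gn(1) mb m(2)] e0 by auto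
  have "LE.energy m m \<le> LE.energy (mix m \<nu>) (mix m \<nu>)"
    using LE.finite_energy_mix(1)[OF mb nb m(2) g1 g2 gn(1)] by (intro min admissible_mix m an)
  then have s: "0 \<le> LE.energy m \<nu> + LE.energy \<nu> m" using LE.finite_energy_mix(2)[OF mb nb m(2) g1 g2 gn(1)] e0 by simp
  have "LE.cos_moment n m = LE.cos_moment n \<nu>" if "n \<ge> 1" for n
  proof -
    have "2 / real n * (LE.cos_moment n m - LE.cos_moment n \<nu>)\<^sup>2 + 2 / real n * (LE.cos_moment n m - LE.cos_moment n \<nu>)\<^sup>2 \<le> 0"
      using p1[of n] p2[of n] s by (simp add: power2_commute)
    then show ?thesis using that by (simp add: mult_le_0_iff divide_le_0_iff)
  qed
  then show ?thesis unfolding \<nu>_def[symmetric] by (rule LE.moments_eq[OF mb nb])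
qed

lemma integral_pullback:
  assumes m: "admissible m"
  shows "(LINT x|pullback m. x ^ k) = ((LINT x|m. branch x ^ k) + (LINT x|m. (- branch x) ^ k)) / 2"
proof -
  define A where "A = distr m borel branch"
  define B where "B = distr m borel (\<lambda>x. - branch x)"
  have [measurable_cong]: "sets m = sets borel" using m by (simp add: admissible_def)
  have ad: "admissible A" "admissible B" unfolding A_def B_def
    by (intro admissible_distr m; auto intro: branch_real_julia)+
  have i: "integrable N (\<lambda>x. x ^ k)" if "admissible N" for N
  proof -
    interpret N: prob_space N using that by (simp add: admissible_def)
    have [measurable_cong]: "sets N = sets borel" using that by (simp add: admissible_def)
    have "AE x in N. x \<in> real_julia" using that by (simp add: admissible_def)
    then have "AE x in N. norm (x ^ k) \<le> beta ^ k"
      by eventually_elim (auto simp: power_abs intro!: power_mono real_julia_abs)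
    then show ?thesis by (rule N.integrable_const_bound) measurable
  qed
  have a: "avg (mix A B) A B" using ad by (intro avg_mix) (auto simp: admissible_def)
  have "(LINT x|pullback m. x ^ k) = ((LINT x|A. x ^ k) + (LINT x|B. x ^ k)) / 2"
    unfolding pullback_def A_def[symmetric] B_def[symmetric] using a i[OF ad(1)] i[OF ad(2)] by (rule avg_integral(2))
  moreover have "(LINT x|A. x ^ k) = (LINT x|m. branch x ^ k)" unfolding A_def by (rule integral_distr) measurable
  moreover have "(LINT x|B. x ^ k) = (LINT x|m. (- branch x) ^ k)" unfolding B_def by (rule integral_distr) measurable
  ultimately show ?thesis by simp
qed

theorem equilibrium_moments:
  assumes eq: "equilibrium_measure (julia_set lam) \<mu>"
  defines "m \<equiv> distr \<mu> borel Re"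
  shows "admissible m" "\<mu> = distr m borel complex_of_real"
    "(LINT x|m. x ^ (2 * j + 1)) = 0" "(LINT x|m. x ^ (2 * j)) = (LINT x|m. (x + lam) ^ j)"
proof -
  have pm: "\<mu> \<in> prob_measures_on (julia_set lam)" using eq by (simp add: equilibrium_measure_def)
  interpret mu: prob_space \<mu> using pm by (simp add: prob_measures_on_def)
  have smu [measurable_cong]: "sets \<mu> = sets borel" using pm by (simp add: prob_measures_on_def)
  have AEj: "AE z in \<mu>. z \<in> julia_set lam" using pm by (simp add: prob_measures_on_def)
  have "AE z in \<mu>. Re z \<in> real_julia" using AEj by eventually_elim (simp add: julia_eq_real_julia)
  then have "AE x in m. x \<in> real_julia" unfolding m_def by (subst AE_distr_iff) auto
  then show ad: "admissible m" unfolding admissible_def m_def by (auto intro!: mu.prob_space_distr)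
  have "distr m borel complex_of_real = distr \<mu> borel (\<lambda>z. complex_of_real (Re z))"
    unfolding m_def by (subst distr_distr) (auto simp: comp_def)
  also have "\<dots> = distr \<mu> borel (\<lambda>z. z)"
  proof (rule distr_cong_AE)
    show "AE z in \<mu>. complex_of_real (Re z) = z" using AEj
      by eventually_elim (simp add: julia_eq_real_julia complex_eq_iff)
  qed auto
  also have "\<dots> = \<mu>" using smu by (simp add: distr_id2)
  finally show mu_eq: "\<mu> = distr m borel complex_of_real" ..
  note mb = admissible_bdd[OF ad]
  have fin: "log_energy (distr m borel complex_of_real) < \<infinity>" using eq mu_eq by (simp add: equilibrium_measure_def)
  have g: "LE.finite_energy m m" by (rule LE.log_energy_finite_imp[OF mb fin])
  have min: "LE.energy m m \<le> LE.energy N N" if N: "admissible N" "LE.finite_energy N N" for N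
  proof -
    interpret N: prob_space N using N by (simp add: admissible_def)
    have [measurable_cong]: "sets N = sets borel" using N by (simp add: admissible_def)
    have jb: "julia_set lam \<in> sets borel"
    proof -
      have "julia_set lam = {z. Im z = 0} \<inter> Re -` real_julia" using julia_eq_real_julia by auto
      moreover have "closed ({z. Im z = 0} \<inter> Re -` real_julia)"
        by (intro closed_Int closed_Collect_eq continuous_intros closed_vimage closed_real_julia)
      ultimately show ?thesis by simp
    qed
    have "AE x in N. x \<in> real_julia" using N by (simp add: admissible_def)
    then have "AE x in N. complex_of_real x \<in> julia_set lam" by eventually_elim (simp add: real_julia_def)
    then have "AE z in distr N borel complex_of_real. z \<in> julia_set lam" using jb by (subst AE_distr_iff) auto
    then have "distr N borel complex_of_real \<in> prob_measures_on (julia_set lam)"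
      unfolding prob_measures_on_def by (auto intro!: N.prob_space_distr)
    then have "log_energy \<mu> \<le> log_energy (distr N borel complex_of_real)" using eq by (simp add: equilibrium_measure_def)
    then have "log_energy (distr m borel complex_of_real) \<le> log_energy (distr N borel complex_of_real)"
      unfolding mu_eq[symmetric] .
    then show ?thesis unfolding LE.log_energy_eq_energy[OF mb g] LE.log_energy_eq_energy[OF admissible_bdd[OF N(1)] N(2)] by simp
  qed
  have mom: "(LINT x|m. x ^ k) = ((LINT x|m. branch x ^ k) + (LINT x|m. (- branch x) ^ k)) / 2" for k
    using equilibrium_balanced[OF ad g min] integral_pullback[OF ad] by simp
  show "(LINT x|m. x ^ (2 * j + 1)) = 0" unfolding mom[of "2 * j + 1"] by (simp add: power_minus_odd)
  have [measurable_cong]: "sets m = sets borel" by (simp add: m_def)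
  have "(LINT x|m. x ^ (2 * j)) = (LINT x|m. branch x ^ (2 * j))"
    using mom[of "2 * j"] by (simp add: power_minus_even)
  also have "\<dots> = (LINT x|m. (x + lam) ^ j)"
  proof (rule integral_cong_AE)
    have "AE x in m. x \<in> real_julia" using ad by (simp add: admissible_def)
    then show "AE x in m. branch x ^ (2 * j) = (x + lam) ^ j"
    proof eventually_elim
      case (elim x)
      then have "(branch x)\<^sup>2 = x + lam" using real_julia_abs[of x] gap unfolding branch_def by (auto simp: abs_le_iff)
      then show ?case by (simp add: power_mult)
    qed
  qed measurable
  finally show "(LINT x|m. x ^ (2 * j)) = (LINT x|m. (x + lam) ^ j)" .
qed

end

section \<open>Square-summable sequences\<close>

definition norm_sq :: "(int \<Rightarrow> complex) \<Rightarrow> real" where "norm_sq f = (\<Sum>\<^sub>\<infinity>n. (cmod (f n))\<^sup>2)"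

lemma ell2_norm_norm_sq: "ell2_norm f = sqrt (norm_sq f)" by (simp add: ell2_norm_def norm_sq_def)

lemma ell2I_bounded:
  assumes "\<And>F. finite F \<Longrightarrow> (\<Sum>n\<in>F. (cmod (f n))\<^sup>2) \<le> B"
  shows "f \<in> ell2" "norm_sq f \<le> B"
proof -
  show f: "f \<in> ell2" unfolding ell2_def mem_Collect_eq
    by (rule nonneg_bdd_above_summable_on) (use assms in \<open>auto intro!: bdd_aboveI2[where M = B]\<close>)
  show "norm_sq f \<le> B" unfolding norm_sq_def
    by (rule infsum_le_finite_sums) (use f assms in \<open>auto simp: ell2_def\<close>)
qed

lemma sum_le_norm_sq: "f \<in> ell2 \<Longrightarrow> finite F \<Longrightarrow> (\<Sum>n\<in>F. (cmod (f n))\<^sup>2) \<le> norm_sq f"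
  unfolding norm_sq_def ell2_def by (intro finite_sum_le_infsum) auto

lemma norm_sq_nonneg: "0 \<le> norm_sq f" by (simp add: norm_sq_def infsum_nonneg)

lemma coord_le_norm_sq: "f \<in> ell2 \<Longrightarrow> (cmod (f n))\<^sup>2 \<le> norm_sq f"
  using sum_le_norm_sq[of f "{n}"] by simp

lemma norm_sq_sum_bound:
  fixes a b :: complex
  shows "(cmod (a + b))\<^sup>2 \<le> 2 * (cmod a)\<^sup>2 + 2 * (cmod b)\<^sup>2"
proof -
  have "(cmod (a + b))\<^sup>2 \<le> (cmod a + cmod b)\<^sup>2" by (intro power_mono norm_triangle_ineq) auto
  moreover have "0 \<le> (cmod a - cmod b)\<^sup>2" by simp
  ultimately show ?thesis unfolding power2_sum power2_diff by linarith
qed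

lemma ell2_add:
  assumes "f \<in> ell2" "g \<in> ell2"
  shows "(\<lambda>n. f n + g n) \<in> ell2" "norm_sq (\<lambda>n. f n + g n) \<le> 2 * norm_sq f + 2 * norm_sq g"
proof -
  have "(\<Sum>n\<in>F. (cmod (f n + g n))\<^sup>2) \<le> 2 * norm_sq f + 2 * norm_sq g" if "finite F" for F
  proof -
    have "(\<Sum>n\<in>F. (cmod (f n + g n))\<^sup>2) \<le> (\<Sum>n\<in>F. 2 * (cmod (f n))\<^sup>2 + 2 * (cmod (g n))\<^sup>2)"
      by (intro sum_mono norm_sq_sum_bound)
    also have "\<dots> = 2 * (\<Sum>n\<in>F. (cmod (f n))\<^sup>2) + 2 * (\<Sum>n\<in>F. (cmod (g n))\<^sup>2)"
      by (simp add: sum.distrib sum_distrib_left)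
    finally show ?thesis using sum_le_norm_sq[OF assms(1) that] sum_le_norm_sq[OF assms(2) that] by linarith
  qed
  note b = this
  show "(\<lambda>n. f n + g n) \<in> ell2" by (rule ell2I_bounded(1)[OF b])
  show "norm_sq (\<lambda>n. f n + g n) \<le> 2 * norm_sq f + 2 * norm_sq g" by (rule ell2I_bounded(2)[OF b])
qed

lemma ell2_scale:
  assumes "f \<in> ell2"
  shows "(\<lambda>n. c * f n) \<in> ell2" "norm_sq (\<lambda>n. c * f n) \<le> (cmod c)\<^sup>2 * norm_sq f"
proof -
  have "(\<Sum>n\<in>F. (cmod (c * f n))\<^sup>2) \<le> (cmod c)\<^sup>2 * norm_sq f" if "finite F" for F
  proof -
    have "(\<Sum>n\<in>F. (cmod (c * f n))\<^sup>2) = (cmod c)\<^sup>2 * (\<Sum>n\<in>F. (cmod (f n))\<^sup>2)"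
      by (simp add: norm_mult power_mult_distrib sum_distrib_left)
    then show ?thesis using sum_le_norm_sq[OF assms that] by (simp add: mult_left_mono)
  qed
  note b = this
  show "(\<lambda>n. c * f n) \<in> ell2" by (rule ell2I_bounded(1)[OF b])
  show "norm_sq (\<lambda>n. c * f n) \<le> (cmod c)\<^sup>2 * norm_sq f" by (rule ell2I_bounded(2)[OF b])
qed

lemma ell2_diff:
  assumes "f \<in> ell2" "g \<in> ell2"
  shows "(\<lambda>n. f n - g n) \<in> ell2"
  using ell2_add(1)[OF assms(1) ell2_scale(1)[OF assms(2), of "-1"]] by simp

lemma ell2_inner_abs_summable:
  assumes "f \<in> ell2" "g \<in> ell2"
  shows "(\<lambda>n. cmod (f n * cnj (g n))) summable_on UNIV" "(\<Sum>\<^sub>\<infinity>n. cmod (f n * cnj (g n))) \<le> sqrt (norm_sq f) * sqrt (norm_sq g)"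
proof -
  have b: "(\<Sum>n\<in>F. cmod (f n * cnj (g n))) \<le> sqrt (norm_sq f) * sqrt (norm_sq g)" if "finite F" for F
  proof -
    have "(\<Sum>n\<in>F. cmod (f n * cnj (g n))) = (\<Sum>n\<in>F. \<bar>cmod (f n)\<bar> * \<bar>cmod (g n)\<bar>)" by (simp add: norm_mult)
    also have "\<dots> \<le> L2_set (\<lambda>n. cmod (f n)) F * L2_set (\<lambda>n. cmod (g n)) F" by (rule L2_set_mult_ineq)
    also have "\<dots> \<le> sqrt (norm_sq f) * sqrt (norm_sq g)"
      unfolding L2_set_def using assms that by (intro mult_mono real_sqrt_le_mono sum_le_norm_sq) (auto simp: norm_sq_nonneg sum_nonneg)
    finally show ?thesis .
  qed
  show s: "(\<lambda>n. cmod (f n * cnj (g n))) summable_on UNIV"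
    by (rule nonneg_bdd_above_summable_on) (use b in \<open>auto intro!: bdd_aboveI2[where M = "sqrt (norm_sq f) * sqrt (norm_sq g)"]\<close>)
  show "(\<Sum>\<^sub>\<infinity>n. cmod (f n * cnj (g n))) \<le> sqrt (norm_sq f) * sqrt (norm_sq g)"
    by (rule infsum_le_finite_sums[OF s b])
qed

lemma ell2_inner_summable: "f \<in> ell2 \<Longrightarrow> g \<in> ell2 \<Longrightarrow> (\<lambda>n. f n * cnj (g n)) summable_on UNIV"
  by (rule Infinite_Sum.abs_summable_summable[OF ell2_inner_abs_summable(1)])

lemma ell2_inner_bound:
  assumes "f \<in> ell2" "g \<in> ell2"
  shows "cmod (ell2_inner f g) \<le> sqrt (norm_sq f) * sqrt (norm_sq g)"
  unfolding ell2_inner_def using norm_infsum_bound[OF ell2_inner_abs_summable(1)[OF assms]] ell2_inner_abs_summable(2)[OF assms] by linarith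

lemma ell2_inner_add_left:
  assumes "f \<in> ell2" "g \<in> ell2" "h \<in> ell2"
  shows "ell2_inner (\<lambda>n. f n + g n) h = ell2_inner f h + ell2_inner g h"
  unfolding ell2_inner_def using ell2_inner_summable assms by (simp add: distrib_right infsum_add)

lemma ell2_inner_add_right:
  assumes "f \<in> ell2" "g \<in> ell2" "h \<in> ell2"
  shows "ell2_inner h (\<lambda>n. f n + g n) = ell2_inner h f + ell2_inner h g"
  unfolding ell2_inner_def using ell2_inner_summable assms by (simp add: distrib_left infsum_add)

lemma ell2_inner_scale_left: "ell2_inner (\<lambda>n. c * f n) h = c * ell2_inner f h"
  unfolding ell2_inner_def by (simp add: mult.assoc infsum_cmult_right')

lemma ell2_inner_scale_right: "ell2_inner h (\<lambda>n. c * f n) = cnj c * ell2_inner h f"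
  unfolding ell2_inner_def by (simp add: mult.left_commute infsum_cmult_right')

lemma ell2_inner_self: "f \<in> ell2 \<Longrightarrow> ell2_inner f f = of_real (norm_sq f)"
proof -
  assume f: "f \<in> ell2"
  have "ell2_inner f f = (\<Sum>\<^sub>\<infinity>n. of_real ((cmod (f n))\<^sup>2))"
    unfolding ell2_inner_def by (intro infsum_cong) (rule complex_norm_square[symmetric])
  also have "\<dots> = of_real (norm_sq f)" unfolding norm_sq_def
    by (rule infsumI, rule has_sum_of_real) (use f in \<open>simp add: ell2_def\<close>)
  finally show ?thesis .
qed

definition trunc :: "nat \<Rightarrow> (int \<Rightarrow> complex) \<Rightarrow> int \<Rightarrow> complex" where
  "trunc N f n = (if \<bar>n\<bar> \<le> int N then f n else 0)"

lemma trunc_ell2: "f \<in> ell2 \<Longrightarrow> trunc N f \<in> ell2" "f \<in> ell2 \<Longrightarrow> norm_sq (trunc N f) \<le> norm_sq f"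
proof -
  assume f: "f \<in> ell2"
  have "(\<Sum>n\<in>F. (cmod (trunc N f n))\<^sup>2) \<le> norm_sq f" if "finite F" for F
  proof -
    have "(\<Sum>n\<in>F. (cmod (trunc N f n))\<^sup>2) \<le> (\<Sum>n\<in>F. (cmod (f n))\<^sup>2)"
      by (intro sum_mono) (simp add: trunc_def)
    then show ?thesis using sum_le_norm_sq[OF f that] by linarith
  qed
  note b = this
  show "trunc N f \<in> ell2" by (rule ell2I_bounded(1)[OF b])
  show "norm_sq (trunc N f) \<le> norm_sq f" by (rule ell2I_bounded(2)[OF b])
qed

lemma trunc_tendsto:
  assumes f: "f \<in> ell2"
  shows "(\<lambda>N. norm_sq (\<lambda>n. f n - trunc N f n)) \<longlonglongrightarrow> 0"
proof (rule LIMSEQ_I)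
  fix e :: real assume e: "e > 0"
  then have e2: "e / 2 > 0" by simp
  have hs: "((\<lambda>n. (cmod (f n))\<^sup>2) has_sum norm_sq f) UNIV" unfolding norm_sq_def using f by (simp add: ell2_def)
  obtain B where B: "finite B" "dist (\<Sum>n\<in>B. (cmod (f n))\<^sup>2) (norm_sq f) \<le> e / 2"
    using has_sum_finite_approximation[OF hs e2] by blast
  define N0 where "N0 = nat (\<Sum>b\<in>B. \<bar>b\<bar>)"
  have "norm_sq (\<lambda>n. f n - trunc N f n) \<le> e / 2" if N: "N \<ge> N0" for N
  proof (rule ell2I_bounded(2))
    fix F :: "int set" assume F: "finite F"
    have inB: "\<bar>b\<bar> \<le> int N" if "b \<in> B" for b
    proof -
      have "\<bar>b\<bar> \<le> (\<Sum>b\<in>B. \<bar>b\<bar>)" using B(1) that by (intro member_le_sum) auto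
      then show ?thesis using N unfolding N0_def by linarith
    qed
    have "(\<Sum>n\<in>F. (cmod (f n - trunc N f n))\<^sup>2) = (\<Sum>n\<in>F - B. (cmod (f n - trunc N f n))\<^sup>2)"
      using F inB by (intro sum.mono_neutral_right) (auto simp: trunc_def)
    also have "\<dots> \<le> (\<Sum>n\<in>F - B. (cmod (f n))\<^sup>2)" by (intro sum_mono) (simp add: trunc_def)
    finally have "(\<Sum>n\<in>F. (cmod (f n - trunc N f n))\<^sup>2) \<le> (\<Sum>n\<in>F - B. (cmod (f n))\<^sup>2)" .
    moreover have "(\<Sum>n\<in>F - B. (cmod (f n))\<^sup>2) + (\<Sum>n\<in>B. (cmod (f n))\<^sup>2) = (\<Sum>n\<in>(F - B) \<union> B. (cmod (f n))\<^sup>2)"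
      using F B(1) by (intro sum.union_disjoint[symmetric]) auto
    moreover have "(\<Sum>n\<in>(F - B) \<union> B. (cmod (f n))\<^sup>2) \<le> norm_sq f" using f F B(1) by (intro sum_le_norm_sq) auto
    ultimately show "(\<Sum>n\<in>F. (cmod (f n - trunc N f n))\<^sup>2) \<le> e / 2" using B(2) unfolding dist_real_def by linarith
  qed
  then have "norm_sq (\<lambda>n. f n - trunc N f n) < e" if "N \<ge> N0" for N using e that by fastforce
  then show "\<exists>no. \<forall>n\<ge>no. norm (norm_sq (\<lambda>na. f na - trunc n f na) - 0) < e"
    by (intro exI[of _ N0]) (simp add: norm_sq_nonneg)
qed

section \<open>Bounded Jacobi operators\<close>

definition jac :: "(int \<Rightarrow> real) \<Rightarrow> ell2_operator" where
  "jac c f = (\<lambda>n. of_real (c (n + 1)) * f (n + 1) + of_real (c n) * f (n - 1))"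

lemma jacobi_operator_jac: "jacobi_operator \<alpha> \<kappa> = jac (\<lambda>n. \<alpha> (\<kappa> + of_int n))"
  by (intro ext) (simp add: jacobi_operator_def jac_def)

lemma bij_shift: "bij (\<lambda>n::int. n + 1)"
  by (rule bij_betwI[of _ _ _ "\<lambda>n. n - 1"]) auto

lemma infsum_shift: "(\<Sum>\<^sub>\<infinity>n::int. F (n + 1)) = (\<Sum>\<^sub>\<infinity>n. F n)" for F :: "int \<Rightarrow> complex"
  by (rule infsum_reindex_bij_betw[OF bij_shift])

lemma summable_shift: "(\<lambda>n::int. F (n + 1)) summable_on UNIV \<longleftrightarrow> F summable_on UNIV" for F :: "int \<Rightarrow> complex"
  by (rule summable_on_reindex_bij_betw[OF bij_shift])

locale bounded_jacobi =
  fixes c :: "int \<Rightarrow> real" and K :: real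
  assumes c_bound: "\<And>n. \<bar>c n\<bar> \<le> K"
begin

lemma K_nonneg: "0 \<le> K" using c_bound[of 0] by linarith

lemma jac_bound: "(cmod (jac c f n))\<^sup>2 \<le> 2 * K\<^sup>2 * ((cmod (f (n + 1)))\<^sup>2 + (cmod (f (n - 1)))\<^sup>2)"
proof -
  have k: "(c n)\<^sup>2 \<le> K\<^sup>2" for n using c_bound[of n] K_nonneg by (simp add: abs_le_square_iff[symmetric])
  have "(cmod (jac c f n))\<^sup>2 \<le> 2 * (cmod (of_real (c (n + 1)) * f (n + 1)))\<^sup>2 + 2 * (cmod (of_real (c n) * f (n - 1)))\<^sup>2"
    unfolding jac_def by (rule norm_sq_sum_bound)
  also have "\<dots> = 2 * ((c (n + 1))\<^sup>2 * (cmod (f (n + 1)))\<^sup>2) + 2 * ((c n)\<^sup>2 * (cmod (f (n - 1)))\<^sup>2)"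
    by (simp add: norm_mult power_mult_distrib)
  also have "\<dots> \<le> 2 * (K\<^sup>2 * (cmod (f (n + 1)))\<^sup>2) + 2 * (K\<^sup>2 * (cmod (f (n - 1)))\<^sup>2)"
    using k by (intro add_mono mult_left_mono mult_right_mono) auto
  finally show ?thesis by (simp add: algebra_simps)
qed

lemma jac_ell2:
  assumes f: "f \<in> ell2"
  shows "jac c f \<in> ell2" "norm_sq (jac c f) \<le> 4 * K\<^sup>2 * norm_sq f"
proof -
  have "(\<Sum>n\<in>F. (cmod (jac c f n))\<^sup>2) \<le> 4 * K\<^sup>2 * norm_sq f" if F: "finite F" for F
  proof -
    have s: "(\<Sum>n\<in>F. (cmod (f (n + d)))\<^sup>2) \<le> norm_sq f" for d
    proof -
      have "(\<Sum>n\<in>F. (cmod (f (n + d)))\<^sup>2) = (\<Sum>n\<in>(\<lambda>n. n + d) ` F. (cmod (f n))\<^sup>2)"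
        by (subst sum.reindex) (auto simp: inj_on_def)
      then show ?thesis using sum_le_norm_sq[OF f, of "(\<lambda>n. n + d) ` F"] F by simp
    qed
    have "(\<Sum>n\<in>F. (cmod (jac c f n))\<^sup>2) \<le> (\<Sum>n\<in>F. 2 * K\<^sup>2 * ((cmod (f (n + 1)))\<^sup>2 + (cmod (f (n - 1)))\<^sup>2))"
      by (intro sum_mono jac_bound)
    also have "\<dots> = 2 * K\<^sup>2 * ((\<Sum>n\<in>F. (cmod (f (n + 1)))\<^sup>2) + (\<Sum>n\<in>F. (cmod (f (n + -1)))\<^sup>2))"
      by (simp add: sum_distrib_left sum.distrib distrib_left)
    also have "\<dots> \<le> 2 * K\<^sup>2 * (norm_sq f + norm_sq f)" by (intro mult_left_mono add_mono s) auto
    finally show ?thesis by simp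
  qed
  note b = this
  show "jac c f \<in> ell2" by (rule ell2I_bounded(1)[OF b])
  show "norm_sq (jac c f) \<le> 4 * K\<^sup>2 * norm_sq f" by (rule ell2I_bounded(2)[OF b])
qed

lemma jac_pow_ell2:
  assumes f: "f \<in> ell2"
  shows "(jac c ^^ i) f \<in> ell2" "norm_sq ((jac c ^^ i) f) \<le> (4 * K\<^sup>2) ^ i * norm_sq f"
proof -
  have "(jac c ^^ i) f \<in> ell2 \<and> norm_sq ((jac c ^^ i) f) \<le> (4 * K\<^sup>2) ^ i * norm_sq f"
  proof (induction i)
    case (Suc i)
    have "norm_sq (jac c ((jac c ^^ i) f)) \<le> 4 * K\<^sup>2 * norm_sq ((jac c ^^ i) f)" using Suc jac_ell2(2) by blast
    also have "\<dots> \<le> 4 * K\<^sup>2 * ((4 * K\<^sup>2) ^ i * norm_sq f)" using Suc by (intro mult_left_mono) auto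
    finally show ?case using Suc jac_ell2(1) by (simp add: mult.assoc)
  qed (use f in simp)
  then show "(jac c ^^ i) f \<in> ell2" "norm_sq ((jac c ^^ i) f) \<le> (4 * K\<^sup>2) ^ i * norm_sq f" by auto
qed

lemma jac_selfadjoint:
  assumes f: "f \<in> ell2" and g: "g \<in> ell2"
  shows "ell2_inner (jac c f) g = ell2_inner f (jac c g)"
proof -
  define F1 where "F1 n = of_real (c n) * f n * cnj (g (n - 1))" for n
  define F2 where "F2 n = of_real (c n) * f (n - 1) * cnj (g n)" for n
  have A: "(\<lambda>n. of_real (c n) * h n) \<in> ell2" if h: "h \<in> ell2" for h :: "int \<Rightarrow> complex"
  proof (rule ell2I_bounded(1))
    fix F :: "int set" assume "finite F"
    have "(cmod (of_real (c n) * h n))\<^sup>2 \<le> K\<^sup>2 * (cmod (h n))\<^sup>2" for n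
      using c_bound[of n] K_nonneg by (simp add: norm_mult power_mult_distrib mult_right_mono abs_le_square_iff[symmetric])
    then have "(\<Sum>n\<in>F. (cmod (of_real (c n) * h n))\<^sup>2) \<le> K\<^sup>2 * (\<Sum>n\<in>F. (cmod (h n))\<^sup>2)"
      unfolding sum_distrib_left by (intro sum_mono)
    also have "\<dots> \<le> K\<^sup>2 * norm_sq h" using sum_le_norm_sq[OF h \<open>finite F\<close>] by (intro mult_left_mono) auto
    finally show "(\<Sum>n\<in>F. (cmod (of_real (c n) * h n))\<^sup>2) \<le> K\<^sup>2 * norm_sq h" .
  qed
  have S: "(\<lambda>n. h (n - 1)) \<in> ell2" if h: "h \<in> ell2" for h :: "int \<Rightarrow> complex"
  proof (rule ell2I_bounded(1))
    fix F :: "int set" assume F: "finite F"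
    have "(\<Sum>n\<in>F. (cmod (h (n - 1)))\<^sup>2) = (\<Sum>n\<in>(\<lambda>n. n - 1) ` F. (cmod (h n))\<^sup>2)"
      by (subst sum.reindex) (auto simp: inj_on_def)
    then show "(\<Sum>n\<in>F. (cmod (h (n - 1)))\<^sup>2) \<le> norm_sq h" using sum_le_norm_sq[OF h, of "(\<lambda>n. n - 1) ` F"] F by simp
  qed
  have s1: "F1 summable_on UNIV" unfolding F1_def using ell2_inner_summable[OF A[OF f] S[OF g]] by simp
  have s2: "F2 summable_on UNIV" unfolding F2_def using ell2_inner_summable[OF A[OF S[OF f]] g] by simp
  have "ell2_inner (jac c f) g = (\<Sum>\<^sub>\<infinity>n. F1 (n + 1) + F2 n)"
    unfolding ell2_inner_def jac_def F1_def F2_def by (intro infsum_cong) (simp add: algebra_simps)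
  also have "\<dots> = (\<Sum>\<^sub>\<infinity>n. F1 (n + 1)) + (\<Sum>\<^sub>\<infinity>n. F2 n)"
    using s1 s2 by (intro infsum_add) (simp_all add: summable_shift)
  also have "\<dots> = (\<Sum>\<^sub>\<infinity>n. F2 (n + 1)) + (\<Sum>\<^sub>\<infinity>n. F1 n)" unfolding infsum_shift by simp
  also have "\<dots> = (\<Sum>\<^sub>\<infinity>n. F2 (n + 1) + F1 n)"
    using s1 s2 by (intro infsum_add[symmetric]) (simp_all add: summable_shift)
  also have "\<dots> = ell2_inner f (jac c g)"
    unfolding ell2_inner_def jac_def F1_def F2_def by (intro infsum_cong) (simp add: algebra_simps)
  finally show ?thesis .
qed

lemma jac_pow_selfadjoint:
  assumes "f \<in> ell2" "g \<in> ell2"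
  shows "ell2_inner ((jac c ^^ i) f) g = ell2_inner f ((jac c ^^ i) g)"
  using assms
proof (induction i arbitrary: g)
  case (Suc i)
  have "ell2_inner ((jac c ^^ Suc i) f) g = ell2_inner ((jac c ^^ i) f) (jac c g)"
    using Suc.prems by (simp add: jac_selfadjoint jac_pow_ell2)
  also have "\<dots> = ell2_inner f ((jac c ^^ i) (jac c g))" using Suc jac_ell2 by simp
  finally show ?case by (simp add: funpow_swap1)
qed simp

lemma jac_pow_diff: "(jac c ^^ i) (\<lambda>n. f n - g n) = (\<lambda>n. (jac c ^^ i) f n - (jac c ^^ i) g n)"
proof (induction i)
  case (Suc i)
  have "jac c (\<lambda>n. f n - g n) = (\<lambda>n. jac c f n - jac c g n)" for f g
    by (intro ext) (simp add: jac_def algebra_simps)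
  then show ?case using Suc by simp
qed simp

lemma moments_trunc_tendsto:
  assumes f: "f \<in> ell2"
  shows "(\<lambda>N. ell2_inner ((jac c ^^ i) (trunc N f)) (trunc N f)) \<longlonglongrightarrow> ell2_inner ((jac c ^^ i) f) f"
proof -
  define d where "d N = (\<lambda>n. f n - trunc N f n)" for N
  have dl: "d N \<in> ell2" for N unfolding d_def by (intro ell2_diff f trunc_ell2)
  have dt: "(\<lambda>N. norm_sq (d N)) \<longlonglongrightarrow> 0" unfolding d_def by (rule trunc_tendsto[OF f])
  define C where "C = sqrt ((4 * K\<^sup>2) ^ i)"
  have eq: "ell2_inner ((jac c ^^ i) f) f - ell2_inner ((jac c ^^ i) (trunc N f)) (trunc N f)
     = ell2_inner ((jac c ^^ i) f) (d N) + ell2_inner ((jac c ^^ i) (d N)) (trunc N f)" for N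
  proof -
    have "ell2_inner ((jac c ^^ i) f) f = ell2_inner ((jac c ^^ i) f) (\<lambda>n. trunc N f n + d N n)" by (simp add: d_def)
    then have "ell2_inner ((jac c ^^ i) f) f = ell2_inner ((jac c ^^ i) f) (trunc N f) + ell2_inner ((jac c ^^ i) f) (d N)"
      unfolding ell2_inner_add_right[OF trunc_ell2(1)[OF f, of N] dl[of N] jac_pow_ell2(1)[OF f, of i]] .
    moreover have "ell2_inner ((jac c ^^ i) f) (trunc N f) = ell2_inner (\<lambda>n. (jac c ^^ i) (trunc N f) n + (jac c ^^ i) (d N) n) (trunc N f)"
      unfolding d_def jac_pow_diff by simp
    then have "ell2_inner ((jac c ^^ i) f) (trunc N f) = ell2_inner ((jac c ^^ i) (trunc N f)) (trunc N f) + ell2_inner ((jac c ^^ i) (d N)) (trunc N f)"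
      unfolding ell2_inner_add_left[OF jac_pow_ell2(1)[OF trunc_ell2(1)[OF f, of N], of i] jac_pow_ell2(1)[OF dl[of N], of i] trunc_ell2(1)[OF f, of N]] .
    ultimately show ?thesis by simp
  qed
  have bound: "norm (ell2_inner ((jac c ^^ i) f) f - ell2_inner ((jac c ^^ i) (trunc N f)) (trunc N f))
     \<le> 2 * (C * sqrt (norm_sq f)) * sqrt (norm_sq (d N))" for N
  proof -
    have jp: "sqrt (norm_sq ((jac c ^^ i) h)) \<le> C * sqrt (norm_sq h)" if "h \<in> ell2" for h
      unfolding C_def real_sqrt_mult[symmetric] by (intro real_sqrt_le_mono jac_pow_ell2 that)
    have "cmod (ell2_inner ((jac c ^^ i) f) (d N)) \<le> sqrt (norm_sq ((jac c ^^ i) f)) * sqrt (norm_sq (d N))"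
      by (intro ell2_inner_bound jac_pow_ell2 f dl)
    also have "\<dots> \<le> C * sqrt (norm_sq f) * sqrt (norm_sq (d N))" by (intro mult_right_mono jp f) (simp add: norm_sq_nonneg)
    finally have 1: "cmod (ell2_inner ((jac c ^^ i) f) (d N)) \<le> C * sqrt (norm_sq f) * sqrt (norm_sq (d N))" .
    have "cmod (ell2_inner ((jac c ^^ i) (d N)) (trunc N f)) \<le> sqrt (norm_sq ((jac c ^^ i) (d N))) * sqrt (norm_sq (trunc N f))"
      by (intro ell2_inner_bound jac_pow_ell2 trunc_ell2 f dl)
    also have "\<dots> \<le> (C * sqrt (norm_sq (d N))) * sqrt (norm_sq f)"
      by (intro mult_mono jp dl real_sqrt_le_mono trunc_ell2 f) (auto simp: norm_sq_nonneg C_def)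
    finally have 2: "cmod (ell2_inner ((jac c ^^ i) (d N)) (trunc N f)) \<le> C * sqrt (norm_sq f) * sqrt (norm_sq (d N))" by (simp add: mult_ac)
    show ?thesis unfolding eq using norm_triangle_ineq[of "ell2_inner ((jac c ^^ i) f) (d N)" "ell2_inner ((jac c ^^ i) (d N)) (trunc N f)"] 1 2
      by simp
  qed
  have "(\<lambda>N. 2 * (C * sqrt (norm_sq f)) * sqrt (norm_sq (d N))) \<longlonglongrightarrow> 2 * (C * sqrt (norm_sq f)) * sqrt 0"
    by (rule tendsto_mult[OF tendsto_const tendsto_real_sqrt[OF dt]])
  then have lim0: "(\<lambda>N. 2 * (C * sqrt (norm_sq f)) * sqrt (norm_sq (d N))) \<longlonglongrightarrow> 0" by simp
  have "(\<lambda>N. ell2_inner ((jac c ^^ i) f) f - ell2_inner ((jac c ^^ i) (trunc N f)) (trunc N f)) \<longlonglongrightarrow> 0"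
    by (rule Lim_null_comparison[OF _ lim0]) (intro always_eventually allI bound)
  from tendsto_diff[OF tendsto_const[of "ell2_inner ((jac c ^^ i) f) f"] this] show ?thesis by simp
qed

end

section \<open>Measures represented by moments\<close>

lemma finite_measure_density_const:
  assumes "finite_measure M"
  shows "finite_measure (density M (\<lambda>_. ennreal r))"
proof
  interpret finite_measure M by fact
  have "emeasure (density M (\<lambda>_. ennreal r)) (space M) = ennreal r * emeasure M (space M)"
    by (simp add: emeasure_density nn_integral_cmult_indicator)
  then show "emeasure (density M (\<lambda>_. ennreal r)) (space (density M (\<lambda>_. ennreal r))) \<noteq> \<infinity>"
    using emeasure_finite by (simp add: ennreal_mult_eq_top_iff)
qed

definition moment_measure :: "real set \<Rightarrow> (nat \<Rightarrow> real) \<Rightarrow> real measure \<Rightarrow> bool" where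
  "moment_measure E L M \<longleftrightarrow> finite_measure M \<and> sets M = sets borel \<and> (AE x in M. x \<in> E) \<and> (\<forall>i. (LINT x|M. x ^ i) = L i)"

lemma moment_measure_scale:
  assumes M: "moment_measure E L M" and r: "0 \<le> r" and E: "E \<in> sets borel"
  shows "moment_measure E (\<lambda>i. r * L i) (density M (\<lambda>_. ennreal r))"
proof -
  have [measurable_cong]: "sets M = sets borel" using M by (simp add: moment_measure_def)
  have "(LINT x|density M (\<lambda>_. ennreal r). x ^ i) = r * (LINT x|M. x ^ i)" for i
    using r by (subst integral_real_density) auto
  then show ?thesis using M unfolding moment_measure_def
    by (auto simp: finite_measure_density_const AE_density elim!: eventually_mono)
qed

text \<open>
  After normalization the measures are tight, since they live on a fixed interval, and a subsequence
  converges weakly.  The limit lives on the closed set \<open>E\<close>, as testing with the distance to \<open>E\<close> shows, and its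
  moments are limits because powers may be truncated outside the interval.  When the total masses tend to
  \<open>0\<close> the zero measure takes the place of the limit.
\<close>

lemma moment_measure_limit:
  assumes E: "closed E" "E \<subseteq> {-B..B}"
    and M: "\<And>j. moment_measure E (m j) (M j)" and lim: "\<And>i. (\<lambda>j. m j i) \<longlonglongrightarrow> L i"
  shows "\<exists>N. moment_measure E L N"
proof -
  have Eb [measurable]: "E \<in> sets borel" using E by simp
  have fin: "finite_measure (M j)" and sM: "sets (M j) = sets borel" and AEE: "AE x in M j. x \<in> E"
    and mom: "(LINT x|M j. x ^ i) = m j i" for i j using M by (auto simp: moment_measure_def)
  have m0: "m j 0 = measure (M j) (space (M j))" for j using mom[of j 0] by simp
  then have m0nn: "0 \<le> m j 0" for j by simp
  have L0: "0 \<le> L 0" by (rule LIMSEQ_le_const[OF lim]) (use m0nn in auto)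
  have mb: "\<bar>m j i\<bar> \<le> \<bar>B\<bar> ^ i * m j 0" for i j
  proof -
    interpret finite_measure "M j" by (rule fin)
    note [measurable_cong] = sM
    have "AE x in M j. \<bar>x ^ i\<bar> \<le> \<bar>B\<bar> ^ i" using AEE
      by eventually_elim (use subsetD[OF E(2)] in \<open>fastforce simp: power_abs intro!: power_mono\<close>)
    moreover from this have i: "integrable (M j) (\<lambda>x. x ^ i)" by (intro integrable_const_bound) auto
    ultimately have "\<bar>LINT x|M j. x ^ i\<bar> \<le> (LINT x|M j. \<bar>B\<bar> ^ i)"
      by (intro order_trans[OF integral_abs_bound] integral_mono_AE) auto
    then show ?thesis unfolding mom m0 by (simp add: mult.commute)
  qed
  show ?thesis
  proof (cases "L 0 = 0")
    case True
    have "L i = 0" for i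
    proof -
      have "(\<lambda>j. \<bar>B\<bar> ^ i * m j 0) \<longlonglongrightarrow> \<bar>B\<bar> ^ i * L 0" by (intro tendsto_intros lim)
      then have "(\<lambda>j. \<bar>B\<bar> ^ i * m j 0) \<longlonglongrightarrow> 0" using True by simp
      then have "(\<lambda>j. m j i) \<longlonglongrightarrow> 0" by (rule Lim_null_comparison[rotated]) (use mb in simp)
      then show ?thesis using lim LIMSEQ_unique by blast
    qed
    moreover have "finite_measure (null_measure borel :: real measure)" by standard simp
    moreover have "AE x in null_measure (borel :: real measure). x \<in> E" by (rule AE_I[of _ _ UNIV]) auto
    ultimately have "moment_measure E L (null_measure borel)" by (simp add: moment_measure_def)
    then show ?thesis by blast
  next
    case False
    then have L0p: "L 0 > 0" using L0 by simp
    then have "\<forall>\<^sub>F j in sequentially. m j 0 > 0" by (intro order_tendstoD(1)[OF lim])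
    then obtain j0 where j0: "\<And>j. j \<ge> j0 \<Longrightarrow> m j 0 > 0" unfolding eventually_sequentially by blast
    define N where "N j = density (M (j + j0)) (\<lambda>_. ennreal (1 / m (j + j0) 0))" for j
    have N: "moment_measure E (\<lambda>i. 1 / m (j + j0) 0 * m (j + j0) i) (N j)" for j
      unfolding N_def using j0[of "j + j0"] by (intro moment_measure_scale M Eb) auto
    have sN [measurable_cong]: "sets (N j) = sets borel" and AEN: "AE x in N j. x \<in> E" for j
      using N by (auto simp: moment_measure_def)
    have rd: "real_distribution (N j)" for j
    proof -
      interpret f: finite_measure "N j" using N by (simp add: moment_measure_def)
      have "(LINT x|N j. x ^ 0) = 1 / m (j + j0) 0 * m (j + j0) 0" using N[of j] unfolding moment_measure_def by blast
      also have "\<dots> = 1" using j0[of "j + j0"] by simp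
      finally have "measure (N j) (space (N j)) = 1" by simp
      then have "prob_space (N j)" by (intro prob_spaceI) (simp add: f.emeasure_eq_measure)
      then show "real_distribution (N j)" using sN by (simp add: real_distribution_def real_distribution_axioms_def)
    qed
    have "tight N" unfolding tight_def
    proof (intro conjI allI impI rd)
      fix e :: real assume e: "e > 0"
      have "measure (N j) {- \<bar>B\<bar> - 1<..\<bar>B\<bar>} = 1" for j
      proof -
        interpret real_distribution "N j" by (rule rd)
        have "AE x in N j. x \<in> {- \<bar>B\<bar> - 1<..\<bar>B\<bar>}" using AEN by eventually_elim (use E(2) in force)
        then show ?thesis by (subst prob_eq_1) auto
      qed
      then show "\<exists>a b. a < b \<and> (\<forall>n. 1 - e < measure (N n) {a<..b})"
        using e by (intro exI[of _ "- \<bar>B\<bar> - 1"] exI[of _ "\<bar>B\<bar>"]) auto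
    qed
    then obtain r Q where r: "strict_mono (r :: nat \<Rightarrow> nat)" "real_distribution Q" "weak_conv_m (N \<circ> id \<circ> r) Q"
      using tight_imp_convergent_subsubsequence[of N id] strict_mono_id by blast
    define N' where "N' j = N (r j)" for j
    have wc: "weak_conv_m N' Q" using r(3) by (simp add: N'_def[abs_def] comp_def)
    interpret Q: real_distribution Q by (rule r(2))
    have rd': "real_distribution (N' j)" for j by (simp add: N'_def rd)
    have conv: "(\<lambda>j. LINT x|N' j. g x) \<longlonglongrightarrow> (LINT x|Q. g x)" if "continuous_on UNIV g" "\<And>x. norm (g x) \<le> C" for g :: "real \<Rightarrow> real" and C
      by (rule weak_conv_imp_integral_bdd_continuous_conv[OF rd' r(2) wc]) (use that in \<open>auto simp: continuous_on_eq_continuous_at\<close>)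
    have Ene: "E \<noteq> {}"
    proof
      interpret N0: real_distribution "N 0" by (rule rd)
      assume "E = {}"
      then have "AE x in N 0. False" using AEN[of 0] by simp
      then show False by (simp add: N0.prob_space_axioms prob_space.AE_False)
    qed
    define g where "g x = min 1 (infdist x E)" for x
    have g01: "0 \<le> g x" "g x \<le> 1" for x by (auto simp: g_def infdist_nonneg)
    have gc: "continuous_on UNIV g" unfolding g_def by (intro continuous_intros)
    have "(LINT x|N' j. g x) = 0" for j
    proof -
      have "AE x in N' j. g x = 0" unfolding N'_def using AEN by eventually_elim (simp add: g_def)
      then show ?thesis by (rule integral_eq_zero_AE)
    qed
    then have "(\<lambda>j::nat. 0) \<longlonglongrightarrow> (LINT x|Q. g x)" using conv[OF gc, of 1] g01 by simp
    then have gI: "(LINT x|Q. g x) = 0" by (simp add: LIMSEQ_const_iff)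
    have gm [measurable]: "g \<in> borel_measurable borel" using gc by (rule borel_measurable_continuous_onI)
    have gi: "integrable Q g" by (rule Q.integrable_const_bound[of _ 1]) (use g01 in auto)
    have "AE x in Q. g x = 0" using integral_nonneg_eq_0_iff_AE[OF gi] gI g01 by simp
    then have AEQ: "AE x in Q. x \<in> E"
    proof eventually_elim
      case (elim x)
      then have "infdist x E = 0" by (simp add: g_def min_def split: if_splits)
      then show ?case using E(1) Ene in_closed_iff_infdist_zero by blast
    qed
    have momQ: "(LINT x|Q. x ^ i) = L i / L 0" for i
    proof -
      define h where "h x = (max (- \<bar>B\<bar>) (min \<bar>B\<bar> x)) ^ i" for x :: real
      have hE: "h x = x ^ i" if "x \<in> E" for x
      proof -
        have "max (- \<bar>B\<bar>) (min \<bar>B\<bar> x) = x" using that E(2) by auto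
        then show ?thesis by (simp add: h_def)
      qed
      have hb: "norm (h x) \<le> \<bar>B\<bar> ^ i" for x unfolding h_def norm_power by (intro power_mono) auto
      have hc: "continuous_on UNIV h" unfolding h_def by (intro continuous_intros)
      have hm [measurable]: "h \<in> borel_measurable borel" using hc by (rule borel_measurable_continuous_onI)
      have "(LINT x|N' j. h x) = 1 / m (r j + j0) 0 * m (r j + j0) i" for j
      proof -
        have "(LINT x|N' j. h x) = (LINT x|N (r j). x ^ i)" unfolding N'_def
          by (rule integral_cong_AE) (measurable, use AEN in \<open>eventually_elim, simp add: hE\<close>)
        then show ?thesis using N[of "r j"] by (simp add: moment_measure_def)
      qed
      then have l1: "(\<lambda>j. 1 / m (r j + j0) 0 * m (r j + j0) i) \<longlonglongrightarrow> (LINT x|Q. h x)" using conv[OF hc hb] by simp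
      have "(\<lambda>j. 1 / m (j + j0) 0 * m (j + j0) i) \<longlonglongrightarrow> 1 / L 0 * L i"
        using L0p by (intro tendsto_intros LIMSEQ_ignore_initial_segment[OF lim]) auto
      from LIMSEQ_subseq_LIMSEQ[OF this r(1)] have "(LINT x|Q. h x) = 1 / L 0 * L i"
        using l1 by (intro LIMSEQ_unique[OF l1]) (simp add: comp_def)
      moreover have "(LINT x|Q. h x) = (LINT x|Q. x ^ i)"
        by (rule integral_cong_AE) (measurable, use AEQ in \<open>eventually_elim, simp add: hE\<close>)
      ultimately show ?thesis by simp
    qed
    have "moment_measure E (\<lambda>i. L i / L 0) Q" using AEQ momQ Q.finite_measure_axioms by (simp add: moment_measure_def)
    then have "moment_measure E (\<lambda>i. L 0 * (L i / L 0)) (density Q (\<lambda>_. ennreal (L 0)))"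
      using L0 by (intro moment_measure_scale Eb)
    then show ?thesis using L0p by auto
  qed
qed

section \<open>Polynomial functional calculus\<close>

lemma ell2_inner_commute: "ell2_inner f g = cnj (ell2_inner g f)"
  unfolding ell2_inner_def by (simp flip: infsum_cnj add: mult.commute)

context bounded_jacobi
begin

lemma moments_real:
  assumes f: "f \<in> ell2"
  shows "ell2_inner ((jac c ^^ i) f) f = of_real (Re (ell2_inner ((jac c ^^ i) f) f))"
proof -
  have "ell2_inner ((jac c ^^ i) f) f = cnj (ell2_inner ((jac c ^^ i) f) f)"
    using jac_pow_selfadjoint[OF f f, of i] ell2_inner_commute[of f "(jac c ^^ i) f"] by simp
  then show ?thesis by (metis Reals_cnj_iff complex_is_Real_iff of_real_Re)
qed

text \<open>The vector \<open>q(J) f\<close>.\<close>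

definition poly_apply :: "(int \<Rightarrow> complex) \<Rightarrow> real poly \<Rightarrow> int \<Rightarrow> complex" where
  "poly_apply f q n = (\<Sum>i\<le>degree q. of_real (coeff q i) * (jac c ^^ i) f n)"

lemma poly_apply_cut: "degree q < N \<Longrightarrow> poly_apply f q n = (\<Sum>i<N. of_real (coeff q i) * (jac c ^^ i) f n)"
  unfolding poly_apply_def by (rule sum.mono_neutral_left) (auto simp: coeff_eq_0)

lemma poly_apply_0: "poly_apply f 0 = (\<lambda>_. 0)" by (intro ext) (simp add: poly_apply_def)

lemma poly_apply_pCons: "poly_apply f (pCons a q) = (\<lambda>n. of_real a * f n + jac c (poly_apply f q) n)"
proof
  fix n
  define N where "N = Suc (degree q)"
  have e: "poly_apply f q = (\<lambda>n. \<Sum>i<N. of_real (coeff q i) * (jac c ^^ i) f n)"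
    using poly_apply_cut[of q N f] by (intro ext) (simp add: N_def)
  have "degree (pCons a q) < Suc N" using degree_pCons_le[of a q] by (simp add: N_def)
  then have "poly_apply f (pCons a q) n = (\<Sum>i<Suc N. of_real (coeff (pCons a q) i) * (jac c ^^ i) f n)" by (rule poly_apply_cut)
  also have "\<dots> = of_real a * f n + (\<Sum>i<N. of_real (coeff q i) * jac c ((jac c ^^ i) f) n)"
    by (subst sum.lessThan_Suc_shift) simp
  also have "(\<Sum>i<N. of_real (coeff q i) * jac c ((jac c ^^ i) f) n) = jac c (poly_apply f q) n"
    unfolding e by (simp add: jac_def sum_distrib_left sum.distrib[symmetric] distrib_left mult_ac)
  finally show "poly_apply f (pCons a q) n = of_real a * f n + jac c (poly_apply f q) n" .
qed

lemma poly_apply_add: "poly_apply f (p + q) n = poly_apply f p n + poly_apply f q n"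
proof -
  define N where "N = Suc (max (degree p) (degree q))"
  have "degree p < N" "degree q < N" "degree (p + q) < N" using degree_add_le_max[of p q] by (auto simp: N_def)
  then show ?thesis by (simp add: poly_apply_cut sum.distrib[symmetric] distrib_right)
qed

lemma poly_apply_smult: "poly_apply f (smult a q) n = of_real a * poly_apply f q n"
proof -
  have "degree (smult a q) < Suc (degree q)" by (simp add: less_Suc_eq_le degree_smult_le)
  then have "poly_apply f (smult a q) n = (\<Sum>i<Suc (degree q). of_real (coeff (smult a q) i) * (jac c ^^ i) f n)" by (rule poly_apply_cut)
  moreover have "poly_apply f q n = (\<Sum>i<Suc (degree q). of_real (coeff q i) * (jac c ^^ i) f n)" by (rule poly_apply_cut) simp
  ultimately show ?thesis by (simp only: coeff_smult of_real_mult mult.assoc sum_distrib_left)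
qed

lemma poly_apply_diff: "poly_apply f (p - q) n = poly_apply f p n - poly_apply f q n"
proof -
  have "p - q = p + smult (- 1) q" by simp
  then show ?thesis by (simp only: poly_apply_add poly_apply_smult) simp
qed

lemma poly_apply_linear_factor: "poly_apply f ([:- x, 1:] * q) n = jac c (poly_apply f q) n - of_real x * poly_apply f q n"
proof -
  have "[:- x, 1:] * q = pCons 0 q + smult (- x) q" by simp
  then show ?thesis by (simp only: poly_apply_add poly_apply_pCons poly_apply_smult) simp
qed

lemma poly_apply_1: "poly_apply f 1 = f" by (intro ext) (simp add: poly_apply_def)

lemma poly_apply_ell2: "f \<in> ell2 \<Longrightarrow> poly_apply f q \<in> ell2"
proof (induction q)
  case 0
  then show ?case by (simp add: poly_apply_0 ell2_def)
next
  case (pCons a q)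
  then show ?case unfolding poly_apply_pCons by (intro ell2_add ell2_scale jac_ell2) auto
qed

end

section \<open>Atoms and support of a spectral measure\<close>

text \<open>
  A measure with the moments of the operator at \<open>f\<close>.  Then \<open>q \<mapsto> q(J) f\<close> is isometric from \<open>L\<^sup>2(M)\<close> to
  the square-summable sequences (\<open>norm_sq_poly_apply\<close>), and both properties of \<open>M\<close> proved here are read off
  from well chosen polynomials.
\<close>

locale jacobi_moments = bounded_jacobi +
  fixes f :: "int \<Rightarrow> complex" and M :: "real measure" and E :: "real set" and L :: "nat \<Rightarrow> real" and B :: real
  assumes f: "f \<in> ell2" and M: "moment_measure E L M" and E: "E \<subseteq> {-B..B}"
    and moments: "\<And>i. ell2_inner ((jac c ^^ i) f) f = of_real (L i)"
begin

lemma finM: "finite_measure M" and sM [measurable_cong]: "sets M = sets borel" and AEM: "AE x in M. x \<in> E"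
  and momM: "(LINT x|M. x ^ i) = L i"
  using M by (auto simp: moment_measure_def)

sublocale fm: finite_measure M by (rule finM)

lemma integrable_continuous:
  fixes g :: "real \<Rightarrow> real"
  assumes g: "continuous_on UNIV g"
  shows "integrable M g"
proof -
  have "compact (g ` {-B..B})" by (intro compact_continuous_image continuous_on_subset[OF g]) auto
  then obtain C where C: "\<And>y. y \<in> g ` {-B..B} \<Longrightarrow> norm y \<le> C" using compact_imp_bounded bounded_iff by metis
  have [measurable]: "g \<in> borel_measurable borel" using g by (rule borel_measurable_continuous_onI)
  have "AE x in M. norm (g x) \<le> C" using AEM by eventually_elim (use C E in blast)
  then show ?thesis by (rule fm.integrable_const_bound) measurable
qed

lemma inner_pow_poly_apply: "ell2_inner ((jac c ^^ i) f) (poly_apply f q) = of_real (LINT x|M. x ^ i * poly q x)"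
proof (induction q arbitrary: i)
  case 0
  show ?case by (simp add: poly_apply_0 ell2_inner_def)
next
  case (pCons a q)
  note j = jac_pow_ell2(1)[OF f]
  have "ell2_inner ((jac c ^^ i) f) (poly_apply f (pCons a q)) =
      of_real a * ell2_inner ((jac c ^^ i) f) f + ell2_inner ((jac c ^^ i) f) (jac c (poly_apply f q))"
    unfolding poly_apply_pCons using f j poly_apply_ell2[OF f]
    by (subst ell2_inner_add_right) (auto simp: ell2_inner_scale_right ell2_scale jac_ell2)
  also have "ell2_inner ((jac c ^^ i) f) (jac c (poly_apply f q)) = ell2_inner ((jac c ^^ Suc i) f) (poly_apply f q)"
    using jac_selfadjoint[OF j poly_apply_ell2[OF f]] by simp
  also have "\<dots> = of_real (LINT x|M. x ^ Suc i * poly q x)" by (rule pCons.IH)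
  also have "of_real a * ell2_inner ((jac c ^^ i) f) f = of_real (LINT x|M. a * x ^ i)"
    by (simp add: moments momM)
  also have "of_real (LINT x|M. a * x ^ i) + of_real (LINT x|M. x ^ Suc i * poly q x) =
      of_real (LINT x|M. a * x ^ i + x ^ Suc i * poly q x)"
    unfolding of_real_add[symmetric]
    by (subst Bochner_Integration.integral_add) (intro integrable_continuous continuous_intros refl)+
  also have "(\<lambda>x. a * x ^ i + x ^ Suc i * poly q x) = (\<lambda>x. x ^ i * poly (pCons a q) x)" by (auto simp: algebra_simps)
  finally show ?case .
qed

lemma inner_poly_apply: "ell2_inner (poly_apply f p) (poly_apply f q) = of_real (LINT x|M. poly p x * poly q x)"
proof (induction p arbitrary: q)
  case 0
  show ?case by (simp add: poly_apply_0 ell2_inner_def)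
next
  case (pCons a p)
  have "ell2_inner (poly_apply f (pCons a p)) (poly_apply f q) = of_real a * ell2_inner f (poly_apply f q) + ell2_inner (jac c (poly_apply f p)) (poly_apply f q)"
    unfolding poly_apply_pCons using f poly_apply_ell2[OF f]
    by (subst ell2_inner_add_left) (auto simp: ell2_inner_scale_left ell2_scale jac_ell2)
  also have "ell2_inner (jac c (poly_apply f p)) (poly_apply f q) = ell2_inner (poly_apply f p) (poly_apply f (pCons 0 q))"
    using jac_selfadjoint[OF poly_apply_ell2[OF f] poly_apply_ell2[OF f]] by (simp add: poly_apply_pCons)
  also have "\<dots> = of_real (LINT x|M. poly p x * poly (pCons 0 q) x)" by (rule pCons.IH)
  also have "of_real a * ell2_inner f (poly_apply f q) = of_real (LINT x|M. a * poly q x)"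
    using inner_pow_poly_apply[of 0 q] by simp
  also have "of_real (LINT x|M. a * poly q x) + of_real (LINT x|M. poly p x * poly (pCons 0 q) x) =
      of_real (LINT x|M. a * poly q x + poly p x * poly (pCons 0 q) x)"
    unfolding of_real_add[symmetric]
    by (subst Bochner_Integration.integral_add) (intro integrable_continuous continuous_intros refl)+
  also have "(\<lambda>x. a * poly q x + poly p x * poly (pCons 0 q) x) = (\<lambda>x. poly (pCons a p) x * poly q x)" by (auto simp: algebra_simps)
  finally show ?case .
qed

lemma norm_sq_poly_apply: "norm_sq (poly_apply f q) = (LINT x|M. (poly q x)\<^sup>2)"
  using ell2_inner_self[OF poly_apply_ell2[OF f], of q] inner_poly_apply[of q q] by (simp add: power2_eq_square flip: of_real_mult)

text \<open>
  Large enough to make \<open>\<bar>t - x\<bar> \<le> radius x\<close> on \<open>E\<close>.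
\<close>

definition radius :: "real \<Rightarrow> real" where "radius x = \<bar>x\<bar> + \<bar>B\<bar> + 1"

text \<open>
  The polynomials \<open>(1 - (t - x)\<^sup>2 / \<rho>\<^sup>2)\<^sup>n\<close> in \<open>t\<close>, where \<open>\<rho>\<close> is the radius above.  On \<open>E\<close> they take
  values between \<open>0\<close> and \<open>1\<close> and converge to the indicator of \<open>x\<close>.
\<close>

definition peak :: "real \<Rightarrow> nat \<Rightarrow> real poly" where
  "peak x n = [:1 - x\<^sup>2 / (radius x)\<^sup>2, 2 * x / (radius x)\<^sup>2, - 1 / (radius x)\<^sup>2:] ^ n"

definition peak_base :: "real \<Rightarrow> real \<Rightarrow> real" where "peak_base x t = 1 - (t - x)\<^sup>2 / (radius x)\<^sup>2"

lemma radius_pos: "radius x > 0" by (simp add: radius_def)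

lemma poly_peak: "poly (peak x n) t = peak_base x t ^ n"
proof -
  have "poly [:1 - x\<^sup>2 / (radius x)\<^sup>2, 2 * x / (radius x)\<^sup>2, - 1 / (radius x)\<^sup>2:] t = peak_base x t"
    using radius_pos[of x] by (simp add: peak_base_def power2_eq_square field_simps)
  then show ?thesis by (simp only: peak_def poly_power)
qed

lemma peak_base_bounds: "t \<in> E \<Longrightarrow> 0 \<le> peak_base x t" "peak_base x t \<le> 1"
proof -
  assume "t \<in> E"
  then have "t \<in> {-B..B}" using E by blast
  then have "\<bar>t\<bar> \<le> \<bar>B\<bar>" by auto
  then have "\<bar>t - x\<bar> \<le> \<bar>radius x\<bar>" by (simp add: radius_def)
  then have "(t - x)\<^sup>2 \<le> (radius x)\<^sup>2" by (simp add: abs_le_square_iff)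
  then show "0 \<le> peak_base x t" using radius_pos[of x] by (simp add: peak_base_def)
qed (simp add: peak_base_def)

lemma peak_base_eq_1: "peak_base x t = 1 \<longleftrightarrow> t = x"
  using radius_pos[of x] by (simp add: peak_base_def)

lemma peak_tendsto: "t \<in> E \<Longrightarrow> (\<lambda>n. poly (peak x n) t) \<longlonglongrightarrow> indicator {x} t"
proof -
  assume t: "t \<in> E"
  show ?thesis
  proof (cases "t = x")
    case True
    then show ?thesis using peak_base_eq_1[of x t] by (simp add: poly_peak)
  next
    case False
    then have "peak_base x t < 1" using peak_base_eq_1[of x t] peak_base_bounds(2)[of x t] by simp
    then show ?thesis using peak_base_bounds(1)[OF t, of x] False by (simp add: poly_peak LIMSEQ_power_zero)
  qed
qed

lemma peak_bounds: "t \<in> E \<Longrightarrow> 0 \<le> poly (peak x n) t \<and> poly (peak x n) t \<le> 1"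
  using peak_base_bounds(1)[of t x] peak_base_bounds(2)[of x t] by (simp add: poly_peak power_le_one)

lemma peak_integral_tendsto:
  assumes g: "continuous_on UNIV g"
  shows "(\<lambda>n. LINT t|M. g t * poly (peak x n) t) \<longlonglongrightarrow> g x * measure M {x}"
    "(\<lambda>n. LINT t|M. g t * (poly (peak x n) t - indicator {x} t)\<^sup>2) \<longlonglongrightarrow> 0"
proof -
  have [measurable]: "g \<in> borel_measurable borel" using g by (rule borel_measurable_continuous_onI)
  have gi: "integrable M (\<lambda>t. \<bar>g t\<bar>)" using g by (intro integrable_continuous continuous_intros)
  have [measurable]: "(\<lambda>t. poly (peak x n) t) \<in> borel_measurable borel" for n by (intro borel_measurable_continuous_onI continuous_intros)
  have "(\<lambda>n. LINT t|M. g t * poly (peak x n) t) \<longlonglongrightarrow> (LINT t|M. g t * indicator {x} t)"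
  proof (rule integral_dominated_convergence[OF _ _ gi])
    show "AE t in M. (\<lambda>n. g t * poly (peak x n) t) \<longlonglongrightarrow> g t * indicator {x} t"
      using AEM by eventually_elim (intro tendsto_intros peak_tendsto)
    show "AE t in M. norm (g t * poly (peak x n) t) \<le> \<bar>g t\<bar>" for n
      using AEM
    proof eventually_elim
      case (elim t)
      show ?case using peak_bounds[OF elim, of x n] by (simp add: abs_mult mult_left_le)
    qed
  qed measurable
  also have "(\<lambda>t. g t * indicator {x} t) = (\<lambda>t. g x * indicator {x} t)" by (auto simp: indicator_def)
  also have "(LINT t|M. g x * indicator {x} t) = g x * measure M {x}"
    by (simp add: sM)
  finally show "(\<lambda>n. LINT t|M. g t * poly (peak x n) t) \<longlonglongrightarrow> g x * measure M {x}" .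
  have "(\<lambda>n. LINT t|M. g t * (poly (peak x n) t - indicator {x} t)\<^sup>2) \<longlonglongrightarrow> (LINT t|M. 0)"
  proof (rule integral_dominated_convergence[OF _ _ gi])
    show "AE t in M. (\<lambda>n. g t * (poly (peak x n) t - indicator {x} t)\<^sup>2) \<longlonglongrightarrow> 0"
      using AEM
    proof eventually_elim
      case (elim t)
      have "(\<lambda>n. g t * (poly (peak x n) t - indicator {x} t)\<^sup>2) \<longlonglongrightarrow> g t * (indicator {x} t - indicator {x} t)\<^sup>2"
        by (intro tendsto_intros peak_tendsto elim)
      then show ?case by simp
    qed
    show "AE t in M. norm (g t * (poly (peak x n) t - indicator {x} t)\<^sup>2) \<le> \<bar>g t\<bar>" for n
      using AEM
    proof eventually_elim
      case (elim t)
      have "\<bar>poly (peak x n) t - indicator {x} t\<bar> \<le> 1" using peak_bounds[OF elim, of x n] by (auto simp: indicator_def)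
      then have "(poly (peak x n) t - indicator {x} t)\<^sup>2 \<le> 1" by (simp add: abs_square_le_1)
      then show ?case by (simp add: abs_mult mult_left_le)
    qed
  qed measurable
  then show "(\<lambda>n. LINT t|M. g t * (poly (peak x n) t - indicator {x} t)\<^sup>2) \<longlonglongrightarrow> 0" by simp
qed

text \<open>
  The vectors \<open>peak x n (J) f\<close> approximate the projection of \<open>f\<close> to the eigenspace of \<open>x\<close>.  By the isometry
  they form a Cauchy sequence and are mapped by \<open>J - x\<close> to vectors that tend to \<open>0\<close>, so their coordinatewise limit solves the
  eigenvalue equation.  It is not zero because the inner products with \<open>f\<close> tend to the mass of the atom.
\<close>

theorem atom_eigenvalue:
  assumes x: "measure M {x} > 0"
  shows "ell2_eigenvalue (jac c) (of_real x)"
proof -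
  define G where "G n = poly_apply f (peak x n)" for n
  have Gl: "G n \<in> ell2" for n by (simp add: G_def poly_apply_ell2 f)
  define d where "d n = (LINT t|M. (poly (peak x n) t - indicator {x} t)\<^sup>2)" for n
  have d0: "d \<longlonglongrightarrow> 0" using peak_integral_tendsto(2)[of "\<lambda>_. 1" x] by (simp add: d_def[abs_def])
  have ii: "integrable M (\<lambda>t. (poly (peak x n) t - indicator {x} t)\<^sup>2)" for n
  proof -
    have [measurable]: "(\<lambda>t. poly (peak x n) t) \<in> borel_measurable borel" for n by (intro borel_measurable_continuous_onI continuous_intros)
    have "AE t in M. norm ((poly (peak x n) t - indicator {x} t)\<^sup>2) \<le> 1" using AEM
    proof eventually_elim
      case (elim t)
      have "\<bar>poly (peak x n) t - indicator {x} t\<bar> \<le> 1" using peak_bounds[OF elim, of x n] by (auto simp: indicator_def)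
      then show ?case by (simp add: abs_square_le_1)
    qed
    then show ?thesis by (rule fm.integrable_const_bound) measurable
  qed
  have diff: "(cmod (G n i - G k i))\<^sup>2 \<le> 2 * d n + 2 * d k" for n k i
  proof -
    have "(cmod (G n i - G k i))\<^sup>2 = (cmod (poly_apply f (peak x n - peak x k) i))\<^sup>2" by (simp add: G_def poly_apply_diff)
    also have "\<dots> \<le> (LINT t|M. (poly (peak x n - peak x k) t)\<^sup>2)"
      using coord_le_norm_sq[OF poly_apply_ell2[OF f]] by (simp only: norm_sq_poly_apply)
    also have "\<dots> \<le> (LINT t|M. 2 * (poly (peak x n) t - indicator {x} t)\<^sup>2 + 2 * (poly (peak x k) t - indicator {x} t)\<^sup>2)"
    proof (rule integral_mono)
      show "integrable M (\<lambda>t. (poly (peak x n - peak x k) t)\<^sup>2)" by (intro integrable_continuous continuous_intros)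
      show "integrable M (\<lambda>t. 2 * (poly (peak x n) t - indicator {x} t)\<^sup>2 + 2 * (poly (peak x k) t - indicator {x} t)\<^sup>2)"
        using ii by simp
      fix t
      define a b where "a = poly (peak x n) t - indicator {x} t" and "b = poly (peak x k) t - indicator {x} t"
      have "0 \<le> (a + b)\<^sup>2" by simp
      then have "(a - b)\<^sup>2 \<le> 2 * a\<^sup>2 + 2 * b\<^sup>2" unfolding power2_sum power2_diff by linarith
      moreover have "a - b = poly (peak x n - peak x k) t" by (simp add: a_def b_def)
      ultimately show "(poly (peak x n - peak x k) t)\<^sup>2 \<le> 2 * (poly (peak x n) t - indicator {x} t)\<^sup>2 + 2 * (poly (peak x k) t - indicator {x} t)\<^sup>2"
        by (simp add: a_def b_def)
    qed
    also have "\<dots> = 2 * d n + 2 * d k" using ii by (simp add: d_def)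
    finally show ?thesis .
  qed
  have "Cauchy (\<lambda>n. G n i)" for i
  proof (rule metric_CauchyI)
    fix e :: real assume e: "e > 0"
    then have "e\<^sup>2 / 4 > 0" by simp
    then obtain N where N: "\<And>n. n \<ge> N \<Longrightarrow> d n < e\<^sup>2 / 4"
      using order_tendstoD(2)[OF d0] unfolding eventually_sequentially by blast
    have "dist (G n i) (G k i) < e" if "n \<ge> N" "k \<ge> N" for n k
    proof -
      have "(cmod (G n i - G k i))\<^sup>2 < e\<^sup>2" using diff[of n i k] N[OF that(1)] N[OF that(2)] by linarith
      then show ?thesis using e by (simp add: dist_norm power_less_imp_less_base)
    qed
    then show "\<exists>N. \<forall>m\<ge>N. \<forall>n\<ge>N. dist (G m i) (G n i) < e" by blast
  qed
  then have "\<exists>y. (\<lambda>n. G n i) \<longlonglongrightarrow> y" for i using Cauchy_convergent convergentD by blast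
  then obtain g where g: "\<And>i. (\<lambda>n. G n i) \<longlonglongrightarrow> g i" by metis
  have nG: "norm_sq (G n) \<le> measure M (space M)" for n
  proof -
    have "norm_sq (G n) = (LINT t|M. (poly (peak x n) t)\<^sup>2)" by (simp add: G_def norm_sq_poly_apply)
    also have "\<dots> \<le> (LINT t|M. 1)"
    proof (rule integral_mono_AE)
      show "integrable M (\<lambda>t. (poly (peak x n) t)\<^sup>2)" by (intro integrable_continuous continuous_intros)
      show "AE t in M. (poly (peak x n) t)\<^sup>2 \<le> 1" using AEM
      proof eventually_elim
        case (elim t)
        show ?case using peak_bounds[OF elim, of x n] by (simp add: abs_square_le_1)
      qed
    qed simp
    finally show ?thesis by simp
  qed
  have gl: "g \<in> ell2"
  proof (rule ell2I_bounded(1))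
    fix F :: "int set" assume F: "finite F"
    have "(\<lambda>n. \<Sum>i\<in>F. (cmod (G n i))\<^sup>2) \<longlonglongrightarrow> (\<Sum>i\<in>F. (cmod (g i))\<^sup>2)" by (intro tendsto_intros g)
    then show "(\<Sum>i\<in>F. (cmod (g i))\<^sup>2) \<le> measure M (space M)"
      by (rule LIMSEQ_le_const2) (use sum_le_norm_sq[OF Gl F] nG order_trans in blast)
  qed
  have eig: "jac c g = (\<lambda>n. of_real x * g n)"
  proof
    fix i
    have J: "(\<lambda>n. jac c (G n) i - of_real x * G n i) \<longlonglongrightarrow> jac c g i - of_real x * g i"
      unfolding jac_def by (intro tendsto_intros g)
    have b: "(cmod (jac c (G n) i - of_real x * G n i))\<^sup>2 \<le> (LINT t|M. (t - x)\<^sup>2 * poly (peak x n) t)" for n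
    proof -
      have "(cmod (jac c (G n) i - of_real x * G n i))\<^sup>2 = (cmod (poly_apply f ([:- x, 1:] * peak x n) i))\<^sup>2"
        by (simp only: poly_apply_linear_factor G_def)
      also have "\<dots> \<le> (LINT t|M. (poly ([:- x, 1:] * peak x n) t)\<^sup>2)"
        using coord_le_norm_sq[OF poly_apply_ell2[OF f]] by (simp only: norm_sq_poly_apply)
      also have "\<dots> \<le> (LINT t|M. (t - x)\<^sup>2 * poly (peak x n) t)"
      proof (rule integral_mono_AE)
        show "integrable M (\<lambda>t. (poly ([:- x, 1:] * peak x n) t)\<^sup>2)" "integrable M (\<lambda>t. (t - x)\<^sup>2 * poly (peak x n) t)"
          by (intro integrable_continuous continuous_intros)+
        show "AE t in M. (poly ([:- x, 1:] * peak x n) t)\<^sup>2 \<le> (t - x)\<^sup>2 * poly (peak x n) t" using AEM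
        proof eventually_elim
          case (elim t)
          have "(poly (peak x n) t)\<^sup>2 \<le> poly (peak x n) t" using peak_bounds[OF elim, of x n]
            by (simp add: power2_eq_square mult_left_le)
          moreover have "poly ([:- x, 1:] * peak x n) t = (t - x) * poly (peak x n) t" by (simp add: algebra_simps)
          ultimately show ?case by (simp add: power_mult_distrib mult_left_mono)
        qed
      qed
      finally show ?thesis .
    qed
    have "(\<lambda>n. LINT t|M. (t - x)\<^sup>2 * poly (peak x n) t) \<longlonglongrightarrow> (x - x)\<^sup>2 * measure M {x}"
      by (rule peak_integral_tendsto(1)) (intro continuous_intros)
    then have z: "(\<lambda>n. LINT t|M. (t - x)\<^sup>2 * poly (peak x n) t) \<longlonglongrightarrow> 0" by simp
    have "(\<lambda>n. (cmod (jac c (G n) i - of_real x * G n i))\<^sup>2) \<longlonglongrightarrow> 0"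
      by (rule Lim_null_comparison[OF _ z]) (use b in simp)
    moreover have "(\<lambda>n. (cmod (jac c (G n) i - of_real x * G n i))\<^sup>2) \<longlonglongrightarrow> (cmod (jac c g i - of_real x * g i))\<^sup>2"
      by (intro tendsto_intros J)
    ultimately have "(cmod (jac c g i - of_real x * g i))\<^sup>2 = 0" by (rule LIMSEQ_unique[rotated])
    then show "jac c g i = of_real x * g i" by simp
  qed
  have "g \<noteq> (\<lambda>_. 0)"
  proof
    assume g0: "g = (\<lambda>_. 0)"
    have "ell2_inner (G n) f = of_real (LINT t|M. poly (peak x n) t)" for n
      using inner_poly_apply[of "peak x n" 1] by (simp add: poly_apply_1 G_def)
    moreover have "(\<lambda>n. LINT t|M. poly (peak x n) t) \<longlonglongrightarrow> measure M {x}"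
      using peak_integral_tendsto(1)[of "\<lambda>_. 1" x] by simp
    ultimately have lim: "(\<lambda>n. ell2_inner (G n) f) \<longlonglongrightarrow> of_real (measure M {x})" by (simp add: tendsto_of_real)
    define A where "A = sqrt (measure M (space M))"
    have A0: "A \<ge> 0" by (simp add: A_def)
    have "measure M {x} \<le> 0 + e" if e: "e > 0" for e
    proof -
      have "(\<lambda>N. A * sqrt (norm_sq (\<lambda>n. f n - trunc N f n))) \<longlonglongrightarrow> A * sqrt 0"
        by (rule tendsto_mult[OF tendsto_const tendsto_real_sqrt[OF trunc_tendsto[OF f]]])
      then have "(\<lambda>N. A * sqrt (norm_sq (\<lambda>n. f n - trunc N f n))) \<longlonglongrightarrow> 0" by simp
      then have "\<forall>\<^sub>F N in sequentially. A * sqrt (norm_sq (\<lambda>n. f n - trunc N f n)) < e" using e by (rule order_tendstoD(2))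
      then obtain N where N: "A * sqrt (norm_sq (\<lambda>n. f n - trunc N f n)) < e"
        by (auto simp: eventually_sequentially)
      define h where "h = (\<lambda>n. f n - trunc N f n)"
      have hl: "h \<in> ell2" unfolding h_def by (intro ell2_diff f trunc_ell2)
      have split: "ell2_inner (G n) f = ell2_inner (G n) (trunc N f) + ell2_inner (G n) h" for n
        using ell2_inner_add_right[OF trunc_ell2(1)[OF f, of N] hl Gl[of n]] by (simp add: h_def)
      have fin: "ell2_inner (G n) (trunc N f) = (\<Sum>i\<in>{-int N..int N}. G n i * cnj (f i))" for n
      proof -
        have "ell2_inner (G n) (trunc N f) = (\<Sum>\<^sub>\<infinity>i\<in>{-int N..int N}. G n i * cnj (f i))"
          unfolding ell2_inner_def by (rule infsum_cong_neutral) (auto simp: trunc_def)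
        then show ?thesis by simp
      qed
      have "(\<lambda>n. \<Sum>i\<in>{-int N..int N}. G n i * cnj (f i)) \<longlonglongrightarrow> (\<Sum>i\<in>{-int N..int N}. g i * cnj (f i))"
        by (intro tendsto_intros g)
      then have t0: "(\<lambda>n. ell2_inner (G n) (trunc N f)) \<longlonglongrightarrow> 0" unfolding fin by (simp add: g0)
      have "(\<lambda>n. ell2_inner (G n) f - ell2_inner (G n) (trunc N f)) \<longlonglongrightarrow> of_real (measure M {x}) - 0"
        by (intro tendsto_diff lim t0)
      then have "(\<lambda>n. ell2_inner (G n) h) \<longlonglongrightarrow> of_real (measure M {x})" unfolding split by simp
      then have "(\<lambda>n. cmod (ell2_inner (G n) h)) \<longlonglongrightarrow> cmod (of_real (measure M {x}))" by (rule tendsto_norm)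
      moreover have "cmod (ell2_inner (G n) h) \<le> e" for n
      proof -
        have "cmod (ell2_inner (G n) h) \<le> sqrt (norm_sq (G n)) * sqrt (norm_sq h)" by (intro ell2_inner_bound Gl hl)
        also have "\<dots> \<le> A * sqrt (norm_sq h)" unfolding A_def
          by (intro mult_right_mono real_sqrt_le_mono nG) (simp add: norm_sq_nonneg)
        finally show ?thesis using N by (simp add: h_def)
      qed
      ultimately have "cmod (of_real (measure M {x})) \<le> e" by (intro LIMSEQ_le_const2) auto
      then show ?thesis by simp
    qed
    then have "measure M {x} \<le> 0" by (rule field_le_epsilon)
    then show False using x by simp
  qed
  then show ?thesis unfolding ell2_eigenvalue_def using gl eig by blast
qed

text \<open>
  A bound \<open>\<parallel>g\<parallel> \<le> C \<parallel>(J - x) g\<parallel>\<close>, applied to \<open>g = q(J) f\<close>, says that the integral of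
  \<open>q\<^sup>2 (1 - C\<^sup>2 (t - x)\<^sup>2)\<close> is not positive.  By Weierstrass this extends to continuous functions in place of
  \<open>q\<close>, and a tent function supported where the other factor is positive must vanish almost everywhere.
\<close>

lemma resolvent_ball_null:
  assumes "of_real x \<in> ell2_resolvent_set (jac c)"
  shows "\<exists>e>0. emeasure M (ball x e) = 0"
proof -
  obtain C0 where C0: "\<And>g. g \<in> ell2 \<Longrightarrow> ell2_norm g \<le> C0 * ell2_norm (\<lambda>n. jac c g n - of_real x * g n)"
    using assms unfolding ell2_resolvent_set_def by blast
  define C where "C = max C0 1"
  have C1: "C \<ge> 1" by (simp add: C_def)
  have C: "norm_sq g \<le> C\<^sup>2 * norm_sq (\<lambda>n. jac c g n - of_real x * g n)" if "g \<in> ell2" for g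
  proof -
    have "sqrt (norm_sq g) \<le> C0 * sqrt (norm_sq (\<lambda>n. jac c g n - of_real x * g n))" using C0[OF that] by (simp add: ell2_norm_norm_sq)
    also have "\<dots> \<le> C * sqrt (norm_sq (\<lambda>n. jac c g n - of_real x * g n))" by (intro mult_right_mono) (auto simp: C_def norm_sq_nonneg)
    finally have "(sqrt (norm_sq g))\<^sup>2 \<le> (C * sqrt (norm_sq (\<lambda>n. jac c g n - of_real x * g n)))\<^sup>2" by (intro power_mono) (auto simp: norm_sq_nonneg)
    then show ?thesis by (simp add: power_mult_distrib norm_sq_nonneg)
  qed
  define w where "w t = 1 - C\<^sup>2 * (t - x)\<^sup>2" for t
  have wc: "continuous_on UNIV w" unfolding w_def by (intro continuous_intros)
  have [measurable]: "w \<in> borel_measurable borel" using wc by (rule borel_measurable_continuous_onI)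
  have poly_neg: "(LINT t|M. (poly q t)\<^sup>2 * w t) \<le> 0" for q
  proof -
    have "(LINT t|M. (poly q t)\<^sup>2) \<le> C\<^sup>2 * (LINT t|M. (poly ([:- x, 1:] * q) t)\<^sup>2)"
    proof -
      have "poly_apply f ([:- x, 1:] * q) = (\<lambda>i. jac c (poly_apply f q) i - of_real x * poly_apply f q i)"
        by (intro ext poly_apply_linear_factor)
      then show ?thesis using C[OF poly_apply_ell2[OF f], of q] unfolding norm_sq_poly_apply[symmetric] by simp
    qed
    also have "C\<^sup>2 * (LINT t|M. (poly ([:- x, 1:] * q) t)\<^sup>2) = (LINT t|M. C\<^sup>2 * (poly ([:- x, 1:] * q) t)\<^sup>2)" by simp
    finally have "(LINT t|M. (poly q t)\<^sup>2 - C\<^sup>2 * (poly ([:- x, 1:] * q) t)\<^sup>2) \<le> 0"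
      by (subst Bochner_Integration.integral_diff) (intro integrable_continuous continuous_intros | simp)+
    moreover have "(poly q t)\<^sup>2 - C\<^sup>2 * (poly ([:- x, 1:] * q) t)\<^sup>2 = (poly q t)\<^sup>2 * w t" for t
      by (simp add: w_def power2_eq_square algebra_simps)
    ultimately show ?thesis by simp
  qed
  define h where "h t = max 0 (1 - 2 * C * \<bar>t - x\<bar>)" for t
  have hc: "continuous_on UNIV h" unfolding h_def by (intro continuous_intros)
  have h01: "0 \<le> h t" "h t \<le> 1" for t using C1 by (auto simp: h_def)
  have "\<exists>q. \<forall>t\<in>{-B..B}. \<bar>h t - poly q t\<bar> < 1 / real (Suc n)" for n
  proof -
    obtain g where g: "real_polynomial_function g" "\<And>t. t \<in> {-B..B} \<Longrightarrow> \<bar>h t - g t\<bar> < 1 / real (Suc n)"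
      using Stone_Weierstrass_real_polynomial_function[of "{-B..B}" h "1 / real (Suc n)"] continuous_on_subset[OF hc] by auto
    then obtain b k where "g = (\<lambda>t. \<Sum>i\<le>k. b i * t ^ i)" unfolding real_polynomial_function_iff_sum by blast
    then have "g = poly (\<Sum>i\<le>k. monom (b i) i)" by (auto simp: poly_sum poly_monom)
    then show ?thesis using g(2) by blast
  qed
  then obtain q where q: "\<And>n t. t \<in> {-B..B} \<Longrightarrow> \<bar>h t - poly (q n) t\<bar> < 1 / real (Suc n)" by metis
  have [measurable]: "(\<lambda>t. poly (q n) t) \<in> borel_measurable borel" "h \<in> borel_measurable borel" for n
    using hc by (auto intro!: borel_measurable_continuous_onI continuous_intros)
  have "(\<lambda>n. LINT t|M. (poly (q n) t)\<^sup>2 * w t) \<longlonglongrightarrow> (LINT t|M. (h t)\<^sup>2 * w t)"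
  proof (rule integral_dominated_convergence)
    show "integrable M (\<lambda>t. 4 * \<bar>w t\<bar>)" using wc by (intro integrable_continuous continuous_intros)
    show "AE t in M. (\<lambda>n. (poly (q n) t)\<^sup>2 * w t) \<longlonglongrightarrow> (h t)\<^sup>2 * w t" using AEM
    proof eventually_elim
      case (elim t)
      have "t \<in> {-B..B}" using elim E by blast
      then have "norm (h t - poly (q n) t) \<le> inverse (real (Suc n))" for n
        using less_imp_le[OF q, of t n] by (simp add: inverse_eq_divide)
      then have "(\<lambda>n. h t - poly (q n) t) \<longlonglongrightarrow> 0"
        by (intro Lim_null_comparison[OF _ LIMSEQ_inverse_real_of_nat] always_eventually allI)
      then have "(\<lambda>n. h t - (h t - poly (q n) t)) \<longlonglongrightarrow> h t - 0" by (intro tendsto_intros)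
      then have "(\<lambda>n. poly (q n) t) \<longlonglongrightarrow> h t" by simp
      then show ?case by (intro tendsto_intros)
    qed
    show "AE t in M. norm ((poly (q n) t)\<^sup>2 * w t) \<le> 4 * \<bar>w t\<bar>" for n using AEM
    proof eventually_elim
      case (elim t)
      have "\<bar>h t - poly (q n) t\<bar> < 1 / real (Suc n)" using q elim E by blast
      also have "\<dots> \<le> 1" by simp
      finally have "\<bar>poly (q n) t\<bar> \<le> 2" using h01[of t] by linarith
      then have "(poly (q n) t)\<^sup>2 \<le> 2\<^sup>2" using abs_le_square_iff[of "poly (q n) t" 2] by simp
      then show ?case by (simp add: abs_mult mult_right_mono)
    qed
  qed measurable
  then have le0: "(LINT t|M. (h t)\<^sup>2 * w t) \<le> 0" by (rule LIMSEQ_le_const2) (use poly_neg in auto)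
  have wpos: "3/4 \<le> w t" if "h t \<noteq> 0" for t
  proof -
    have "2 * C * \<bar>t - x\<bar> \<le> 1" using that by (auto simp: h_def max_def split: if_splits)
    then have "\<bar>t - x\<bar> * C \<le> 1/2" by (simp add: mult_ac)
    then have "(\<bar>t - x\<bar> * C)\<^sup>2 \<le> (1/2)\<^sup>2" using C1 by (intro power_mono) auto
    moreover have "(\<bar>t - x\<bar> * C)\<^sup>2 = C\<^sup>2 * (t - x)\<^sup>2" by (simp add: power_mult_distrib mult.commute)
    ultimately have "C\<^sup>2 * (t - x)\<^sup>2 \<le> (1/2)\<^sup>2" by simp
    then show ?thesis by (simp add: w_def power_divide)
  qed
  have nn: "0 \<le> (h t)\<^sup>2 * w t" for t using wpos[of t] by (cases "h t = 0") auto
  have "integrable M (\<lambda>t. (h t)\<^sup>2 * w t)" using hc wc by (intro integrable_continuous continuous_intros)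
  from integral_nonneg_eq_0_iff_AE[OF this] have "AE t in M. (h t)\<^sup>2 * w t = 0"
    using le0 nn by (simp add: antisym integral_nonneg_AE)
  then have "AE t in M. t \<notin> ball x (1 / (2 * C))"
  proof eventually_elim
    case (elim t)
    then have "h t = 0" using wpos[of t] by (cases "h t = 0") auto
    then show ?case using C1 by (auto simp: h_def dist_real_def max_def field_simps abs_minus_commute split: if_splits)
  qed
  then have "emeasure M (ball x (1 / (2 * C))) = 0"
    by (subst (asm) AE_iff_measurable[OF _ refl]) (auto simp: sM sets_eq_imp_space_eq[OF sM] ball_def)
  then show ?thesis using C1 by (intro exI[of _ "1 / (2 * C)"]) auto
qed

theorem AE_spectrum: "AE x in M. complex_of_real x \<in> ell2_spectrum (jac c)"
proof -
  define Rs where "Rs = {x. complex_of_real x \<in> ell2_resolvent_set (jac c)}"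
  obtain e where e: "\<And>x. x \<in> Rs \<Longrightarrow> e x > 0 \<and> emeasure M (ball x (e x)) = 0"
    using resolvent_ball_null unfolding Rs_def by (metis mem_Collect_eq)
  define \<F> where "\<F> = (\<lambda>x. ball x (e x)) ` Rs"
  have "\<And>S. S \<in> \<F> \<Longrightarrow> open S" by (auto simp: \<F>_def)
  then obtain \<F>' where F': "\<F>' \<subseteq> \<F>" "countable \<F>'" "\<Union>\<F>' = \<Union>\<F>" by (rule Lindelof)
  have "\<Union>\<F>' \<in> null_sets M"
  proof (rule null_sets_UN'[of \<F>' id M, simplified])
    show "countable \<F>'" by fact
    fix S assume "S \<in> \<F>'"
    then obtain x where "x \<in> Rs" "S = ball x (e x)" using F'(1) by (auto simp: \<F>_def)
    then show "S \<in> null_sets M" using e by (auto simp: null_sets_def sM)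
  qed
  then have "AE x in M. x \<notin> \<Union>\<F>'" by (rule AE_not_in)
  then show ?thesis
  proof eventually_elim
    case (elim x)
    have "x \<notin> Rs"
    proof
      assume x: "x \<in> Rs"
      then have "x \<in> ball x (e x)" using e by simp
      then show False using elim x unfolding F'(3) \<F>_def by blast
    qed
    then show ?case by (simp add: Rs_def ell2_spectrum_def)
  qed
qed

end

section \<open>Real solutions of the renormalized eigenvalue equation\<close>

text \<open>
  Applying the equation at \<open>N - 1\<close>, \<open>N\<close> and \<open>N + 1\<close> with \<open>N = 2n - r\<close> computes \<open>z\<^sup>2 f(N)\<close>.  The odd values drop out,
  the sum rule turns the diagonal term into \<open>\<lambda> f(N)\<close> and the product rule gives the new off-diagonal
  coefficients.
\<close>

lemma renormalized_equation:
  fixes c c' :: "int \<Rightarrow> real" and f :: "int \<Rightarrow> 'a::real_normed_field" and r :: int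
  assumes mul: "\<And>n. c (2*n - r) * c (2*n - r - 1) = c' n"
    and sq: "\<And>n. (c (2*n - r))\<^sup>2 + (c (2*n - r + 1))\<^sup>2 = lam"
    and eq: "\<And>n. of_real (c (n + 1)) * f (n + 1) + of_real (c n) * f (n - 1) = z * f n"
  shows "of_real (c' (n + 1)) * f (2 * (n + 1) - r) + of_real (c' n) * f (2 * (n - 1) - r)
    = (z\<^sup>2 - of_real lam) * f (2 * n - r)"
proof -
  define N where "N = 2 * n - r"
  have idx: "2 * (n + 1) - r = N + 2" "2 * (n - 1) - r = N - 2" by (simp_all add: N_def)
  have e0: "of_real (c (N + 1)) * f (N + 1) + of_real (c N) * f (N - 1) = z * f N" by (rule eq)
  have e1: "of_real (c (N + 2)) * f (N + 2) + of_real (c (N + 1)) * f N = z * f (N + 1)"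
    using eq[of "N + 1"] by (simp add: algebra_simps)
  have e2: "of_real (c N) * f N + of_real (c (N - 1)) * f (N - 2) = z * f (N - 1)"
    using eq[of "N - 1"] by (simp add: algebra_simps)
  have m0: "c N * c (N - 1) = c' n" using mul[of n] by (simp add: N_def)
  have m1: "c (N + 2) * c (N + 1) = c' (n + 1)"
    using mul[of "n + 1"] by (simp add: N_def algebra_simps)
  have s: "(of_real (c N))\<^sup>2 + (of_real (c (N + 1)))\<^sup>2 = (of_real lam :: 'a)"
    using sq[of n] unfolding N_def[symmetric] by (metis of_real_add of_real_power)
  have "z\<^sup>2 * f N = z * (z * f N)" by (simp add: power2_eq_square)
  also have "\<dots> = of_real (c (N + 1)) * (z * f (N + 1)) + of_real (c N) * (z * f (N - 1))"
    unfolding e0[symmetric] by (simp add: algebra_simps)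
  also have "\<dots> = of_real (c (N + 2) * c (N + 1)) * f (N + 2) + of_real (c N * c (N - 1)) * f (N - 2)
      + ((of_real (c N))\<^sup>2 + (of_real (c (N + 1)))\<^sup>2) * f N"
    unfolding e1[symmetric] e2[symmetric] by (simp add: algebra_simps power2_eq_square)
  finally show ?thesis unfolding idx N_def[symmetric] m0 m1 s by (simp add: algebra_simps)
qed

text \<open>
  Let \<open>S m\<close> be the sum over \<open>{m..<M}\<close>.  As \<open>u m + u (m - 1) = S (m - 1) - S (m + 1)\<close>, the hypothesis bounds
  \<open>(1 + C) S (m + 1)\<close> by \<open>e + C S (m - 1)\<close>, and every two steps gain the factor \<open>C / (1 + C)\<close>.
\<close>

lemma tail_decay:
  fixes u :: "int \<Rightarrow> real"
  assumes nn: "\<And>n. 0 \<le> u n" and C: "0 < C" and e: "0 \<le> e"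
    and step: "\<And>m. m0 \<le> m \<Longrightarrow> m \<le> M \<Longrightarrow> sum u {m..<M} \<le> e + C * (u m + u (m - 1))"
    and F: "sum u {m0..<M} \<le> F" and "0 \<le> F"
  shows "m0 + 2 * int t \<le> M \<Longrightarrow> sum u {m0 + 2 * int t..<M} \<le> (C / (1 + C)) ^ t * F + e"
proof (induction t)
  case 0
  then show ?case using F e by simp
next
  case (Suc t)
  define m where "m = m0 + 2 * int t + 1"
  have mM: "m0 \<le> m" "m + 1 \<le> M" and m2: "m0 + 2 * int (Suc t) = m + 1"
    using Suc.prems by (auto simp: m_def)
  have split: "sum u {m - 1..<M} = u (m - 1) + u m + sum u {m + 1..<M}"
    "sum u {m..<M} = u m + sum u {m + 1..<M}"
  proof -
    have "{m - 1..<M} = insert (m - 1) (insert m {m + 1..<M})" using mM by auto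
    then show "sum u {m - 1..<M} = u (m - 1) + u m + sum u {m + 1..<M}" by simp
    have "{m..<M} = insert m {m + 1..<M}" using mM by auto
    then show "sum u {m..<M} = u m + sum u {m + 1..<M}" by simp
  qed
  have IH: "sum u {m - 1..<M} \<le> (C / (1 + C)) ^ t * F + e"
    using Suc.IH Suc.prems by (simp add: m_def)
  have "sum u {m + 1..<M} \<le> sum u {m..<M}" using split(2) nn[of m] by simp
  also have "\<dots> \<le> e + C * (u m + u (m - 1))" using step[of m] mM by simp
  finally have "(1 + C) * sum u {m + 1..<M} \<le> e + C * sum u {m - 1..<M}"
    unfolding split(1) by (simp add: algebra_simps)
  also have "\<dots> \<le> e + C * ((C / (1 + C)) ^ t * F + e)"
    using IH C by (simp add: mult_left_mono)
  finally have "sum u {m + 1..<M} \<le> (e + C * ((C / (1 + C)) ^ t * F + e)) / (1 + C)"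
    using C by (simp add: pos_le_divide_eq mult.commute)
  also have "\<dots> = (C / (1 + C)) ^ Suc t * F + e"
    using C by (simp add: divide_simps) (simp add: algebra_simps)
  finally show ?case unfolding m2 .
qed

text \<open>
  A square-summable real solution \<open>f\<close> of the eigenvalue equation, together with the coefficients
  \<open>c k\<close> and the spectral parameters \<open>z k\<close> of all its renormalizations.  The bound \<open>2/3\<close> holds on the
  Julia set; being greater than \<open>1/2\<close>, it lets the recursion in \<open>boundary_bound_bond\<close> close.
\<close>

locale renormalized_solution =
  fixes lam :: real and c :: "nat \<Rightarrow> int \<Rightarrow> real" and r :: "nat \<Rightarrow> int"
    and z :: "nat \<Rightarrow> real" and f :: "int \<Rightarrow> real"
  assumes lam1: "1 \<le> lam"
    and c_bounds: "\<And>k n. 0 \<le> c k n" "\<And>k n. c k n \<le> lam"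
    and c_mul: "\<And>k n. c k (2*n - r k) * c k (2*n - r k - 1) = c (Suc k) n"
    and c_sq: "\<And>k n. (c k (2*n - r k))\<^sup>2 + (c k (2*n - r k + 1))\<^sup>2 = lam"
    and z_step: "\<And>k. z (Suc k) = (z k)\<^sup>2 - lam"
    and z_low: "\<And>k. 2/3 \<le> \<bar>z k\<bar>"
    and eq: "\<And>n. c 0 (n + 1) * f (n + 1) + c 0 n * f (n - 1) = z 0 * f n"
    and l2: "(\<lambda>n. (f n)\<^sup>2) summable_on UNIV"
begin

text \<open>
  The renormalized solutions and the offset for which the \<open>k\<close>-th one is \<open>f\<close> sampled at \<open>s k + 2\<^sup>k n\<close>.
  The blocks of level \<open>k\<close> are the intervals between neighbouring sampling points.
\<close>

primrec h :: "nat \<Rightarrow> int \<Rightarrow> real" where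
  "h 0 = f"
| "h (Suc k) = (\<lambda>n. h k (2 * n - r k))"

primrec s :: "nat \<Rightarrow> int" where
  "s 0 = 0"
| "s (Suc k) = s k - 2 ^ k * r k"

lemma h_eq: "h k n = f (s k + 2 ^ k * n)"
  by (induction k arbitrary: n) (auto simp: algebra_simps)

lemma h_solution: "c k (n + 1) * h k (n + 1) + c k n * h k (n - 1) = z k * h k n"
proof (induction k arbitrary: n)
  case 0
  show ?case by (simp add: eq)
next
  case (Suc k)
  from renormalized_equation[of "c k" "r k" "c (Suc k)" lam "h k" "z k" n]
  show ?case using Suc c_mul c_sq by (simp add: z_step)
qed

section \<open>Mass of blocks\<close>

text \<open>
  Half the share of the edge between \<open>n - 1\<close> and \<open>n\<close> in the quadratic form of the Jacobi matrix at \<open>h k\<close>.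
\<close>

definition bond :: "nat \<Rightarrow> int \<Rightarrow> real" where
  "bond k n = c k n * h k (n - 1) * h k n"

lemma bond_add: "bond k n + bond k (n + 1) = z k * (h k n)\<^sup>2"
  using arg_cong[OF h_solution[of k n], of "\<lambda>x. x * h k n"]
  by (simp add: bond_def power2_eq_square algebra_simps)

lemma bond_even: "z k * bond k (2 * n - r k) = bond (Suc k) n + (c k (2 * n - r k))\<^sup>2 * (h (Suc k) n)\<^sup>2"
proof -
  define N where "N = 2 * n - r k"
  have "c k N * h k N + c k (N - 1) * h k (N - 2) = z k * h k (N - 1)"
    using h_solution[of k "N - 1"] by (simp add: algebra_simps)
  then have "z k * (c k N * h k (N - 1) * h k N)
      = c k N * h k N * (c k N * h k N + c k (N - 1) * h k (N - 2))" by (simp add: algebra_simps)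
  also have "\<dots> = (c k N * c k (N - 1)) * h k (N - 2) * h k N + (c k N)\<^sup>2 * (h k N)\<^sup>2"
    by (simp add: algebra_simps power2_eq_square)
  finally show ?thesis
    using c_mul[of k n] unfolding bond_def N_def by (simp add: algebra_simps)
qed

lemma z_nonzero: "z k \<noteq> 0" using z_low[of k] by auto

text \<open>
  By \<open>bond_add\<close> the difference of \<open>h\<^sup>2\<close> at neighbouring sites is a difference of bonds divided by
  \<open>z k\<close>.  Hence the odd sites carry as much mass as the even ones up to a telescoping sum.
\<close>

lemma one_step_mass:
  assumes "m \<le> m'"
  shows "(\<Sum>n\<in>{2*m - r k..<2*m' - r k}. (h k n)\<^sup>2) =
    2 * (\<Sum>n\<in>{m..<m'}. (h (Suc k) n)\<^sup>2) + (bond k (2*m' - r k) - bond k (2*m - r k)) / z k"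
  using assms
proof (induction m' rule: int_ge_induct)
  case base
  show ?case by simp
next
  case (step i)
  define N where "N = 2 * i - r k"
  have "{2*m - r k..<2*(i+1) - r k} = insert (N + 1) (insert N {2*m - r k..<N})"
    using step.hyps by (auto simp: N_def)
  then have "(\<Sum>n\<in>{2*m - r k..<2*(i+1) - r k}. (h k n)\<^sup>2) =
      (h k N)\<^sup>2 + (h k (N+1))\<^sup>2 + (\<Sum>n\<in>{2*m - r k..<N}. (h k n)\<^sup>2)" by simp
  moreover have "{m..<i+1} = insert i {m..<i}" using step.hyps by auto
  then have "(\<Sum>n\<in>{m..<i+1}. (h (Suc k) n)\<^sup>2) = (h k N)\<^sup>2 + (\<Sum>n\<in>{m..<i}. (h (Suc k) n)\<^sup>2)"
    by (simp add: N_def)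
  moreover have "bond k (N + 2) - bond k N = z k * ((h k (N+1))\<^sup>2 - (h k N)\<^sup>2)"
    using bond_add[of k N] bond_add[of k "N + 1"] by (simp add: algebra_simps)
  then have "(bond k (N + 2) - bond k N) / z k = (h k (N+1))\<^sup>2 - (h k N)\<^sup>2"
    using z_nonzero[of k] by simp
  moreover have e: "2 * (i + 1) - r k = N + 2" by (simp add: N_def)
  ultimately show ?case using step.IH unfolding e N_def[symmetric]
    by (simp add: diff_divide_distrib)
qed

text \<open>
  The accumulated boundary terms of \<open>k\<close> applications of \<open>one_step_mass\<close>.
\<close>

primrec boundary :: "nat \<Rightarrow> int \<Rightarrow> real" where
  "boundary 0 m = 0"
| "boundary (Suc k) m = boundary k (2 * m - r k) + 2 ^ k * bond k (2 * m - r k) / z k"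

lemma block_mass:
  assumes "m \<le> m'"
  shows "(\<Sum>n\<in>{s k + 2^k * m..<s k + 2^k * m'}. (f n)\<^sup>2) =
    2 ^ k * (\<Sum>n\<in>{m..<m'}. (h k n)\<^sup>2) + boundary k m' - boundary k m"
  using assms
proof (induction k arbitrary: m m')
  case 0
  then show ?case by simp
next
  case (Suc k)
  have idx: "s (Suc k) + 2 ^ Suc k * i = s k + 2 ^ k * (2 * i - r k)" for i
    by (simp add: algebra_simps)
  have "(\<Sum>n\<in>{s (Suc k) + 2^Suc k * m..<s (Suc k) + 2^Suc k * m'}. (f n)\<^sup>2) =
    2 ^ k * (\<Sum>n\<in>{2*m - r k..<2*m' - r k}. (h k n)\<^sup>2) + boundary k (2*m' - r k) - boundary k (2*m - r k)"
    unfolding idx using Suc.IH[of "2*m - r k" "2*m' - r k"] Suc.prems by simp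
  also have "\<dots> = 2 ^ Suc k * (\<Sum>n\<in>{m..<m'}. (h (Suc k) n)\<^sup>2) + boundary (Suc k) m' - boundary (Suc k) m"
    unfolding one_step_mass[OF Suc.prems] by (simp add: algebra_simps diff_divide_distrib)
  finally show ?case .
qed

text \<open>
  The boundary term at level \<open>k + 1\<close> is the one at level \<open>k\<close> plus \<open>2\<^sup>k bond / z\<close>.  By \<open>bond_even\<close>
  a bond of level \<open>k\<close> is bounded by \<open>3/2\<close> of the corresponding one of level \<open>k + 1\<close> plus a multiple of \<open>h\<^sup>2\<close>.
  The prefactor doubles with the level, so the recursion closes with the constant \<open>9/2\<close>: it becomes
  \<open>6 \<cdot> 3/2 = 2 \<cdot> 9/2\<close>.
\<close>

lemma boundary_bound_bond: "\<bar>boundary k m\<bar> \<le> 2 ^ k * (9/2) * (\<bar>bond k m\<bar> + 2 * lam * (h k m)\<^sup>2)"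
proof (induction k arbitrary: m)
  case 0
  show ?case using lam1 by simp
next
  case (Suc k)
  define N where "N = 2 * m - r k"
  define W where "W = \<bar>bond (Suc k) m\<bar>"
  define X where "X = (h (Suc k) m)\<^sup>2"
  have X0: "0 \<le> X" "0 \<le> W" by (auto simp: X_def W_def)
  have hX: "(h k N)\<^sup>2 = X" by (simp add: X_def N_def)
  have csq: "(c k N)\<^sup>2 \<le> lam" using c_sq[of k m] by (simp add: N_def) (smt (verit) zero_le_power2)
  have "2/3 * \<bar>bond k N\<bar> \<le> \<bar>z k\<bar> * \<bar>bond k N\<bar>" using z_low[of k] by (intro mult_right_mono) auto
  also have "\<dots> = \<bar>bond (Suc k) m + (c k N)\<^sup>2 * X\<bar>"
    using bond_even[of k m] unfolding N_def[symmetric] X_def[symmetric] by (metis abs_mult)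
  also have "\<dots> \<le> W + \<bar>(c k N)\<^sup>2 * X\<bar>" unfolding W_def by (rule abs_triangle_ineq)
  also have "\<dots> \<le> W + lam * X" using csq X0 by (simp add: mult_right_mono)
  finally have w: "\<bar>bond k N\<bar> \<le> 3/2 * (W + lam * X)" by simp
  have "\<bar>bond k N / z k\<bar> \<le> \<bar>bond k N\<bar> / (2/3)"
    unfolding abs_divide using z_low[of k] by (intro divide_left_mono) auto
  then have q: "\<bar>2 ^ k * bond k N / z k\<bar> \<le> 2 ^ k * (3/2 * \<bar>bond k N\<bar>)"
    using mult_left_mono[of "\<bar>bond k N / z k\<bar>" "3/2 * \<bar>bond k N\<bar>" "2 ^ k"] by (simp add: abs_mult)
  have "\<bar>boundary (Suc k) m\<bar> \<le> \<bar>boundary k N\<bar> + \<bar>2 ^ k * bond k N / z k\<bar>"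
    unfolding boundary.simps N_def by (rule abs_triangle_ineq)
  also have "\<dots> \<le> 2 ^ k * (9/2) * (\<bar>bond k N\<bar> + 2 * lam * X) + 2 ^ k * (3/2 * \<bar>bond k N\<bar>)"
    using Suc.IH[of N, unfolded hX] q by linarith
  also have "\<dots> = 2 ^ k * (6 * \<bar>bond k N\<bar> + 9 * lam * X)" by (simp add: field_simps)
  also have "\<dots> \<le> 2 ^ k * (9 * W + 18 * lam * X)"
    using w by (intro mult_left_mono) (auto simp: algebra_simps)
  also have "\<dots> = 2 ^ Suc k * (9/2) * (W + 2 * lam * X)" by (simp add: algebra_simps)
  finally show ?case by (simp add: W_def X_def)
qed

lemma boundary_bound: "\<bar>boundary k m\<bar> \<le> 2 ^ k * (9 * lam) * (\<bar>h k m\<bar> * (\<bar>h k m\<bar> + \<bar>h k (m - 1)\<bar>))"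
proof -
  have "\<bar>bond k m\<bar> = c k m * (\<bar>h k (m - 1)\<bar> * \<bar>h k m\<bar>)"
    using c_bounds(1) by (simp add: bond_def abs_mult)
  also have "\<dots> \<le> lam * (\<bar>h k (m - 1)\<bar> * \<bar>h k m\<bar>)"
    using c_bounds(2) by (intro mult_right_mono) auto
  also have "\<dots> \<le> 2 * lam * (\<bar>h k (m - 1)\<bar> * \<bar>h k m\<bar>)"
    using lam1 by (intro mult_right_mono) auto
  finally have "\<bar>bond k m\<bar> + 2 * lam * (h k m)\<^sup>2 \<le> 2 * lam * (\<bar>h k m\<bar> * (\<bar>h k m\<bar> + \<bar>h k (m - 1)\<bar>))"
    by (simp add: algebra_simps power2_eq_square flip: abs_mult)
  then have "2 ^ k * (9/2) * (\<bar>bond k m\<bar> + 2 * lam * (h k m)\<^sup>2)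
     \<le> 2 ^ k * (9/2) * (2 * lam * (\<bar>h k m\<bar> * (\<bar>h k m\<bar> + \<bar>h k (m - 1)\<bar>)))"
    by (intro mult_left_mono) auto
  also have "\<dots> = 2 ^ k * (9 * lam) * (\<bar>h k m\<bar> * (\<bar>h k m\<bar> + \<bar>h k (m - 1)\<bar>))" by simp
  finally show ?thesis using boundary_bound_bond[of k m] by linarith
qed

text \<open>
  The rescaled mass at level \<open>k\<close>.  In contrast to \<open>h\<close>, its sums are bounded uniformly in \<open>k\<close>
  (\<open>u_total\<close>).
\<close>

definition u :: "nat \<Rightarrow> int \<Rightarrow> real" where "u k n = 2 ^ k * (h k n)\<^sup>2"

lemma u_nonneg: "0 \<le> u k n" by (simp add: u_def)

lemma block_mass_u:
  assumes "m \<le> m'"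
  shows "sum (u k) {m..<m'} = (\<Sum>n\<in>{s k + 2^k * m..<s k + 2^k * m'}. (f n)\<^sup>2) + boundary k m - boundary k m'"
  using block_mass[OF assms, of k] by (simp add: u_def sum_distrib_left)

lemma boundary_bound_u: "\<bar>boundary k m\<bar> \<le> 18 * lam * (u k m + u k (m - 1))"
proof -
  have "\<bar>h k m\<bar> * (\<bar>h k m\<bar> + \<bar>h k (m - 1)\<bar>) \<le> 2 * ((h k m)\<^sup>2 + (h k (m - 1))\<^sup>2)"
  proof -
    have "\<bar>h k m\<bar> * \<bar>h k (m - 1)\<bar> \<le> (h k m)\<^sup>2 + (h k (m - 1))\<^sup>2"
    proof -
      have "0 \<le> (\<bar>h k m\<bar> - \<bar>h k (m - 1)\<bar>)\<^sup>2" by simp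
      then have "2 * (\<bar>h k m\<bar> * \<bar>h k (m - 1)\<bar>) \<le> (h k m)\<^sup>2 + (h k (m - 1))\<^sup>2"
        by (simp add: power2_diff)
      moreover have "0 \<le> \<bar>h k m\<bar> * \<bar>h k (m - 1)\<bar>" by simp
      ultimately show ?thesis by linarith
    qed
    moreover have "\<bar>h k m\<bar> * \<bar>h k m\<bar> = (h k m)\<^sup>2" by (simp add: power2_eq_square)
    ultimately show ?thesis unfolding distrib_left using zero_le_power2[of "h k (m - 1)"] by linarith
  qed
  then have "2 ^ k * (9 * lam) * (\<bar>h k m\<bar> * (\<bar>h k m\<bar> + \<bar>h k (m - 1)\<bar>))
    \<le> 2 ^ k * (9 * lam) * (2 * ((h k m)\<^sup>2 + (h k (m - 1))\<^sup>2))"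
    using lam1 by (intro mult_left_mono) auto
  also have "\<dots> = 18 * lam * (u k m + u k (m - 1))" by (simp add: u_def algebra_simps)
  finally show ?thesis using boundary_bound[of k m] by linarith
qed

definition F :: real where "F = (\<Sum>\<^sub>\<infinity>n. (f n)\<^sup>2)"

lemma finite_mass: "finite A \<Longrightarrow> (\<Sum>n\<in>A. (f n)\<^sup>2) \<le> F"
  unfolding F_def by (rule finite_sum_le_infsum[OF l2]) auto

lemma F_nonneg: "0 \<le> F" using finite_mass[of "{}"] by simp

lemma small_outside:
  assumes "e > 0"
  obtains R where "R \<ge> 0" "\<And>A. finite A \<Longrightarrow> A \<inter> {-R..R} = {} \<Longrightarrow> (\<Sum>n\<in>A. (f n)\<^sup>2) \<le> e"
proof -
  have "((\<lambda>n. (f n)\<^sup>2) has_sum F) UNIV" unfolding F_def using l2 by simp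
  then obtain B where B: "finite B" "dist (\<Sum>n\<in>B. (f n)\<^sup>2) F \<le> e"
    using has_sum_finite_approximation[OF _ assms] by blast
  define R where "R = (\<Sum>b\<in>B. \<bar>b\<bar>)"
  have "B \<subseteq> {-R..R}"
  proof
    fix b assume "b \<in> B"
    then have "\<bar>b\<bar> \<le> R" unfolding R_def using B(1) by (intro member_le_sum) auto
    then show "b \<in> {-R..R}" by auto
  qed
  moreover have "R \<ge> 0" by (auto simp: R_def intro: sum_nonneg)
  moreover have "(\<Sum>n\<in>A. (f n)\<^sup>2) \<le> e" if "finite A" "A \<inter> B = {}" for A
  proof -
    have "(\<Sum>n\<in>A. (f n)\<^sup>2) + (\<Sum>n\<in>B. (f n)\<^sup>2) = (\<Sum>n\<in>A \<union> B. (f n)\<^sup>2)"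
      using that B(1) by (simp add: sum.union_disjoint)
    also have "\<dots> \<le> F" using that B(1) by (intro finite_mass) auto
    finally show ?thesis using B(2) by (simp add: dist_real_def)
  qed
  ultimately show ?thesis using that[of R] by blast
qed

lemma index_growth: "\<bar>n\<bar> - \<bar>s k\<bar> \<le> \<bar>s k + 2 ^ k * n\<bar>"
proof -
  have "\<bar>n\<bar> \<le> 2 ^ k * \<bar>n\<bar>"
    using mult_right_mono[of 1 "2 ^ k :: int" "\<bar>n\<bar>"] by simp
  also have "\<dots> = \<bar>2 ^ k * n\<bar>" by (simp add: abs_mult)
  finally show ?thesis by linarith
qed

lemma boundary_small:
  assumes "e > 0"
  obtains M where "\<And>m. M \<le> \<bar>m\<bar> \<Longrightarrow> \<bar>boundary k m\<bar> \<le> e"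
proof -
  define d where "d = e / (36 * lam * 2 ^ k)"
  have d: "d > 0" using assms lam1 by (simp add: d_def)
  obtain R where R: "R \<ge> 0" "\<And>A. finite A \<Longrightarrow> A \<inter> {-R..R} = {} \<Longrightarrow> (\<Sum>n\<in>A. (f n)\<^sup>2) \<le> d"
    using small_outside[OF d] by blast
  have hs: "(h k m)\<^sup>2 \<le> d" if "R + \<bar>s k\<bar> + 1 \<le> \<bar>m\<bar>" for m
  proof -
    have "s k + 2 ^ k * m \<notin> {-R..R}" using index_growth[of m k] that by (simp only: atLeastAtMost_iff) linarith
    then show ?thesis using R(2)[of "{s k + 2 ^ k * m}"] by (simp add: h_eq)
  qed
  have "\<bar>boundary k m\<bar> \<le> e" if "R + \<bar>s k\<bar> + 2 \<le> \<bar>m\<bar>" for m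
  proof -
    have "(h k m)\<^sup>2 \<le> d" "(h k (m - 1))\<^sup>2 \<le> d" using that by (intro hs; linarith)+
    then have "u k m + u k (m - 1) \<le> 2 ^ k * d + 2 ^ k * d"
      unfolding u_def by (intro add_mono mult_left_mono) auto
    then have "18 * lam * (u k m + u k (m - 1)) \<le> 18 * lam * (2 ^ k * d + 2 ^ k * d)"
      using lam1 by (intro mult_left_mono) auto
    also have "\<dots> = e" using lam1 by (simp add: d_def field_simps)
    finally show ?thesis using boundary_bound_u[of k m] by linarith
  qed
  then show ?thesis using that by blast
qed

text \<open>
  The block identity over a long interval, where the boundary terms are negligible since \<open>f\<close> tends to \<open>0\<close>.
\<close>

lemma u_total: 
  assumes "finite A"
  shows "sum (u k) A \<le> F"
proof (rule field_le_epsilon)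
  fix e :: real assume "e > 0"
  then have "e / 2 > 0" by simp
  then obtain M where M: "\<And>m. M \<le> \<bar>m\<bar> \<Longrightarrow> \<bar>boundary k m\<bar> \<le> e / 2" using boundary_small by blast
  define L where "L = \<bar>M\<bar> + (\<Sum>b\<in>A. \<bar>b\<bar>) + 1"
  have L: "L \<ge> 0" "M \<le> L" by (auto simp: L_def intro!: add_nonneg_nonneg sum_nonneg) (smt (verit) abs_ge_zero sum_nonneg)
  have "A \<subseteq> {-L..<L}"
  proof
    fix b assume "b \<in> A"
    then have "\<bar>b\<bar> \<le> (\<Sum>b\<in>A. \<bar>b\<bar>)" using assms by (intro member_le_sum) auto
    then show "b \<in> {-L..<L}" by (auto simp: L_def)
  qed
  then have "sum (u k) A \<le> sum (u k) {-L..<L}" by (intro sum_mono2) (auto simp: u_nonneg)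
  also have "\<dots> = (\<Sum>n\<in>{s k + 2^k * (-L)..<s k + 2^k * L}. (f n)\<^sup>2) + boundary k (-L) - boundary k L"
    using L by (intro block_mass_u) auto
  also have "\<dots> \<le> F + (e/2 + e/2)"
    using finite_mass[of "{s k + 2^k * (-L)..<s k + 2^k * L}"] M[of L] M[of "-L"] L by simp
  finally show "sum (u k) A \<le> F + e" by simp
qed

lemma u_le: "u k n \<le> F" using u_total[of "{n}" k] by simp

text \<open>
  The factor of \<open>tail_decay\<close> for the constant of \<open>boundary_bound_u\<close>.
\<close>

abbreviation (input) "decay \<equiv> 18 * lam / (1 + 18 * lam)"

text \<open>
  If \<open>f\<close> has little mass to the right of a point, then by the block identity the mass of \<open>u k\<close> to the right of
  \<open>m\<close> is essentially the boundary term at \<open>m\<close>, which is bounded by the two adjacent values of \<open>u k\<close>.  This is the situation of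
  \<open>tail_decay\<close>.
\<close>

lemma right_decay:
  assumes e: "e > 0" and tail: "\<And>A. finite A \<Longrightarrow> A \<subseteq> {s k + 2 ^ k * m0..} \<Longrightarrow> (\<Sum>n\<in>A. (f n)\<^sup>2) \<le> e"
  shows "u k (m0 + 2 * int t) \<le> decay ^ t * F + 2 * e"
proof -
  obtain M0 where M0: "\<And>m. M0 \<le> \<bar>m\<bar> \<Longrightarrow> \<bar>boundary k m\<bar> \<le> e" using boundary_small[OF e] by blast
  define M where "M = max \<bar>M0\<bar> (m0 + 2 * int t + 1)"
  have M: "m0 + 2 * int t < M" "M0 \<le> \<bar>M\<bar>" by (auto simp: M_def)
  have "sum (u k) {m0 + 2 * int t..<M} \<le> decay ^ t * F + 2 * e"
  proof (rule tail_decay)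
    fix m assume m: "m0 \<le> m" "m \<le> M"
    have "sum (u k) {m..<M} = (\<Sum>n\<in>{s k + 2^k * m..<s k + 2^k * M}. (f n)\<^sup>2) + boundary k m - boundary k M"
      using m by (intro block_mass_u)
    also have "\<dots> \<le> e + 18 * lam * (u k m + u k (m - 1)) + e"
    proof -
      have "2 ^ k * m0 \<le> 2 ^ k * m" using m by (intro mult_left_mono) auto
      then have "{s k + 2^k * m..<s k + 2^k * M} \<subseteq> {s k + 2 ^ k * m0..}"
        by (intro subsetI) (simp only: atLeastLessThan_iff atLeast_iff, linarith)
      then have "(\<Sum>n\<in>{s k + 2^k * m..<s k + 2^k * M}. (f n)\<^sup>2) \<le> e" by (intro tail) auto
      then show ?thesis using boundary_bound_u[of k m] M0[OF M(2)] by linarith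
    qed
    finally show "sum (u k) {m..<M} \<le> 2 * e + 18 * lam * (u k m + u k (m - 1))" by simp
  qed (use e lam1 M F_nonneg u_total in \<open>auto simp: u_nonneg\<close>)
  moreover have "u k (m0 + 2 * int t) \<le> sum (u k) {m0 + 2 * int t..<M}"
    using M by (intro member_le_sum) (auto simp: u_nonneg)
  ultimately show ?thesis by linarith
qed

lemma left_decay:
  assumes e: "e > 0" and tail: "\<And>A. finite A \<Longrightarrow> A \<subseteq> {..<s k + 2 ^ k * m0} \<Longrightarrow> (\<Sum>n\<in>A. (f n)\<^sup>2) \<le> e"
  shows "u k (m0 - 1 - 2 * int t) \<le> decay ^ t * F + 2 * e"
proof -
  obtain M0 where M0: "\<And>m. M0 \<le> \<bar>m\<bar> \<Longrightarrow> \<bar>boundary k m\<bar> \<le> e" using boundary_small[OF e] by blast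
  define M where "M = max \<bar>M0\<bar> (1 - m0 + 2 * int t + 1)"
  have M: "1 - m0 + 2 * int t < M + 1" "M0 \<le> \<bar>-M\<bar>" "1 - m0 \<le> M + 1" by (auto simp: M_def)
  have refl: "sum (\<lambda>n. u k (- n)) {a..<b} = sum (u k) {1 - b..<1 - a}" for a b
    by (rule sum.reindex_bij_witness[of _ uminus uminus]) auto
  have "sum (\<lambda>n. u k (- n)) {(1 - m0) + 2 * int t..<M + 1} \<le> decay ^ t * F + 2 * e"
  proof (rule tail_decay)
    fix m assume m: "1 - m0 \<le> m" "m \<le> M + 1"
    have "sum (\<lambda>n. u k (- n)) {m..<M + 1} = sum (u k) {-M..<1 - m}" unfolding refl by simp
    also have "\<dots> = (\<Sum>n\<in>{s k + 2^k * (-M)..<s k + 2^k * (1 - m)}. (f n)\<^sup>2) + boundary k (-M) - boundary k (1 - m)"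
      using m by (intro block_mass_u) auto
    also have "\<dots> \<le> e + e + 18 * lam * (u k (1 - m) + u k (1 - m - 1))"
    proof -
      have "2 ^ k * (1 - m) \<le> 2 ^ k * m0" using m by (intro mult_left_mono) auto
      then have "{s k + 2^k * (-M)..<s k + 2^k * (1 - m)} \<subseteq> {..<s k + 2 ^ k * m0}"
        by (intro subsetI) (simp only: atLeastLessThan_iff lessThan_iff, linarith)
      then have "(\<Sum>n\<in>{s k + 2^k * (-M)..<s k + 2^k * (1 - m)}. (f n)\<^sup>2) \<le> e"
        by (intro tail) auto
      then show ?thesis using boundary_bound_u[of k "1 - m"] M0[OF M(2)] by linarith
    qed
    finally show "sum (\<lambda>n. u k (- n)) {m..<M + 1} \<le> 2 * e + 18 * lam * (u k (- m) + u k (- (m - 1)))"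
      by (simp add: algebra_simps)
  next
    show "sum (\<lambda>n. u k (- n)) {1 - m0..<M + 1} \<le> F" unfolding refl by (intro u_total) auto
  qed (use e lam1 M F_nonneg in \<open>auto simp: u_nonneg\<close>)
  moreover have "u k (m0 - 1 - 2 * int t) \<le> sum (\<lambda>n. u k (- n)) {(1 - m0) + 2 * int t..<M + 1}"
    using M member_le_sum[of "(1 - m0) + 2 * int t" "{(1 - m0) + 2 * int t..<M + 1}" "\<lambda>n. u k (- n)"]
    by (auto simp: u_nonneg algebra_simps)
  ultimately show ?thesis by linarith
qed

section \<open>Blocks around a point\<close>

text \<open>
  The left end of the block of level \<open>k\<close> that contains \<open>x\<close>; its right end is farther by \<open>2\<^sup>k\<close>.
\<close>

definition block_left :: "nat \<Rightarrow> int \<Rightarrow> int" where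
  "block_left k x = s k + 2 ^ k * ((x - s k) div 2 ^ k)"

lemma block_left_bounds: "block_left k x \<le> x \<and> x < block_left k x + 2 ^ k"
proof -
  have "x - s k = 2 ^ k * ((x - s k) div 2 ^ k) + (x - s k) mod 2 ^ k" by simp
  moreover have "0 \<le> (x - s k) mod 2 ^ k" "(x - s k) mod 2 ^ k < 2 ^ k" by simp_all
  ultimately show ?thesis unfolding block_left_def by linarith
qed

lemma s_grid: "\<exists>i. s (k + j) = s k + 2 ^ k * i"
proof (induction j)
  case 0
  show ?case by (rule exI[of _ 0]) simp
next
  case (Suc j)
  then obtain i where "s (k + j) = s k + 2 ^ k * i" by blast
  then show ?case by (intro exI[of _ "i - 2 ^ j * r (k + j)"]) (simp add: algebra_simps power_add)
qed

lemma block_left_cases: "block_left (Suc k) x = block_left k x \<or> block_left (Suc k) x = block_left k x - 2 ^ k"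
proof -
  obtain i where i: "s (Suc k) = s k + 2 ^ k * i" using s_grid[of k 1] by auto
  define q where "q = i + 2 * ((x - s (Suc k)) div 2 ^ Suc k) - (x - s k) div 2 ^ k"
  have q: "block_left (Suc k) x = block_left k x + 2 ^ k * q"
    unfolding block_left_def i q_def by (simp add: algebra_simps)
  have p: "(0::int) < 2 ^ k" by simp
  have "2 ^ k * q < 2 ^ k * 1" "2 ^ k * (-2) < 2 ^ k * q"
    using q block_left_bounds[of k x] block_left_bounds[of "Suc k" x] by (linarith, simp only: power_Suc, linarith)
  then have "q < 1" "-2 < q" using p mult_less_cancel_left_pos by blast+
  then have "q = 0 \<or> q = -1" by auto
  then show ?thesis using q by auto
qed

definition left_end :: "nat \<Rightarrow> int \<Rightarrow> real" where "left_end k x = 2 ^ k * (f (block_left k x))\<^sup>2"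
definition right_end :: "nat \<Rightarrow> int \<Rightarrow> real" where "right_end k x = 2 ^ k * (f (block_left k x + 2 ^ k))\<^sup>2"

text \<open>
  The mass of the block around \<open>x\<close> is the value of \<open>u k\<close> at its left end plus two boundary terms,
  and each boundary term contains a factor \<open>h\<close> at its own end.
\<close>

lemma block_estimate:
  "(f x)\<^sup>2 \<le> left_end k x + 18 * lam * sqrt F * sqrt (left_end k x) + 18 * lam * sqrt F * sqrt (right_end k x)"
proof -
  define q where "q = (x - s k) div 2 ^ k"
  have B: "\<bar>boundary k m\<bar> \<le> 18 * lam * sqrt F * sqrt (u k m)" for m
  proof -
    have a: "sqrt (2 ^ k) * \<bar>h k n\<bar> = sqrt (u k n)" for n
      by (simp add: u_def real_sqrt_mult)
    have "2 ^ k * (\<bar>h k m\<bar> * (\<bar>h k m\<bar> + \<bar>h k (m - 1)\<bar>)) =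
        (sqrt (2 ^ k) * \<bar>h k m\<bar>) * (sqrt (2 ^ k) * \<bar>h k m\<bar> + sqrt (2 ^ k) * \<bar>h k (m - 1)\<bar>)"
      by (simp add: algebra_simps)
    also have "\<dots> = sqrt (u k m) * (sqrt (u k m) + sqrt (u k (m - 1)))" unfolding a ..
    also have "\<dots> \<le> sqrt (u k m) * (sqrt F + sqrt F)"
      by (intro mult_left_mono add_mono real_sqrt_le_mono u_le) (simp add: u_nonneg)
    finally have "9 * lam * (2 ^ k * (\<bar>h k m\<bar> * (\<bar>h k m\<bar> + \<bar>h k (m - 1)\<bar>)))
        \<le> 9 * lam * (sqrt (u k m) * (sqrt F + sqrt F))"
      using lam1 by (intro mult_left_mono) auto
    then show ?thesis using boundary_bound[of k m] by (simp add: algebra_simps)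
  qed
  have uL: "u k q = left_end k x" "u k (q + 1) = right_end k x"
    by (simp_all add: u_def h_eq left_end_def right_end_def block_left_def q_def algebra_simps)
  have "x \<in> {s k + 2^k * q..<s k + 2^k * (q + 1)}"
    using block_left_bounds[of k x] by (auto simp: block_left_def q_def algebra_simps)
  then have "(f x)\<^sup>2 \<le> (\<Sum>n\<in>{s k + 2^k * q..<s k + 2^k * (q + 1)}. (f n)\<^sup>2)"
    by (intro member_le_sum) auto
  also have "\<dots> = sum (u k) {q..<q+1} + boundary k (q + 1) - boundary k q"
    using block_mass_u[of q "q + 1" k] by simp
  also have "sum (u k) {q..<q+1} = u k q" 
  proof -
    have "{q..<q+1} = {q}" by auto
    then show ?thesis by simp
  qed
  finally show ?thesis using B[of q] B[of "q + 1"] unfolding uL by linarith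
qed

lemma decay_power: "e > 0 \<Longrightarrow> \<exists>j. 2 ^ (j + 2) * (decay ^ (2 ^ j - 1) * F) < e"
proof -
  assume e: "e > 0"
  have th: "0 < decay" "decay < 1" using lam1 by (auto simp: divide_simps)
  have L: "(\<lambda>n. real n * decay ^ n) \<longlonglongrightarrow> 0"
    using powser_times_n_limit_0[of decay] th by (simp only: real_norm_def abs_of_pos)
  have "filterlim (\<lambda>j::nat. (2::nat) ^ j) at_top sequentially"
    by (rule filterlim_at_top_mono[OF filterlim_ident]) (auto intro!: always_eventually simp: less_imp_le)
  from filterlim_compose[OF L this]
  have "(\<lambda>j. real (2 ^ j) * decay ^ (2 ^ j)) \<longlonglongrightarrow> 0" .
  then have "(\<lambda>j. 4 * F / decay * (real (2 ^ j) * decay ^ (2 ^ j))) \<longlonglongrightarrow> 4 * F / decay * 0"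
    by (intro tendsto_intros)
  then have "(\<lambda>j. 4 * F / decay * (real (2 ^ j) * decay ^ (2 ^ j))) \<longlonglongrightarrow> 0" by simp
  then have "\<forall>\<^sub>F j in sequentially. 4 * F / decay * (real (2 ^ j) * decay ^ (2 ^ j)) < e"
    using e by (rule order_tendstoD(2))
  then obtain j where j: "4 * F / decay * (real (2 ^ j) * decay ^ (2 ^ j)) < e"
    unfolding eventually_sequentially by blast
  have "decay ^ (2 ^ j) = decay ^ (2 ^ j - 1) * decay"
    by (metis power_Suc2 Suc_diff_1 pos2 zero_less_power)
  moreover have "4 * F / t * (real (2 ^ j) * (a * t)) = 2 ^ (j + 2) * (a * F)" if "t > 0" for a t :: real
    using that by (simp add: field_simps)
  ultimately have "4 * F / decay * (real (2 ^ j) * decay ^ (2 ^ j)) = 2 ^ (j + 2) * (decay ^ (2 ^ j - 1) * F)"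
    using th(1) by metis
  then show ?thesis using j by (intro exI[of _ j]) simp
qed

text \<open>
  When the left end moves from level \<open>k\<close> to level \<open>k + 1\<close>, it moves by \<open>2\<^sup>k\<close>, to the left of a point that is already
  far out.  On the finer level \<open>k - j - 1\<close> these are \<open>2\<^bsup>j+1\<^esup>\<close> steps, enough for the geometric decay to beat the
  factor \<open>2\<^bsup>j+2\<^esup>\<close> between the weights of the two levels.
\<close>

lemma left_end_small:
  assumes inf: "\<And>K. \<exists>k\<ge>K. block_left (Suc k) x \<noteq> block_left k x" and e: "e > 0"
  shows "\<exists>K. \<forall>k\<ge>K. block_left (Suc k) x \<noteq> block_left k x \<longrightarrow> left_end (Suc k) x \<le> e"
proof -
  obtain j where j: "2 ^ (j + 2) * (decay ^ (2 ^ j - 1) * F) < e / 2" using decay_power[of "e/2"] e by auto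
  define d where "d = e / 2 ^ (j + 4)"
  have d: "d > 0" using e by (simp add: d_def)
  obtain R where R: "R \<ge> 0" "\<And>A. finite A \<Longrightarrow> A \<inter> {-R..R} = {} \<Longrightarrow> (\<Sum>n\<in>A. (f n)\<^sup>2) \<le> d"
    using small_outside[OF d] by blast
  have anti: "block_left (Suc k) x \<le> block_left k x" for k using block_left_cases[of k x] by auto
  have far: "\<exists>K. block_left K x \<le> x - int n" for n
  proof (induction n)
    case 0
    show ?case using block_left_bounds[of 0 x] by auto
  next
    case (Suc n)
    then obtain K where K: "block_left K x \<le> x - int n" by blast
    obtain k where k: "k \<ge> K" "block_left (Suc k) x \<noteq> block_left k x" using inf by blast
    have "block_left k x \<le> block_left K x" using k(1) anti by (rule lift_Suc_antimono_le[rotated])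
    moreover have "block_left (Suc k) x \<le> block_left k x - 1" using k(2) anti[of k] by linarith
    ultimately show ?case using K by (intro exI[of _ "Suc k"]) simp
  qed
  obtain K0 where K0: "block_left K0 x \<le> x - int (nat (\<bar>x\<bar> + R))" using far by blast
  have K0': "block_left k x \<le> - R" if "k \<ge> K0" for k
    using lift_Suc_antimono_le[of "\<lambda>k. block_left k x", OF anti that] K0 by linarith
  show ?thesis
  proof (intro exI allI impI)
    fix k assume k: "k \<ge> K0 + j + 1" and ne: "block_left (Suc k) x \<noteq> block_left k x"
    \<comment> \<open>The finer level on which the move of the end is resolved.\<close>
    define l where "l = k - j - 1"
    have kl: "k = l + (j + 1)" using k by (simp add: l_def)
    define q where "q = (x - s k) div 2 ^ k"
    obtain i where i: "s k = s l + 2 ^ l * i" using s_grid[of l "j + 1"] kl by auto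
    define m0 where "m0 = i + 2 ^ (j + 1) * q"
    have pk: "(2::int) ^ k = 2 ^ l * 2 ^ (j + 1)" unfolding kl by (rule power_add)
    have "block_left k x = s k + 2 ^ k * q" by (simp add: block_left_def q_def)
    then have m0: "block_left k x = s l + 2 ^ l * m0" unfolding i m0_def pk by (simp add: algebra_simps)
    have "block_left (Suc k) x = block_left k x - 2 ^ k" using ne block_left_cases[of k x] by auto
    then have m1: "block_left (Suc k) x = s l + 2 ^ l * (m0 - 2 ^ (j + 1))"
      using m0 by (simp add: kl power_add algebra_simps)
    have t: "m0 - 1 - 2 * int (2 ^ j - 1) = m0 - 2 ^ (j + 1) + 1"
      by (simp add: of_nat_diff algebra_simps)
    have "u l ((m0 - 1) - 1 - 2 * int (2 ^ j - 1)) \<le> decay ^ (2 ^ j - 1) * F + 2 * d"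
    proof (rule left_decay[OF d])
      fix A assume A: "finite A" "A \<subseteq> {..<s l + 2 ^ l * (m0 - 1)}"
      have "s l + 2 ^ l * (m0 - 1) \<le> - R" using m0 K0'[of k] k by (simp add: algebra_simps) (smt (verit) zero_less_power)
      then show "(\<Sum>n\<in>A. (f n)\<^sup>2) \<le> d" using A by (intro R(2)) auto
    qed
    moreover have "(m0 - 1) - 1 - 2 * int (2 ^ j - 1) = m0 - 2 ^ (j + 1)" using t by simp
    ultimately have "u l (m0 - 2 ^ (j + 1)) \<le> decay ^ (2 ^ j - 1) * F + 2 * d" by simp
    moreover have "left_end (Suc k) x = 2 ^ (j + 2) * u l (m0 - 2 ^ (j + 1))"
      unfolding left_end_def u_def h_eq m1[symmetric] by (simp add: kl power_add)
    ultimately have "left_end (Suc k) x \<le> 2 ^ (j + 2) * (decay ^ (2 ^ j - 1) * F + 2 * d)"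
      by (simp only: mult_le_cancel_left_pos zero_less_power zero_less_numeral)
    also have "\<dots> \<le> e" using j by (simp add: d_def power_add algebra_simps)
    finally show "left_end (Suc k) x \<le> e" .
  qed
qed

text \<open>
  The mirror image of \<open>left_end_small\<close>: the right end moves exactly when the left end stays.
\<close>

lemma right_end_small:
  assumes inf: "\<And>K. \<exists>k\<ge>K. block_left (Suc k) x = block_left k x" and e: "e > 0"
  shows "\<exists>K. \<forall>k\<ge>K. block_left (Suc k) x = block_left k x \<longrightarrow> right_end (Suc k) x \<le> e"
proof -
  obtain j where j: "2 ^ (j + 2) * (decay ^ (2 ^ j - 1) * F) < e / 2" using decay_power[of "e/2"] e by auto
  define d where "d = e / 2 ^ (j + 4)"
  have d: "d > 0" using e by (simp add: d_def)
  obtain R where R: "R \<ge> 0" "\<And>A. finite A \<Longrightarrow> A \<inter> {-R..R} = {} \<Longrightarrow> (\<Sum>n\<in>A. (f n)\<^sup>2) \<le> d"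
    using small_outside[OF d] by blast
  define rgt where "rgt k = block_left k x + 2 ^ k" for k
  have rgt_cases: "rgt (Suc k) = rgt k \<or> block_left (Suc k) x = block_left k x \<and> rgt (Suc k) = rgt k + 2 ^ k" for k
    using block_left_cases[of k x] by (auto simp: rgt_def)
  have mono: "rgt k \<le> rgt (Suc k)" for k using rgt_cases[of k] by auto
  have far: "\<exists>K. x + int n \<le> rgt K" for n
  proof (induction n)
    case 0
    show ?case using block_left_bounds[of 0 x] by (intro exI[of _ 0]) (auto simp: rgt_def)
  next
    case (Suc n)
    then obtain K where K: "x + int n \<le> rgt K" by blast
    obtain k where k: "k \<ge> K" "block_left (Suc k) x = block_left k x" using inf by blast
    have "rgt K \<le> rgt k" using k(1) mono by (rule lift_Suc_mono_le[rotated])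
    moreover have "rgt k + 1 \<le> rgt (Suc k)" using k(2) by (simp add: rgt_def)
    ultimately show ?case using K by (intro exI[of _ "Suc k"]) simp
  qed
  obtain K0 where K0: "x + int (nat (\<bar>x\<bar> + R + 1)) \<le> rgt K0" using far by blast
  have K0': "R + 1 \<le> rgt k" if "k \<ge> K0" for k
    using lift_Suc_mono_le[of rgt, OF mono that] K0 by linarith
  show ?thesis
  proof (intro exI allI impI)
    fix k assume k: "k \<ge> K0 + j + 1" and ne: "block_left (Suc k) x = block_left k x"
    \<comment> \<open>The finer level on which the move of the end is resolved.\<close>
    define l where "l = k - j - 1"
    have kl: "k = l + (j + 1)" using k by (simp add: l_def)
    define q where "q = (x - s k) div 2 ^ k"
    obtain i where i: "s k = s l + 2 ^ l * i" using s_grid[of l "j + 1"] kl by auto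
    define m0 where "m0 = i + 2 ^ (j + 1) * (q + 1)"
    have pk: "(2::int) ^ k = 2 ^ l * 2 ^ (j + 1)" unfolding kl by (rule power_add)
    have "rgt k = s k + 2 ^ k * (q + 1)" by (simp add: rgt_def block_left_def q_def algebra_simps)
    then have m0: "rgt k = s l + 2 ^ l * m0" unfolding i m0_def pk by (simp add: algebra_simps)
    have "rgt (Suc k) = rgt k + 2 ^ k" using ne by (simp add: rgt_def)
    then have m1: "rgt (Suc k) = s l + 2 ^ l * (m0 + 2 ^ (j + 1))"
      using m0 by (simp add: kl power_add algebra_simps)
    have t: "(m0 + 2) + 2 * int (2 ^ j - 1) = m0 + 2 ^ (j + 1)"
      by (simp add: of_nat_diff algebra_simps)
    have "u l ((m0 + 2) + 2 * int (2 ^ j - 1)) \<le> decay ^ (2 ^ j - 1) * F + 2 * d"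
    proof (rule right_decay[OF d])
      fix A assume A: "finite A" "A \<subseteq> {s l + 2 ^ l * (m0 + 2)..}"
      have "R + 1 \<le> s l + 2 ^ l * (m0 + 2)" using m0 K0'[of k] k by (simp add: algebra_simps) (smt (verit) zero_less_power)
      then show "(\<Sum>n\<in>A. (f n)\<^sup>2) \<le> d" using A by (intro R(2)) auto
    qed
    then have "u l (m0 + 2 ^ (j + 1)) \<le> decay ^ (2 ^ j - 1) * F + 2 * d" unfolding t .
    moreover have "right_end (Suc k) x = 2 ^ (j + 2) * u l (m0 + 2 ^ (j + 1))"
      unfolding right_end_def u_def h_eq m1[symmetric] by (simp add: kl power_add rgt_def)
    ultimately have "right_end (Suc k) x \<le> 2 ^ (j + 2) * (decay ^ (2 ^ j - 1) * F + 2 * d)"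
      by (simp only: mult_le_cancel_left_pos zero_less_power zero_less_numeral)
    also have "\<dots> \<le> e" using j by (simp add: d_def power_add algebra_simps)
    finally show "right_end (Suc k) x \<le> e" .
  qed
qed

text \<open>
  An end that no longer moves carries a weight \<open>2\<^sup>k\<close> that grows without bound, while the weighted value is bounded.
\<close>

lemma constant_site_zero:
  assumes "\<And>k. k \<ge> K \<Longrightarrow> 2 ^ k * (f n)\<^sup>2 \<le> F"
  shows "f n = 0"
proof (rule ccontr)
  assume "f n \<noteq> 0"
  then have p: "(f n)\<^sup>2 > 0" by simp
  obtain k where k: "F / (f n)\<^sup>2 < 2 ^ k" using real_arch_pow[of 2 "F / (f n)\<^sup>2"] by auto
  have "(2::real) ^ k \<le> 2 ^ (K + k)" by (simp add: power_increasing)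
  then have "F / (f n)\<^sup>2 < 2 ^ (K + k)" using k by linarith
  then have "F < 2 ^ (K + k) * (f n)\<^sup>2" using p by (simp add: pos_divide_less_eq)
  then show False using assms[of "K + k"] by simp
qed

lemma left_end_le: "left_end k x \<le> F" and right_end_le: "right_end k x \<le> F"
proof -
  define q where "q = (x - s k) div 2 ^ k"
  have "u k q = left_end k x" "u k (q + 1) = right_end k x"
    by (simp_all add: u_def h_eq left_end_def right_end_def block_left_def q_def algebra_simps)
  then show "left_end k x \<le> F" "right_end k x \<le> F" using u_le by metis+
qed

text \<open>
  If one end is eventually constant, \<open>f\<close> vanishes there and the other end moves at every level.  Otherwise
  take a level at which the left end moves right after one at which the right end moved: the left value is
  small, and the right value, small at the previous level, has only doubled.
\<close>

lemma ends_small: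
  assumes e: "e > 0"
  shows "\<exists>k. left_end k x \<le> 2 * e \<and> right_end k x \<le> 2 * e"
proof (cases "\<exists>K. \<forall>k\<ge>K. block_left (Suc k) x = block_left k x")
  case True
  then obtain K where K: "\<And>k. k \<ge> K \<Longrightarrow> block_left (Suc k) x = block_left k x" by blast
  have cst: "block_left k x = block_left K x" if "k \<ge> K" for k
    using that by (induction rule: dec_induct) (auto simp: K)
  have "f (block_left K x) = 0"
  proof (rule constant_site_zero)
    fix k assume "k \<ge> K"
    then show "2 ^ k * (f (block_left K x))\<^sup>2 \<le> F" using left_end_le[of k x] cst[of k] by (simp add: left_end_def)
  qed
  then have L0: "left_end k x = 0" if "k \<ge> K" for k using cst[OF that] by (simp add: left_end_def)
  obtain K' where "\<forall>k\<ge>K'. block_left (Suc k) x = block_left k x \<longrightarrow> right_end (Suc k) x \<le> e"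
    using right_end_small[OF _ e, of x] K by (meson nle_le)
  then have "right_end (Suc (max K K')) x \<le> e" using K[of "max K K'"] by auto
  then show ?thesis using L0[of "Suc (max K K')"] e by (intro exI[of _ "Suc (max K K')"]) auto
next
  case nF: False
  show ?thesis
  proof (cases "\<exists>K. \<forall>k\<ge>K. block_left (Suc k) x \<noteq> block_left k x")
    case True
    then obtain K where K: "\<And>k. k \<ge> K \<Longrightarrow> block_left (Suc k) x \<noteq> block_left k x" by blast
    have step: "block_left (Suc k) x + 2 ^ Suc k = block_left k x + 2 ^ k" if "k \<ge> K" for k
      using K[OF that] block_left_cases[of k x] by auto
    have cst: "block_left k x + 2 ^ k = block_left K x + 2 ^ K" if "k \<ge> K" for k
      using that by (induction rule: dec_induct) (auto simp: step simp del: power_Suc)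
    have "f (block_left K x + 2 ^ K) = 0"
    proof (rule constant_site_zero)
      fix k assume "k \<ge> K"
      then show "2 ^ k * (f (block_left K x + 2 ^ K))\<^sup>2 \<le> F" using right_end_le[of k x] cst[of k] by (simp add: right_end_def)
    qed
    then have R0: "right_end k x = 0" if "k \<ge> K" for k using cst[OF that] by (simp add: right_end_def)
    obtain K' where "\<forall>k\<ge>K'. block_left (Suc k) x \<noteq> block_left k x \<longrightarrow> left_end (Suc k) x \<le> e"
      using left_end_small[OF _ e, of x] K by (meson nle_le)
    then have "left_end (Suc (max K K')) x \<le> e" using K[of "max K K'"] by auto
    then show ?thesis using R0[of "Suc (max K K')"] e by (intro exI[of _ "Suc (max K K')"]) auto
  next
    case nT: False
    have "\<exists>K. \<forall>k\<ge>K. block_left (Suc k) x \<noteq> block_left k x \<longrightarrow> left_end (Suc k) x \<le> e"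
      by (rule left_end_small[OF _ e]) (use nF in blast)
    then obtain K1 where K1: "\<And>k. k \<ge> K1 \<Longrightarrow> block_left (Suc k) x \<noteq> block_left k x \<Longrightarrow> left_end (Suc k) x \<le> e" by blast
    have "\<exists>K. \<forall>k\<ge>K. block_left (Suc k) x = block_left k x \<longrightarrow> right_end (Suc k) x \<le> e"
      by (rule right_end_small[OF _ e]) (use nT in blast)
    then obtain K2 where K2: "\<And>k. k \<ge> K2 \<Longrightarrow> block_left (Suc k) x = block_left k x \<Longrightarrow> right_end (Suc k) x \<le> e" by blast
    \<comment> \<open>From a level \<open>a\<close> at which the left end stays, go on to the first level \<open>B\<close> at which it moves.\<close>
    obtain a where a: "a \<ge> max K1 K2" "block_left (Suc a) x = block_left a x" using nT by blast
    define P where "P b \<longleftrightarrow> b \<ge> a \<and> block_left (Suc b) x \<noteq> block_left b x" for b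
    have "\<exists>b. P b" using nF unfolding P_def by blast
    then obtain B where b: "P B" and least: "\<And>b. P b \<Longrightarrow> B \<le> b" by (metis LeastI Least_le)
    have "B \<noteq> a" "a \<le> B" using b a(2) unfolding P_def by auto
    then obtain b' where b': "B = Suc b'" "b' \<ge> a" by (cases B) auto
    have eqb: "block_left (Suc b') x = block_left b' x" using least[of b'] b' unfolding P_def by auto
    then have "right_end (Suc b') x \<le> e" using K2[of b'] b'(2) a(1) by auto
    have ne: "block_left (Suc (Suc b')) x \<noteq> block_left (Suc b') x" using b b' unfolding P_def by auto
    then have "left_end (Suc (Suc b')) x \<le> e" using K1[of "Suc b'"] b'(2) a(1) by auto
    moreover have "block_left (Suc (Suc b')) x + 2 ^ Suc (Suc b') = block_left (Suc b') x + 2 ^ Suc b'"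
      using ne block_left_cases[of "Suc b'" x] by auto
    then have "right_end (Suc (Suc b')) x = 2 ^ Suc (Suc b') * (f (block_left (Suc b') x + 2 ^ Suc b'))\<^sup>2"
      by (simp only: right_end_def)
    then have "right_end (Suc (Suc b')) x = 2 * right_end (Suc b') x" by (simp add: right_end_def)
    ultimately show ?thesis using \<open>right_end (Suc b') x \<le> e\<close> e by (intro exI[of _ "Suc (Suc b')"]) auto
  qed
qed

theorem solution_zero: "f x = 0"
proof -
  define C where "C = 36 * lam * sqrt F"
  have C: "C \<ge> 0" using lam1 F_nonneg by (simp add: C_def)
  have "(f x)\<^sup>2 \<le> 0 + d" if d: "d > 0" for d
  proof -
    \<comment> \<open>Chosen such that each of the three terms of \<open>block_estimate\<close> is at most a fraction of \<open>d\<close>.\<close>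
    define e where "e = min (d / 4) ((d / (4 * (C + 1)))\<^sup>2 / 2)"
    have e: "e > 0" using d C by (auto simp: e_def)
    obtain k where k: "left_end k x \<le> 2 * e" "right_end k x \<le> 2 * e" using ends_small[OF e] by blast
    have se: "sqrt (2 * e) \<le> d / (4 * (C + 1))"
      by (rule real_le_lsqrt) (use d C in \<open>auto simp: e_def\<close>)
    have "sqrt (left_end k x) \<le> sqrt (2 * e)" "sqrt (right_end k x) \<le> sqrt (2 * e)" using k by auto
    then have "sqrt (left_end k x) \<le> d / (4 * (C + 1))" "sqrt (right_end k x) \<le> d / (4 * (C + 1))" using se by linarith+
    then have "C / 2 * sqrt (left_end k x) \<le> C / 2 * (d / (4 * (C + 1)))" "C / 2 * sqrt (right_end k x) \<le> C / 2 * (d / (4 * (C + 1)))"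
      using C by (auto intro!: mult_left_mono simp del: times_divide_eq_right)
    moreover have "C / 2 * (d / (4 * (C + 1))) \<le> d / 8" using C d by (simp add: field_simps)
    moreover have "2 * e \<le> d / 2" by (auto simp: e_def)
    moreover have "(f x)\<^sup>2 \<le> left_end k x + C / 2 * sqrt (left_end k x) + C / 2 * sqrt (right_end k x)"
      using block_estimate[of x k] by (simp add: C_def)
    ultimately have "(f x)\<^sup>2 \<le> d" using k(1) d by linarith
    then show ?thesis by simp
  qed
  then have "(f x)\<^sup>2 \<le> 0" by (rule field_le_epsilon)
  then show ?thesis by simp
qed

end

section \<open>The orthonormal polynomials on the real line\<close>

lemma poly_map_Re: "poly (map_poly Re q) x = Re (poly q (of_real x))"
  by (induction q) (auto simp: map_poly_pCons)

text \<open>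
  The equilibrium measure, the orthonormal polynomials and their coefficients are moved to the real line, where
  the results on the energy and on invariant functionals apply.
\<close>

locale julia_polys = quadratic_julia lam for lam +
  fixes \<mu> :: "complex measure" and p :: "nat \<Rightarrow> complex poly" and a :: "nat \<Rightarrow> real"
  assumes eq: "equilibrium_measure (julia_set lam) \<mu>"
    and on: "orthonormal_polys \<mu> p"
    and rc: "recurrence_coeffs p a"
begin

text \<open>The equilibrium measure, regarded as a measure on the line.\<close>

definition m :: "real measure" where "m = distr \<mu> borel Re"

lemma m_adm: "admissible m" and mu_m: "\<mu> = distr m borel complex_of_real"
  and m_odd: "(LINT x|m. x ^ (2 * j + 1)) = 0" and m_even: "(LINT x|m. x ^ (2 * j)) = (LINT x|m. (x + lam) ^ j)"
  using equilibrium_moments[OF eq] unfolding m_def by auto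

lemma sm [measurable_cong]: "sets m = sets borel" and AE_real_julia: "AE x in m. x \<in> real_julia"
  using m_adm by (auto simp: admissible_def)

sublocale mp: prob_space m using m_adm by (simp add: admissible_def)

lemma integrable_m:
  fixes g :: "real \<Rightarrow> real"
  assumes g: "continuous_on UNIV g"
  shows "integrable m g"
proof -
  have "compact (g ` {-beta..beta})" by (intro compact_continuous_image continuous_on_subset[OF g]) auto
  then obtain C where C: "\<And>y. y \<in> g ` {-beta..beta} \<Longrightarrow> norm y \<le> C" using compact_imp_bounded bounded_iff by metis
  have [measurable]: "g \<in> borel_measurable borel" using g by (rule borel_measurable_continuous_onI)
  have "AE x in m. norm (g x) \<le> C" using AE_real_julia
  proof eventually_elim
    case (elim x)
    then have "x \<in> {-beta..beta}" using real_julia_abs[of x] by (auto simp: abs_le_iff)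
    then show ?case using C by blast
  qed
  then show ?thesis by (rule mp.integrable_const_bound) measurable
qed

definition P :: "nat \<Rightarrow> real poly" where "P n = map_poly Re (p n)"

lemma a0: "a 0 = 0" and a_pos: "n \<ge> 1 \<Longrightarrow> a n > 0"
  and rec_c: "[:0, 1:] * p n = smult (of_real (a n)) (p (n - 1)) + smult (of_real (a (n + 1))) (p (n + 1))"
proof -
  show a0: "a 0 = 0" using rc by (simp add: recurrence_coeffs_def)
  show "n \<ge> 1 \<Longrightarrow> a n > 0" using rc by (simp add: recurrence_coeffs_def)
  show "[:0, 1:] * p n = smult (of_real (a n)) (p (n - 1)) + smult (of_real (a (n + 1))) (p (n + 1))"
  proof (cases "n = 0")
    case True
    have "[:0, 1:] * p 0 = smult (of_real (a 1)) (p 1)" using rc unfolding recurrence_coeffs_def by blast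
    then show ?thesis using True a0 by simp
  next
    case False
    then have "n \<ge> 1" by simp
    then show ?thesis using rc unfolding recurrence_coeffs_def by blast
  qed
qed

lemma rec_eval: "of_real x * poly (p n) (of_real x) =
   of_real (a n) * poly (p (n - 1)) (of_real x) + of_real (a (n + 1)) * poly (p (n + 1)) (of_real x)"
  using arg_cong[OF rec_c[of n], of "\<lambda>q. poly q (of_real x)"] by simp

lemma degp: "degree (p n) = n" and lcp: "\<exists>c>0. lead_coeff (p n) = of_real c"
  using on unfolding orthonormal_polys_def by blast+

text \<open>
  The recurrence determines all polynomials from the constant \<open>p 0\<close>, and its coefficients are real.
\<close>

lemma Im_p: "Im (poly (p n) (of_real x)) = 0"
proof -
  have "Im (poly (p n) (of_real x)) = 0 \<and> Im (poly (p (Suc n)) (of_real x)) = 0"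
  proof (induction n)
    case 0
    obtain c where c: "lead_coeff (p 0) = of_real c" using lcp by blast
    have "p 0 = [:coeff (p 0) 0:]" using degp[of 0] by (metis degree_eq_zeroE coeff_pCons_0)
    then have "poly (p 0) (of_real x) = of_real c" using c degp[of 0] by (metis mult_zero_right add.right_neutral poly_0 poly_pCons)
    then have z: "Im (poly (p 0) (of_real x)) = 0" by simp
    have "x * Im (poly (p 0) (of_real x)) = a 0 * Im (poly (p (0 - 1)) (of_real x)) + a (0 + 1) * Im (poly (p (0 + 1)) (of_real x))"
      using arg_cong[OF rec_eval[of x 0], of Im] by simp
    then have "a 1 * Im (poly (p 1) (of_real x)) = 0" using z a0 by simp
    then show ?case using z a_pos[of 1] by simp
  next
    case (Suc n)
    have "x * Im (poly (p (Suc n)) (of_real x)) = a (Suc n) * Im (poly (p n) (of_real x)) + a (Suc (Suc n)) * Im (poly (p (Suc (Suc n))) (of_real x))"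
      using arg_cong[OF rec_eval[of x "Suc n"], of Im] by simp
    then show ?case using Suc a_pos[of "Suc (Suc n)"] by simp
  qed
  then show ?thesis by simp
qed

lemma p_P: "poly (p n) (of_real x) = of_real (poly (P n) x)"
  unfolding P_def poly_map_Re using Im_p[of n x] by (simp add: complex_eq_iff)

lemma coeff_P: "coeff (P n) i = Re (coeff (p n) i)" by (simp add: P_def coeff_map_poly)

lemma degP: "degree (P n) = n"
proof (rule antisym)
  show "degree (P n) \<le> n" by (intro degree_le allI impI) (simp add: coeff_P coeff_eq_0 degp)
  obtain c where "c > 0" "lead_coeff (p n) = of_real c" using lcp by blast
  then have "coeff (P n) n \<noteq> 0" using degp[of n] by (simp add: coeff_P)
  then show "n \<le> degree (P n)" by (rule le_degree)
qed

lemma lcP: "lead_coeff (P n) > 0"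
proof -
  obtain c where "c > 0" "lead_coeff (p n) = of_real c" using lcp by blast
  then show ?thesis using degp[of n] by (simp add: coeff_P degP)
qed

lemma rec_P: "x * poly (P n) x = a n * poly (P (n - 1)) x + a (n + 1) * poly (P (n + 1)) x"
  using rec_eval[of x n] unfolding p_P of_real_mult[symmetric] of_real_add[symmetric] of_real_eq_iff .

lemma orthP: "(LINT x|m. poly (P k) x * poly (P n) x) = (if k = n then 1 else 0)"
proof -
  have "(LINT z|\<mu>. poly (p k) z * cnj (poly (p n) z)) = (LINT x|m. poly (p k) (of_real x) * cnj (poly (p n) (of_real x)))"
    by (subst mu_m, rule integral_distr) (auto intro!: borel_measurable_continuous_onI continuous_intros)
  also have "\<dots> = (LINT x|m. complex_of_real (poly (P k) x * poly (P n) x))" unfolding p_P by simp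
  also have "\<dots> = complex_of_real (LINT x|m. poly (P k) x * poly (P n) x)" by (rule integral_complex_of_real)
  finally have "complex_of_real (LINT x|m. poly (P k) x * poly (P n) x) = (if k = n then 1 else 0)"
    using on by (simp add: orthonormal_polys_def)
  then show ?thesis by (metis of_real_1 of_real_0 of_real_eq_iff)
qed

lemma even_integral: "(LINT x|m. poly q (x\<^sup>2)) = (LINT x|m. poly q (x + lam))"
proof -
  have "(LINT x|m. poly q (x\<^sup>2)) = (LINT x|m. (\<Sum>i\<le>degree q. coeff q i * x ^ (2 * i)))"
    by (simp add: poly_altdef power_mult)
  also have "\<dots> = (\<Sum>i\<le>degree q. LINT x|m. coeff q i * x ^ (2 * i))"
    by (intro Bochner_Integration.integral_sum integrable_m continuous_intros)
  also have "\<dots> = (\<Sum>i\<le>degree q. LINT x|m. coeff q i * (x + lam) ^ i)"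
    by (simp add: m_even)
  also have "\<dots> = (LINT x|m. (\<Sum>i\<le>degree q. coeff q i * (x + lam) ^ i))"
    by (intro Bochner_Integration.integral_sum[symmetric] integrable_m continuous_intros)
  also have "\<dots> = (LINT x|m. poly q (x + lam))" by (simp add: poly_altdef)
  finally show ?thesis .
qed

lemma odd_integral: "(LINT x|m. x * poly q (x\<^sup>2)) = 0"
proof -
  have "(LINT x|m. x * poly q (x\<^sup>2)) = (LINT x|m. (\<Sum>i\<le>degree q. coeff q i * x ^ (2 * i + 1)))"
  proof -
    have "x * poly q (x\<^sup>2) = (\<Sum>i\<le>degree q. coeff q i * x ^ (2 * i + 1))" for x
      unfolding poly_altdef sum_distrib_left by (intro sum.cong refl) (simp add: power_mult mult.left_commute)
    then show ?thesis by simp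
  qed
  also have "\<dots> = (\<Sum>i\<le>degree q. LINT x|m. coeff q i * x ^ (2 * i + 1))"
    by (intro Bochner_Integration.integral_sum integrable_m continuous_intros)
  also have "\<dots> = 0" using m_odd by simp
  finally show ?thesis .
qed

sublocale iop: invariant_orthonormal_polys "\<lambda>q. LINT x|m. poly q x" P a lam
proof
  have ip: "integrable m (poly q)" for q by (intro integrable_m continuous_intros)
  show "(LINT x|m. poly (q1 + q2) x) = (LINT x|m. poly q1 x) + (LINT x|m. poly q2 x)" for q1 q2
    using ip by simp
  show "(LINT x|m. poly (smult c q) x) = c * (LINT x|m. poly q x)" for c q by simp
  have comp: "poly (q \<circ>\<^sub>p [:-lam, 0, 1:]) x = poly (q \<circ>\<^sub>p [:-lam, 1:]) (x\<^sup>2)" for q x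
    by (simp add: poly_pcompose power2_eq_square algebra_simps)
  show "(LINT x|m. poly (q \<circ>\<^sub>p [:-lam, 0, 1:]) x) = (LINT x|m. poly q x)" for q
    unfolding comp even_integral by (simp add: poly_pcompose)
  show "(LINT x|m. poly ([:0, 1:] * (q \<circ>\<^sub>p [:-lam, 0, 1:])) x) = 0" for q
    using odd_integral[of "q \<circ>\<^sub>p [:-lam, 1:]"] by (simp add: comp[symmetric])
  show "(LINT x|m. poly (P k * P n) x) = (if k = n then 1 else 0)" for k n using orthP by simp
  show "degree (P n) = n" for n by (rule degP)
  show "lead_coeff (P n) > 0" for n by (rule lcP)
  show "a 0 = 0" by (rule a0)
  show "[:0, 1:] * P n = smult (a n) (P (n - 1)) + smult (a (n + 1)) (P (n + 1))" for n
    unfolding poly_eq_poly_eq_iff[symmetric] using rec_P[of _ n] by (intro ext) simp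
qed

sublocale ds: doubling_sequence a lam
proof
  show "lam > 3" by (rule lam)
  show "a 0 = 0" by (rule a0)
  show "0 \<le> a n" for n using a0 a_pos[of n] by (cases "n = 0") auto
  show "(a (2 * n))\<^sup>2 + (a (2 * n + 1))\<^sup>2 = lam" for n by (rule iop.coeff_sum)
  show "a (2 * n) * a (2 * n - 1) = a n" if "n \<ge> 1" for n using that by (rule iop.coeff_product)
qed

section \<open>Moments of finitely supported vectors\<close>

definition half_line_jac :: "(nat \<Rightarrow> complex) \<Rightarrow> nat \<Rightarrow> complex" where
  "half_line_jac g l = of_real (a (l + 1)) * g (l + 1) + of_real (a l) * g (l - 1)"

definition poly_comb :: "nat \<Rightarrow> (nat \<Rightarrow> complex) \<Rightarrow> real \<Rightarrow> complex" where
  "poly_comb B g x = (\<Sum>l<B. g l * of_real (poly (P l) x))"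

lemma poly_comb_shift:
  assumes g: "\<And>l. l \<ge> B \<Longrightarrow> g l = 0"
  shows "of_real x * poly_comb B g x = poly_comb (Suc B) (half_line_jac g) x" "\<And>l. l \<ge> Suc B \<Longrightarrow> half_line_jac g l = 0"
proof -
  define F where "F l = of_real (a l) * g l * of_real (poly (P (l - 1)) x)" for l
  define G where "G l = of_real (a (l + 1)) * g l * of_real (poly (P (l + 1)) x)" for l
  have "of_real x * poly_comb B g x = (\<Sum>l<B. g l * of_real (x * poly (P l) x))"
    by (simp add: poly_comb_def sum_distrib_left mult_ac)
  also have "\<dots> = (\<Sum>l<B. F l + G l)" unfolding rec_P by (simp add: F_def G_def algebra_simps)
  also have "\<dots> = (\<Sum>l<B. F l) + (\<Sum>l<B. G l)" by (rule sum.distrib)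
  also have "(\<Sum>l<B. F l) = (\<Sum>l<Suc (Suc B). F l)" using g by (simp add: F_def)
  also have "\<dots> = (\<Sum>l<Suc B. F (Suc l))" by (subst sum.lessThan_Suc_shift) (simp add: F_def a0)
  also have "(\<Sum>l<B. G l) = (\<Sum>l<Suc B. of_real (a l) * g (l - 1) * of_real (poly (P l) x))"
    by (subst sum.lessThan_Suc_shift) (simp add: G_def a0)
  also have "(\<Sum>l<Suc B. F (Suc l)) + (\<Sum>l<Suc B. of_real (a l) * g (l - 1) * of_real (poly (P l) x)) = poly_comb (Suc B) (half_line_jac g) x"
    unfolding poly_comb_def sum.distrib[symmetric] by (intro sum.cong refl) (simp add: F_def half_line_jac_def algebra_simps)
  finally show "of_real x * poly_comb B g x = poly_comb (Suc B) (half_line_jac g) x" .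
  show "half_line_jac g l = 0" if "l \<ge> Suc B" for l using g[of "l + 1"] g[of "l - 1"] that by (simp add: half_line_jac_def)
qed

lemma poly_comb_pow:
  assumes g: "\<And>l. l \<ge> B \<Longrightarrow> g l = 0"
  shows "of_real x ^ i * poly_comb B g x = poly_comb (B + i) ((half_line_jac ^^ i) g) x \<and> (\<forall>l\<ge>B + i. (half_line_jac ^^ i) g l = 0)"
proof (induction i)
  case 0
  show ?case using g by simp
next
  case (Suc i)
  have "of_real x ^ Suc i * poly_comb B g x = of_real x * poly_comb (B + i) ((half_line_jac ^^ i) g) x" using Suc by (simp add: mult.assoc)
  then show ?case using Suc poly_comb_shift(1)[of "B + i" "(half_line_jac ^^ i) g" x] poly_comb_shift(2)[of "B + i" "(half_line_jac ^^ i) g"] by auto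
qed

lemma poly_comb_continuous: "continuous_on UNIV (poly_comb B g)"
  unfolding poly_comb_def by (intro continuous_intros)

text \<open>
  Multiplication by \<open>x\<close> acts on the coefficients of a combination of the \<open>P l\<close> as the half-line Jacobi
  matrix, and orthonormality turns the integral into an inner product.
\<close>

lemma moment_poly_comb:
  assumes g: "\<And>l. l \<ge> B \<Longrightarrow> g l = 0"
  shows "complex_of_real (LINT x|m. x ^ i * (cmod (poly_comb B g x))\<^sup>2) = (\<Sum>l<B. (half_line_jac ^^ i) g l * cnj (g l))"
proof -
  have iP: "integrable m (\<lambda>x. poly (P l) x * poly (P k) x)" for l k by (intro integrable_m continuous_intros)
  have iC: "integrable m (\<lambda>x. complex_of_real (poly (P l) x * poly (P k) x))" for l k using iP by (rule integrable_of_real)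
  have e: "complex_of_real (x ^ i * (cmod (poly_comb B g x))\<^sup>2) =
     (\<Sum>l<B + i. \<Sum>k<B. ((half_line_jac ^^ i) g l * cnj (g k)) * complex_of_real (poly (P l) x * poly (P k) x))" for x
  proof -
    have "complex_of_real (x ^ i * (cmod (poly_comb B g x))\<^sup>2) = of_real x ^ i * poly_comb B g x * cnj (poly_comb B g x)"
      unfolding of_real_mult complex_norm_square by (simp add: mult.assoc)
    also have "\<dots> = poly_comb (B + i) ((half_line_jac ^^ i) g) x * cnj (poly_comb B g x)" using poly_comb_pow[OF g] by simp
    also have "\<dots> = (\<Sum>l<B + i. \<Sum>k<B. ((half_line_jac ^^ i) g l * cnj (g k)) * complex_of_real (poly (P l) x * poly (P k) x))"
      unfolding poly_comb_def cnj_sum sum_product by (intro sum.cong refl) (simp add: mult_ac)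
    finally show ?thesis .
  qed
  have "complex_of_real (LINT x|m. x ^ i * (cmod (poly_comb B g x))\<^sup>2) = (LINT x|m. complex_of_real (x ^ i * (cmod (poly_comb B g x))\<^sup>2))"
    by (rule integral_complex_of_real[symmetric])
  also have "\<dots> = (\<Sum>l<B + i. \<Sum>k<B. ((half_line_jac ^^ i) g l * cnj (g k)) * (LINT x|m. complex_of_real (poly (P l) x * poly (P k) x)))"
  proof -
    have i1: "integrable m (\<lambda>x. c * complex_of_real (poly (P l) x * poly (P k) x))" for c l k
      by (rule integrable_mult_right) (rule iC)
    have i2: "integrable m (\<lambda>x. \<Sum>k<B. ((half_line_jac ^^ i) g l * cnj (g k)) * complex_of_real (poly (P l) x * poly (P k) x))" for l
      by (rule Bochner_Integration.integrable_sum) (rule i1)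
    show ?thesis unfolding e
      by (subst Bochner_Integration.integral_sum[OF i2], subst Bochner_Integration.integral_sum[OF i1], subst integral_mult_right_zero, rule refl)
  qed
  also have "\<dots> = (\<Sum>l<B + i. \<Sum>k<B. ((half_line_jac ^^ i) g l * cnj (g k)) * (if l = k then 1 else 0))"
    unfolding integral_complex_of_real orthP by (intro sum.cong refl) simp
  also have "\<dots> = (\<Sum>l<B + i. if l < B then (half_line_jac ^^ i) g l * cnj (g l) else 0)"
    by (intro sum.cong refl) (simp add: if_distrib sum.delta cong: if_cong)
  also have "\<dots> = (\<Sum>l<B. (half_line_jac ^^ i) g l * cnj (g l))"
    by (intro sum.mono_neutral_cong_right) auto
  finally show ?thesis .
qed

lemma real_julia_subset: "real_julia \<subseteq> {-beta..beta}"
proof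
  fix x assume "x \<in> real_julia"
  then have "\<bar>x\<bar> \<le> beta" by (rule real_julia_abs)
  then show "x \<in> {-beta..beta}" by auto
qed

text \<open>
  The half-line coefficients with index \<open>0\<close> placed at \<open>- k\<close>.  For \<open>k\<close> close to \<open>\<kappa>\<close> they approximate the
  coefficients of \<open>J\<^sub>\<kappa>\<close>, and \<open>a 0 = 0\<close> decouples the added zeros.
\<close>

definition cut_coeff :: "nat \<Rightarrow> int \<Rightarrow> real" where
  "cut_coeff k n = (if n \<ge> - int k then a (nat (n + int k)) else 0)"

lemma jac_cut:
  assumes f: "\<And>n. n < - int k \<Longrightarrow> f n = 0"
  shows "(jac (cut_coeff k) ^^ i) f n = (if n \<ge> - int k then (half_line_jac ^^ i) (\<lambda>l. f (int l - int k)) (nat (n + int k)) else 0)"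
proof (induction i arbitrary: n)
  case 0
  show ?case using f by simp
next
  case (Suc i)
  define g where "g = (\<lambda>l. f (int l - int k))"
  define J where "J = (jac (cut_coeff k) ^^ i) f"
  define G where "G = (half_line_jac ^^ i) g"
  have IH: "J n = (if n \<ge> - int k then G (nat (n + int k)) else 0)" for n
    using Suc[of n] by (simp add: J_def G_def g_def)
  have e: "(jac (cut_coeff k) ^^ Suc i) f n = of_real (cut_coeff k (n + 1)) * J (n + 1) + of_real (cut_coeff k n) * J (n - 1)"
    unfolding funpow.simps comp_def J_def[symmetric] by (simp add: jac_def)
  have e2: "(half_line_jac ^^ Suc i) g l = of_real (a (l + 1)) * G (l + 1) + of_real (a l) * G (l - 1)" for l
    unfolding funpow.simps comp_def G_def[symmetric] by (simp add: half_line_jac_def)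
  have "of_real (cut_coeff k (n + 1)) * J (n + 1) + of_real (cut_coeff k n) * J (n - 1) =
    (if n \<ge> - int k then (half_line_jac ^^ Suc i) g (nat (n + int k)) else 0)"
  proof (cases "n \<ge> - int k")
    case True
    then obtain l where "n + int k = int l" using zero_le_imp_eq_int[of "n + int k"] by auto
    then have l: "n = int l - int k" by simp
    have n: "nat (n + 1 + int k) = l + 1" "nat (n + int k) = l" "nat (n - 1 + int k) = l - 1" using l by auto
    show ?thesis unfolding IH cut_coeff_def e2 n using True l a0 by (cases "l = 0") auto
  next
    case False
    then have "cut_coeff k (n + 1) = 0" "cut_coeff k n = 0" using a0 by (auto simp: cut_coeff_def)
    then show ?thesis using False by simp
  qed
  then show ?case unfolding e g_def .
qed

text \<open>
  The measure has density \<open>\<bar>\<Sum>\<^sub>n f\<^sub>n P\<^bsub>n+k\<^esub>\<bar>\<^sup>2\<close> with respect to the equilibrium measure.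
\<close>

lemma moment_measure_cut:
  assumes f: "\<And>n. n \<notin> {-int N..int N} \<Longrightarrow> f n = 0" and k: "k \<ge> N"
  shows "\<exists>M. moment_measure real_julia (\<lambda>i. Re (\<Sum>n\<in>{-int N..int N}. (jac (cut_coeff k) ^^ i) f n * cnj (f n))) M"
proof -
  define g where "g l = f (int l - int k)" for l
  define B where "B = N + k + 1"
  have g0: "g l = 0" if "l \<ge> B" for l unfolding g_def using that by (intro f) (auto simp: B_def)
  have um [measurable]: "(\<lambda>x. (cmod (poly_comb B g x))\<^sup>2) \<in> borel_measurable borel"
    by (intro borel_measurable_continuous_onI continuous_intros poly_comb_continuous)
  define M where "M = density m (\<lambda>x. ennreal ((cmod (poly_comb B g x))\<^sup>2))"
  have ui: "integrable m (\<lambda>x. (cmod (poly_comb B g x))\<^sup>2)" by (intro integrable_m continuous_intros poly_comb_continuous)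
  have "emeasure M (space M) = (\<integral>\<^sup>+x. ennreal ((cmod (poly_comb B g x))\<^sup>2) \<partial>m)"
    unfolding M_def by (simp add: emeasure_density cong: nn_integral_cong)
  also have "\<dots> < \<infinity>" using ui by (subst nn_integral_eq_integral) auto
  finally have "finite_measure M" by (intro finite_measureI) auto
  moreover have "sets M = sets borel" by (simp add: M_def sm)
  moreover have "AE x in M. x \<in> real_julia" unfolding M_def using AE_real_julia by (subst AE_density) (auto elim!: eventually_mono)
  moreover have "(LINT x|M. x ^ i) = Re (\<Sum>n\<in>{-int N..int N}. (jac (cut_coeff k) ^^ i) f n * cnj (f n))" for i
  proof -
    have "(LINT x|M. x ^ i) = (LINT x|m. x ^ i * (cmod (poly_comb B g x))\<^sup>2)"
      unfolding M_def by (subst integral_real_density) (auto simp: mult.commute)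
    also have "\<dots> = Re (\<Sum>l<B. (half_line_jac ^^ i) g l * cnj (g l))" 
      using arg_cong[OF moment_poly_comb[of B g i, OF g0], where f = Re] unfolding Re_complex_of_real by simp
    also have "(\<Sum>l<B. (half_line_jac ^^ i) g l * cnj (g l)) = (\<Sum>n\<in>{-int k..int N}. (jac (cut_coeff k) ^^ i) f n * cnj (f n))"
    proof (rule sum.reindex_bij_witness[of _ "\<lambda>n. nat (n + int k)" "\<lambda>l. int l - int k"])
      fix l assume "l \<in> {..<B}"
      have "(jac (cut_coeff k) ^^ i) f (int l - int k) = (half_line_jac ^^ i) g l"
        by (subst jac_cut) (use f k in \<open>auto simp: g_def[abs_def]\<close>)
      then show "(jac (cut_coeff k) ^^ i) f (int l - int k) * cnj (f (int l - int k)) = (half_line_jac ^^ i) g l * cnj (g l)"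
        by (simp add: g_def)
    qed (auto simp: B_def)
    also have "\<dots> = (\<Sum>n\<in>{-int N..int N}. (jac (cut_coeff k) ^^ i) f n * cnj (f n))"
      using k f by (intro sum.mono_neutral_right) auto
    finally show ?thesis .
  qed
  ultimately have "moment_measure real_julia (\<lambda>i. Re (\<Sum>n\<in>{-int N..int N}. (jac (cut_coeff k) ^^ i) f n * cnj (f n))) M"
    by (simp add: moment_measure_def)
  then show ?thesis by blast
qed

text \<open>The coefficients of \<open>J\<^sub>\<kappa>\<close>.\<close>

definition hcoeff :: "dyadic \<Rightarrow> int \<Rightarrow> real" where "hcoeff \<kappa> n = ds.\<alpha> (\<kappa> + of_int n)"

lemma hcoeff_bound: "\<bar>hcoeff \<kappa> n\<bar> \<le> sqrt lam"
proof -
  have "hcoeff \<kappa> n \<le> sqrt lam" unfolding hcoeff_def by (rule real_le_rsqrt[OF ds.alpha_bounds(2)])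
  then show ?thesis using ds.alpha_bounds(1) by (simp add: hcoeff_def)
qed

lemma hcoeff_jacobi: "bounded_jacobi (hcoeff \<kappa>) (sqrt lam)"
  by standard (rule hcoeff_bound)

lemma jac_pow_tendsto:
  assumes "\<And>n. (\<lambda>j. cj j n) \<longlonglongrightarrow> c n"
  shows "(\<lambda>j. (jac (cj j) ^^ i) f n) \<longlonglongrightarrow> (jac c ^^ i) f n"
proof (induction i arbitrary: n)
  case (Suc i)
  show ?case unfolding funpow.simps comp_def
    unfolding jac_def[of _ "(jac _ ^^ i) f"] by (intro tendsto_intros assms Suc)
qed simp

text \<open>
  Each moment at \<open>f\<close> involves finitely many coefficients only, hence is a limit of the moments of the
  half-line matrices.
\<close>

lemma moment_measure_finite_support:
  assumes f: "\<And>n. n \<notin> {-int N..int N} \<Longrightarrow> f n = 0"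
  shows "\<exists>M. moment_measure real_julia (\<lambda>i. Re (ell2_inner ((jac (hcoeff \<kappa>) ^^ i) f) f)) M"
proof -
  obtain k :: "nat \<Rightarrow> nat" where k: "dyadic_dist.MCauchy (\<lambda>i. int (k i))" "\<And>i. i \<le> k i" and \<kappa>: "\<kappa> = Dyadic (\<lambda>i. int (k i))"
    using ds.nonneg_representative[of \<kappa>] by metis
  define k' where "k' j = k (j + N)" for j
  have kN: "k' j \<ge> N" for j using k(2)[of "j + N"] by (simp add: k'_def)
  have lim: "(\<lambda>j. cut_coeff (k' j) n) \<longlonglongrightarrow> hcoeff \<kappa> n" for n
  proof -
    have l: "(\<lambda>j. a (nat (int (k (j + N)) + n))) \<longlonglongrightarrow> hcoeff \<kappa> n"
      using LIMSEQ_ignore_initial_segment[OF ds.alpha_shift_tendsto[OF k, of n], of N] by (simp add: hcoeff_def \<kappa>)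
    show ?thesis
    proof (rule Lim_transform_eventually[OF l], unfold eventually_sequentially, intro exI[of _ "nat \<bar>n\<bar>"] allI impI)
      fix j assume "nat \<bar>n\<bar> \<le> j"
      then have "- int (k' j) \<le> n" using k(2)[of "j + N"] by (simp add: k'_def)
      then show "a (nat (int (k (j + N)) + n)) = cut_coeff (k' j) n" by (simp add: cut_coeff_def k'_def add.commute)
    qed
  qed
  define L where "L j i = Re (\<Sum>n\<in>{-int N..int N}. (jac (cut_coeff (k' j)) ^^ i) f n * cnj (f n))" for j i
  have "\<exists>M. moment_measure real_julia (L j) M" for j using moment_measure_cut[OF f kN] by (simp add: L_def[abs_def])
  then obtain Mj where Mj: "\<And>j. moment_measure real_julia (L j) (Mj j)" by metis
  have inner: "ell2_inner ((jac (hcoeff \<kappa>) ^^ i) f) f = (\<Sum>n\<in>{-int N..int N}. (jac (hcoeff \<kappa>) ^^ i) f n * cnj (f n))" for i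
  proof -
    have "ell2_inner ((jac (hcoeff \<kappa>) ^^ i) f) f = (\<Sum>\<^sub>\<infinity>n\<in>{-int N..int N}. (jac (hcoeff \<kappa>) ^^ i) f n * cnj (f n))"
      unfolding ell2_inner_def by (rule infsum_cong_neutral) (use f in auto)
    then show ?thesis by simp
  qed
  have lims: "(\<lambda>j. L j i) \<longlonglongrightarrow> Re (ell2_inner ((jac (hcoeff \<kappa>) ^^ i) f) f)" for i
    unfolding inner L_def by (intro tendsto_intros jac_pow_tendsto lim)
  show ?thesis by (rule moment_measure_limit[OF closed_real_julia real_julia_subset Mj lims])
qed

lemma moment_measure_exists:
  assumes f: "f \<in> ell2"
  shows "\<exists>M. moment_measure real_julia (\<lambda>i. Re (ell2_inner ((jac (hcoeff \<kappa>) ^^ i) f) f)) M"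
proof -
  interpret bounded_jacobi "hcoeff \<kappa>" "sqrt lam" by (rule hcoeff_jacobi)
  have "\<exists>M. moment_measure real_julia (\<lambda>i. Re (ell2_inner ((jac (hcoeff \<kappa>) ^^ i) (trunc N f)) (trunc N f))) M" for N
    by (rule moment_measure_finite_support[of N]) (auto simp: trunc_def)
  then obtain MN where MN: "\<And>N. moment_measure real_julia (\<lambda>i. Re (ell2_inner ((jac (hcoeff \<kappa>) ^^ i) (trunc N f)) (trunc N f))) (MN N)" by metis
  have lims: "(\<lambda>N. Re (ell2_inner ((jac (hcoeff \<kappa>) ^^ i) (trunc N f)) (trunc N f))) \<longlonglongrightarrow> Re (ell2_inner ((jac (hcoeff \<kappa>) ^^ i) f) f)" for i
    by (intro tendsto_Re moments_trunc_tendsto f)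
  show ?thesis by (rule moment_measure_limit[OF closed_real_julia real_julia_subset MN lims])
qed

end

section \<open>Spectrum of the limit operators\<close>

context julia_polys
begin

lemma hcoeff_range: "0 \<le> hcoeff \<kappa> n" "hcoeff \<kappa> n \<le> lam"
proof -
  show "0 \<le> hcoeff \<kappa> n" by (simp add: hcoeff_def ds.alpha_bounds(1))
  have "lam \<le> lam\<^sup>2" using lam by (simp add: power2_eq_square)
  then have "sqrt lam \<le> lam" using lam by (intro real_le_lsqrt) auto
  then show "hcoeff \<kappa> n \<le> lam" using hcoeff_bound[of \<kappa> n] by linarith
qed

context
  fixes \<kappa> \<kappa>' :: dyadic and r :: int
  assumes half: "\<kappa> = 2 * \<kappa>' + of_int r"
begin

lemma hcoeff_even: "hcoeff \<kappa> (2 * n - r) = ds.\<alpha> (2 * (\<kappa>' + of_int n))"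
  and hcoeff_odd: "hcoeff \<kappa> (2 * n - r + 1) = ds.\<alpha> (2 * (\<kappa>' + of_int n) + 1)"
  and hcoeff_pred: "hcoeff \<kappa> (2 * n - r - 1) = ds.\<alpha> (2 * (\<kappa>' + of_int n) - 1)"
  unfolding hcoeff_def half by (simp_all add: algebra_simps)

lemma hcoeff_mul: "hcoeff \<kappa> (2 * n - r) * hcoeff \<kappa> (2 * n - r - 1) = hcoeff \<kappa>' n"
  unfolding hcoeff_even hcoeff_pred ds.alpha_prod by (simp add: hcoeff_def)

lemma hcoeff_sq: "(hcoeff \<kappa> (2 * n - r))\<^sup>2 + (hcoeff \<kappa> (2 * n - r + 1))\<^sup>2 = lam"
  unfolding hcoeff_even hcoeff_odd by (rule ds.alpha_sum)

lemma hcoeff_even_le: "(hcoeff \<kappa> (2 * n - r))\<^sup>2 \<le> 1"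
  unfolding hcoeff_even by (rule ds.alpha_even)

end

definition eigenvector :: "dyadic \<Rightarrow> complex \<Rightarrow> (int \<Rightarrow> complex) \<Rightarrow> bool" where
  "eigenvector \<kappa> z f \<longleftrightarrow> f \<in> ell2 \<and> f \<noteq> (\<lambda>_. 0) \<and> jac (hcoeff \<kappa>) f = (\<lambda>n. z * f n)"

lemma eigenvalue_bound:
  assumes "eigenvector \<kappa> z f"
  shows "cmod z \<le> 2 * sqrt lam"
proof -
  interpret J: bounded_jacobi "hcoeff \<kappa>" "sqrt lam" by (rule hcoeff_jacobi)
  have f: "f \<in> ell2" and nz: "f \<noteq> (\<lambda>_. 0)" and ev: "jac (hcoeff \<kappa>) f = (\<lambda>n. z * f n)"
    using assms by (auto simp: eigenvector_def)
  obtain n where n: "f n \<noteq> 0" using nz by (auto simp: fun_eq_iff)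
  then have "0 < (cmod (f n))\<^sup>2" by simp
  then have pos: "norm_sq f > 0" using coord_le_norm_sq[OF f, of n] by linarith
  have "(cmod z)\<^sup>2 * norm_sq f = norm_sq (jac (hcoeff \<kappa>) f)"
    by (simp add: ev norm_sq_def norm_mult power_mult_distrib infsum_cmult_right')
  also have "\<dots> \<le> 4 * lam * norm_sq f" using J.jac_ell2(2)[OF f] lam by simp
  finally have "(cmod z)\<^sup>2 \<le> 4 * lam" using pos by (rule mult_right_le_imp_le)
  also have "4 * lam = (2 * sqrt lam)\<^sup>2" using lam by (simp add: power_mult_distrib)
  finally show ?thesis by (rule power2_le_imp_le) (use lam in simp)
qed

lemma ell2_subsequence:
  assumes "f \<in> ell2"
  shows "(\<lambda>n. f (2 * n - r)) \<in> ell2"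
proof -
  have "(\<lambda>n. (cmod (f n))\<^sup>2) summable_on range (\<lambda>n. 2 * n - r)"
    using assms unfolding ell2_def mem_Collect_eq by (rule summable_on_subset_banach) auto
  then have "((\<lambda>n. (cmod (f n))\<^sup>2) \<circ> (\<lambda>n. 2 * n - r)) summable_on UNIV"
    by (subst (asm) summable_on_reindex) (auto simp: inj_on_def)
  then show ?thesis by (simp add: ell2_def o_def)
qed

text \<open>
  The equation for the restriction is \<open>renormalized_equation\<close>; the point is that the restriction is not zero.
  If it were, the equation at odd sites would give \<open>f = 0\<close> unless \<open>z = 0\<close>.  For \<open>z = 0\<close> the equation at even
  sites relates neighbouring odd values, with coefficients whose squares are at most \<open>1\<close> and at least \<open>\<lambda> - 1 \<ge> 2\<close>, so that
  \<open>f\<close> would grow exponentially to the left.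
\<close>

lemma eigenvector_halve:
  assumes half: "\<kappa> = 2 * \<kappa>' + of_int r" and e: "eigenvector \<kappa> z f"
  shows "eigenvector \<kappa>' (quad_map lam z) (\<lambda>n. f (2 * n - r))"
proof -
  have f: "f \<in> ell2" and nz: "f \<noteq> (\<lambda>_. 0)" and ev: "jac (hcoeff \<kappa>) f = (\<lambda>n. z * f n)"
    using e by (auto simp: eigenvector_def)
  have eqn: "of_real (hcoeff \<kappa> (n + 1)) * f (n + 1) + of_real (hcoeff \<kappa> n) * f (n - 1) = z * f n" for n
    using fun_cong[OF ev, of n] by (simp add: jac_def)
  have h: "(\<lambda>n. f (2 * n - r)) \<noteq> (\<lambda>_. 0)"
  proof
    assume "(\<lambda>n. f (2 * n - r)) = (\<lambda>_. 0)"
    then have even0: "f (2 * n - r) = 0" for n by (metis (full_types))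
    have "z * f (2 * n - r + 1) = 0" for n
      using eqn[of "2 * n - r + 1"] even0[of n] even0[of "n + 1"] by (simp add: algebra_simps)
    moreover have "f (2 * n - r + 1) = 0" if z: "z = 0" for n
    proof -
      define g where "g n = (cmod (f (2 * n - r + 1)))\<^sup>2" for n
      have step: "2 * g n \<le> g (n - 1)" for n
      proof -
        have "of_real (hcoeff \<kappa> (2 * n - r + 1)) * f (2 * n - r + 1) = - (of_real (hcoeff \<kappa> (2 * n - r)) * f (2 * n - r - 1))"
          using eqn[of "2 * n - r"] z by (simp add: eq_neg_iff_add_eq_0)
        then have "(cmod (of_real (hcoeff \<kappa> (2 * n - r + 1)) * f (2 * n - r + 1)))\<^sup>2 =
            (cmod (of_real (hcoeff \<kappa> (2 * n - r)) * f (2 * n - r - 1)))\<^sup>2" by simp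
        then have eq: "(hcoeff \<kappa> (2 * n - r + 1))\<^sup>2 * g n = (hcoeff \<kappa> (2 * n - r))\<^sup>2 * g (n - 1)"
          by (simp add: norm_mult power_mult_distrib g_def algebra_simps)
        have "2 * g n \<le> (hcoeff \<kappa> (2 * n - r + 1))\<^sup>2 * g n"
          using hcoeff_sq[OF half, of n] hcoeff_even_le[OF half, of n] lam by (intro mult_right_mono) (auto simp: g_def)
        also have "\<dots> \<le> 1 * g (n - 1)" unfolding eq
          using hcoeff_even_le[OF half, of n] by (intro mult_right_mono) (auto simp: g_def)
        finally show ?thesis by simp
      qed
      have pow: "2 ^ k * g n \<le> g (n - int k)" for k
      proof (induction k)
        case (Suc k)
        have "2 ^ Suc k * g n \<le> 2 * g (n - int k)" using Suc by simp
        also have "\<dots> \<le> g (n - int (Suc k))" using step[of "n - int k"] by (simp add: algebra_simps)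
        finally show ?case .
      qed simp
      have bd: "2 ^ k * g n \<le> norm_sq f" for k
        using pow[of k] coord_le_norm_sq[OF f, of "2 * (n - int k) - r + 1"] unfolding g_def by linarith
      have "g n \<le> 0"
      proof (rule ccontr)
        assume "\<not> g n \<le> 0"
        then have p: "g n > 0" by simp
        obtain k where "norm_sq f / g n < 2 ^ k" using real_arch_pow[of 2 "norm_sq f / g n"] by auto
        then show False using bd[of k] p by (simp add: divide_less_eq)
      qed
      then show ?thesis by (simp add: g_def)
    qed
    ultimately have odd0: "f (2 * n - r + 1) = 0" for n by (metis mult_eq_0_iff)
    have "f n = 0" for n
    proof (cases "even (n + r)")
      case True
      then obtain k where "n + r = 2 * k" by (elim evenE)
      then have "n = 2 * k - r" by simp
      then show ?thesis using even0 by simp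
    next
      case False
      then obtain k where "n + r = 2 * k + 1" by (elim oddE)
      then have "n = 2 * k - r + 1" by simp
      then show ?thesis using odd0 by simp
    qed
    then show False using nz by auto
  qed
  have "jac (hcoeff \<kappa>') (\<lambda>n. f (2 * n - r)) = (\<lambda>n. quad_map lam z * f (2 * n - r))"
    unfolding jac_def quad_map_def
    by (intro ext renormalized_equation[OF hcoeff_mul[OF half] hcoeff_sq[OF half] eqn])
  then show ?thesis using h ell2_subsequence[OF f] by (simp add: eigenvector_def)
qed

text \<open>
  Every point of the orbit of \<open>z\<close> is an eigenvalue of some \<open>J\<^bsub>\<kappa>\<^sub>k\<^esub>\<close>, hence bounded by \<open>2 sqrt \<lambda>\<close>.  So
  \<open>z\<close> lies in the Julia set, and \<open>solution_zero\<close> applies to the real and imaginary part of an eigenvector.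
\<close>

theorem no_eigenvalue: "\<not> ell2_eigenvalue (jac (hcoeff \<kappa>)) z"
proof
  assume "ell2_eigenvalue (jac (hcoeff \<kappa>)) z"
  then obtain f where e: "eigenvector \<kappa> z f" unfolding ell2_eigenvalue_def eigenvector_def by blast
  have "\<forall>\<kappa>::dyadic. \<exists>\<kappa>'. \<exists>r. r \<in> {0, 1::int} \<and> \<kappa> = 2 * \<kappa>' + of_int r" by (intro allI ds.dyadic_halve)
  then obtain hf where "\<forall>\<kappa>::dyadic. \<exists>r. r \<in> {0, 1::int} \<and> \<kappa> = 2 * hf \<kappa> + of_int r" by (rule choice[THEN exE])
  then obtain hr where hr: "\<forall>\<kappa>::dyadic. hr \<kappa> \<in> {0, 1::int} \<and> \<kappa> = 2 * hf \<kappa> + of_int (hr \<kappa>)" by (rule choice[THEN exE])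
  define ks where "ks k = (hf ^^ k) \<kappa>" for k
  define rs where "rs k = hr (ks k)" for k
  have ks: "ks k = 2 * ks (Suc k) + of_int (rs k)" for k
    using hr[rule_format, of "ks k", THEN conjunct2] unfolding rs_def by (simp add: ks_def)
  have "\<exists>g. eigenvector (ks k) (orb k z) g" for k
  proof (induction k)
    case 0
    show ?case using e by (intro exI[of _ f]) (simp add: ks_def)
  next
    case (Suc k)
    then obtain g where "eigenvector (ks k) (orb k z) g" by blast
    then have "eigenvector (ks (Suc k)) (orb (Suc k) z) (\<lambda>n. g (2 * n - rs k))"
      using eigenvector_halve[OF ks[of k]] by simp
    then show ?case by blast
  qed
  then have "cmod (orb k z) \<le> 2 * sqrt lam" for k using eigenvalue_bound by blast
  then have "z \<in> julia_set lam" by (rule bounded_orbit_julia)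
  then have z: "z = of_real (Re z)" and real_julia: "Re z \<in> real_julia" using julia_eq_real_julia by (auto simp: complex_eq_iff)
  define xs where "xs k = (real_quad ^^ k) (Re z)" for k
  have xs: "xs k \<in> real_julia" for k by (induction k) (auto simp: xs_def real_julia real_julia_quad)
  have real0: "u n = 0" if "(\<lambda>n. (u n)\<^sup>2) summable_on UNIV"
    and "\<And>n. hcoeff \<kappa> (n + 1) * u (n + 1) + hcoeff \<kappa> n * u (n - 1) = Re z * u n" for u n
  proof -
    interpret renormalized_solution lam "\<lambda>k. hcoeff (ks k)" rs xs u
    proof
      show "xs (Suc k) = (xs k)\<^sup>2 - lam" for k by (simp add: xs_def real_quad_def)
      show "2/3 \<le> \<bar>xs k\<bar>" for k using xs by (rule real_julia_low)
      show "1 \<le> lam" using lam by simp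
      show "hcoeff (ks 0) (n + 1) * u (n + 1) + hcoeff (ks 0) n * u (n - 1) = xs 0 * u n" for n
        using that(2)[of n] by (simp add: ks_def xs_def)
    qed (rule hcoeff_range hcoeff_mul[OF ks] hcoeff_sq[OF ks] that(1))+
    show ?thesis by (rule solution_zero)
  qed
  have f: "(\<lambda>n. (cmod (f n))\<^sup>2) summable_on UNIV" and nz: "f \<noteq> (\<lambda>_. 0)" and ev: "jac (hcoeff \<kappa>) f = (\<lambda>n. z * f n)"
    using e by (auto simp: eigenvector_def ell2_def)
  have eqn: "of_real (hcoeff \<kappa> (n + 1)) * f (n + 1) + of_real (hcoeff \<kappa> n) * f (n - 1) = of_real (Re z) * f n" for n
    using fun_cong[OF ev, of n] unfolding jac_def z[symmetric] .
  have "Re (f n) = 0" for n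
  proof (rule real0)
    show "(\<lambda>n. (Re (f n))\<^sup>2) summable_on UNIV"
      by (rule summable_on_comparison_test[OF f]) (auto simp: cmod_power2)
    show "hcoeff \<kappa> (n + 1) * Re (f (n + 1)) + hcoeff \<kappa> n * Re (f (n - 1)) = Re z * Re (f n)" for n
      using arg_cong[OF eqn[of n], of Re] by simp
  qed
  moreover have "Im (f n) = 0" for n
  proof (rule real0)
    show "(\<lambda>n. (Im (f n))\<^sup>2) summable_on UNIV"
      by (rule summable_on_comparison_test[OF f]) (auto simp: cmod_power2)
    show "hcoeff \<kappa> (n + 1) * Im (f (n + 1)) + hcoeff \<kappa> n * Im (f (n - 1)) = Re z * Im (f n)" for n
      using arg_cong[OF eqn[of n], of Im] by simp
  qed
  ultimately have "f = (\<lambda>_. 0)" by (auto simp: complex_eq_iff)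
  then show False using nz by simp
qed

text \<open>
  The measure with the moments of the operator lives on the Julia set, a null set, and has no atoms because there are no
  eigenvalues.
\<close>

theorem singular_continuous_spectrum: "purely_singular_continuous_spectrum (jac (hcoeff \<kappa>))"
  unfolding purely_singular_continuous_spectrum_def
proof
  fix f :: "int \<Rightarrow> complex" assume f: "f \<in> ell2"
  obtain M where M: "moment_measure real_julia (\<lambda>i. Re (ell2_inner ((jac (hcoeff \<kappa>) ^^ i) f) f)) M"
    using moment_measure_exists[OF f] by blast
  interpret J: bounded_jacobi "hcoeff \<kappa>" "sqrt lam" by (rule hcoeff_jacobi)
  interpret S: jacobi_moments "hcoeff \<kappa>" "sqrt lam" f M real_julia "\<lambda>i. Re (ell2_inner ((jac (hcoeff \<kappa>) ^^ i) f) f)" beta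
    by standard (use f M real_julia_subset J.moments_real in auto)
  have "emeasure M {x} = 0" for x
  proof -
    have "\<not> measure M {x} > 0" using S.atom_eigenvalue[of x] no_eigenvalue[of \<kappa> "of_real x"] by blast
    then have "measure M {x} = 0" using measure_nonneg[of M "{x}"] by linarith
    then show ?thesis unfolding S.fm.emeasure_eq_measure by simp
  qed
  moreover have "emeasure M (UNIV - real_julia) = 0"
    using S.AEM by (subst (asm) AE_iff_measurable[OF _ refl]) (auto simp: S.sM sets_eq_imp_space_eq[OF S.sM] set_diff_eq)
  ultimately have "singular_continuous M" unfolding singular_continuous_def using real_julia_borel real_julia_null by blast
  moreover have "spectral_measure (jac (hcoeff \<kappa>)) f M"
    unfolding spectral_measure_def using S.finM S.sM S.AE_spectrum S.moments S.momM by simp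
  ultimately show "\<exists>M. spectral_measure (jac (hcoeff \<kappa>)) f M \<and> singular_continuous M" by blast
qed

end

theorem theorem1p1:
  fixes lam :: real and \<mu> :: "complex measure" and p :: "nat \<Rightarrow> complex poly"
    and a :: "nat \<Rightarrow> real" and \<kappa> :: dyadic
  assumes "lam > 3"
    and "equilibrium_measure (julia_set lam) \<mu>"
    and "orthonormal_polys \<mu> p"
    and "recurrence_coeffs p a"
  shows "(\<nexists>z. ell2_eigenvalue (jacobi_operator (dyadic_extension a) \<kappa>) z) \<and>
         purely_singular_continuous_spectrum (jacobi_operator (dyadic_extension a) \<kappa>)"
proof -
  interpret julia_polys lam \<mu> p a by standard (use assms in auto)
  have "jacobi_operator (dyadic_extension a) \<kappa> = jac (hcoeff \<kappa>)"
    by (simp add: jacobi_operator_jac hcoeff_def[abs_def] ds.\<alpha>_def)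
  then show ?thesis using no_eigenvalue singular_continuous_spectrum by simp
qed

end
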